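(* Let $F/K$ be a function field in one variable and $q$ a non-degenerate quadratic form over $F$ with $\dim(q)\geq 3$. Let $S\subseteq\mathcal{V}(F/K)$ be finite and $R=\bigcap_{v\in\Delta_K q\cup S}\mathcal{O}_v$. Assume that $\mathbb{S}_{\mathcal{O}_v}(q)\neq\emptyset$ for all $v\in\Delta_K q$. Then $\mathbb{S}_R(q)\neq\emptyset$.
   Context: A function field in one variable is a finitely generated field extension of transcendence degree $1$. For a quadratic form $q$ on an $F$-vector space $V$, $\mathfrak{b}_q(x,y)=q(x+y)-q(x)-q(y)$; $q$ is regular if for every $x\neq0$ with $q(x)=0$ there is $y$ with $\mathfrak{b}_q(x,y)\neq0$, and non-degenerate if $q_L$ is regular for every field extension $L/F$. For a domain $R$, $\mathcal{Q}(R)=\{x\in R\mid 1+4x\in R^\times\}$. $\mathbb{S}(q)=\mathcal{Q}(F)\cap\{-q(x)q(y)/\mathfrak{b}_q(x,y)^2\mid x,y\in V,\ \mathfrak{b}_q(x,y)\neq0\}$ and, for a subring $R\subseteq F$ with fraction field $F$, $\mathbb{S}_R(q)=\mathbb{S}(q)\cap R^\times\cap\mathcal{Q}(R)$. $\mathcal{V}(F/K)$ is the set of valuations on $F$ with value group $\mathbb{Z}$ trivial on $K$; $F_v$ is the henselisation of $F$ at $v$; $\Delta_K q=\{v\in\mathcal{V}(F/K)\mid q\text{ anisotropic over }F_v\}$. *)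

theory Defs
  imports
    "HOL-Algebra.Finite_Extensions"
    "HOL-Algebra.Generated_Fields"
    "Jordan_Normal_Form.Missing_VectorSpace"
begin

section \<open>Function fields in one variable\<close>

text \<open>Transcendence degree 1 says that some one-element set \<open>{t}\<close> is a transcendence basis.\<close>

definition function_field_one_var :: "('a, 'm) ring_scheme \<Rightarrow> 'a set \<Rightarrow> bool" where
  "function_field_one_var F K \<longleftrightarrow>
     field F \<and> subfield K F \<and>
     (\<exists>A. finite A \<and> A \<subseteq> carrier F \<and> generate_field F (K \<union> A) = carrier F) \<and>
     (\<exists>t\<in>carrier F. ring.transcendental F K t \<and>
        (\<forall>x\<in>carrier F. ring.algebraic F (generate_field F (insert t K)) x))"


section \<open>Quadratic forms\<close>

definition polar ::
  "('a, 'm) ring_scheme \<Rightarrow> ('a, 'v, 'n) module_scheme \<Rightarrow> ('v \<Rightarrow> 'a) \<Rightarrow> 'v \<Rightarrow> 'v \<Rightarrow> 'a" where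
  "polar F V q x y = q (x \<oplus>\<^bsub>V\<^esub> y) \<ominus>\<^bsub>F\<^esub> q x \<ominus>\<^bsub>F\<^esub> q y"

text \<open>The polar form is symmetric, so linearity in the first argument is bilinearity.\<close>

definition quadratic_form ::
  "('a, 'm) ring_scheme \<Rightarrow> ('a, 'v, 'n) module_scheme \<Rightarrow> ('v \<Rightarrow> 'a) \<Rightarrow> bool" where
  "quadratic_form F V q \<longleftrightarrow>
     vectorspace F V \<and> vectorspace.fin_dim F V \<and>
     q \<in> carrier V \<rightarrow> carrier F \<and>
     (\<forall>a\<in>carrier F. \<forall>x\<in>carrier V. q (a \<odot>\<^bsub>V\<^esub> x) = a [^]\<^bsub>F\<^esub> (2::nat) \<otimes>\<^bsub>F\<^esub> q x) \<and>
     (\<forall>x\<in>carrier V. \<forall>y\<in>carrier V. \<forall>z\<in>carrier V.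
        polar F V q (x \<oplus>\<^bsub>V\<^esub> y) z = polar F V q x z \<oplus>\<^bsub>F\<^esub> polar F V q y z) \<and>
     (\<forall>a\<in>carrier F. \<forall>x\<in>carrier V. \<forall>z\<in>carrier V.
        polar F V q (a \<odot>\<^bsub>V\<^esub> x) z = a \<otimes>\<^bsub>F\<^esub> polar F V q x z)"

definition regular ::
  "('a, 'm) ring_scheme \<Rightarrow> ('a, 'v, 'n) module_scheme \<Rightarrow> ('v \<Rightarrow> 'a) \<Rightarrow> bool" where
  "regular F V q \<longleftrightarrow>
     (\<forall>x\<in>carrier V. x \<noteq> \<zero>\<^bsub>V\<^esub> \<and> q x = \<zero>\<^bsub>F\<^esub> \<longrightarrow> (\<exists>y\<in>carrier V. polar F V q x y \<noteq> \<zero>\<^bsub>F\<^esub>))"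

definition anisotropic ::
  "('a, 'm) ring_scheme \<Rightarrow> ('a, 'v, 'n) module_scheme \<Rightarrow> ('v \<Rightarrow> 'a) \<Rightarrow> bool" where
  "anisotropic F V q \<longleftrightarrow> (\<forall>x\<in>carrier V. q x = \<zero>\<^bsub>F\<^esub> \<longrightarrow> x = \<zero>\<^bsub>V\<^esub>)"

text \<open>
  Extension of scalars along a field embedding \<open>\<phi> : F \<rightarrow> L\<close>. A basis \<open>e\<^sub>0, \<dots>, e\<^sub>n\<^sub>-\<^sub>1\<close> of
  \<open>V\<close> is chosen once and for all and \<open>L \<otimes> V\<close> is realised as the coordinate space \<open>L\<^sup>n\<close>,
  with \<open>x\<close> standing for \<open>\<Sum> x\<^sub>i \<otimes> e\<^sub>i\<close>. The form \<open>q\<^sub>L\<close> is then given by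
  \<open>q\<^sub>L(x) = \<Sum> q(e\<^sub>i) x\<^sub>i\<^sup>2 + \<Sum>\<^bsub>i<j\<^esub> b\<^sub>q(e\<^sub>i, e\<^sub>j) x\<^sub>i x\<^sub>j\<close>.
  Another basis leads to an isometric form.
\<close>

definition chosen_basis :: "('a, 'm) ring_scheme \<Rightarrow> ('a, 'v, 'n) module_scheme \<Rightarrow> 'v list" where
  "chosen_basis F V = (SOME bs. distinct bs \<and> vectorspace.basis F V (set bs))"

definition ext_space ::
  "('a, 'm) ring_scheme \<Rightarrow> ('a, 'v, 'n) module_scheme \<Rightarrow> ('l, 'k) ring_scheme
     \<Rightarrow> ('l, nat \<Rightarrow> 'l) module" where
  "ext_space F V L = LinearCombinations.ring.func_space L {..<length (chosen_basis F V)}"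

definition ext_form ::
  "('a, 'm) ring_scheme \<Rightarrow> ('a, 'v, 'n) module_scheme \<Rightarrow> ('v \<Rightarrow> 'a)
     \<Rightarrow> ('l, 'k) ring_scheme \<Rightarrow> ('a \<Rightarrow> 'l) \<Rightarrow> (nat \<Rightarrow> 'l) \<Rightarrow> 'l" where
  "ext_form F V q L \<phi> x =
     (let bs = chosen_basis F V; n = length bs in
       (\<Oplus>\<^bsub>L\<^esub>i\<in>{..<n}. \<phi> (q (bs ! i)) \<otimes>\<^bsub>L\<^esub> x i [^]\<^bsub>L\<^esub> (2::nat))
       \<oplus>\<^bsub>L\<^esub>
       (\<Oplus>\<^bsub>L\<^esub>p\<in>{(i, j). i < j \<and> j < n}.
          \<phi> (polar F V q (bs ! fst p) (bs ! snd p)) \<otimes>\<^bsub>L\<^esub> (x (fst p) \<otimes>\<^bsub>L\<^esub> x (snd p))))"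

text \<open>
  A definition cannot quantify over all types, so the extensions \<open>L/F\<close> here range over the
  fields whose elements are of type \<^typ>\<open>nat \<Rightarrow> 'a\<close>. Nothing is lost: \<open>b\<^sub>q\<^sub>L(x, _) = 0\<close> only has
  to be tested on the basis of \<open>V\<close>, so a vector \<open>x\<close> violating regularity over some \<open>L\<close> already
  does so over the finitely generated extension of \<open>F\<close> by the coordinates of \<open>x\<close>. As
  \<^typ>\<open>nat \<Rightarrow> 'a\<close> is infinite and at least as large as \<open>F\<close>, it contains a copy of every finitely
  generated (and every algebraic) extension of \<open>F\<close>.
\<close>

definition nondegenerate ::
  "('a, 'm) ring_scheme \<Rightarrow> ('a, 'v, 'n) module_scheme \<Rightarrow> ('v \<Rightarrow> 'a) \<Rightarrow> bool" where
  "nondegenerate F V q \<longleftrightarrow>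
     (\<forall>(L :: (nat \<Rightarrow> 'a) ring) \<phi>. field L \<and> \<phi> \<in> ring_hom F L \<longrightarrow>
        regular L (ext_space F V L) (ext_form F V q L \<phi>))"


section \<open>Valuations and henselisations\<close>

text \<open>
  Valuations with value group exactly \<open>\<int>\<close>, as functions on \<open>F\<^sup>\<times>\<close> (the value \<open>\<infinity>\<close> at \<open>0\<close> is
  left implicit); outside \<open>F\<^sup>\<times>\<close> the function is \<^const>\<open>undefined\<close>, so that equal valuations are
  equal functions.
\<close>

definition valuations :: "('a, 'm) ring_scheme \<Rightarrow> 'a set \<Rightarrow> ('a \<Rightarrow> int) set" where
  "valuations F K = {v \<in> extensional (carrier F - {\<zero>\<^bsub>F\<^esub>}).
     v ` (carrier F - {\<zero>\<^bsub>F\<^esub>}) = UNIV \<and>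
     (\<forall>x\<in>carrier F - {\<zero>\<^bsub>F\<^esub>}. \<forall>y\<in>carrier F - {\<zero>\<^bsub>F\<^esub>}. v (x \<otimes>\<^bsub>F\<^esub> y) = v x + v y) \<and>
     (\<forall>x\<in>carrier F - {\<zero>\<^bsub>F\<^esub>}. \<forall>y\<in>carrier F - {\<zero>\<^bsub>F\<^esub>}.
        x \<oplus>\<^bsub>F\<^esub> y \<noteq> \<zero>\<^bsub>F\<^esub> \<longrightarrow> min (v x) (v y) \<le> v (x \<oplus>\<^bsub>F\<^esub> y)) \<and>
     (\<forall>x\<in>K - {\<zero>\<^bsub>F\<^esub>}. v x = 0)}"

definition val_ring :: "('a, 'm) ring_scheme \<Rightarrow> ('a \<Rightarrow> int) \<Rightarrow> 'a set" where
  "val_ring F v = {x \<in> carrier F. x = \<zero>\<^bsub>F\<^esub> \<or> 0 \<le> v x}"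

abbreviation subring_units :: "('a, 'm) ring_scheme \<Rightarrow> 'a set \<Rightarrow> 'a set" where
  "subring_units F R \<equiv> Units (F\<lparr>carrier := R\<rparr>)"

text \<open>
  Valued fields of arbitrary rank are given by their valuation rings \<open>A \<subseteq> E\<close>;
  \<^term>\<open>A - subring_units E A\<close> is the maximal ideal of \<open>A\<close>.
\<close>

definition valuation_ring :: "('a, 'm) ring_scheme \<Rightarrow> 'a set \<Rightarrow> bool" where
  "valuation_ring E A \<longleftrightarrow>
     field E \<and> subring A E \<and> (\<forall>x\<in>carrier E - {\<zero>\<^bsub>E\<^esub>}. x \<in> A \<or> inv\<^bsub>E\<^esub> x \<in> A)"

text \<open>
  Polynomials are the coefficient lists of \<^theory>\<open>HOL-Algebra.Polynomials\<close>, leading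
  coefficient first. The derivative is not normalised, which does not matter for evaluation.
\<close>

definition poly_deriv :: "('a, 'm) ring_scheme \<Rightarrow> 'a list \<Rightarrow> 'a list" where
  "poly_deriv E p = map (\<lambda>i. add_pow E (length p - 1 - i) (p ! i)) [0..<length p - 1]"

definition henselian :: "('a, 'm) ring_scheme \<Rightarrow> 'a set \<Rightarrow> bool" where
  "henselian E A \<longleftrightarrow>
     valuation_ring E A \<and>
     (\<forall>p\<in>carrier (univ_poly E A). \<forall>a\<in>A.
        ring.eval E p a \<in> A - subring_units E A \<and>
        ring.eval E (poly_deriv E p) a \<in> subring_units E A \<longrightarrow>
        (\<exists>b\<in>A. ring.eval E p b = \<zero>\<^bsub>E\<^esub> \<and> b \<ominus>\<^bsub>E\<^esub> a \<in> A - subring_units E A))"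

text \<open>Embeddings of valued fields \<open>(E, A) \<rightarrow> (E', A')\<close>.\<close>

definition valued_hom ::
  "('a, 'm) ring_scheme \<Rightarrow> 'a set \<Rightarrow> ('b, 'k) ring_scheme \<Rightarrow> 'b set \<Rightarrow> ('a \<Rightarrow> 'b) set" where
  "valued_hom E A E' A' = {\<phi> \<in> ring_hom E E'. \<forall>x\<in>carrier E. \<phi> x \<in> A' \<longleftrightarrow> x \<in> A}"

text \<open>
  \<open>(H, B)\<close> with \<open>\<iota> : F \<rightarrow> H\<close> is a henselisation of \<open>(F, A)\<close>: it is a henselian extension, and
  every henselian extension of \<open>(F, A)\<close> receives a unique embedding over \<open>F\<close> from it. As in
  \<^const>\<open>nondegenerate\<close>, all extensions have elements of type \<^typ>\<open>nat \<Rightarrow> 'a\<close>. Henselisations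
  are algebraic over \<open>F\<close>, so they exist within this type, and comparison with one of them shows
  that the property characterises the henselisation up to isomorphism over \<open>F\<close>.
\<close>

definition henselisation ::
  "('a, 'm) ring_scheme \<Rightarrow> 'a set \<Rightarrow> (nat \<Rightarrow> 'a) ring \<Rightarrow> (nat \<Rightarrow> 'a) set
     \<Rightarrow> ('a \<Rightarrow> nat \<Rightarrow> 'a) \<Rightarrow> bool" where
  "henselisation F A H B \<iota> \<longleftrightarrow>
     henselian H B \<and> \<iota> \<in> valued_hom F A H B \<and>
     (\<forall>(E :: (nat \<Rightarrow> 'a) ring) C \<phi>. henselian E C \<and> \<phi> \<in> valued_hom F A E C \<longrightarrow>
        (\<exists>!\<psi>. \<psi> \<in> valued_hom H B E C \<and> \<psi> \<in> extensional (carrier H) \<and>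
           (\<forall>x\<in>carrier F. \<psi> (\<iota> x) = \<phi> x)))"

text \<open>
  \<open>F\<^sub>v\<close> being determined up to isomorphism over \<open>F\<close>, anisotropy over \<open>F\<^sub>v\<close> does not depend on the
  henselisation used.
\<close>

definition Delta ::
  "('a, 'm) ring_scheme \<Rightarrow> 'a set \<Rightarrow> ('a, 'v, 'n) module_scheme \<Rightarrow> ('v \<Rightarrow> 'a)
     \<Rightarrow> ('a \<Rightarrow> int) set" where
  "Delta F K V q = {v \<in> valuations F K.
     \<forall>H B \<iota>. henselisation F (val_ring F v) H B \<iota> \<longrightarrow>
       anisotropic H (ext_space F V H) (ext_form F V q H \<iota>)}"


section \<open>The sets \<open>\<Q>(R)\<close>, \<open>S(q)\<close> and \<open>S\<^sub>R(q)\<close>\<close>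

text \<open>All domains \<open>R\<close> are given as subrings of \<open>F\<close>.\<close>

definition Q_set :: "('a, 'm) ring_scheme \<Rightarrow> 'a set \<Rightarrow> 'a set" where
  "Q_set F R = {x \<in> R. \<one>\<^bsub>F\<^esub> \<oplus>\<^bsub>F\<^esub> add_pow F (4::nat) x \<in> subring_units F R}"

definition S_set ::
  "('a, 'm) ring_scheme \<Rightarrow> ('a, 'v, 'n) module_scheme \<Rightarrow> ('v \<Rightarrow> 'a) \<Rightarrow> 'a set" where
  "S_set F V q = Q_set F (carrier F) \<inter>
     {\<ominus>\<^bsub>F\<^esub> (q x \<otimes>\<^bsub>F\<^esub> q y) \<otimes>\<^bsub>F\<^esub> inv\<^bsub>F\<^esub> (polar F V q x y [^]\<^bsub>F\<^esub> (2::nat)) | x y.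
        x \<in> carrier V \<and> y \<in> carrier V \<and> polar F V q x y \<noteq> \<zero>\<^bsub>F\<^esub>}"

definition S_set_over ::
  "('a, 'm) ring_scheme \<Rightarrow> 'a set \<Rightarrow> ('a, 'v, 'n) module_scheme \<Rightarrow> ('v \<Rightarrow> 'a) \<Rightarrow> 'a set" where
  "S_set_over F R V q = S_set F V q \<inter> subring_units F R \<inter> Q_set F R"

end

(*
  An element of S(q) is given by vectors x, y with b(x,y) = 1, and it lies in S_R(q) when q(x)q(y) and
  1 - 4q(x)q(y) are units at all v in Delta and S. Such pairs exist at each v: on Delta by assumption, and off
  Delta because q is isotropic over the completion, which contains the henselisation. If Delta is empty, weak
  approximation suffices.

  If Delta is not empty, then q is anisotropic, and Hensel's lemma gives v(q(x)) + v(q(y)) <= 2 v(b(x,y)) for v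
  in Delta. Hence the vectors of integral norm form a module at v, on which b is integral, and such a vector has
  unit norm as soon as its pairing with another one is a unit. Moreover, if b(x0,y0) = 1, then for almost all v
  in Delta the element q(x0) g^2 / q(g x0 + y0) is integral, with a zero wherever g has one, while it is close
  to 1 where g has a large pole. Together with weak approximation this gives strong approximation on the
  infinite set Delta. So x and y can be chosen close to the given local pairs at a finite set of places, and
  such that at every other place of Delta the integral vectors x and 2q(x)y - x, the latter of norm
  -q(x)(1 - 4q(x)q(y)), have a unit pairing with an integral vector.
*)
theory Submission
  imports Defs "HOL-Algebra.Chinese_Remainder"
begin

text \<open>\<open>Delta\<close> quantifies over all henselisations. A place in it therefore yields
  anisotropy only once a henselisation has been constructed, whereas a place outside it yields an
  isotropic vector over some henselisation, which the universal property carries to the completion,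
  where F is dense. The discriminant 1 - 4 q(x) q(y) is minus the Gram determinant of b on x, y. The
  vector 2 q(x) y - x is orthogonal to x, so its norm turns the condition on the discriminant into
  one on an integral vector. In characteristic 2 the discriminant is 1. The obstacle is that a
  vector can be corrected at finitely many places only, while Delta is infinite. Each vector is
  therefore given one pairing that is nonzero in F, hence a unit at almost all places, and is
  corrected at the remaining ones along a direction that leaves this pairing fixed. For x these are
  the pairing with x0 and a direction orthogonal to x0. For 2 q(x) y - x they are the pairing with
  the component of x orthogonal to the base plane and the direction in that plane orthogonal to x.
  Dimension 3 is what makes this component nonzero.\<close>

section \<open>Discrete valuations and weak approximation\<close>

text \<open>\<open>v\<close> carries no value at zero, so n <= v(x) has to be read together with x =
  0. Collecting both in one set, the fractional ideal of level n, keeps zero out of later case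
  distinctions.\<close>

definition vge :: "('a, 'm) ring_scheme \<Rightarrow> ('a \<Rightarrow> int) \<Rightarrow> int \<Rightarrow> 'a set" where
  "vge F v n = {x \<in> carrier F. x = \<zero>\<^bsub>F\<^esub> \<or> n \<le> v x}"

lemma val_ring_eq_vge: "val_ring F v = vge F v 0"
  by (auto simp: val_ring_def vge_def)

text \<open>Constants are not mentioned, so that completions are instances as well.\<close>

locale valued_field = field F for F (structure) +
  fixes v :: "'a \<Rightarrow> int"
  assumes v_mult: "\<lbrakk>x \<in> carrier F; y \<in> carrier F; x \<noteq> \<zero>; y \<noteq> \<zero>\<rbrakk> \<Longrightarrow> v (x \<otimes> y) = v x + v y"
    and v_add: "\<lbrakk>x \<in> carrier F; y \<in> carrier F; x \<noteq> \<zero>; y \<noteq> \<zero>; x \<oplus> y \<noteq> \<zero>\<rbrakk> \<Longrightarrow> min (v x) (v y) \<le> v (x \<oplus> y)"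
    and v_surj: "\<exists>x\<in>carrier F. x \<noteq> \<zero> \<and> v x = n"
begin

lemma v_one [simp]: "v \<one> = 0"
  using v_mult[of \<one> \<one>] by simp

lemma inv_closed_nz: "\<lbrakk>x \<in> carrier F; x \<noteq> \<zero>\<rbrakk> \<Longrightarrow> inv x \<in> carrier F \<and> inv x \<noteq> \<zero> \<and> x \<otimes> inv x = \<one> \<and> inv x \<otimes> x = \<one>"
  using field_Units by (metis DiffI Units_inv_closed Units_l_inv Units_r_inv l_null singletonD zero_not_one r_null)

lemma v_inv: "\<lbrakk>x \<in> carrier F; x \<noteq> \<zero>\<rbrakk> \<Longrightarrow> v (inv x) = - v x"
  using v_mult[of x "inv x"] inv_closed_nz[of x] by simp

lemma v_minus: "\<lbrakk>x \<in> carrier F; x \<noteq> \<zero>\<rbrakk> \<Longrightarrow> v (\<ominus> x) = v x"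
proof -
  assume x: "x \<in> carrier F" "x \<noteq> \<zero>"
  have m: "\<ominus> \<one> \<noteq> \<zero>" using zero_not_one by (metis minus_minus minus_zero one_closed)
  have "v (\<ominus> \<one> \<otimes> \<ominus> \<one>) = v (\<ominus> \<one>) + v (\<ominus> \<one>)"
    using m by (intro v_mult) auto
  moreover have "\<ominus> \<one> \<otimes> \<ominus> \<one> = \<one>" by algebra
  ultimately have "v (\<ominus> \<one>) = 0" by simp
  moreover have "\<ominus> x = \<ominus> \<one> \<otimes> x" using x by algebra
  ultimately show ?thesis using v_mult[of "\<ominus> \<one>" x] x m by simp
qed

lemma mult_nz: "\<lbrakk>x \<in> carrier F; y \<in> carrier F; x \<noteq> \<zero>; y \<noteq> \<zero>\<rbrakk> \<Longrightarrow> x \<otimes> y \<noteq> \<zero>"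
  using integral by blast

lemma pow_nz: "\<lbrakk>x \<in> carrier F; x \<noteq> \<zero>\<rbrakk> \<Longrightarrow> x [^] (n::nat) \<noteq> \<zero>"
  by (induct n) (auto simp: mult_nz)

lemma v_pow: "\<lbrakk>x \<in> carrier F; x \<noteq> \<zero>\<rbrakk> \<Longrightarrow> v (x [^] (n::nat)) = int n * v x"
  by (induct n) (auto simp: v_mult pow_nz algebra_simps)

lemma vge_carrier: "x \<in> vge F v n \<Longrightarrow> x \<in> carrier F"
  by (simp add: vge_def)

lemma vge_iff: "\<lbrakk>x \<in> carrier F; x \<noteq> \<zero>\<rbrakk> \<Longrightarrow> x \<in> vge F v n \<longleftrightarrow> n \<le> v x"
  by (simp add: vge_def)

lemma vge_zero [simp]: "\<zero> \<in> vge F v n"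
  by (simp add: vge_def)

lemma vge_one [simp]: "\<one> \<in> vge F v 0"
  by (simp add: vge_def)

lemma vge_mono: "\<lbrakk>x \<in> vge F v n; m \<le> n\<rbrakk> \<Longrightarrow> x \<in> vge F v m"
  by (auto simp: vge_def)

lemma vge_add: "\<lbrakk>x \<in> vge F v n; y \<in> vge F v n\<rbrakk> \<Longrightarrow> x \<oplus> y \<in> vge F v n"
  using v_add[of x y] by (cases "x = \<zero> \<or> y = \<zero> \<or> x \<oplus> y = \<zero>") (auto simp: vge_def)

lemma vge_minus: "x \<in> vge F v n \<Longrightarrow> \<ominus> x \<in> vge F v n"
  using v_minus[of x] by (cases "x = \<zero>") (auto simp: vge_def)

lemma vge_diff: "\<lbrakk>x \<in> vge F v n; y \<in> vge F v n\<rbrakk> \<Longrightarrow> x \<ominus> y \<in> vge F v n"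
  unfolding a_minus_def by (intro vge_add vge_minus)

lemma vge_mult: "\<lbrakk>x \<in> vge F v m; y \<in> vge F v n\<rbrakk> \<Longrightarrow> x \<otimes> y \<in> vge F v (m + n)"
  using v_mult[of x y] by (cases "x = \<zero> \<or> y = \<zero>") (auto simp: vge_def)

lemma vge_mult0: "\<lbrakk>x \<in> vge F v 0; y \<in> vge F v n\<rbrakk> \<Longrightarrow> x \<otimes> y \<in> vge F v n"
  using vge_mult[of x 0 y n] by simp

lemma vge_mult0r: "\<lbrakk>x \<in> vge F v n; y \<in> vge F v 0\<rbrakk> \<Longrightarrow> x \<otimes> y \<in> vge F v n"
  using vge_mult[of x n y 0] by simp

lemma vge_inv: "\<lbrakk>x \<in> carrier F; x \<noteq> \<zero>; n \<le> - v x\<rbrakk> \<Longrightarrow> inv x \<in> vge F v n"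
  using inv_closed_nz[of x] v_inv[of x] by (auto simp: vge_def)

lemma vge_all_zero: "(\<And>n. x \<in> vge F v n) \<Longrightarrow> x = \<zero>"
proof (rule ccontr)
  assume *: "\<And>n. x \<in> vge F v n" and nz: "x \<noteq> \<zero>"
  show False using *[of "v x + 1"] nz by (simp add: vge_def)
qed

lemma vge_exists: "x \<in> carrier F \<Longrightarrow> \<exists>n. x \<in> vge F v n"
  by (auto simp: vge_def)

lemma v_add_strict:
  assumes "x \<in> carrier F" "x \<noteq> \<zero>" "y \<in> vge F v (v x + 1)"
  shows "x \<oplus> y \<noteq> \<zero>" "v (x \<oplus> y) = v x"
proof -
  have y: "y \<in> carrier F" using assms(3) vge_carrier by blast
  have my: "\<ominus> y \<in> vge F v (v x + 1)" using assms(3) vge_minus by blast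
  show nz: "x \<oplus> y \<noteq> \<zero>"
  proof
    assume "x \<oplus> y = \<zero>"
    hence "x = \<ominus> y" using assms(1) y by (metis minus_equality a_comm)
    thus False using my assms(1,2) by (simp add: vge_def)
  qed
  have xe: "(x \<oplus> y) \<oplus> \<ominus> y = x" using assms(1) y by algebra
  have "\<not> v x < v (x \<oplus> y)"
  proof
    assume "v x < v (x \<oplus> y)"
    hence "x \<oplus> y \<in> vge F v (v x + 1)" using nz assms(1) y by (simp add: vge_def)
    from vge_add[OF this my] show False using xe assms(1,2) by (simp add: vge_def)
  qed
  moreover have "x \<oplus> y \<in> vge F v (v x)"
    by (intro vge_add) (use assms in \<open>auto simp: vge_def\<close>)
  ultimately show "v (x \<oplus> y) = v x" using nz by (simp add: vge_def)
qed

lemma v_close: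
  assumes "x \<in> carrier F" "x \<noteq> \<zero>" "y \<in> carrier F" "y \<ominus> x \<in> vge F v (v x + 1)"
  shows "y \<noteq> \<zero>" "v y = v x"
proof -
  have "x \<oplus> (y \<ominus> x) = y" using assms by algebra
  thus "y \<noteq> \<zero>" "v y = v x" using v_add_strict[OF assms(1,2,4)] by auto
qed

lemma vge_inv_diff:
  assumes "x \<in> carrier F" "x \<noteq> \<zero>" "y \<in> carrier F" "y \<noteq> \<zero>" "y \<ominus> x \<in> vge F v n"
  shows "inv y \<ominus> inv x \<in> vge F v (n - v x - v y)"
proof -
  note i = inv_closed_nz[OF assms(1,2)] inv_closed_nz[OF assms(3,4)]
  have ic: "inv x \<in> carrier F" "inv y \<in> carrier F" using i by auto
  have "inv x \<otimes> inv y \<otimes> (y \<ominus> x) = inv x \<otimes> (inv y \<otimes> y) \<ominus> inv y \<otimes> (inv x \<otimes> x)"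
    using ic assms(1,3) by algebra
  also have "\<dots> = inv x \<ominus> inv y" using i by simp
  finally have p: "inv x \<otimes> inv y \<otimes> (y \<ominus> x) = inv x \<ominus> inv y" .
  have e: "inv y \<ominus> inv x = \<ominus> (inv x \<otimes> inv y \<otimes> (y \<ominus> x))"
    unfolding p using i by algebra
  have "inv x \<otimes> inv y \<otimes> (y \<ominus> x) \<in> vge F v ((- v x + - v y) + n)"
    by (intro vge_mult assms(5) vge_inv assms) auto
  thus ?thesis unfolding e using vge_minus by (simp add: algebra_simps)
qed

lemma vge_finsum: "\<lbrakk>finite A; \<And>i. i \<in> A \<Longrightarrow> f i \<in> vge F v n\<rbrakk> \<Longrightarrow> finsum F f A \<in> vge F v n"
proof (induct A rule: finite_induct)
  case (insert a A)
  moreover have "f \<in> A \<rightarrow> carrier F" "f a \<in> carrier F" using insert vge_carrier by auto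
  ultimately show ?case by (auto intro: vge_add)
qed auto

lemma subring_vge: "subring (vge F v 0) F"
  by (intro subringI) (auto intro: vge_add vge_minus vge_mult0 simp: vge_carrier)

lemma v_div_closed: "\<lbrakk>x \<in> carrier F; y \<in> carrier F; y \<noteq> \<zero>; x \<in> vge F v n; n - v y \<ge> m\<rbrakk> \<Longrightarrow> x \<otimes> inv y \<in> vge F v m"
  using vge_mult[of x n "inv y" "- v y"] vge_inv[of y "- v y"] vge_mono by fastforce

end

lemma (in field) subring_units_iff:
  assumes "subring A R"
  shows "x \<in> subring_units R A \<longleftrightarrow> x \<in> A \<and> x \<noteq> \<zero> \<and> inv x \<in> A"
proof -
  have A: "A \<subseteq> carrier R" "\<one> \<in> A" using subringE[OF assms] by auto
  have i: "\<And>x. x \<in> carrier R \<Longrightarrow> x \<noteq> \<zero> \<Longrightarrow> inv x \<in> carrier R \<and> x \<otimes> inv x = \<one> \<and> inv x \<otimes> x = \<one>"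
    using field_Units by auto
  show ?thesis
  proof
    assume "x \<in> subring_units R A"
    then obtain y where y: "x \<in> A" "y \<in> A" "x \<otimes> y = \<one>" "y \<otimes> x = \<one>" by (auto simp: Units_def)
    have "x \<noteq> \<zero>" using y A zero_not_one by (metis l_null subsetD)
    moreover have "inv x = y" using y A by (intro inv_unique'[symmetric]) auto
    ultimately show "x \<in> A \<and> x \<noteq> \<zero> \<and> inv x \<in> A" using y by auto
  next
    assume "x \<in> A \<and> x \<noteq> \<zero> \<and> inv x \<in> A"
    thus "x \<in> subring_units R A" using i[of x] A by (auto simp: Units_def)
  qed
qed

lemma (in valued_field) val_units_iff:
  "x \<in> subring_units F (val_ring F v) \<longleftrightarrow> x \<in> carrier F \<and> x \<noteq> \<zero> \<and> v x = 0"
  unfolding val_ring_eq_vge subring_units_iff[OF subring_vge]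
  using inv_closed_nz[of x] v_inv[of x] by (auto simp: vge_def)

lemma valuations_valued_field:
  assumes "field F" "v \<in> valuations F K"
  shows "valued_field F v"
proof -
  interpret field F by fact
  show ?thesis
  proof unfold_locales
    fix n :: int
    have "n \<in> v ` (carrier F - {\<zero>\<^bsub>F\<^esub>})" using assms(2) by (auto simp: valuations_def)
    thus "\<exists>x\<in>carrier F. x \<noteq> \<zero>\<^bsub>F\<^esub> \<and> v x = n" by auto
  qed (use assms(2) in \<open>auto simp: valuations_def\<close>)
qed

lemma valuations_eqI:
  assumes "v \<in> valuations F K" "w \<in> valuations F K"
    and "\<And>x. x \<in> carrier F \<Longrightarrow> x \<noteq> \<zero>\<^bsub>F\<^esub> \<Longrightarrow> v x = w x"
  shows "v = w"
  using assms by (intro extensionalityI[of v "carrier F - {\<zero>\<^bsub>F\<^esub>}" w]) (auto simp: valuations_def)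

context field
begin

text \<open>If the valuation ring of v were contained in that of w, units at v would be units at w.
  For p of value 1 at v, the elements z and p^(v z) would then differ by a unit at w, so w would be
  w(p) times v, and surjectivity onto the integers would force w(p) = 1.\<close>

lemma valuation_separates:
  assumes v: "v \<in> valuations R K" and w: "w \<in> valuations R K" and "v \<noteq> w"
  shows "\<exists>z\<in>carrier R. z \<noteq> \<zero> \<and> 0 \<le> v z \<and> w z < 0"
proof (rule ccontr)
  assume "\<not> ?thesis"
  hence A: "\<And>z. z \<in> carrier R \<Longrightarrow> z \<noteq> \<zero> \<Longrightarrow> 0 \<le> v z \<Longrightarrow> 0 \<le> w z" by force
  interpret v: valued_field R v by (rule valuations_valued_field[OF field_axioms v])
  interpret w: valued_field R w by (rule valuations_valued_field[OF field_axioms w])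
  have U: "w z = 0" if "z \<in> carrier R" "z \<noteq> \<zero>" "v z = 0" for z
    using A[of z] A[of "inv z"] that v.inv_closed_nz[of z] v.v_inv[of z] w.v_inv[of z] by auto
  obtain p where p: "p \<in> carrier R" "p \<noteq> \<zero>" "v p = 1" using v.v_surj by blast
  have main: "w z = v z * w p" if z: "z \<in> carrier R" "z \<noteq> \<zero>" for z
  proof (cases "0 \<le> v z")
    case True
    then obtain k where k: "v z = int k" using nonneg_int_cases by blast
    define q where "q = inv (p [^] k)"
    have pk: "p [^] k \<in> carrier R" "p [^] k \<noteq> \<zero>" using p v.pow_nz by auto
    have q: "q \<in> carrier R" "q \<noteq> \<zero>" "v q = - v z" "w q = - (v z * w p)"
      unfolding q_def using v.inv_closed_nz[OF pk] v.v_inv[OF pk] w.v_inv[OF pk] p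
      by (auto simp: v.v_pow w.v_pow k)
    show ?thesis using U[of "z \<otimes> q"] q z v.mult_nz by (simp add: v.v_mult w.v_mult)
  next
    case False
    then obtain k where k: "v z = - int k" by (metis int_cases2 of_nat_0_le_iff)
    define q where "q = p [^] k"
    have q: "q \<in> carrier R" "q \<noteq> \<zero>" "v q = - v z" "w q = - (v z * w p)"
      unfolding q_def using p v.pow_nz by (auto simp: v.v_pow w.v_pow k)
    show ?thesis using U[of "z \<otimes> q"] q z v.mult_nz by (simp add: v.v_mult w.v_mult)
  qed
  obtain z where z: "z \<in> carrier R" "z \<noteq> \<zero>" "w z = 1" using w.v_surj by blast
  have "v z * w p = 1" using main[OF z(1,2)] z by simp
  moreover have "0 \<le> w p" using A[of p] p by simp
  ultimately have "w p = 1" by (metis abs_of_nonneg zmult_eq_1_iff abs_1 abs_minus_cancel)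
  hence "v = w" using main by (intro valuations_eqI[OF v w]) auto
  thus False using \<open>v \<noteq> w\<close> by simp
qed

text \<open>A quotient of two elements that separate v and w in opposite directions.\<close>

lemma valuation_separates2:
  assumes v: "v \<in> valuations R K" and w: "w \<in> valuations R K" and "v \<noteq> w"
  shows "\<exists>z\<in>carrier R. z \<noteq> \<zero> \<and> 0 < v z \<and> w z < 0"
proof -
  interpret v: valued_field R v by (rule valuations_valued_field[OF field_axioms v])
  interpret w: valued_field R w by (rule valuations_valued_field[OF field_axioms w])
  obtain a where a: "a \<in> carrier R" "a \<noteq> \<zero>" "0 \<le> v a" "w a < 0"
    using valuation_separates[OF assms] by blast
  obtain b where b: "b \<in> carrier R" "b \<noteq> \<zero>" "0 \<le> w b" "v b < 0"
    using valuation_separates[OF w v] assms(3) by blast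
  have "a \<otimes> inv b \<in> carrier R" "a \<otimes> inv b \<noteq> \<zero>" "0 < v (a \<otimes> inv b)" "w (a \<otimes> inv b) < 0"
    using a b v.inv_closed_nz[of b] v.mult_nz by (auto simp: v.v_mult w.v_mult v.v_inv w.v_inv)
  thus ?thesis by blast
qed

text \<open>Induction on B with z = x + y^r, where x serves the places treated so far and y the new
  one. For large r one summand strictly dominates at each place of B, so no pole cancels.\<close>

lemma valuation_separates_finite:
  assumes "finite B" "B \<subseteq> valuations R K" "v \<in> valuations R K" "v \<notin> B"
  shows "\<exists>z\<in>carrier R. z \<noteq> \<zero> \<and> 0 < v z \<and> (\<forall>w\<in>B. w z < 0)"
  using assms
proof (induct B rule: finite_induct)
  case empty
  interpret v: valued_field R v by (rule valuations_valued_field[OF field_axioms]) fact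
  show ?case using v.v_surj[of 1] by fastforce
next
  case (insert w B)
  interpret v: valued_field R v by (rule valuations_valued_field[OF field_axioms]) fact
  have wV: "w \<in> valuations R K" using insert by auto
  interpret w: valued_field R w by (rule valuations_valued_field[OF field_axioms wV])
  obtain x where x: "x \<in> carrier R" "x \<noteq> \<zero>" "0 < v x" "\<forall>w\<in>B. w x < 0" using insert by auto
  obtain y where y: "y \<in> carrier R" "y \<noteq> \<zero>" "0 < v y" "w y < 0"
    using valuation_separates2[of v K w] insert wV by auto
  show ?case
  proof (cases "w x < 0")
    case True
    thus ?thesis using x by auto
  next
    case False
    \<comment> \<open>Exceeds all pole orders of x on B. Where y has a pole in B, y^r then dominates
      x; elsewhere in B, x dominates.\<close>
    define r where "r = Suc (nat (Max (insert 0 ((\<lambda>u. - u x) ` B))))"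
    have r: "- u x < int r" if "u \<in> B" for u
    proof -
      have "- u x \<le> Max (insert 0 ((\<lambda>u. - u x) ` B))" using that insert(1) by (intro Max_ge) auto
      thus ?thesis unfolding r_def by linarith
    qed
    have r0: "0 < int r" by (simp add: r_def)
    define z where "z = x \<oplus> y [^] r"
    have yr: "y [^] r \<in> carrier R" "y [^] r \<noteq> \<zero>" using y v.pow_nz by auto
    have vr: "v (y [^] r) > 0" using v.v_pow[of y r] y r0 by simp
    have wr: "w (y [^] r) < 0" using w.v_pow[of y r] y r0 by (simp add: mult_less_0_iff)
    have sym: "x \<oplus> y [^] r = y [^] r \<oplus> x" using x yr by (intro a_comm) auto
    have "x \<in> vge R w (w (y [^] r) + 1)" using False wr x by (simp add: w.vge_iff)
    from w.v_add_strict[OF yr this] have wz: "z \<noteq> \<zero>" "w z < 0"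
      unfolding z_def sym using wr by auto
    have "z \<in> vge R v 1" unfolding z_def
      by (intro v.vge_add) (use x yr vr in \<open>auto simp: v.vge_iff\<close>)
    hence vz: "0 < v z" using wz by (simp add: vge_def)
    have "u z < 0" if u: "u \<in> B" for u
    proof -
      interpret u: valued_field R u
        by (rule valuations_valued_field[OF field_axioms]) (use u insert in auto)
      have ux: "u x < 0" using x u by auto
      show ?thesis
      proof (cases "0 \<le> u y")
        case True
        hence "y [^] r \<in> vge R u (u x + 1)" using u.v_pow[of y r] y yr ux by (simp add: u.vge_iff) 
           (smt (verit, best) mult_nonneg_nonneg of_nat_0_le_iff)
        from u.v_add_strict[OF x(1,2) this] show ?thesis unfolding z_def using ux by auto
      next
        case False
        have "int r * u y \<le> int r * (-1)" using False r0 by (intro mult_left_mono) auto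
        hence "u (y [^] r) < u x" using u.v_pow[of y r] y r[OF u] by simp
        hence "x \<in> vge R u (u (y [^] r) + 1)" using x by (simp add: u.vge_iff)
        from u.v_add_strict[OF yr this] show ?thesis unfolding z_def sym using \<open>u (y [^] r) < u x\<close> ux by auto
      qed
    qed
    thus ?thesis using wz vz x yr by (auto simp: z_def)
  qed
qed

text \<open>The element is e = 1 / (1 + x^m), where x has a zero at v and poles on B: e - 1 = - e
  x^m is small at v, and e itself is small on B.\<close>

lemma approx_idempotent:
  assumes "finite B" "B \<subseteq> valuations R K" "v \<in> valuations R K" "v \<notin> B"
  shows "\<exists>e\<in>carrier R. e \<ominus> \<one> \<in> vge R v n \<and> (\<forall>w\<in>B. e \<in> vge R w n)"
proof -
  interpret v: valued_field R v by (rule valuations_valued_field[OF field_axioms]) fact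
  obtain x where x: "x \<in> carrier R" "x \<noteq> \<zero>" "0 < v x" "\<forall>w\<in>B. w x < 0"
    using valuation_separates_finite[OF assms] by blast
  \<comment> \<open>The successor keeps m positive even when n is not, so that x^m has a zero at v
    and poles on B in any case.\<close>
  define m where "m = Suc (nat n)"
  define y where "y = x [^] m"
  have y: "y \<in> carrier R" "y \<noteq> \<zero>" unfolding y_def using x v.pow_nz by auto
  have vy: "n \<le> v y" "0 < v y"
  proof -
    have "int m * 1 \<le> int m * v x" using x by (intro mult_left_mono) auto
    hence "int m \<le> v y" using v.v_pow[of x m] x by (simp add: y_def)
    thus "n \<le> v y" "0 < v y" unfolding m_def by linarith+
  qed
  have "y \<in> vge R v (v \<one> + 1)" using vy y by (simp add: v.vge_iff)
  from v.v_add_strict[OF _ _ this] have s: "\<one> \<oplus> y \<noteq> \<zero>" "v (\<one> \<oplus> y) = 0" by auto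
  have sc: "\<one> \<oplus> y \<in> carrier R" using y by simp
  define e where "e = inv (\<one> \<oplus> y)"
  have e: "e \<in> carrier R" "e \<noteq> \<zero>" "e \<otimes> (\<one> \<oplus> y) = \<one>" "v e = 0"
    unfolding e_def using v.inv_closed_nz[OF sc s(1)] v.v_inv[OF sc s(1)] s by auto
  have ey: "e \<otimes> y \<in> carrier R" using e y by simp
  have "e \<otimes> (\<one> \<oplus> y) = e \<oplus> e \<otimes> y" using e(1) y by algebra
  hence one: "e \<oplus> e \<otimes> y = \<one>" using e by simp
  have "e \<ominus> (e \<oplus> e \<otimes> y) = \<ominus> (e \<otimes> y)" using e(1) y by algebra
  hence "e \<ominus> \<one> = \<ominus> (e \<otimes> y)" using one by simp
  moreover have "e \<otimes> y \<in> vge R v n" using v.vge_iff[of "e \<otimes> y"] e y v.mult_nz[of e y] vy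
    by (simp add: v.v_mult)
  ultimately have 1: "e \<ominus> \<one> \<in> vge R v n" using v.vge_minus by simp
  have "e \<in> vge R w n" if w: "w \<in> B" for w
  proof -
    interpret w: valued_field R w
      by (rule valuations_valued_field[OF field_axioms]) (use w assms in auto)
    have "int m * w x \<le> int m * (-1)" using x w by (intro mult_left_mono) auto
    hence wy: "w y \<le> - n" "w y < 0" using w.v_pow[of x m] x by (auto simp: m_def y_def)
    have "\<one> \<in> vge R w (w y + 1)" using wy by (simp add: w.vge_iff)
    from w.v_add_strict[OF y this] have "w (y \<oplus> \<one>) = w y" by auto
    hence "w (\<one> \<oplus> y) = w y" using y by (simp add: a_comm)
    hence "w e = - w y" unfolding e_def using w.v_inv[OF sc s(1)] by simp
    thus ?thesis using e wy by (simp add: w.vge_iff)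
  qed
  thus ?thesis using 1 e by blast
qed

theorem weak_approximation:
  assumes "finite B" "B \<subseteq> valuations R K" "\<And>v. v \<in> B \<Longrightarrow> f v \<in> carrier R"
  shows "\<exists>x\<in>carrier R. \<forall>v\<in>B. x \<ominus> f v \<in> vge R v (n v)"
proof -
  have V: "\<And>v. v \<in> B \<Longrightarrow> valued_field R v"
    using valuations_valued_field[OF field_axioms] assms by auto
  have "\<forall>v\<in>B. \<forall>w\<in>B. \<exists>k. f w \<in> vge R v k" using valued_field.vge_exists[OF V] assms(3) by blast
  then obtain k where k: "\<And>v w. v \<in> B \<Longrightarrow> w \<in> B \<Longrightarrow> f w \<in> vge R v (k v w)" by metis
  \<comment> \<open>An accuracy that absorbs the poles of all \<open>f w\<close> on B.\<close>
  define N where "N = Max (insert 0 ((\<lambda>(v, w). n v - k v w) ` (B \<times> B)))"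
  have N: "n v \<le> N + k v w" if "v \<in> B" "w \<in> B" for v w
  proof -
    have "n v - k v w \<le> N" unfolding N_def using that assms(1) by (intro Max_ge) auto
    thus ?thesis by simp
  qed
  have "\<exists>e\<in>carrier R. e \<ominus> \<one> \<in> vge R v N \<and> (\<forall>w\<in>B - {v}. e \<in> vge R w N)" if "v \<in> B" for v
    using approx_idempotent[of "B - {v}" K v N] assms that by auto
  then obtain e where e: "\<And>v. v \<in> B \<Longrightarrow> e v \<in> carrier R" "\<And>v. v \<in> B \<Longrightarrow> e v \<ominus> \<one> \<in> vge R v N"
    "\<And>v w. v \<in> B \<Longrightarrow> w \<in> B \<Longrightarrow> w \<noteq> v \<Longrightarrow> e v \<in> vge R w N"
    by (metis DiffI singletonD)
  define x where "x = (\<Oplus>w\<in>B. e w \<otimes> f w)"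
  have xc: "x \<in> carrier R" unfolding x_def using e assms by (intro finsum_closed) auto
  have "x \<ominus> f v \<in> vge R v (n v)" if v: "v \<in> B" for v
  proof -
    interpret v: valued_field R v by (rule V[OF v])
    define s where "s = (\<Oplus>w\<in>B - {v}. e w \<otimes> f w)"
    have s: "s \<in> vge R v (n v)" unfolding s_def
    proof (rule v.vge_finsum)
      fix w assume w: "w \<in> B - {v}"
      have "e w \<otimes> f w \<in> vge R v (N + k v w)" using e k v w by (intro v.vge_mult) auto
      thus "e w \<otimes> f w \<in> vge R v (n v)" using v.vge_mono N v w by auto
    qed (use assms in auto)
    have "x = e v \<otimes> f v \<oplus> s"
      unfolding x_def s_def using e assms v
      by (subst finsum_insert[symmetric]) (auto simp: insert_absorb)
    moreover have "s \<in> carrier R" using s v.vge_carrier by auto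
    ultimately have eq: "x \<ominus> f v = (e v \<ominus> \<one>) \<otimes> f v \<oplus> s" using e(1) assms(3) v by algebra
    have "(e v \<ominus> \<one>) \<otimes> f v \<in> vge R v (N + k v v)" using e k v by (intro v.vge_mult) auto
    thus ?thesis unfolding eq using v.vge_mono N v s by (intro v.vge_add) auto
  qed
  thus ?thesis using xc by blast
qed

end

section \<open>Zeros and poles in function fields\<close>

text \<open>By the strict triangle inequality the other terms cannot cancel a term of smallest
  value. This is the source of linear independence in \<open>finite_zeros\<close>.\<close>

lemma (in valued_field) combine_dominant:
  assumes "length Ks = length Us" "set Ks \<subseteq> carrier F" "set Us \<subseteq> carrier F" "i < length Us"
    and "Ks ! i \<otimes> Us ! i \<noteq> \<zero>"
    and "\<And>j. j < length Us \<Longrightarrow> j \<noteq> i \<Longrightarrow> Ks ! j \<otimes> Us ! j \<in> vge F v (v (Ks ! i \<otimes> Us ! i) + 1)"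
  shows "combine Ks Us \<noteq> \<zero>"
proof -
  define m where "m = v (Ks ! i \<otimes> Us ! i)"
  have all: "combine Ks Us \<in> vge F v n"
    if "length Ks = length Us" "\<And>j. j < length Us \<Longrightarrow> Ks ! j \<otimes> Us ! j \<in> vge F v n" for Ks Us n
    using that
  proof (induct Ks Us rule: list_induct2)
    case (Cons k Ks u Us)
    have "k \<otimes> u \<in> vge F v n" using Cons(3)[of 0] by simp
    moreover have "combine Ks Us \<in> vge F v n" using Cons(3)[of "Suc j" for j] by (intro Cons(2)) auto
    ultimately show ?case by (simp add: vge_add)
  qed simp
  have "combine Ks Us \<noteq> \<zero> \<and> v (combine Ks Us) = m"
    using assms[folded m_def] m_def
  proof (induct Ks Us arbitrary: i rule: list_induct2)
    case (Cons k Ks u Us)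
    have c: "combine Ks Us \<in> carrier F" "k \<otimes> u \<in> carrier F" using Cons by auto
    show ?case
    proof (cases i)
      case 0
      have "combine Ks Us \<in> vge F v (m + 1)"
      proof (rule all[OF Cons(1)])
        fix j assume "j < length Us"
        thus "Ks ! j \<otimes> Us ! j \<in> vge F v (m + 1)" using Cons(7)[of "Suc j"] 0 by simp
      qed
      thus ?thesis using v_add_strict[of "k \<otimes> u" "combine Ks Us"] Cons 0 by simp
    next
      case (Suc i')
      have 1: "k \<otimes> u \<in> vge F v (m + 1)" using Cons(7)[of 0] Suc by simp
      have 2: "combine Ks Us \<noteq> \<zero> \<and> v (combine Ks Us) = m"
      proof (rule Cons(2)[of i'])
        fix j assume "j < length Us" "j \<noteq> i'"
        thus "Ks ! j \<otimes> Us ! j \<in> vge F v (m + 1)" using Cons(7)[of "Suc j"] Suc by simp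
      qed (use Cons Suc in auto)
      have "combine (k # Ks) (u # Us) = combine Ks Us \<oplus> k \<otimes> u" using c by (simp add: a_comm)
      thus ?thesis using v_add_strict[of "combine Ks Us" "k \<otimes> u"] 1 2 c by simp
    qed
  qed simp
  thus ?thesis by simp
qed

context field
begin

lemma valuations_const: "v \<in> valuations R K \<Longrightarrow> k \<in> K \<Longrightarrow> k \<noteq> \<zero> \<Longrightarrow> v k = 0"
  by (auto simp: valuations_def)

text \<open>The elements with a denominator in K[u] form a subfield that contains K and u.\<close>

lemma generate_field_fraction:
  assumes K: "subfield K R" and u: "u \<in> carrier R" and x: "x \<in> generate_field R (insert u K)"
  shows "\<exists>d\<in>simple_extension K u. d \<noteq> \<zero> \<and> d \<otimes> x \<in> simple_extension K u"
proof -
  have Kc: "K \<subseteq> carrier R" using subfieldE(3)[OF K] .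
  have S: "subring (simple_extension K u) R"
    by (rule simple_extension_is_subring[OF subfieldE(1)[OF K] u])
  note Sp = subringE[OF S]
  have Sc: "\<And>x. x \<in> simple_extension K u \<Longrightarrow> x \<in> carrier R" using Sp(1) by auto
  define E where "E = {x \<in> carrier R. \<exists>d\<in>simple_extension K u. d \<noteq> \<zero> \<and> d \<otimes> x \<in> simple_extension K u}"
  have inc: "simple_extension K u \<subseteq> E"
    unfolding E_def using Sp(1,3) by auto (metis Sc l_one zero_not_one)
  have "subfield E R"
  proof (intro subfieldI' subringI)
    show "E \<subseteq> carrier R" by (auto simp: E_def)
    show "\<one> \<in> E" using inc Sp(3) by auto
    fix x assume x: "x \<in> E"
    then obtain d where d: "d \<in> simple_extension K u" "d \<noteq> \<zero>" "d \<otimes> x \<in> simple_extension K u" "x \<in> carrier R"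
      by (auto simp: E_def)
    have "d \<otimes> \<ominus> x = \<ominus> (d \<otimes> x)" using d Sc by algebra
    thus "\<ominus> x \<in> E" using d Sp(5) by (auto simp: E_def)
    fix y assume "y \<in> E"
    then obtain e where e: "e \<in> simple_extension K u" "e \<noteq> \<zero>" "e \<otimes> y \<in> simple_extension K u" "y \<in> carrier R"
      by (auto simp: E_def)
    have c: "d \<in> carrier R" "e \<in> carrier R" "d \<otimes> x \<in> carrier R" using d e Sc by auto
    have de: "d \<otimes> e \<in> simple_extension K u" "d \<otimes> e \<noteq> \<zero>" using d e Sp(6) c integral by blast+
    have "d \<otimes> e \<otimes> (x \<otimes> y) = (d \<otimes> x) \<otimes> (e \<otimes> y)" using c d e by algebra
    thus "x \<otimes> y \<in> E" using de d e Sp(6)[OF d(3) e(3)] by (auto simp: E_def)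
    have "d \<otimes> e \<otimes> (x \<oplus> y) = e \<otimes> (d \<otimes> x) \<oplus> d \<otimes> (e \<otimes> y)" using c d e by algebra
    thus "x \<oplus> y \<in> E" using de d e Sp(7)[OF Sp(6)[OF e(1) d(3)] Sp(6)[OF d(1) e(3)]] by (auto simp: E_def)
  next
    fix x assume "x \<in> E - {\<zero>}"
    then obtain d where d: "d \<in> simple_extension K u" "d \<noteq> \<zero>" "d \<otimes> x \<in> simple_extension K u" "x \<in> carrier R" "x \<noteq> \<zero>"
      by (auto simp: E_def)
    have i: "inv x \<in> carrier R" "x \<otimes> inv x = \<one>" using field_Units d by auto
    have c: "d \<in> carrier R" using d Sc by auto
    have "d \<otimes> x \<otimes> inv x = d" using c d i by (simp add: m_assoc)
    moreover have "d \<otimes> x \<noteq> \<zero>" using d c integral by blast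
    ultimately show "inv x \<in> E" using d i by (auto simp: E_def)
  qed
  moreover have "insert u K \<subseteq> E"
    using inc simple_extension_mem[OF subfieldE(1)[OF K] u] simple_extension_incl[OF Kc u] by auto
  ultimately have "generate_field R (insert u K) \<subseteq> E"
    using generate_field_min_subfield1[of "insert u K" E] Kc u by auto
  thus ?thesis using x by (auto simp: E_def)
qed

text \<open>e is the lowest exponent in a polynomial expression of x in u, found by Horner
  induction. The point is that it does not depend on v: all zeros of u induce proportional
  valuations on K[u].\<close>

lemma simple_extension_order:
  assumes K: "subfield K R" and u: "u \<in> carrier R" "u \<noteq> \<zero>" and x: "x \<in> simple_extension K u"
  shows "x = \<zero> \<or> (\<exists>e::nat. \<forall>v\<in>valuations R K. 0 < v u \<longrightarrow> v x = int e * v u)"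
  using x
proof (induct x rule: simple_extension.induct)
  case (lin k1 k2)
  have k: "k1 \<in> carrier R" "k2 \<in> carrier R"
    using lin simple_extension_in_carrier[OF subfieldE(3)[OF K] u(1)] subfieldE(3)[OF K] by auto
  have k1: "k1 = \<zero> \<or> (\<exists>e::nat. \<forall>v\<in>valuations R K. 0 < v u \<longrightarrow> v (k1 \<otimes> u) = int (Suc e) * v u)"
    using lin(2) valued_field.v_mult[OF valuations_valued_field[OF field_axioms]] k u
    by (cases "k1 = \<zero>") (fastforce simp: algebra_simps)+
  show ?case
  proof (cases "k2 = \<zero>")
    case True
    thus ?thesis using k1 k u by (metis l_null l_zero m_closed r_zero zero_closed)
  next
    case False
    have "v (k1 \<otimes> u \<oplus> k2) = int 0 * v u" if v: "v \<in> valuations R K" "0 < v u" for v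
    proof -
      interpret v: valued_field R v by (rule valuations_valued_field[OF field_axioms v(1)])
      have v0: "v k2 = 0" using valuations_const[OF v(1) lin(3) False] .
      have "k1 \<otimes> u \<in> vge R v 1"
      proof (cases "k1 = \<zero>")
        case False
        then obtain e where "v (k1 \<otimes> u) = int (Suc e) * v u" using k1 v by blast
        moreover have "1 * 1 \<le> int (Suc e) * v u" using v by (intro mult_mono) auto
        ultimately have "1 \<le> v (k1 \<otimes> u)" by simp
        thus ?thesis using k u by (auto simp: vge_def)
      qed (use u in simp)
      hence "v (k2 \<oplus> k1 \<otimes> u) = 0" using v.v_add_strict[of k2 "k1 \<otimes> u"] k False v0 by simp
      thus ?thesis using k u by (simp add: a_comm)
    qed
    thus ?thesis by blast
  qed
qed simp

lemma generate_field_order: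
  assumes K: "subfield K R" and u: "u \<in> carrier R" "u \<noteq> \<zero>"
    and x: "x \<in> generate_field R (insert u K)" "x \<noteq> \<zero>"
  shows "\<exists>e::int. \<forall>v\<in>valuations R K. 0 < v u \<longrightarrow> v x = e * v u"
proof -
  have Kc: "K \<subseteq> carrier R" using subfieldE(3)[OF K] .
  have Sc: "simple_extension K u \<subseteq> carrier R" by (rule simple_extension_in_carrier[OF Kc u(1)])
  obtain d where d: "d \<in> simple_extension K u" "d \<noteq> \<zero>" "d \<otimes> x \<in> simple_extension K u"
    using generate_field_fraction[OF K u(1) x(1)] by blast
  have xc: "x \<in> carrier R" using generate_field_in_carrier[of "insert u K"] x u Kc by auto
  have dc: "d \<in> carrier R" using d Sc by auto
  have nz: "d \<otimes> x \<noteq> \<zero>" using d x xc dc integral by blast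
  obtain e1 where e1: "\<forall>v\<in>valuations R K. 0 < v u \<longrightarrow> v d = int e1 * v u"
    using simple_extension_order[OF K u d(1)] d by blast
  obtain e2 where e2: "\<forall>v\<in>valuations R K. 0 < v u \<longrightarrow> v (d \<otimes> x) = int e2 * v u"
    using simple_extension_order[OF K u d(3)] nz by blast
  have "v x = (int e2 - int e1) * v u" if v: "v \<in> valuations R K" "0 < v u" for v
  proof -
    have "v (d \<otimes> x) = v d + v x"
      using valued_field.v_mult[OF valuations_valued_field[OF field_axioms v(1)]] d x xc dc by auto
    moreover have "v d = int e1 * v u" "v (d \<otimes> x) = int e2 * v u" using e1 e2 v by blast+
    ultimately show ?thesis by (simp add: algebra_simps)
  qed
  thus ?thesis by blast
qed

text \<open>
  On \<open>K(u)\<close> all \<open>v\<close> with \<open>v u > 0\<close> are proportional. Hence elements adapted to different such \<open>v\<close> by weak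
  approximation are linearly independent over \<open>K(u)\<close>.
\<close>

lemma finite_zeros:
  assumes K: "subfield K R" and u: "u \<in> carrier R" "u \<noteq> \<zero>"
    and fd: "finite_dimension (generate_field R (insert u K)) (carrier R)"
  shows "finite {v \<in> valuations R K. 0 < v u}"
proof (rule ccontr)
  assume inf: "infinite {v \<in> valuations R K. 0 < v u}"
  define L where "L = generate_field R (insert u K)"
  have L: "subfield L R" unfolding L_def
    using generate_field_is_subfield[of "insert u K"] subfieldE(3)[OF K] u by auto
  have Lc: "L \<subseteq> carrier R" using subfieldE(3)[OF L] .
  obtain n where n: "dimension n L (carrier R)"
    using fd unfolding finite_dimension_def L_def[symmetric] by blast
  \<comment> \<open>One place more than the dimension over K(u), so that the functions
    \<open>e v\<close> are forced to be linearly dependent over K(u).\<close>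
  obtain B where B: "B \<subseteq> {v \<in> valuations R K. 0 < v u}" "finite B" "card B = Suc n"
    using infinite_arbitrarily_large[OF inf] by metis
  obtain vs where vs: "set vs = B" "distinct vs" using finite_distinct_list[OF B(2)] by blast
  have lvs: "length vs = Suc n" using vs B by (metis distinct_card)
  have "\<exists>e\<in>carrier R. e \<ominus> \<one> \<in> vge R v 1 \<and> (\<forall>w\<in>B - {v}. e \<in> vge R w 1)" if "v \<in> B" for v
    using approx_idempotent[of "B - {v}" K v 1] B that by auto
  then obtain e where e: "\<And>v. v \<in> B \<Longrightarrow> e v \<in> carrier R" "\<And>v. v \<in> B \<Longrightarrow> e v \<ominus> \<one> \<in> vge R v 1"
    "\<And>v w. v \<in> B \<Longrightarrow> w \<in> B \<Longrightarrow> w \<noteq> v \<Longrightarrow> e v \<in> vge R w 1"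
    by (metis DiffI singletonD)
  define Us where "Us = map e vs"
  have Us: "set Us \<subseteq> carrier R" "length Us = Suc n" unfolding Us_def using e vs lvs by auto
  have "\<not> independent L Us"
    using independent_length_le_dimension[OF L n, of Us] Us by auto
  then obtain Ks where Ks: "length Ks = length Us" "combine Ks Us = \<zero>" "set Ks \<subseteq> L" "set Ks \<noteq> {\<zero>}"
    using dependent_imp_non_trivial_combine[OF L Us(1)] by blast
  have Ksc: "set Ks \<subseteq> carrier R" using Ks(3) Lc by auto
  have "\<exists>o'. \<forall>v\<in>valuations R K. 0 < v u \<longrightarrow> v k = o' * v u" if "k \<in> L" "k \<noteq> \<zero>" for k
    using generate_field_order[OF K u] that unfolding L_def by blast
  then obtain ord where ord: "\<And>k v. k \<in> L \<Longrightarrow> k \<noteq> \<zero> \<Longrightarrow> v \<in> valuations R K \<Longrightarrow> 0 < v u \<Longrightarrow> v k = ord k * v u"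
    by metis
  define I where "I = {i. i < length Us \<and> Ks ! i \<noteq> \<zero>}"
  have "\<exists>k\<in>set Ks. k \<noteq> \<zero>" using Ks(1,4) Us(2) by (cases Ks) auto
  hence "I \<noteq> {}" "finite I" unfolding I_def using Ks(1) by (auto simp: in_set_conv_nth)
  then obtain i where i: "i \<in> I" "\<And>j. j \<in> I \<Longrightarrow> ord (Ks ! i) \<le> ord (Ks ! j)"
    using arg_min_if_finite[of I "\<lambda>i. ord (Ks ! i)"] by (metis not_less)
  have il: "i < length Us" "Ks ! i \<noteq> \<zero>" using i by (auto simp: I_def)
  define v where "v = vs ! i"
  have vB: "v \<in> B" "v \<in> valuations R K" "0 < v u" unfolding v_def using il vs B lvs Us
    by (metis nth_mem, metis (mono_tags, lifting) nth_mem mem_Collect_eq subsetD, metis (mono_tags, lifting) nth_mem mem_Collect_eq subsetD)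
  interpret v: valued_field R v by (rule valuations_valued_field[OF field_axioms vB(2)])
  have Usi: "Us ! j = e (vs ! j)" if "j < length Us" for j using that by (simp add: Us_def)
  have ei: "Us ! i \<noteq> \<zero>" "v (Us ! i) = 0"
    using v.v_close[of \<one> "Us ! i"] e(1,2)[OF vB(1)] Usi[OF il(1)] by (simp_all add: v_def[symmetric])
  have Kc: "\<And>j. j < length Us \<Longrightarrow> Ks ! j \<in> L" "\<And>j. j < length Us \<Longrightarrow> Ks ! j \<in> carrier R"
    using Ks(1,3) Ksc by auto
  have Uc: "\<And>j. j < length Us \<Longrightarrow> Us ! j \<in> carrier R" using Us by auto
  have vi: "v (Ks ! i \<otimes> Us ! i) = ord (Ks ! i) * v u"
    using v.v_mult[of "Ks ! i" "Us ! i"] ei il Kc Uc ord[OF Kc(1)[OF il(1)] il(2) vB(2,3)] by simp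
  have "combine Ks Us \<noteq> \<zero>"
  proof (rule v.combine_dominant[OF Ks(1) Ksc Us(1) il(1)])
    show "Ks ! i \<otimes> Us ! i \<noteq> \<zero>" using v.mult_nz ei il Kc Uc by auto
    fix j assume j: "j < length Us" "j \<noteq> i"
    show "Ks ! j \<otimes> Us ! j \<in> vge R v (v (Ks ! i \<otimes> Us ! i) + 1)"
    proof (cases "Ks ! j = \<zero>")
      case True
      thus ?thesis using Uc[OF j(1)] by simp
    next
      case False
      have jI: "j \<in> I" using j False by (auto simp: I_def)
      have "ord (Ks ! i) * v u \<le> ord (Ks ! j) * v u" using i(2)[OF jI] vB(3) by (intro mult_right_mono) auto
      hence 1: "Ks ! j \<in> vge R v (ord (Ks ! i) * v u)"
        using ord[OF Kc(1)[OF j(1)] False vB(2,3)] Kc(2)[OF j(1)] False by (simp add: v.vge_iff)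
      have "vs ! j \<noteq> v" unfolding v_def using vs j il Us lvs by (metis nth_eq_iff_index_eq)
      moreover have "vs ! j \<in> B" using vs j Us lvs by (metis nth_mem)
      ultimately have "Us ! j \<in> vge R v 1" using e(3)[of "vs ! j" v] vB Usi[OF j(1)] by auto
      thus ?thesis unfolding vi using v.vge_mult[OF 1] by blast
    qed
  qed
  thus False using Ks(2) by simp
qed

lemma (in valued_field) eval_vge_neg:
  assumes "set p \<subseteq> vge F v 0" "x \<in> carrier F" "x \<noteq> \<zero>" "v x < 0" "p \<noteq> []"
  shows "eval p x \<in> vge F v (int (length p - 1) * v x)"
  using assms(1,5)
proof (induct p)
  case (Cons a p)
  have x: "x [^] length p \<in> vge F v (int (length p) * v x)"
    using v_pow[OF assms(2,3), of "length p"] assms by (simp add: vge_def)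
  have 1: "a \<otimes> x [^] length p \<in> vge F v (int (length p) * v x)"
    by (rule vge_mult0[OF _ x]) (use Cons in auto)
  have 2: "eval p x \<in> vge F v (int (length p) * v x)"
  proof (cases "p = []")
    case False
    hence "int (length p) * v x \<le> int (length p - 1) * v x"
      using assms(4) by (intro mult_right_mono_neg) auto
    thus ?thesis using Cons False vge_mono by auto
  qed simp
  show ?case using vge_add[OF 1 2] by simp
qed simp

text \<open>At a pole of x the leading term has strictly smaller value than all others, because its
  coefficient is a unit. In \<open>finite_support\<close> this bounds the poles of an algebraic
  element by the zeros and poles of its coefficients.\<close>

lemma (in valued_field) eval_unit_coeffs_neg:
  assumes "a \<in> carrier F" "a \<noteq> \<zero>" "v a = 0" "set p \<subseteq> vge F v 0" "x \<in> carrier F" "x \<noteq> \<zero>" "v x < 0" 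
  shows "eval (a # p) x \<noteq> \<zero>"
proof -
  have x: "x [^] length p \<in> carrier F" "x [^] length p \<noteq> \<zero>" using assms pow_nz by auto
  have ax: "a \<otimes> x [^] length p \<in> carrier F" "a \<otimes> x [^] length p \<noteq> \<zero>" using x assms mult_nz by auto
  have vx: "v (a \<otimes> x [^] length p) = int (length p) * v x" using v_mult x assms v_pow by auto
  have "eval p x \<in> vge F v (v (a \<otimes> x [^] length p) + 1)"
  proof (cases "p = []")
    case False
    have "int (length p - 1) * v x \<ge> int (length p) * v x + 1"
    proof -
      have "int (length p) = int (length p - 1) + 1" using False by (cases p) auto
      hence "int (length p) * v x = int (length p - 1) * v x + v x" by (metis distrib_right mult_1)
      thus ?thesis using assms(7) by simp
    qed
    thus ?thesis unfolding vx using vge_mono[OF eval_vge_neg[OF assms(4-7) False]] by simp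
  qed simp
  from v_add_strict(1)[OF ax this] show ?thesis by simp
qed

end

section \<open>Finiteness of the set of zeros and poles\<close>

locale function_field = field F for F (structure) +
  fixes K
  assumes ff: "function_field_one_var F K"
begin

lemma K: "subfield K F" using ff by (simp add: function_field_one_var_def)

text \<open>The tower K(u), K(u)(t), F: t is algebraic over K(u), and the finitely many generators
  of F are algebraic over K(t).\<close>

lemma finite_dimension_over_generated:
  assumes u: "u \<in> carrier F" and t: "t \<in> carrier F" "algebraic (generate_field F (insert u K)) t"
    and alg: "\<forall>x\<in>carrier F. algebraic (generate_field F (insert t K)) x"
  shows "finite_dimension (generate_field F (insert u K)) (carrier F)"
proof -
  define L where "L = generate_field F (insert u K)"
  have Kc: "K \<subseteq> carrier F" using subfieldE(3)[OF K] .
  have L: "subfield L F" "insert u K \<subseteq> L" unfolding L_def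
    using generate_fieldE[of "insert u K"] u Kc by auto
  obtain A where A: "finite A" "A \<subseteq> carrier F" "generate_field F (K \<union> A) = carrier F"
    using ff by (auto simp: function_field_one_var_def)
  obtain xs where xs: "set xs = A" using finite_list[OF A(1)] by blast
  define M where "M = finite_extension L [t]"
  have t1: "\<And>x. x \<in> set [t] \<Longrightarrow> (algebraic over L) x" using t by (simp add: over_def L_def)
  have M: "subfield M F" "finite_dimension L M"
    unfolding M_def using finite_extension_is_subfield[OF L(1), of "[t]"] t1 t
      finite_extension_finite_dimension(1)[OF L(1), of "[t]"] by (force, force)
  have LM: "L \<subseteq> M" "t \<in> M"
    unfolding M_def using finite_extension_incl[OF subfieldE(3)[OF L(1)], of "[t]"] t
      finite_extension_mem[OF subfieldE(1)[OF L(1)], of "[t]"] by auto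
  have tM: "generate_field F (insert t K) \<subseteq> M"
    using generate_field_min_subfield1[of "insert t K" M] t Kc M LM L by auto
  have aM: "\<And>x. x \<in> set xs \<Longrightarrow> (algebraic over M) x"
    using algebraic_mono[OF tM] alg xs A(2) by (auto simp: over_def)
  have sx: "set xs \<subseteq> carrier F" using xs A by simp
  define N where "N = finite_extension M xs"
  have N: "subfield N F" "finite_dimension M N"
    unfolding N_def using finite_extension_is_subfield[OF M(1) sx aM]
      finite_extension_finite_dimension(1)[OF M(1) sx aM] by auto
  have MN: "M \<subseteq> N" "set xs \<subseteq> N"
    unfolding N_def using finite_extension_incl[OF subfieldE(3)[OF M(1)] sx]
      finite_extension_mem[OF subfieldE(1)[OF M(1)] sx] by auto
  have "generate_field F (K \<union> A) \<subseteq> N"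
    by (rule generate_field_min_subfield1) (use Kc A N MN xs LM L in auto)
  hence "N = carrier F" using A subfieldE(3)[OF N(1)] by auto
  thus ?thesis using telescopic_base_dim(1)[OF L(1) M(1) M(2)] N(2) by (simp add: L_def)
qed

text \<open>A polynomial in t has poles only at poles of t, that is, at zeros of 1/t. If u = p(t) is
  not constant, then t is a root of p(X) - u and thus algebraic over K(u), so
  \<open>finite_zeros\<close> applies to u as well as to 1/t.\<close>

lemma finite_support_generator:
  assumes t: "t \<in> carrier F" "transcendental K t"
    and alg: "\<forall>x\<in>carrier F. algebraic (generate_field F (insert t K)) x"
    and u: "u \<in> simple_extension K t" "u \<noteq> \<zero>"
  shows "finite {v \<in> valuations F K. v u \<noteq> 0}"
proof -
  have Kc: "K \<subseteq> carrier F" using subfieldE(3)[OF K] .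
  have t0: "t \<noteq> \<zero>"
    using t(2) zero_is_algebraic[OF subfieldE(1)[OF K]] by (auto simp: over_def)
  have it: "inv t \<in> carrier F" "inv t \<noteq> \<zero>" "inv (inv t) = t"
    using field_Units t t0 by (auto simp: Units_inv_inv) 
  have "t \<in> generate_field F (insert (inv t) K)"
    using generate_field.m_inv[OF generate_field.incl[of "inv t" "insert (inv t) K" F]] it by auto
  hence "algebraic (generate_field F (insert (inv t) K)) t"
    using algebraic_self[OF subfieldE(1)[OF generate_field_is_subfield[of "insert (inv t) K"]]] it Kc
    by (auto simp: over_def)
  from finite_zeros[OF K it(1,2) finite_dimension_over_generated[OF it(1) t(1) this alg]]
  have f1: "finite {v \<in> valuations F K. 0 < v (inv t)}" .
  have uc: "u \<in> carrier F" using simple_extension_in_carrier[OF Kc t(1)] u by auto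
  obtain p where p: "p \<in> carrier (K[X])" "u = eval p t"
    using u simple_extension_as_eval_img[OF Kc t(1)] by auto
  have pK: "set p \<subseteq> K" "polynomial K p" using p(1) by (auto simp: univ_poly_def polynomial_def)
  have f2: "finite {v \<in> valuations F K. 0 < v u}"
  proof (cases "length p \<ge> 2")
    case True
    define L where "L = generate_field F (insert u K)"
    have L: "subfield L F" "insert u K \<subseteq> L" unfolding L_def
      using generate_fieldE[of "insert u K"] uc Kc by auto
    obtain a c p' where pe: "p = (a # p') @ [c]" 
      using True by (cases p; cases "tl p" rule: rev_cases) auto
    have ac: "a \<in> K" "c \<in> K" "a \<noteq> \<zero>" "set p' \<subseteq> K" using pK pe by (auto simp: polynomial_def)
    \<comment> \<open>This is p(X) - u. As p has degree at least 1, the leading coefficient is not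
      touched and q is nonzero.\<close>
    define q where "q = (a # p') @ [c \<ominus> u]"
    have "c \<ominus> u \<in> L" using subringE[OF subfieldE(1)[OF L(1)]] L ac by (auto simp: a_minus_def)
    hence q: "q \<in> carrier (L[X])" "q \<noteq> []" using ac L by (auto simp: q_def univ_poly_def polynomial_def)
    have e: "eval ((a # p') @ [b]) t = eval (a # p') t \<otimes> t \<oplus> b" if "b \<in> carrier F" for b
      using eval_append_aux[of "a # p'" b t] ac Kc t(1) that by auto
    have E: "eval (a # p') t \<in> carrier F" using eval_in_carrier[of "a # p'" t] ac Kc t by auto
    have cc: "c \<in> carrier F" using ac Kc by auto
    have "eval q t = eval (a # p') t \<otimes> t \<oplus> (c \<ominus> u)" unfolding q_def by (rule e) (use cc uc in simp)
    also have "\<dots> = (eval (a # p') t \<otimes> t \<oplus> c) \<ominus> u" using E cc uc t(1) by algebra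
    also have "eval (a # p') t \<otimes> t \<oplus> c = u" using e[OF cc] p(2) pe by simp
    finally have "eval q t = \<zero>" using uc by algebra
    hence "algebraic L t" using algebraicI[OF q] by (simp add: over_def)
    thus ?thesis
      using finite_zeros[OF K uc u(2)] finite_dimension_over_generated[OF uc t(1) _ alg] by (simp add: L_def)
  next
    case False
    then consider "p = []" | c where "p = [c]" by (cases p; cases "tl p") auto
    hence "u \<in> K"
    proof cases
      case 1 thus ?thesis using p u by simp
    next
      case 2 thus ?thesis using p pK Kc t by auto
    qed
    hence "v u = 0" if "v \<in> valuations F K" for v using valuations_const that u by auto
    hence E: "{v \<in> valuations F K. 0 < v u} = {}" by fastforce
    show ?thesis unfolding E by simp
  qed
  have "{v \<in> valuations F K. v u \<noteq> 0} \<subseteq> {v \<in> valuations F K. 0 < v (inv t)} \<union> {v \<in> valuations F K. 0 < v u}"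
  proof
    fix v assume "v \<in> {v \<in> valuations F K. v u \<noteq> 0}"
    hence v: "v \<in> valuations F K" "v u \<noteq> 0" by auto
    interpret v: valued_field F v by (rule valuations_valued_field[OF field_axioms v(1)])
    show "v \<in> {v \<in> valuations F K. 0 < v (inv t)} \<union> {v \<in> valuations F K. 0 < v u}"
    proof (cases "0 < v (inv t)")
      case False
      hence "t \<in> vge F v 0" using v.v_inv[OF t(1) t0] t by (simp add: vge_def)
      moreover have "K \<subseteq> vge F v 0" using valuations_const[OF v(1)] Kc by (fastforce simp: vge_def)
      ultimately have "simple_extension K t \<subseteq> vge F v 0"
        by (intro simple_extension_subring_incl v.subring_vge)
      thus ?thesis using u v by (auto simp: vge_def)
    qed (use v in auto)
  qed
  thus ?thesis using f1 f2 finite_subset by blast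
qed

text \<open>A pole of an element algebraic over K(t) is a zero or pole of some coefficient of its
  equation. Zeros are the poles of the inverse.\<close>

theorem finite_support:
  assumes f: "f \<in> carrier F" "f \<noteq> \<zero>"
  shows "finite {v \<in> valuations F K. v f \<noteq> 0}"
proof -
  have Kc: "K \<subseteq> carrier F" using subfieldE(3)[OF K] .
  obtain t where t: "t \<in> carrier F" "transcendental K t"
    "\<forall>x\<in>carrier F. algebraic (generate_field F (insert t K)) x"
    using ff by (auto simp: function_field_one_var_def)
  define L where "L = generate_field F (insert t K)"
  have L: "subfield L F" unfolding L_def
    using generate_field_is_subfield[of "insert t K"] Kc t by auto
  have Lc: "L \<subseteq> carrier F" using subfieldE(3)[OF L] .
  have Lfin: "finite {v \<in> valuations F K. v c \<noteq> 0}" if c: "c \<in> L" "c \<noteq> \<zero>" for c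
  proof -
    obtain d where d: "d \<in> simple_extension K t" "d \<noteq> \<zero>" "d \<otimes> c \<in> simple_extension K t"
      using generate_field_fraction[OF K t(1)] c unfolding L_def by blast
    have dc: "d \<in> carrier F" "c \<in> carrier F" using d simple_extension_in_carrier[OF Kc t(1)] c Lc by auto
    have nz: "d \<otimes> c \<noteq> \<zero>" using d c dc integral by blast
    have "v (d \<otimes> c) = v d + v c" if "v \<in> valuations F K" for v
      using valued_field.v_mult[OF valuations_valued_field[OF field_axioms that]] dc d c by auto
    hence "{v \<in> valuations F K. v c \<noteq> 0} \<subseteq> {v \<in> valuations F K. v d \<noteq> 0} \<union> {v \<in> valuations F K. v (d \<otimes> c) \<noteq> 0}"
      by fastforce
    thus ?thesis using finite_support_generator[OF t d(1,2)] finite_support_generator[OF t d(3) nz]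
        finite_subset by blast
  qed
  have neg: "finite {v \<in> valuations F K. v g < 0}" if g: "g \<in> carrier F" "g \<noteq> \<zero>" for g
  proof -
    obtain p where p: "p \<in> carrier (L[X])" "p \<noteq> []" "eval p g = \<zero>"
      using algebraicE[OF subfieldE(1)[OF L] g(1)] t(3) g(1) by (auto simp: over_def L_def)
    obtain a p' where pe: "p = a # p'" using p by (cases p) auto
    have ap: "a \<in> L" "a \<noteq> \<zero>" "set p' \<subseteq> L" using p pe by (auto simp: univ_poly_def polynomial_def)
    have "{v \<in> valuations F K. v g < 0} \<subseteq> (\<Union>c\<in>set p - {\<zero>}. {v \<in> valuations F K. v c \<noteq> 0})"
    proof
      fix v assume "v \<in> {v \<in> valuations F K. v g < 0}"
      hence v: "v \<in> valuations F K" "v g < 0" by auto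
      interpret v: valued_field F v by (rule valuations_valued_field[OF field_axioms v(1)])
      show "v \<in> (\<Union>c\<in>set p - {\<zero>}. {v \<in> valuations F K. v c \<noteq> 0})"
      proof (rule ccontr)
        assume n: "v \<notin> (\<Union>c\<in>set p - {\<zero>}. {v \<in> valuations F K. v c \<noteq> 0})"
        have "set p' \<subseteq> vge F v 0" using n v ap Lc pe by (fastforce simp: vge_def)
        moreover have "v a = 0" using n v ap pe by auto
        ultimately have "eval p g \<noteq> \<zero>" unfolding pe
          using ap Lc g v by (intro v.eval_unit_coeffs_neg) auto
        thus False using p by simp
      qed
    qed
    moreover have "finite (\<Union>c\<in>set p - {\<zero>}. {v \<in> valuations F K. v c \<noteq> 0})"
      using Lfin ap pe by auto
    ultimately show ?thesis using finite_subset by blast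
  qed
  have i: "inv f \<in> carrier F" "inv f \<noteq> \<zero>" using field_Units f Units_inv_Units by auto
  have "v (inv f) = - v f" if "v \<in> valuations F K" for v
    using valued_field.v_inv[OF valuations_valued_field[OF field_axioms that]] f by auto
  hence "{v \<in> valuations F K. v f \<noteq> 0} \<subseteq> {v \<in> valuations F K. v f < 0} \<union> {v \<in> valuations F K. v (inv f) < 0}"
    by fastforce
  thus ?thesis using neg[OF f] neg[OF i] finite_subset by blast
qed

end

section \<open>Completions\<close>

context valued_field
begin

text \<open>Eventual closeness to a constant, for each accuracy, is equivalent to the usual
  condition on pairs of terms and passes to sums, products and inverses by looking at one index at a
  time.\<close>

definition cauchy :: "(nat \<Rightarrow> 'a) \<Rightarrow> bool" where
  "cauchy s \<longleftrightarrow> (\<forall>n. s n \<in> carrier F) \<and>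
     (\<forall>N. \<exists>c\<in>carrier F. \<forall>\<^sub>F n in sequentially. s n \<ominus> c \<in> vge F v N)"

definition seq_eq :: "(nat \<Rightarrow> 'a) \<Rightarrow> (nat \<Rightarrow> 'a) \<Rightarrow> bool" where
  "seq_eq s t \<longleftrightarrow> (\<forall>N. \<forall>\<^sub>F n in sequentially. s n \<ominus> t n \<in> vge F v N)"

text \<open>
  Elements of the completion are chosen representatives of classes of Cauchy sequences, so that its type
  is the one over which henselisations are defined.
\<close>

definition rep :: "(nat \<Rightarrow> 'a) \<Rightarrow> nat \<Rightarrow> 'a" where
  "rep s = (SOME t. cauchy t \<and> seq_eq t s)"

definition sadd where "sadd s t = (\<lambda>n::nat. s n \<oplus> t n)"
definition smul where "smul s t = (\<lambda>n::nat. s n \<otimes> t n)"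

definition compl :: "(nat \<Rightarrow> 'a) ring" where
  "compl = \<lparr>carrier = {s. cauchy s \<and> rep s = s}, mult = (\<lambda>s t. rep (smul s t)), one = rep (\<lambda>_. \<one>),
     zero = rep (\<lambda>_. \<zero>), add = (\<lambda>s t. rep (sadd s t))\<rparr>"

text \<open>Along a Cauchy sequence that does not tend to zero the values are eventually constant
  (\<open>compl_nonzero\<close>); that constant is meant.\<close>

definition vcompl :: "(nat \<Rightarrow> 'a) \<Rightarrow> int" where
  "vcompl s = (SOME k. \<forall>\<^sub>F n in sequentially. v (s n) = k)"

lemma minus_self: "x \<in> carrier F \<Longrightarrow> x \<ominus> x = \<zero>"
  by (simp add: a_minus_def r_neg)

lemma cauchy_carrier [simp]: "cauchy s \<Longrightarrow> s n \<in> carrier F"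
  by (simp add: cauchy_def)

lemma cauchyD:
  assumes "cauchy s" shows "\<exists>c\<in>carrier F. \<forall>\<^sub>F n in sequentially. s n \<ominus> c \<in> vge F v N"
  by (rule spec[OF conjunct2[OF iffD1[OF cauchy_def assms]]])

lemma cauchy_const [simp]: assumes "c \<in> carrier F" shows "cauchy (\<lambda>_. c)"
  unfolding cauchy_def
proof (intro conjI allI)
  fix N
  have "\<forall>\<^sub>F n in sequentially. c \<ominus> c \<in> vge F v N" using assms by (simp add: minus_self)
  thus "\<exists>d\<in>carrier F. \<forall>\<^sub>F n in sequentially. c \<ominus> d \<in> vge F v N" using assms by (intro bexI[of _ c])
qed (use assms in simp)

lemma cauchy_bounded: assumes "cauchy s" shows "\<exists>B. \<forall>\<^sub>F n in sequentially. s n \<in> vge F v B"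
proof -
  obtain c where c: "c \<in> carrier F" "\<forall>\<^sub>F n in sequentially. s n \<ominus> c \<in> vge F v 0"
    using cauchyD[OF assms, of "0"] by (elim bexE)
  obtain k where k: "c \<in> vge F v k" using vge_exists c by blast
  show ?thesis
  proof (rule exI, use c(2) in eventually_elim)
    fix n assume n: "s n \<ominus> c \<in> vge F v 0"
    have "s n = (s n \<ominus> c) \<oplus> c" using c assms cauchy_carrier[OF assms, of n] by algebra
    moreover have "s n \<ominus> c \<in> vge F v (min 0 k)" "c \<in> vge F v (min 0 k)" using n k vge_mono by auto
    ultimately show "s n \<in> vge F v (min 0 k)" using vge_add by metis
  qed
qed

lemma cauchy_sadd [simp]: assumes "cauchy s" "cauchy t" shows "cauchy (sadd s t)"
  unfolding cauchy_def
proof (intro conjI allI)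
  fix N
  obtain c where c: "c \<in> carrier F" "\<forall>\<^sub>F n in sequentially. s n \<ominus> c \<in> vge F v N"
    using cauchyD[OF assms(1), of "N"] by (elim bexE)
  obtain d where d: "d \<in> carrier F" "\<forall>\<^sub>F n in sequentially. t n \<ominus> d \<in> vge F v N"
    using cauchyD[OF assms(2), of "N"] by (elim bexE)
  have "\<forall>\<^sub>F n in sequentially. sadd s t n \<ominus> (c \<oplus> d) \<in> vge F v N"
    using c(2) d(2)
  proof eventually_elim
    fix n assume n: "s n \<ominus> c \<in> vge F v N" "t n \<ominus> d \<in> vge F v N"
    have "sadd s t n \<ominus> (c \<oplus> d) = (s n \<ominus> c) \<oplus> (t n \<ominus> d)" unfolding sadd_def
      using c(1) d(1) cauchy_carrier[OF assms(1), of n] cauchy_carrier[OF assms(2), of n] by algebra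
    thus "sadd s t n \<ominus> (c \<oplus> d) \<in> vge F v N" using vge_add[OF n] by simp
  qed
  thus "\<exists>c\<in>carrier F. \<forall>\<^sub>F n in sequentially. sadd s t n \<ominus> c \<in> vge F v N" using c(1) d(1)
    by (intro bexI[of _ "c \<oplus> d"]) simp_all
qed (use assms in \<open>simp add: sadd_def\<close>)

lemma cauchy_smul [simp]: assumes "cauchy s" "cauchy t" shows "cauchy (smul s t)"
  unfolding cauchy_def
proof (intro conjI allI)
  fix N
  obtain B where B: "\<forall>\<^sub>F n in sequentially. s n \<in> vge F v B" using cauchy_bounded[OF assms(1)] by blast
  obtain d where d: "d \<in> carrier F" "\<forall>\<^sub>F n in sequentially. t n \<ominus> d \<in> vge F v (N - B)"
    using cauchyD[OF assms(2), of "(N - B)"] by (elim bexE)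
  obtain k where k: "d \<in> vge F v k" using vge_exists d by blast
  obtain c where c: "c \<in> carrier F" "\<forall>\<^sub>F n in sequentially. s n \<ominus> c \<in> vge F v (N - k)"
    using cauchyD[OF assms(1), of "(N - k)"] by (elim bexE)
  have "\<forall>\<^sub>F n in sequentially. smul s t n \<ominus> (c \<otimes> d) \<in> vge F v N"
    using c(2) d(2) B
  proof eventually_elim
    fix n assume n: "s n \<ominus> c \<in> vge F v (N - k)" "t n \<ominus> d \<in> vge F v (N - B)" "s n \<in> vge F v B"
    have "smul s t n \<ominus> (c \<otimes> d) = s n \<otimes> (t n \<ominus> d) \<oplus> (s n \<ominus> c) \<otimes> d" unfolding smul_def
      using c(1) d(1) cauchy_carrier[OF assms(1), of n] cauchy_carrier[OF assms(2), of n] by algebra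
    moreover have "s n \<otimes> (t n \<ominus> d) \<in> vge F v N" "(s n \<ominus> c) \<otimes> d \<in> vge F v N"
      using vge_mult[OF n(3,2)] vge_mult[OF n(1) k] by simp_all
    ultimately show "smul s t n \<ominus> (c \<otimes> d) \<in> vge F v N" using vge_add by simp
  qed
  thus "\<exists>c\<in>carrier F. \<forall>\<^sub>F n in sequentially. smul s t n \<ominus> c \<in> vge F v N" using c(1) d(1)
    by (intro bexI[of _ "c \<otimes> d"]) simp_all
qed (use assms in \<open>simp add: smul_def\<close>)

lemma seq_eq_refl: "cauchy s \<Longrightarrow> seq_eq s s"
  by (simp add: seq_eq_def minus_self)

lemma seq_eq_sym: assumes "cauchy s" "cauchy t" "seq_eq s t" shows "seq_eq t s"
  unfolding seq_eq_def
proof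
  fix N
  have "\<forall>\<^sub>F n in sequentially. s n \<ominus> t n \<in> vge F v N" using assms(3) by (simp add: seq_eq_def)
  thus "\<forall>\<^sub>F n in sequentially. t n \<ominus> s n \<in> vge F v N"
  proof eventually_elim
    fix n assume n: "s n \<ominus> t n \<in> vge F v N"
    have "t n \<ominus> s n = \<ominus> (s n \<ominus> t n)"
      using cauchy_carrier[OF assms(1), of n] cauchy_carrier[OF assms(2), of n] by algebra
    thus "t n \<ominus> s n \<in> vge F v N" using vge_minus[OF n] by simp
  qed
qed

lemma seq_eq_trans: assumes "cauchy s" "cauchy t" "cauchy u" "seq_eq s t" "seq_eq t u" shows "seq_eq s u"
  unfolding seq_eq_def
proof
  fix N
  have "\<forall>\<^sub>F n in sequentially. s n \<ominus> t n \<in> vge F v N" "\<forall>\<^sub>F n in sequentially. t n \<ominus> u n \<in> vge F v N"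
    using assms by (simp_all add: seq_eq_def)
  thus "\<forall>\<^sub>F n in sequentially. s n \<ominus> u n \<in> vge F v N"
  proof eventually_elim
    fix n assume n: "s n \<ominus> t n \<in> vge F v N" "t n \<ominus> u n \<in> vge F v N"
    have "s n \<ominus> u n = (s n \<ominus> t n) \<oplus> (t n \<ominus> u n)"
      using cauchy_carrier[OF assms(1), of n] cauchy_carrier[OF assms(2), of n]
        cauchy_carrier[OF assms(3), of n] by algebra
    thus "s n \<ominus> u n \<in> vge F v N" using vge_add[OF n] by simp
  qed
qed

lemma seq_eq_sadd: assumes "cauchy s" "cauchy s'" "cauchy t" "seq_eq s s'"
  shows "seq_eq (sadd s t) (sadd s' t)"
  unfolding seq_eq_def
proof
  fix N
  have "\<forall>\<^sub>F n in sequentially. s n \<ominus> s' n \<in> vge F v N" using assms by (simp add: seq_eq_def)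
  thus "\<forall>\<^sub>F n in sequentially. sadd s t n \<ominus> sadd s' t n \<in> vge F v N"
  proof eventually_elim
    fix n assume n: "s n \<ominus> s' n \<in> vge F v N"
    have "sadd s t n \<ominus> sadd s' t n = s n \<ominus> s' n" unfolding sadd_def
      using cauchy_carrier[OF assms(1), of n] cauchy_carrier[OF assms(2), of n]
        cauchy_carrier[OF assms(3), of n] by algebra
    thus "sadd s t n \<ominus> sadd s' t n \<in> vge F v N" using n by simp
  qed
qed

lemma seq_eq_smul: assumes "cauchy s" "cauchy s'" "cauchy t" "seq_eq s s'"
  shows "seq_eq (smul s t) (smul s' t)"
  unfolding seq_eq_def
proof
  fix N
  obtain B where B: "\<forall>\<^sub>F n in sequentially. t n \<in> vge F v B" using cauchy_bounded[OF assms(3)] by blast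
  have "\<forall>\<^sub>F n in sequentially. s n \<ominus> s' n \<in> vge F v (N - B)" using assms by (simp add: seq_eq_def)
  thus "\<forall>\<^sub>F n in sequentially. smul s t n \<ominus> smul s' t n \<in> vge F v N" using B
  proof eventually_elim
    fix n assume n: "s n \<ominus> s' n \<in> vge F v (N - B)" "t n \<in> vge F v B"
    have "smul s t n \<ominus> smul s' t n = (s n \<ominus> s' n) \<otimes> t n" unfolding smul_def
      using cauchy_carrier[OF assms(1), of n] cauchy_carrier[OF assms(2), of n]
        cauchy_carrier[OF assms(3), of n] by algebra
    thus "smul s t n \<ominus> smul s' t n \<in> vge F v N" using vge_mult[OF n] by simp
  qed
qed

lemma sadd_comm: "cauchy s \<Longrightarrow> cauchy t \<Longrightarrow> sadd s t = sadd t s"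
  by (auto simp: sadd_def a_comm)

lemma smul_comm: "cauchy s \<Longrightarrow> cauchy t \<Longrightarrow> smul s t = smul t s"
  by (auto simp: smul_def m_comm)

lemma rep_props: "cauchy s \<Longrightarrow> cauchy (rep s) \<and> seq_eq (rep s) s"
  unfolding rep_def by (rule someI[of _ s]) (simp add: seq_eq_refl)

lemma cauchy_rep [simp]: "cauchy s \<Longrightarrow> cauchy (rep s)"
  using rep_props by blast

lemma rep_eqI: assumes "cauchy s" "cauchy t" "seq_eq s t" shows "rep s = rep t"
proof -
  have "(cauchy u \<and> seq_eq u s) = (cauchy u \<and> seq_eq u t)" for u
    using assms seq_eq_trans seq_eq_sym by blast
  thus ?thesis unfolding rep_def by simp
qed

lemma rep_rep [simp]: "cauchy s \<Longrightarrow> rep (rep s) = rep s"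
  using rep_eqI rep_props by blast

lemma rep_sadd_l [simp]: "cauchy s \<Longrightarrow> cauchy t \<Longrightarrow> rep (sadd (rep s) t) = rep (sadd s t)"
  by (intro rep_eqI cauchy_sadd seq_eq_sadd) (simp_all add: rep_props)

lemma rep_sadd_r [simp]: "cauchy s \<Longrightarrow> cauchy t \<Longrightarrow> rep (sadd t (rep s)) = rep (sadd t s)"
  using rep_sadd_l sadd_comm by (metis cauchy_rep)

lemma rep_smul_l [simp]: "cauchy s \<Longrightarrow> cauchy t \<Longrightarrow> rep (smul (rep s) t) = rep (smul s t)"
  by (intro rep_eqI cauchy_smul seq_eq_smul) (simp_all add: rep_props)

lemma rep_smul_r [simp]: "cauchy s \<Longrightarrow> cauchy t \<Longrightarrow> rep (smul t (rep s)) = rep (smul t s)"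
  using rep_smul_l smul_comm by (metis cauchy_rep)

lemma compl_simps:
  "carrier compl = {s. cauchy s \<and> rep s = s}" "s \<otimes>\<^bsub>compl\<^esub> t = rep (smul s t)"
  "s \<oplus>\<^bsub>compl\<^esub> t = rep (sadd s t)" "\<one>\<^bsub>compl\<^esub> = rep (\<lambda>_. \<one>)" "\<zero>\<^bsub>compl\<^esub> = rep (\<lambda>_. \<zero>)"
  by (simp_all add: compl_def)

text \<open>At an accuracy N at which s is not eventually small, the approximating constant c has
  v(c) < N, so from some index on s n and c have the same value.\<close>

lemma cauchy_eventually_value:
  assumes s: "cauchy s" and nz: "\<not> seq_eq s (\<lambda>_. \<zero>)"
  shows "\<exists>k. \<forall>\<^sub>F n in sequentially. s n \<noteq> \<zero> \<and> v (s n) = k"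
proof -
  obtain N where N: "\<not> (\<forall>\<^sub>F n in sequentially. s n \<in> vge F v N)"
    using nz s by (auto simp: seq_eq_def a_minus_def)
  obtain c where c: "c \<in> carrier F" "\<forall>\<^sub>F n in sequentially. s n \<ominus> c \<in> vge F v N"
    using cauchyD[OF s, of "N"] by (elim bexE)
  have "c \<notin> vge F v N"
  proof
    assume cN: "c \<in> vge F v N"
    have "\<forall>\<^sub>F n in sequentially. s n \<in> vge F v N" using c(2)
    proof eventually_elim
      fix n assume n: "s n \<ominus> c \<in> vge F v N"
      have "s n = (s n \<ominus> c) \<oplus> c" using c s cauchy_carrier[OF s, of n] by algebra
      thus "s n \<in> vge F v N" using vge_add[OF n cN] by simp
    qed
    thus False using N by simp
  qed
  hence c': "c \<noteq> \<zero>" "v c + 1 \<le> N" using c(1) by (auto simp: vge_def)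
  have "\<forall>\<^sub>F n in sequentially. s n \<noteq> \<zero> \<and> v (s n) = v c" using c(2)
  proof eventually_elim
    fix n assume n: "s n \<ominus> c \<in> vge F v N"
    show "s n \<noteq> \<zero> \<and> v (s n) = v c"
      using v_close[OF c(1) c'(1) _ vge_mono[OF n c'(2)]] s by simp
  qed
  thus ?thesis by blast
qed

lemma compl_nonzero:
  assumes "s \<in> carrier compl" "s \<noteq> \<zero>\<^bsub>compl\<^esub>"
  shows "\<forall>\<^sub>F n in sequentially. s n \<noteq> \<zero> \<and> v (s n) = vcompl s"
proof -
  have s: "cauchy s" "rep s = s" using assms by (auto simp: compl_simps)
  have "\<not> seq_eq s (\<lambda>_. \<zero>)" using assms s rep_eqI[of s "\<lambda>_. \<zero>"] by (auto simp: compl_simps)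
  then obtain k where k: "\<forall>\<^sub>F n in sequentially. s n \<noteq> \<zero> \<and> v (s n) = k"
    using cauchy_eventually_value s by blast
  hence "\<forall>\<^sub>F n in sequentially. v (s n) = k" by eventually_elim simp
  hence "\<forall>\<^sub>F n in sequentially. v (s n) = vcompl s" unfolding vcompl_def by (rule someI)
  thus ?thesis using k by eventually_elim simp
qed

lemma vge_seq_eq:
  assumes "cauchy s" "cauchy t" "seq_eq s t" "\<forall>\<^sub>F n in sequentially. t n \<in> vge F v N"
  shows "\<forall>\<^sub>F n in sequentially. s n \<in> vge F v N"
proof -
  have "\<forall>\<^sub>F n in sequentially. s n \<ominus> t n \<in> vge F v N" using assms(3) by (simp add: seq_eq_def)
  thus ?thesis using assms(4)
  proof eventually_elim
    fix n assume n: "s n \<ominus> t n \<in> vge F v N" "t n \<in> vge F v N"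
    have "s n = (s n \<ominus> t n) \<oplus> t n"
      using cauchy_carrier[OF assms(1), of n] cauchy_carrier[OF assms(2), of n] by algebra
    thus "s n \<in> vge F v N" using vge_add[OF n] by simp
  qed
qed

lemma zero_compl_small: "\<forall>\<^sub>F n in sequentially. \<zero>\<^bsub>compl\<^esub> n \<in> vge F v N"
  using vge_seq_eq[of "rep (\<lambda>_. \<zero>)" "\<lambda>_. \<zero>" N] rep_props[of "\<lambda>_. \<zero>"] by (simp add: compl_simps)

lemma vge_compl_iff:
  assumes "s \<in> carrier compl"
  shows "s \<in> vge compl vcompl N \<longleftrightarrow> (\<forall>\<^sub>F n in sequentially. s n \<in> vge F v N)"
proof (cases "s = \<zero>\<^bsub>compl\<^esub>")
  case True
  thus ?thesis using assms zero_compl_small by (simp add: vge_def[of compl])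
next
  case False
  note e = compl_nonzero[OF assms False]
  have sc: "s n \<in> carrier F" for n using assms by (simp add: compl_simps)
  show ?thesis
  proof
    assume "s \<in> vge compl vcompl N"
    hence "N \<le> vcompl s" using False by (simp add: vge_def)
    thus "\<forall>\<^sub>F n in sequentially. s n \<in> vge F v N" using e sc by (auto elim!: eventually_mono simp: vge_def)
  next
    assume "\<forall>\<^sub>F n in sequentially. s n \<in> vge F v N"
    hence "\<forall>\<^sub>F n in sequentially. N \<le> vcompl s" using e by eventually_elim (auto simp: vge_def)
    thus "s \<in> vge compl vcompl N" using assms by (simp add: vge_def)
  qed
qed

section \<open>Field structure and valuation of the completion\<close>

lemma cring_compl: "cring compl"
proof (rule cringI)
  show "abelian_group compl"
  proof (rule abelian_groupI)
    fix x y z assume "x \<in> carrier compl" "y \<in> carrier compl" "z \<in> carrier compl"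
    hence xyz: "cauchy x" "cauchy y" "cauchy z" by (auto simp: compl_simps)
    have "sadd (sadd x y) z = sadd x (sadd y z)" using xyz by (auto simp: sadd_def a_assoc)
    thus "x \<oplus>\<^bsub>compl\<^esub> y \<oplus>\<^bsub>compl\<^esub> z = x \<oplus>\<^bsub>compl\<^esub> (y \<oplus>\<^bsub>compl\<^esub> z)" using xyz by (simp add: compl_simps)
  next
    fix x assume "x \<in> carrier compl"
    hence x: "cauchy x" "rep x = x" by (auto simp: compl_simps)
    have m: "(\<lambda>n. \<ominus> x n) = smul (\<lambda>_. \<ominus> \<one>) x" using x by (auto simp: smul_def l_minus)
    have mc: "cauchy (\<lambda>n. \<ominus> x n)" unfolding m using x by (intro cauchy_smul) auto
    have "sadd (\<lambda>n. \<ominus> x n) x = (\<lambda>_. \<zero>)" using x by (auto simp: sadd_def l_neg)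
    hence "rep (\<lambda>n. \<ominus> x n) \<oplus>\<^bsub>compl\<^esub> x = \<zero>\<^bsub>compl\<^esub>" using x mc by (simp add: compl_simps)
    moreover have "rep (\<lambda>n. \<ominus> x n) \<in> carrier compl" using mc by (simp add: compl_simps)
    ultimately show "\<exists>y\<in>carrier compl. y \<oplus>\<^bsub>compl\<^esub> x = \<zero>\<^bsub>compl\<^esub>" by blast
    have "sadd (\<lambda>_. \<zero>) x = x" using x by (auto simp: sadd_def)
    thus "\<zero>\<^bsub>compl\<^esub> \<oplus>\<^bsub>compl\<^esub> x = x" using x by (simp add: compl_simps)
  qed (auto simp: compl_simps sadd_comm)
  show "Group.comm_monoid compl"
  proof (rule comm_monoidI)
    fix x y z assume "x \<in> carrier compl" "y \<in> carrier compl" "z \<in> carrier compl"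
    hence xyz: "cauchy x" "cauchy y" "cauchy z" by (auto simp: compl_simps)
    have "smul (smul x y) z = smul x (smul y z)" using xyz by (auto simp: smul_def m_assoc)
    thus "x \<otimes>\<^bsub>compl\<^esub> y \<otimes>\<^bsub>compl\<^esub> z = x \<otimes>\<^bsub>compl\<^esub> (y \<otimes>\<^bsub>compl\<^esub> z)" using xyz by (simp add: compl_simps)
  next
    fix x assume "x \<in> carrier compl"
    hence x: "cauchy x" "rep x = x" by (auto simp: compl_simps)
    have "smul (\<lambda>_. \<one>) x = x" using x by (auto simp: smul_def)
    thus "\<one>\<^bsub>compl\<^esub> \<otimes>\<^bsub>compl\<^esub> x = x" using x by (simp add: compl_simps)
  qed (auto simp: compl_simps smul_comm)
  fix x y z assume "x \<in> carrier compl" "y \<in> carrier compl" "z \<in> carrier compl"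
  hence xyz: "cauchy x" "cauchy y" "cauchy z" by (auto simp: compl_simps)
  have "smul (sadd x y) z = sadd (smul x z) (smul y z)" using xyz by (auto simp: sadd_def smul_def l_distr)
  thus "(x \<oplus>\<^bsub>compl\<^esub> y) \<otimes>\<^bsub>compl\<^esub> z = x \<otimes>\<^bsub>compl\<^esub> z \<oplus>\<^bsub>compl\<^esub> y \<otimes>\<^bsub>compl\<^esub> z"
    using xyz by (simp add: compl_simps)
qed

lemma compl_inverse:
  assumes s: "s \<in> carrier compl" "s \<noteq> \<zero>\<^bsub>compl\<^esub>"
  shows "\<exists>t\<in>carrier compl. t \<otimes>\<^bsub>compl\<^esub> s = \<one>\<^bsub>compl\<^esub>"
proof -
  have cs: "cauchy s" "rep s = s" using s by (auto simp: compl_simps)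
  define k where "k = vcompl s"
  note e = compl_nonzero[OF s, folded k_def]
  \<comment> \<open>The pointwise inverse; the finitely many vanishing terms are sent to
    zero.\<close>
  define t where "t = (\<lambda>n. if s n = \<zero> then \<zero> else inv (s n))"
  have tc: "t n \<in> carrier F" for n using inv_closed_nz[of "s n"] cs by (auto simp: t_def)
  have ct: "cauchy t" unfolding cauchy_def
  proof (intro conjI allI)
    fix N
    \<comment> \<open>Accuracy k + 1 forces v(c) = k. The bound N + 2 k makes up for inversion,
      which lowers the accuracy of a difference by v(c) + v(s n).\<close>
    obtain c where c: "c \<in> carrier F" "\<forall>\<^sub>F n in sequentially. s n \<ominus> c \<in> vge F v (max (N + 2 * k) (k + 1))"
      using cauchyD[OF cs(1), of "(max (N + 2 * k) (k + 1))"] by (elim bexE)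
    have "\<forall>\<^sub>F n in sequentially. c \<noteq> \<zero> \<and> v c = k"
      using e c(2)
    proof eventually_elim
      fix n assume n: "s n \<noteq> \<zero> \<and> v (s n) = k" "s n \<ominus> c \<in> vge F v (max (N + 2 * k) (k + 1))"
      have sn: "s n \<in> carrier F" using cs by simp
      have "c \<ominus> s n = \<ominus> (s n \<ominus> c)" using sn c(1) by algebra
      hence "c \<ominus> s n \<in> vge F v (v (s n) + 1)" using vge_mono[OF vge_minus[OF n(2)]] n(1) by simp
      thus "c \<noteq> \<zero> \<and> v c = k" using v_close[of "s n" c] sn c(1) n by auto
    qed
    hence c': "c \<noteq> \<zero>" "v c = k" by auto
    have "\<forall>\<^sub>F n in sequentially. t n \<ominus> inv c \<in> vge F v N" using e c(2)
    proof eventually_elim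
      fix n assume n: "s n \<noteq> \<zero> \<and> v (s n) = k" "s n \<ominus> c \<in> vge F v (max (N + 2 * k) (k + 1))"
      have "inv (s n) \<ominus> inv c \<in> vge F v (max (N + 2 * k) (k + 1) - v c - v (s n))"
        by (rule vge_inv_diff) (use c c' n cs in auto)
      thus "t n \<ominus> inv c \<in> vge F v N" unfolding t_def using n c' vge_mono by auto
    qed
    thus "\<exists>c\<in>carrier F. \<forall>\<^sub>F n in sequentially. t n \<ominus> c \<in> vge F v N"
      using inv_closed_nz[OF c(1) c'(1)] by (intro bexI[of _ "inv c"]) simp_all
  qed (use tc in simp)
  have "seq_eq (smul t s) (\<lambda>_. \<one>)" unfolding seq_eq_def
  proof
    fix N
    show "\<forall>\<^sub>F n in sequentially. smul t s n \<ominus> \<one> \<in> vge F v N" using e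
    proof eventually_elim
      fix n assume n: "s n \<noteq> \<zero> \<and> v (s n) = k"
      hence "smul t s n = \<one>" using inv_closed_nz[of "s n"] cs by (simp add: smul_def t_def)
      thus "smul t s n \<ominus> \<one> \<in> vge F v N" by (simp add: a_minus_def r_neg)
    qed
  qed
  hence "rep (smul t s) = rep (\<lambda>_. \<one>)" using ct cs by (intro rep_eqI) auto
  thus ?thesis using ct cs by (intro bexI[of _ "rep t"]) (simp_all add: compl_simps)
qed

lemma compl_one_nz: "\<one>\<^bsub>compl\<^esub> \<noteq> \<zero>\<^bsub>compl\<^esub>"
proof
  assume "\<one>\<^bsub>compl\<^esub> = \<zero>\<^bsub>compl\<^esub>"
  hence "seq_eq (\<lambda>_. \<one>) (\<lambda>_. \<zero>)"
    using rep_props[of "\<lambda>_. \<one>"] rep_props[of "\<lambda>_. \<zero>"] seq_eq_sym seq_eq_trans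
    by (metis cauchy_const compl_simps(4,5) one_closed zero_closed)
  hence "\<one> \<in> vge F v 1" unfolding seq_eq_def by (auto simp: a_minus_def dest: spec[of _ 1])
  thus False by (simp add: vge_def)
qed

lemma field_compl: "field compl"
proof -
  interpret C: cring compl by (rule cring_compl)
  show ?thesis
  proof (rule C.cring_fieldI)
    have "s \<in> Units compl" if s: "s \<in> carrier compl" "s \<noteq> \<zero>\<^bsub>compl\<^esub>" for s
      using compl_inverse[OF s] s C.m_comm by (auto simp: Units_def)
    moreover have "\<zero>\<^bsub>compl\<^esub> \<notin> Units compl" using compl_one_nz by (auto simp: Units_def)
    ultimately show "Units compl = carrier compl - {\<zero>\<^bsub>compl\<^esub>}" by (auto simp: Units_def)
  qed
qed

definition emb :: "'a \<Rightarrow> nat \<Rightarrow> 'a" where "emb x = rep (\<lambda>_. x)"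

lemma emb_hom: "emb \<in> ring_hom F compl"
proof (rule ring_hom_memI)
  fix x y assume xy: "x \<in> carrier F" "y \<in> carrier F"
  show "emb (x \<otimes> y) = emb x \<otimes>\<^bsub>compl\<^esub> emb y" "emb (x \<oplus> y) = emb x \<oplus>\<^bsub>compl\<^esub> emb y"
    using xy by (simp_all add: emb_def compl_simps) (simp_all add: smul_def sadd_def)
qed (simp_all add: emb_def compl_simps)

lemma emb_eventually: "x \<in> carrier F \<Longrightarrow> \<forall>\<^sub>F n in sequentially. emb x n \<ominus> x \<in> vge F v N"
  using rep_props[of "\<lambda>_. x"] by (simp add: emb_def seq_eq_def)

lemma valued_field_compl: "valued_field compl vcompl"
  and vcompl_emb: "x \<in> carrier F \<Longrightarrow> x \<noteq> \<zero> \<Longrightarrow> emb x \<noteq> \<zero>\<^bsub>compl\<^esub> \<and> vcompl (emb x) = v x"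
proof -
  interpret C: field compl by (rule field_compl)
  have E: "emb x \<noteq> \<zero>\<^bsub>compl\<^esub> \<and> vcompl (emb x) = v x" if x: "x \<in> carrier F" "x \<noteq> \<zero>" for x
  proof -
    have ex: "emb x \<in> carrier compl" using ring_hom_closed[OF emb_hom] x by auto
    hence exc: "emb x n \<in> carrier F" for n by (simp add: compl_simps)
    have ev: "\<forall>\<^sub>F n in sequentially. emb x n \<noteq> \<zero> \<and> v (emb x n) = v x"
      using emb_eventually[OF x(1), of "v x + 1"] v_close[OF x exc] by (auto elim!: eventually_mono)
    have nz: "emb x \<noteq> \<zero>\<^bsub>compl\<^esub>"
    proof
      assume "emb x = \<zero>\<^bsub>compl\<^esub>"
      hence "\<forall>\<^sub>F n in sequentially. emb x n \<in> vge F v (v x + 1)" using zero_compl_small by simp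
      hence "\<forall>\<^sub>F n in sequentially. False" using ev by eventually_elim (simp add: vge_def)
      thus False by simp
    qed
    have "\<forall>\<^sub>F n in sequentially. vcompl (emb x) = v x" using compl_nonzero[OF ex nz] ev by eventually_elim simp
    thus ?thesis using nz by simp
  qed
  show "x \<in> carrier F \<Longrightarrow> x \<noteq> \<zero> \<Longrightarrow> emb x \<noteq> \<zero>\<^bsub>compl\<^esub> \<and> vcompl (emb x) = v x" by (rule E)
  show "valued_field compl vcompl"
  proof unfold_locales
    fix s t assume st: "s \<in> carrier compl" "t \<in> carrier compl" "s \<noteq> \<zero>\<^bsub>compl\<^esub>" "t \<noteq> \<zero>\<^bsub>compl\<^esub>"
    have c: "cauchy s" "cauchy t" using st by (auto simp: compl_simps)
    have "s \<otimes>\<^bsub>compl\<^esub> t \<noteq> \<zero>\<^bsub>compl\<^esub>" using st C.integral by blast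
    from compl_nonzero[OF _ this] st
    have 1: "\<forall>\<^sub>F n in sequentially. (s \<otimes>\<^bsub>compl\<^esub> t) n \<noteq> \<zero> \<and> v ((s \<otimes>\<^bsub>compl\<^esub> t) n) = vcompl (s \<otimes>\<^bsub>compl\<^esub> t)" by simp
    have 2: "\<forall>\<^sub>F n in sequentially. (s \<otimes>\<^bsub>compl\<^esub> t) n \<ominus> s n \<otimes> t n \<in> vge F v (vcompl s + vcompl t + 1)"
      using rep_props[OF cauchy_smul[OF c]] unfolding compl_simps seq_eq_def by (simp add: smul_def)
    have "\<forall>\<^sub>F n in sequentially. vcompl (s \<otimes>\<^bsub>compl\<^esub> t) = vcompl s + vcompl t"
      using 1 2 compl_nonzero[OF st(1,3)] compl_nonzero[OF st(2,4)]
    proof eventually_elim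
      fix n assume a: "(s \<otimes>\<^bsub>compl\<^esub> t) n \<noteq> \<zero> \<and> v ((s \<otimes>\<^bsub>compl\<^esub> t) n) = vcompl (s \<otimes>\<^bsub>compl\<^esub> t)"
        "(s \<otimes>\<^bsub>compl\<^esub> t) n \<ominus> s n \<otimes> t n \<in> vge F v (vcompl s + vcompl t + 1)"
        "s n \<noteq> \<zero> \<and> v (s n) = vcompl s" "t n \<noteq> \<zero> \<and> v (t n) = vcompl t"
      have "v (s n \<otimes> t n) = vcompl s + vcompl t" using v_mult[of "s n" "t n"] a c by auto
      thus "vcompl (s \<otimes>\<^bsub>compl\<^esub> t) = vcompl s + vcompl t"
        using v_close[of "s n \<otimes> t n" "(s \<otimes>\<^bsub>compl\<^esub> t) n"] a c mult_nz[of "s n" "t n"] by (auto simp: compl_simps)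
    qed
    thus "vcompl (s \<otimes>\<^bsub>compl\<^esub> t) = vcompl s + vcompl t" by simp
  next
    fix s t assume st: "s \<in> carrier compl" "t \<in> carrier compl" "s \<noteq> \<zero>\<^bsub>compl\<^esub>" "t \<noteq> \<zero>\<^bsub>compl\<^esub>" "s \<oplus>\<^bsub>compl\<^esub> t \<noteq> \<zero>\<^bsub>compl\<^esub>"
    have c: "cauchy s" "cauchy t" using st by (auto simp: compl_simps)
    define m where "m = min (vcompl s) (vcompl t)"
    have "\<forall>\<^sub>F n in sequentially. sadd s t n \<in> vge F v m"
      using compl_nonzero[OF st(1,3)] compl_nonzero[OF st(2,4)]
    proof eventually_elim
      fix n assume a: "s n \<noteq> \<zero> \<and> v (s n) = vcompl s" "t n \<noteq> \<zero> \<and> v (t n) = vcompl t"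
      show "sadd s t n \<in> vge F v m" unfolding sadd_def
        by (intro vge_add) (use a c in \<open>auto simp: vge_def m_def\<close>)
    qed
    hence "\<forall>\<^sub>F n in sequentially. (s \<oplus>\<^bsub>compl\<^esub> t) n \<in> vge F v m"
      using vge_seq_eq[of "rep (sadd s t)" "sadd s t" m] rep_props[of "sadd s t"] c by (simp add: compl_simps)
    hence "s \<oplus>\<^bsub>compl\<^esub> t \<in> vge compl vcompl m" using vge_compl_iff[of "s \<oplus>\<^bsub>compl\<^esub> t"] st by simp
    thus "min (vcompl s) (vcompl t) \<le> vcompl (s \<oplus>\<^bsub>compl\<^esub> t)" using st(5) by (simp add: vge_def m_def)
  next
    fix n
    obtain x where "x \<in> carrier F" "x \<noteq> \<zero>" "v x = n" using v_surj by blast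
    thus "\<exists>x\<in>carrier compl. x \<noteq> \<zero>\<^bsub>compl\<^esub> \<and> vcompl x = n"
      using E[of x] ring_hom_closed[OF emb_hom] by (intro bexI[of _ "emb x"]) auto
  qed
qed

text \<open>The limit of a Cauchy sequence s is its own class \<open>rep s\<close>. For s in the
  completion either disjunct gives b = s, which yields density.\<close>

lemma compl_limit:
  assumes "cauchy s"
  shows "\<exists>b\<in>carrier compl. (s = b \<or> rep s = b) \<and> (\<forall>N. \<forall>\<^sub>F n in sequentially. b \<ominus>\<^bsub>compl\<^esub> emb (s n) \<in> vge compl vcompl N)"
proof -
  interpret C: valued_field compl vcompl by (rule valued_field_compl)
  have rs: "rep s \<in> carrier compl" using assms by (simp add: compl_simps)
  have "\<forall>\<^sub>F n in sequentially. rep s \<ominus>\<^bsub>compl\<^esub> emb (s n) \<in> vge compl vcompl N" for N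
  proof -
    obtain c where c: "c \<in> carrier F" "\<forall>\<^sub>F n in sequentially. s n \<ominus> c \<in> vge F v N"
      using cauchyD[OF assms, of "N"] by (elim bexE)
    \<comment> \<open>For d as close to c as the tail of s is, the sequence s - d is small along
      this tail, and the value in the completion is read off there.\<close>
    have close: "rep s \<ominus>\<^bsub>compl\<^esub> emb d \<in> vge compl vcompl N"
      if d: "d \<in> carrier F" "d \<ominus> c \<in> vge F v N" for d
    proof -
      have ed: "emb d \<in> carrier compl" "emb (\<ominus> d) \<in> carrier compl" using ring_hom_closed[OF emb_hom] d by auto
      have "ring_hom_ring F compl emb"
        by (intro ring_hom_ringI2 emb_hom ring_axioms C.ring_axioms)
      then interpret E: ring_hom_ring F compl emb .
      have "emb (\<ominus> d) = \<ominus>\<^bsub>compl\<^esub> emb d" using d by simp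
      hence eq: "rep s \<ominus>\<^bsub>compl\<^esub> emb d = rep (sadd s (\<lambda>_. \<ominus> d))"
      proof -
        have "rep s \<ominus>\<^bsub>compl\<^esub> emb d = rep s \<oplus>\<^bsub>compl\<^esub> rep (\<lambda>_. \<ominus> d)"
          using \<open>emb (\<ominus> d) = \<ominus>\<^bsub>compl\<^esub> emb d\<close> unfolding a_minus_def emb_def by simp
        thus ?thesis using assms d by (simp add: compl_simps)
      qed
      have sd: "cauchy (sadd s (\<lambda>_. \<ominus> d))" using assms d by simp
      have "\<forall>\<^sub>F n in sequentially. sadd s (\<lambda>_. \<ominus> d) n \<in> vge F v N" using c(2)
      proof eventually_elim
        fix n assume n: "s n \<ominus> c \<in> vge F v N"
        have "sadd s (\<lambda>_. \<ominus> d) n = (s n \<ominus> c) \<ominus> (d \<ominus> c)" unfolding sadd_def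
          using cauchy_carrier[OF assms, of n] c(1) d(1) by algebra
        thus "sadd s (\<lambda>_. \<ominus> d) n \<in> vge F v N" using vge_diff[OF n d(2)] by simp
      qed
      hence "\<forall>\<^sub>F n in sequentially. rep (sadd s (\<lambda>_. \<ominus> d)) n \<in> vge F v N"
        using vge_seq_eq[of "rep (sadd s (\<lambda>_. \<ominus> d))" "sadd s (\<lambda>_. \<ominus> d)" N] rep_props[OF sd] sd by simp
      moreover have "rep s \<ominus>\<^bsub>compl\<^esub> emb d \<in> carrier compl" using rs ed by simp
      ultimately show ?thesis using vge_compl_iff[of "rep s \<ominus>\<^bsub>compl\<^esub> emb d" N] unfolding eq by simp
    qed
    show ?thesis using c(2) by eventually_elim (use close assms in auto)
  qed
  thus ?thesis using rs by (intro bexI[of _ "rep s"]) simp_all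
qed

lemma compl_dense:
  assumes s: "s \<in> carrier compl"
  shows "\<exists>x\<in>carrier F. s \<ominus>\<^bsub>compl\<^esub> emb x \<in> vge compl vcompl N"
proof -
  have c: "cauchy s" "rep s = s" using s by (auto simp: compl_simps)
  from compl_limit[OF c(1)] c(2) have "\<forall>\<^sub>F n in sequentially. s \<ominus>\<^bsub>compl\<^esub> emb (s n) \<in> vge compl vcompl N"
    by auto
  hence "\<exists>n. s \<ominus>\<^bsub>compl\<^esub> emb (s n) \<in> vge compl vcompl N"
    by (rule eventually_happens'[OF sequentially_bot])
  then obtain n where "s \<ominus>\<^bsub>compl\<^esub> emb (s n) \<in> vge compl vcompl N" ..
  thus ?thesis using c by (intro bexI[of _ "s n"]) auto
qed

end

text \<open>What is used of the completion, freed from sequences and representatives. Increments of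
  value at least n make a sequence Cauchy by the ultrametric inequality, so \<open>complete\<close>
  is completeness for sequences of F.\<close>

locale completed_field = valued_field F v + C: valued_field C w
  for F (structure) and v and C :: "'b ring" and w +
  fixes \<iota>
  assumes hom: "\<iota> \<in> ring_hom F C"
    and w_emb: "x \<in> carrier F \<Longrightarrow> x \<noteq> \<zero> \<Longrightarrow> \<iota> x \<noteq> \<zero>\<^bsub>C\<^esub> \<and> w (\<iota> x) = v x"
    and dense: "s \<in> carrier C \<Longrightarrow> \<exists>x\<in>carrier F. s \<ominus>\<^bsub>C\<^esub> \<iota> x \<in> vge C w N"
    and complete: "\<lbrakk>\<And>n. a n \<in> carrier F; \<And>n. a (Suc n) \<ominus> a n \<in> vge F v (int n)\<rbrakk>
      \<Longrightarrow> \<exists>b\<in>carrier C. \<forall>N. \<forall>\<^sub>F n in sequentially. b \<ominus>\<^bsub>C\<^esub> \<iota> (a n) \<in> vge C w N"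

lemma (in valued_field) completion: "completed_field F v compl vcompl emb"
proof -
  interpret C: valued_field compl vcompl by (rule valued_field_compl)
  show ?thesis
  proof unfold_locales
    fix a assume a: "\<And>n. a n \<in> carrier F" "\<And>n. a (Suc n) \<ominus> a n \<in> vge F v (int n)"
    have "cauchy a" unfolding cauchy_def
    proof (intro conjI allI)
      fix N
      define m where "m = nat N"
      have "a (m + k) \<ominus> a m \<in> vge F v N" for k
      proof (induct k)
        case (Suc k)
        have "a (Suc (m + k)) \<ominus> a m = (a (Suc (m + k)) \<ominus> a (m + k)) \<oplus> (a (m + k) \<ominus> a m)"
          using a(1)[of "Suc (m + k)"] a(1)[of "m + k"] a(1)[of m] by algebra
        moreover have "a (Suc (m + k)) \<ominus> a (m + k) \<in> vge F v N"
          using vge_mono[OF a(2)[of "m + k"], of N] by (simp add: m_def)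
        ultimately show ?case using vge_add Suc by simp
      qed (use a in \<open>simp add: minus_self\<close>)
      hence "a n \<ominus> a m \<in> vge F v N" if "n \<ge> m" for n using that by (metis le_add_diff_inverse)
      thus "\<exists>c\<in>carrier F. \<forall>\<^sub>F n in sequentially. a n \<ominus> c \<in> vge F v N"
        using a(1) by (intro bexI[of _ "a m"]) (auto simp: eventually_sequentially)
    qed (use a in simp)
    thus "\<exists>b\<in>carrier compl. \<forall>N. \<forall>\<^sub>F n in sequentially. b \<ominus>\<^bsub>compl\<^esub> emb (a n) \<in> vge compl vcompl N"
      using compl_limit by blast
  qed (use emb_hom vcompl_emb compl_dense in auto)
qed

section \<open>Henselian valuation rings\<close>

lemma poly_deriv_single: "poly_deriv R [a] = []" "poly_deriv R [] = []"
  by (simp_all add: poly_deriv_def)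

lemma length_poly_deriv: "length (poly_deriv R p) = length p - 1"
  by (simp add: poly_deriv_def)

lemma poly_deriv_Cons:
  assumes "p \<noteq> []"
  shows "poly_deriv R (a # p) = add_pow R (length p) a # poly_deriv R p"
proof (rule nth_equalityI)
  show "length (poly_deriv R (a # p)) = length (add_pow R (length p) a # poly_deriv R p)"
    using assms by (cases p) (simp_all add: length_poly_deriv)
  fix i assume "i < length (poly_deriv R (a # p))"
  hence "i < length p" by (simp add: length_poly_deriv)
  thus "poly_deriv R (a # p) ! i = (add_pow R (length p) a # poly_deriv R p) ! i"
    by (cases i) (auto simp: poly_deriv_def)
qed

lemma poly_deriv_consistent: "poly_deriv (R\<lparr>carrier := A\<rparr>) p = poly_deriv R p"
  by (simp add: poly_deriv_def add_pow_def nat_pow_def)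

section \<open>Taylor expansion over a subring\<close>

context cring
begin

lemma subring_add_pow: "subring A R \<Longrightarrow> a \<in> A \<Longrightarrow> add_pow R (n::nat) a \<in> A"
  by (induct n) (auto simp: subringE add.nat_pow_Suc)

lemma subring_pow: "subring A R \<Longrightarrow> a \<in> A \<Longrightarrow> a [^] (n::nat) \<in> A"
  by (induct n) (auto simp: subringE)

lemma subring_eval: "subring A R \<Longrightarrow> set p \<subseteq> A \<Longrightarrow> x \<in> A \<Longrightarrow> eval p x \<in> A"
  by (induct p) (auto simp: subringE subring_pow)

lemma subring_poly_deriv: "subring A R \<Longrightarrow> set p \<subseteq> A \<Longrightarrow> set (poly_deriv R p) \<subseteq> A"
  by (auto simp: poly_deriv_def intro!: subring_add_pow)

lemma pow_taylor:
  assumes A: "subring A R" and x: "x \<in> A" "h \<in> A"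
  shows "\<exists>r\<in>A. (x \<oplus> h) [^] (Suc n) = x [^] (Suc n) \<oplus> h \<otimes> add_pow R (Suc n) (x [^] n) \<oplus> h \<otimes> h \<otimes> r"
proof (induct n)
  case 0
  have "x \<in> carrier R" "h \<in> carrier R" using x subringE(1)[OF A] by auto
  thus ?case using subringE(2)[OF A] by (intro bexI[of _ \<zero>]) auto
next
  case (Suc n)
  then obtain r where r: "r \<in> A" 
    "(x \<oplus> h) [^] (Suc n) = x [^] (Suc n) \<oplus> h \<otimes> add_pow R (Suc n) (x [^] n) \<oplus> h \<otimes> h \<otimes> r" by blast
  have c: "x \<in> carrier R" "h \<in> carrier R" "r \<in> carrier R" using x r subringE(1)[OF A] by auto
  define a where "a = x [^] Suc n"
  define b where "b = add_pow R (Suc n) (x [^] n)"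
  have ab: "a \<in> A" "b \<in> A" unfolding a_def b_def by (intro subring_add_pow subring_pow A x(1))+
  have abc: "a \<in> carrier R" "b \<in> carrier R" using ab subringE(1)[OF A] by auto
  have bx: "add_pow R (Suc (Suc n)) (x [^] Suc n) = b \<otimes> x \<oplus> a"
  proof -
    have "b \<otimes> x = add_pow R (Suc n) (x [^] Suc n)"
      unfolding b_def using c by (subst add_pow_ldistr) (auto simp: a_def)
    thus ?thesis using c by (simp add: a_def add.nat_pow_Suc)
  qed
  have "(x \<oplus> h) [^] (Suc (Suc n)) = (a \<oplus> h \<otimes> b \<oplus> h \<otimes> h \<otimes> r) \<otimes> (x \<oplus> h)"
    using r(2) by (simp add: a_def b_def)
  also have "\<dots> = a \<otimes> x \<oplus> h \<otimes> (b \<otimes> x \<oplus> a) \<oplus> h \<otimes> h \<otimes> (b \<oplus> r \<otimes> x \<oplus> h \<otimes> r)"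
    using c abc by algebra
  also have "a \<otimes> x = x [^] (Suc (Suc n))" by (simp add: a_def)
  finally have "(x \<oplus> h) [^] Suc (Suc n) = x [^] Suc (Suc n) \<oplus>
      h \<otimes> add_pow R (Suc (Suc n)) (x [^] Suc n) \<oplus> h \<otimes> h \<otimes> (b \<oplus> r \<otimes> x \<oplus> h \<otimes> r)"
    unfolding bx .
  moreover have "b \<oplus> r \<otimes> x \<oplus> h \<otimes> r \<in> A" using ab r x subringE[OF A] by auto
  ultimately show ?case by blast
qed

text \<open>The expansion stops at second order and leaves the remainder unspecified in A. No
  division by factorials occurs, so it holds in every characteristic and preserves
  integrality.\<close>

lemma eval_taylor:
  assumes A: "subring A R" and p: "set p \<subseteq> A" and x: "x \<in> A" "h \<in> A"
  shows "\<exists>r\<in>A. eval p (x \<oplus> h) = eval p x \<oplus> h \<otimes> eval (poly_deriv R p) x \<oplus> h \<otimes> h \<otimes> r"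
  using p
proof (induct p)
  case Nil
  have "h \<in> carrier R" using x subringE(1)[OF A] by auto
  thus ?case using subringE(2)[OF A] by (intro bexI[of _ \<zero>]) (auto simp: poly_deriv_single)
next
  case (Cons a p)
  have c: "x \<in> carrier R" "h \<in> carrier R" "a \<in> carrier R" using x Cons subringE(1)[OF A] by auto
  show ?case
  proof (cases "p = []")
    case True
    thus ?thesis using c subringE(2)[OF A] by (intro bexI[of _ \<zero>]) (auto simp: poly_deriv_single)
  next
    case False
    obtain r where r: "r \<in> A" "eval p (x \<oplus> h) = eval p x \<oplus> h \<otimes> eval (poly_deriv R p) x \<oplus> h \<otimes> h \<otimes> r"
      using Cons by auto
    obtain n where n: "length p = Suc n" using False by (cases p) auto
    obtain s where s: "s \<in> A" 
      "(x \<oplus> h) [^] (Suc n) = x [^] (Suc n) \<oplus> h \<otimes> add_pow R (Suc n) (x [^] n) \<oplus> h \<otimes> h \<otimes> s"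
      using pow_taylor[OF A x] by blast
    define e where "e = eval p x"
    define d where "d = eval (poly_deriv R p) x"
    define u where "u = x [^] Suc n"
    define b where "b = add_pow R (Suc n) (x [^] n)"
    have "e \<in> A" "d \<in> A" unfolding e_def d_def
      using Cons A x subring_eval subring_poly_deriv by auto
    hence ec: "e \<in> carrier R" "d \<in> carrier R" "r \<in> carrier R" "s \<in> carrier R" "u \<in> carrier R" "b \<in> carrier R"
      using r s subringE(1)[OF A] c by (auto simp: u_def b_def)
    have ab: "add_pow R (Suc n) a \<otimes> x [^] n = a \<otimes> b"
      unfolding b_def using c by (subst add_pow_ldistr, simp, simp, subst add_pow_rdistr, auto)
    have "eval (a # p) (x \<oplus> h) = a \<otimes> (u \<oplus> h \<otimes> b \<oplus> h \<otimes> h \<otimes> s) \<oplus> (e \<oplus> h \<otimes> d \<oplus> h \<otimes> h \<otimes> r)"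
      using r s n by (simp add: e_def d_def u_def b_def)
    also have "\<dots> = (a \<otimes> u \<oplus> e) \<oplus> h \<otimes> (a \<otimes> b \<oplus> d) \<oplus> h \<otimes> h \<otimes> (a \<otimes> s \<oplus> r)"
      using c ec by algebra
    also have "a \<otimes> u \<oplus> e = eval (a # p) x" by (simp add: n u_def e_def)
    also have "a \<otimes> b \<oplus> d = eval (poly_deriv R (a # p)) x"
      using ab n by (simp add: poly_deriv_Cons[OF False] length_poly_deriv d_def)
    finally show ?thesis using r s Cons subringE[OF A] by (intro bexI[of _ "a \<otimes> s \<oplus> r"]) auto
  qed
qed

lemma eval_diff:
  assumes A: "subring A R" and p: "set p \<subseteq> A" and x: "x \<in> A" "y \<in> A"
  shows "\<exists>r\<in>A. eval p y \<ominus> eval p x = (y \<ominus> x) \<otimes> r"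
proof -
  have h: "y \<ominus> x \<in> A" using x subringE[OF A] by (auto simp: a_minus_def)
  obtain r where r: "r \<in> A"
    "eval p (x \<oplus> (y \<ominus> x)) = eval p x \<oplus> (y \<ominus> x) \<otimes> eval (poly_deriv R p) x \<oplus> (y \<ominus> x) \<otimes> (y \<ominus> x) \<otimes> r"
    using eval_taylor[OF A p x(1) h] by blast
  define e where "e = eval p x"
  define d where "d = eval (poly_deriv R p) x"
  have ed: "e \<in> A" "d \<in> A" unfolding e_def d_def using A x p subring_eval subring_poly_deriv by auto
  hence c: "e \<in> carrier R" "d \<in> carrier R" "r \<in> carrier R" "x \<in> carrier R" "y \<in> carrier R"
    using r x subringE(1)[OF A] by auto
  have "x \<oplus> (y \<ominus> x) = y" using c by algebra
  hence "eval p y \<ominus> eval p x = (e \<oplus> (y \<ominus> x) \<otimes> d \<oplus> (y \<ominus> x) \<otimes> (y \<ominus> x) \<otimes> r) \<ominus> e"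
    using r by (simp add: e_def d_def)
  also have "\<dots> = (y \<ominus> x) \<otimes> (d \<oplus> (y \<ominus> x) \<otimes> r)" using c by algebra
  finally show ?thesis using ed r h subringE[OF A] by (intro bexI[of _ "d \<oplus> (y \<ominus> x) \<otimes> r"]) auto
qed

end

text \<open>Henselisations are tested against valuation rings of arbitrary rank, so divisibility in
  A takes the place of an integer-valued valuation.\<close>

locale valring = field E for E (structure) +
  fixes A
  assumes sub: "subring A E"
    and val: "\<lbrakk>x \<in> carrier E; x \<noteq> \<zero>\<rbrakk> \<Longrightarrow> x \<in> A \<or> inv x \<in> A"
begin

abbreviation "UA \<equiv> subring_units E A"
abbreviation "MA \<equiv> A - UA"

lemma valuation_ring: "valuation_ring E A"
  using sub val field_axioms by (auto simp: valuation_ring_def)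

lemma A_carrier: "x \<in> A \<Longrightarrow> x \<in> carrier E" using subringE(1)[OF sub] by auto
lemma A_one: "\<one> \<in> A" using subringE(3)[OF sub] .
lemma A_zero: "\<zero> \<in> A" using subringE(2)[OF sub] .
lemma A_minus: "x \<in> A \<Longrightarrow> \<ominus> x \<in> A" using subringE(5)[OF sub] .
lemma A_mult: "x \<in> A \<Longrightarrow> y \<in> A \<Longrightarrow> x \<otimes> y \<in> A" using subringE(6)[OF sub] .
lemma A_add: "x \<in> A \<Longrightarrow> y \<in> A \<Longrightarrow> x \<oplus> y \<in> A" using subringE(7)[OF sub] .
lemma inv_nz: "\<lbrakk>x \<in> carrier E; x \<noteq> \<zero>\<rbrakk> \<Longrightarrow> inv x \<in> carrier E \<and> inv x \<noteq> \<zero> \<and> x \<otimes> inv x = \<one> \<and> inv x \<otimes> x = \<one> \<and> inv (inv x) = x"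
  using field_Units Units_inv_Units by (metis Diff_iff Units_inv_closed Units_inv_inv Units_l_inv Units_r_inv singletonD singletonI)

lemma U_iff: "x \<in> UA \<longleftrightarrow> x \<in> A \<and> x \<noteq> \<zero> \<and> inv x \<in> A"
  by (rule subring_units_iff[OF sub])

lemma U_inv: "x \<in> UA \<Longrightarrow> inv x \<in> A \<and> x \<in> A \<and> x \<otimes> inv x = \<one> \<and> x \<noteq> \<zero> \<and> inv x \<otimes> x = \<one>"
  using U_iff inv_nz A_carrier by blast

lemma U_cancel: assumes "x \<in> A" "y \<in> A" "x \<otimes> y \<in> UA" shows "y \<in> UA"
proof -
  note i = U_inv[OF assms(3)]
  have c: "x \<in> carrier E" "y \<in> carrier E" "inv (x \<otimes> y) \<in> carrier E" using assms A_carrier i by auto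
  have y0: "y \<noteq> \<zero>" using i c by auto
  have "(inv (x \<otimes> y) \<otimes> x) \<otimes> y = \<one>" using i c by (simp add: m_assoc)
  hence "inv y = inv (x \<otimes> y) \<otimes> x" using c by (metis inv_char m_closed m_comm)
  thus ?thesis using y0 assms i A_mult by (simp add: U_iff)
qed

lemma M_mult: "x \<in> A \<Longrightarrow> y \<in> MA \<Longrightarrow> x \<otimes> y \<in> MA"
  using U_cancel A_mult by auto

lemma M_multr: "x \<in> A \<Longrightarrow> y \<in> MA \<Longrightarrow> y \<otimes> x \<in> MA"
  using M_mult A_carrier m_comm by (metis DiffD1)

text \<open>One of x / y and y / x lies in A, so x + y is an A-multiple of x or of y.\<close>

lemma M_add: assumes "x \<in> MA" "y \<in> MA" shows "x \<oplus> y \<in> MA"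
proof -
  have *: "x \<oplus> y \<in> MA" if xy: "x \<in> MA" "y \<in> MA" "y \<noteq> \<zero>" "x \<otimes> inv y \<in> A" for x y
  proof -
    have c: "x \<in> carrier E" "y \<in> carrier E" using xy A_carrier by auto
    note i = inv_nz[OF c(2) xy(3)]
    have ic: "inv y \<in> carrier E" using i by simp
    have "(x \<otimes> inv y \<oplus> \<one>) \<otimes> y = x \<otimes> (inv y \<otimes> y) \<oplus> y" using c ic by algebra
    hence "(x \<otimes> inv y \<oplus> \<one>) \<otimes> y = x \<oplus> y" using i c by simp
    thus ?thesis using M_mult[of "x \<otimes> inv y \<oplus> \<one>" y] xy A_add A_one by metis
  qed
  have c: "x \<in> carrier E" "y \<in> carrier E" using assms A_carrier by auto
  show ?thesis
  proof (cases "x = \<zero> \<or> y = \<zero>")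
    case True
    thus ?thesis using assms c by auto
  next
    case False
    note i = inv_nz[of x] inv_nz[of y]
    have nz: "x \<otimes> inv y \<noteq> \<zero>" using i c False integral by blast
    have ic: "inv x \<in> carrier E" "inv y \<in> carrier E" using i c False by auto
    have "(x \<otimes> inv y) \<otimes> (y \<otimes> inv x) = x \<otimes> (inv y \<otimes> y) \<otimes> inv x"
      using c ic by algebra
    hence "(x \<otimes> inv y) \<otimes> (y \<otimes> inv x) = \<one>" using i c False by simp
    hence "inv (x \<otimes> inv y) = y \<otimes> inv x" using i c False
      by (metis inv_char m_closed m_comm)
    hence "x \<otimes> inv y \<in> A \<or> y \<otimes> inv x \<in> A" using val[of "x \<otimes> inv y"] nz i c False by auto
    thus ?thesis using *[of x y] *[of y x] assms c False by (auto simp: a_comm)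
  qed
qed

lemma M_minus: "x \<in> MA \<Longrightarrow> \<ominus> x \<in> MA"
  using M_mult[of "\<ominus> \<one>" x] A_one A_minus A_carrier by (simp add: l_minus)

lemma U_add_M: assumes "u \<in> UA" "m \<in> MA" shows "u \<oplus> m \<in> UA"
proof (rule ccontr)
  have c: "u \<in> carrier E" "m \<in> carrier E" "u \<in> A" "m \<in> A" using assms A_carrier U_inv by auto
  assume "u \<oplus> m \<notin> UA"
  hence "u \<oplus> m \<in> MA" using c A_add by auto
  hence "(u \<oplus> m) \<oplus> \<ominus> m \<in> MA" using M_add M_minus assms by blast
  moreover have "(u \<oplus> m) \<oplus> \<ominus> m = u" using c by algebra
  ultimately show False using assms by simp
qed

lemma eval_A: "set p \<subseteq> A \<Longrightarrow> x \<in> A \<Longrightarrow> eval p x \<in> A"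
  by (rule subring_eval[OF sub])

lemma eval_M_congr:
  assumes "set p \<subseteq> A" "x \<in> A" "y \<in> A" "y \<ominus> x \<in> MA"
  shows "eval p x \<in> UA \<longleftrightarrow> eval p y \<in> UA"
proof -
  obtain r where r: "r \<in> A" "eval p y \<ominus> eval p x = (y \<ominus> x) \<otimes> r" using eval_diff[OF sub assms(1-3)] by blast
  have c: "eval p x \<in> carrier E" "eval p y \<in> carrier E" using eval_A assms A_carrier by auto
  have m: "eval p y \<ominus> eval p x \<in> MA" using r M_multr assms by metis
  have "eval p y = eval p x \<oplus> (eval p y \<ominus> eval p x)" "eval p x = eval p y \<oplus> \<ominus> (eval p y \<ominus> eval p x)"
    using c by algebra+
  thus ?thesis using U_add_M M_minus m by metis
qed

text \<open>With h = b' - b, Taylor expansion at b reads 0 = h (p'(b) + h r), and the second factor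
  is a unit.\<close>

lemma hensel_root_unique:
  assumes p: "set p \<subseteq> A" and b: "b \<in> A" "b' \<in> A" "eval p b = \<zero>" "eval p b' = \<zero>"
    and m: "b' \<ominus> b \<in> MA" and u: "eval (poly_deriv E p) b \<in> UA"
  shows "b = b'"
proof -
  define h where "h = b' \<ominus> b"
  have h: "h \<in> A" "h \<in> MA" using m by (auto simp: h_def)
  obtain r where r: "r \<in> A" "eval p (b \<oplus> h) = eval p b \<oplus> h \<otimes> eval (poly_deriv E p) b \<oplus> h \<otimes> h \<otimes> r"
    using eval_taylor[OF sub p b(1) h(1)] by blast
  define d where "d = eval (poly_deriv E p) b"
  have c: "b \<in> carrier E" "b' \<in> carrier E" "h \<in> carrier E" "r \<in> carrier E" "d \<in> carrier E"
    using b h r u U_inv A_carrier by (auto simp: d_def)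
  have bh: "b \<oplus> h = b'" unfolding h_def using c by algebra
  have "\<zero> = \<zero> \<oplus> h \<otimes> d \<oplus> h \<otimes> h \<otimes> r" using r(2) b unfolding bh d_def by simp
  also have "\<dots> = h \<otimes> (d \<oplus> h \<otimes> r)" using c by algebra
  finally have "h \<otimes> (d \<oplus> h \<otimes> r) = \<zero>" by simp
  moreover have "d \<oplus> h \<otimes> r \<in> UA" using U_add_M M_multr[OF r(1) h(2)] u by (simp add: d_def)
  ultimately have "h = \<zero>" using integral[of h "d \<oplus> h \<otimes> r"] U_inv c A_carrier by auto
  thus ?thesis using bh c by simp
qed

end

lemma valuation_ring_valring: "valuation_ring E A \<Longrightarrow> valring E A"
  by (auto simp: valuation_ring_def valring_def valring_axioms_def)

lemma univ_poly_carrier_iff: "p \<in> carrier (univ_poly E A) \<longleftrightarrow> set p \<subseteq> A \<and> (p \<noteq> [] \<longrightarrow> hd p \<noteq> \<zero>\<^bsub>E\<^esub>)"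
  by (auto simp: univ_poly_def polynomial_def)

context valued_field
begin

lemma valring: "valring F (vge F v 0)"
proof (intro valring.intro valring_axioms.intro field_axioms subring_vge)
  fix x assume x: "x \<in> carrier F" "x \<noteq> \<zero>"
  show "x \<in> vge F v 0 \<or> inv x \<in> vge F v 0"
    using x inv_closed_nz[OF x] v_inv[OF x] by (auto simp: vge_def)
qed

lemma M_iff: "x \<in> vge F v 0 - subring_units F (vge F v 0) \<longleftrightarrow> x \<in> vge F v 1"
  using val_units_iff[of x] by (auto simp: val_ring_eq_vge vge_def)

end

context completed_field
begin

lemma emb_closed: "x \<in> carrier F \<Longrightarrow> \<iota> x \<in> carrier C"
  using ring_hom_closed[OF hom] .

lemma emb_hom_ring: "ring_hom_ring F C \<iota>"
  by (intro ring_hom_ringI2 hom ring_axioms C.ring_axioms)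

sublocale I: ring_hom_ring F C \<iota> by (rule emb_hom_ring)

lemma emb_vge: "x \<in> carrier F \<Longrightarrow> \<iota> x \<in> vge C w n \<longleftrightarrow> x \<in> vge F v n"
  using w_emb[of x] emb_closed[of x] by (cases "x = \<zero>") (auto simp: vge_def)

text \<open>Newton iteration with the slope p'(a) kept fixed. It runs inside F, since
  \<open>complete\<close> speaks of sequences of F: each correction is replaced by an element of F
  that agrees with it to the accuracy of the next stage.\<close>

lemma henselian_completion: "henselian C (vge C w 0)"
  unfolding henselian_def
proof (intro conjI ballI impI)
  interpret CV: valring C "vge C w 0" by (rule C.valring)
  show "valuation_ring C (vge C w 0)" by (rule CV.valuation_ring)
  fix p a assume p: "p \<in> carrier (univ_poly C (vge C w 0))" and a: "a \<in> vge C w 0"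
    and r: "C.eval p a \<in> vge C w 0 - subring_units C (vge C w 0) \<and>
      C.eval (poly_deriv C p) a \<in> subring_units C (vge C w 0)"
  let ?O = "vge C w 0"
  have pO: "set p \<subseteq> ?O" using p by (auto simp: univ_poly_carrier_iff)
  have dO: "set (poly_deriv C p) \<subseteq> ?O" using C.subring_poly_deriv[OF C.subring_vge pO] .
  define u where "u = inv\<^bsub>C\<^esub> (C.eval (poly_deriv C p) a)"
  have u: "u \<in> ?O" "C.eval (poly_deriv C p) a \<otimes>\<^bsub>C\<^esub> u = \<one>\<^bsub>C\<^esub>" using CV.U_inv r by (auto simp: u_def)
  \<comment> \<open>Indexed so that stage 0 is the hypothesis of Hensel's lemma, a value of at least
    1.\<close>
  define P where "P = (\<lambda>k s. s \<in> carrier F \<and> \<iota> s \<ominus>\<^bsub>C\<^esub> a \<in> vge C w 1 \<and> C.eval p (\<iota> s) \<in> vge C w (int (Suc k)))"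
  have inO: "\<iota> s \<in> ?O" if "s \<in> carrier F" "\<iota> s \<ominus>\<^bsub>C\<^esub> a \<in> vge C w 1" for s
  proof -
    have "\<iota> s = (\<iota> s \<ominus>\<^bsub>C\<^esub> a) \<oplus>\<^bsub>C\<^esub> a" using emb_closed[OF that(1)] C.vge_carrier[OF a] by algebra
    thus ?thesis using C.vge_add[OF C.vge_mono[OF that(2)] a] by simp
  qed
  have start: "\<exists>s. P 0 s"
  proof -
    obtain s where s: "s \<in> carrier F" "a \<ominus>\<^bsub>C\<^esub> \<iota> s \<in> vge C w 1"
      using dense[OF C.vge_carrier[OF a], of 1] by (elim bexE)
    have "\<iota> s \<ominus>\<^bsub>C\<^esub> a = \<ominus>\<^bsub>C\<^esub> (a \<ominus>\<^bsub>C\<^esub> \<iota> s)" using emb_closed[OF s(1)] C.vge_carrier[OF a] by algebra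
    hence 1: "\<iota> s \<ominus>\<^bsub>C\<^esub> a \<in> vge C w 1" using C.vge_minus[OF s(2)] by simp
    have 2: "C.eval p (\<iota> s) \<in> ?O" using C.subring_eval[OF C.subring_vge pO inO[OF s(1) 1]] .
    have "C.eval p (\<iota> s) \<notin> subring_units C ?O"
      using CV.eval_M_congr[OF pO a inO[OF s(1) 1]] 1 r C.M_iff by blast
    hence "C.eval p (\<iota> s) \<in> vge C w 1" using 2 C.M_iff by blast
    thus ?thesis using s 1 by (auto simp: P_def)
  qed
  have step: "\<exists>t. P (Suc k) t \<and> t \<ominus> s \<in> vge F v (int k)" if s: "P k s" for k s
  proof -
    have sc: "s \<in> carrier F" "\<iota> s \<ominus>\<^bsub>C\<^esub> a \<in> vge C w 1" "C.eval p (\<iota> s) \<in> vge C w (int (Suc k))"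
      using s by (auto simp: P_def)
    have sO: "\<iota> s \<in> ?O" using inO sc by blast
    define e where "e = C.eval p (\<iota> s)"
    \<comment> \<open>The correction for the fixed slope, u being the inverse of p'(a). The error in
      the slope, p'(s) - p'(a), has value at least 1, which is why the accuracy grows by one in each
      step.\<close>
    define g where "g = \<ominus>\<^bsub>C\<^esub> (e \<otimes>\<^bsub>C\<^esub> u)"
    have g: "g \<in> vge C w (int (Suc k))" unfolding g_def e_def
      using C.vge_minus[OF C.vge_mult0r[OF sc(3) u(1)]] .
    obtain d where d: "d \<in> carrier F" "g \<ominus>\<^bsub>C\<^esub> \<iota> d \<in> vge C w (int (Suc (Suc k)))"
      using dense[OF C.vge_carrier[OF g], of "int (Suc (Suc k))"] by (elim bexE)
    define z where "z = g \<ominus>\<^bsub>C\<^esub> \<iota> d"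
    have zc: "z \<in> vge C w (int (Suc (Suc k)))" using d by (simp add: z_def)
    have cc: "\<iota> d \<in> carrier C" "g \<in> carrier C" "\<iota> s \<in> carrier C" "a \<in> carrier C" "u \<in> carrier C" "e \<in> carrier C" "z \<in> carrier C"
      using emb_closed d sc(1) C.vge_carrier[OF g] C.vge_carrier[OF a] C.vge_carrier[OF u(1)]
        C.vge_carrier[OF sc(3)] C.vge_carrier[OF zc] by (auto simp: e_def)
    have dg: "\<iota> d = g \<ominus>\<^bsub>C\<^esub> z" unfolding z_def using cc(1,2) by algebra
    have id: "\<iota> d \<in> vge C w (int (Suc k))" unfolding dg
      using C.vge_diff[OF g C.vge_mono[OF zc]] by simp
    have idO: "\<iota> d \<in> ?O" "\<iota> d \<in> vge C w 1" using C.vge_mono[OF id] by auto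
    obtain q where q: "q \<in> ?O" "C.eval p (\<iota> s \<oplus>\<^bsub>C\<^esub> \<iota> d) = C.eval p (\<iota> s) \<oplus>\<^bsub>C\<^esub>
        \<iota> d \<otimes>\<^bsub>C\<^esub> C.eval (poly_deriv C p) (\<iota> s) \<oplus>\<^bsub>C\<^esub> \<iota> d \<otimes>\<^bsub>C\<^esub> \<iota> d \<otimes>\<^bsub>C\<^esub> q"
      using C.eval_taylor[OF C.subring_vge pO sO idO(1)] by blast
    define D where "D = C.eval (poly_deriv C p) (\<iota> s)"
    define D0 where "D0 = C.eval (poly_deriv C p) a"
    obtain y where y: "y \<in> ?O" "D \<ominus>\<^bsub>C\<^esub> D0 = (\<iota> s \<ominus>\<^bsub>C\<^esub> a) \<otimes>\<^bsub>C\<^esub> y"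
      using C.eval_diff[OF C.subring_vge dO a sO] unfolding D_def D0_def by blast
    have Dc: "D \<in> ?O" "D0 \<in> ?O" unfolding D_def D0_def using CV.eval_A dO a sO by auto
    have DD: "D \<ominus>\<^bsub>C\<^esub> D0 \<in> vge C w 1" unfolding y(2) using C.vge_mult0r[OF sc(2) y(1)] .
    have c2: "D \<in> carrier C" "D0 \<in> carrier C" "q \<in> carrier C" using Dc q C.vge_carrier by auto
    have Du: "D0 \<otimes>\<^bsub>C\<^esub> u = \<one>\<^bsub>C\<^esub>" using u by (simp add: D0_def)
    have "e \<oplus>\<^bsub>C\<^esub> \<iota> d \<otimes>\<^bsub>C\<^esub> D = e \<oplus>\<^bsub>C\<^esub> (\<ominus>\<^bsub>C\<^esub> (e \<otimes>\<^bsub>C\<^esub> u) \<ominus>\<^bsub>C\<^esub> z) \<otimes>\<^bsub>C\<^esub> (D0 \<oplus>\<^bsub>C\<^esub> (D \<ominus>\<^bsub>C\<^esub> D0))"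
    proof -
      have "D = D0 \<oplus>\<^bsub>C\<^esub> (D \<ominus>\<^bsub>C\<^esub> D0)" using c2 by algebra
      thus ?thesis unfolding dg g_def by simp
    qed
    also have "\<dots> = e \<ominus>\<^bsub>C\<^esub> e \<otimes>\<^bsub>C\<^esub> (D0 \<otimes>\<^bsub>C\<^esub> u) \<oplus>\<^bsub>C\<^esub> (g \<otimes>\<^bsub>C\<^esub> (D \<ominus>\<^bsub>C\<^esub> D0) \<ominus>\<^bsub>C\<^esub> z \<otimes>\<^bsub>C\<^esub> D)"
      unfolding g_def using cc c2 by algebra
    also have "\<dots> = g \<otimes>\<^bsub>C\<^esub> (D \<ominus>\<^bsub>C\<^esub> D0) \<ominus>\<^bsub>C\<^esub> z \<otimes>\<^bsub>C\<^esub> D"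
      unfolding Du using cc c2 by algebra
    finally have E: "e \<oplus>\<^bsub>C\<^esub> \<iota> d \<otimes>\<^bsub>C\<^esub> D = g \<otimes>\<^bsub>C\<^esub> (D \<ominus>\<^bsub>C\<^esub> D0) \<ominus>\<^bsub>C\<^esub> z \<otimes>\<^bsub>C\<^esub> D" .
    have e1: "g \<otimes>\<^bsub>C\<^esub> (D \<ominus>\<^bsub>C\<^esub> D0) \<in> vge C w (int (Suc (Suc k)))"
      using C.vge_mult[OF g DD] by (simp add: algebra_simps)
    have e2: "z \<otimes>\<^bsub>C\<^esub> D \<in> vge C w (int (Suc (Suc k)))" using C.vge_mult0r[OF zc Dc(1)] .
    have e3: "\<iota> d \<otimes>\<^bsub>C\<^esub> \<iota> d \<otimes>\<^bsub>C\<^esub> q \<in> vge C w (int (Suc (Suc k)))"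
      using C.vge_mult0r[OF C.vge_mult[OF id idO(2)] q(1)] by (simp add: algebra_simps)
    have st: "\<iota> (s \<oplus> d) = \<iota> s \<oplus>\<^bsub>C\<^esub> \<iota> d" using sc d by simp
    have "C.eval p (\<iota> (s \<oplus> d)) \<in> vge C w (int (Suc (Suc k)))"
      unfolding st q(2) e_def[symmetric] D_def[symmetric] E using e1 e2 e3 C.vge_add C.vge_diff by blast
    moreover have "\<iota> (s \<oplus> d) \<ominus>\<^bsub>C\<^esub> a \<in> vge C w 1"
    proof -
      have "\<iota> (s \<oplus> d) \<ominus>\<^bsub>C\<^esub> a = (\<iota> s \<ominus>\<^bsub>C\<^esub> a) \<oplus>\<^bsub>C\<^esub> \<iota> d" unfolding st using cc by algebra
      thus ?thesis using C.vge_add[OF sc(2) idO(2)] by simp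
    qed
    moreover have "(s \<oplus> d) \<ominus> s \<in> vge F v (int k)"
    proof -
      have "(s \<oplus> d) \<ominus> s = d" using sc(1) d(1) by algebra
      thus ?thesis using emb_vge[OF d(1), of "int k"] C.vge_mono[OF id] by simp
    qed
    ultimately show ?thesis using sc d by (auto simp: P_def intro!: exI[of _ "s \<oplus> d"])
  qed
  obtain s where s: "\<And>k. P k (s k)" "\<And>k. s (Suc k) \<ominus> s k \<in> vge F v (int k)"
    using dependent_nat_choice[of P "\<lambda>k s t. t \<ominus> s \<in> vge F v (int k)"] start step by metis
  have sc: "\<And>k. s k \<in> carrier F" using s by (auto simp: P_def)
  obtain b where b: "b \<in> carrier C" "\<forall>N. \<forall>\<^sub>F n in sequentially. b \<ominus>\<^bsub>C\<^esub> \<iota> (s n) \<in> vge C w N"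
    using complete[of s, OF sc s(2)] by (elim bexE)
  have near: "\<exists>n. b \<ominus>\<^bsub>C\<^esub> \<iota> (s n) \<in> vge C w N \<and> int n \<ge> N" for N
  proof -
    have "\<forall>\<^sub>F n in sequentially. b \<ominus>\<^bsub>C\<^esub> \<iota> (s n) \<in> vge C w N" using b(2) by (rule spec)
    moreover have "\<forall>\<^sub>F n in sequentially. int n \<ge> N"
      by (auto simp: eventually_sequentially intro!: exI[of _ "nat N"])
    ultimately have "\<forall>\<^sub>F n in sequentially. b \<ominus>\<^bsub>C\<^esub> \<iota> (s n) \<in> vge C w N \<and> int n \<ge> N"
      by (rule eventually_conj)
    thus ?thesis by (rule eventually_happens'[OF sequentially_bot])
  qed
  have ba: "b \<ominus>\<^bsub>C\<^esub> a \<in> vge C w 1"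
  proof -
    obtain n where n: "b \<ominus>\<^bsub>C\<^esub> \<iota> (s n) \<in> vge C w 1" using near[of 1] by (elim exE conjE)
    have "b \<ominus>\<^bsub>C\<^esub> a = (b \<ominus>\<^bsub>C\<^esub> \<iota> (s n)) \<oplus>\<^bsub>C\<^esub> (\<iota> (s n) \<ominus>\<^bsub>C\<^esub> a)"
      using b(1) C.vge_carrier[OF a] emb_closed[OF sc] by algebra
    thus ?thesis using C.vge_add[OF n] s(1)[of n] by (simp add: P_def)
  qed
  have bO: "b \<in> ?O"
  proof -
    have "b = (b \<ominus>\<^bsub>C\<^esub> a) \<oplus>\<^bsub>C\<^esub> a" using b(1) C.vge_carrier[OF a] by algebra
    thus ?thesis using C.vge_add[OF C.vge_mono[OF ba] a] by simp
  qed
  have "C.eval p b \<in> vge C w N" for N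
  proof -
    obtain n where n: "b \<ominus>\<^bsub>C\<^esub> \<iota> (s n) \<in> vge C w N" "int n \<ge> N" using near[of N] by (elim exE conjE)
    have sO: "\<iota> (s n) \<in> ?O" using inO s(1)[of n] by (auto simp: P_def)
    obtain y where y: "y \<in> ?O" "C.eval p b \<ominus>\<^bsub>C\<^esub> C.eval p (\<iota> (s n)) = (b \<ominus>\<^bsub>C\<^esub> \<iota> (s n)) \<otimes>\<^bsub>C\<^esub> y"
      using C.eval_diff[OF C.subring_vge pO sO bO] by blast
    have 1: "C.eval p b \<ominus>\<^bsub>C\<^esub> C.eval p (\<iota> (s n)) \<in> vge C w N" unfolding y(2) using C.vge_mult0r[OF n(1) y(1)] .
    have 2: "C.eval p (\<iota> (s n)) \<in> vge C w N" using s(1)[of n] n(2) C.vge_mono by (auto simp: P_def)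
    have "C.eval p b = (C.eval p b \<ominus>\<^bsub>C\<^esub> C.eval p (\<iota> (s n))) \<oplus>\<^bsub>C\<^esub> C.eval p (\<iota> (s n))"
      using C.vge_carrier[OF CV.eval_A[OF pO bO]] C.vge_carrier[OF 2] by algebra
    thus ?thesis using C.vge_add[OF 1 2] by simp
  qed
  hence "C.eval p b = \<zero>\<^bsub>C\<^esub>" by (rule C.vge_all_zero)
  thus "\<exists>b\<in>?O. C.eval p b = \<zero>\<^bsub>C\<^esub> \<and> b \<ominus>\<^bsub>C\<^esub> a \<in> ?O - subring_units C ?O"
    using bO ba C.M_iff by blast
qed

end

section \<open>Henselisations\<close>

lemma RDirProd_simps:
  "carrier (RDirProd R S) = carrier R \<times> carrier S"
  "\<zero>\<^bsub>RDirProd R S\<^esub> = (\<zero>\<^bsub>R\<^esub>, \<zero>\<^bsub>S\<^esub>)" "\<one>\<^bsub>RDirProd R S\<^esub> = (\<one>\<^bsub>R\<^esub>, \<one>\<^bsub>S\<^esub>)"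
  "(a, b) \<oplus>\<^bsub>RDirProd R S\<^esub> (c, d) = (a \<oplus>\<^bsub>R\<^esub> c, b \<oplus>\<^bsub>S\<^esub> d)"
  "(a, b) \<otimes>\<^bsub>RDirProd R S\<^esub> (c, d) = (a \<otimes>\<^bsub>R\<^esub> c, b \<otimes>\<^bsub>S\<^esub> d)"
  by (simp_all add: RDirProd_def DirProd_def monoid.defs)

lemma RDirProd_cring: assumes "cring R" "cring S" shows "cring (RDirProd R S)"
proof -
  interpret R: cring R by fact
  interpret S: cring S by fact
  interpret P: ring "RDirProd R S" by (intro RDirProd_ring R.ring_axioms S.ring_axioms)
  show ?thesis
    by unfold_locales (auto simp: RDirProd_simps R.m_comm S.m_comm)
qed

lemma RDirProd_fst_hom: "fst \<in> ring_hom (RDirProd R S) R"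
  and RDirProd_snd_hom: "snd \<in> ring_hom (RDirProd R S) S"
  by (auto simp: ring_hom_def RDirProd_simps)

lemma (in ring_hom_ring) hom_poly_deriv:
  assumes "set p \<subseteq> carrier R" shows "map h (poly_deriv R p) = poly_deriv S (map h p)"
proof -
  have ap: "h (add_pow R (n::nat) x) = add_pow S n (h x)" if "x \<in> carrier R" for n x
    using that by (induct n) (auto simp: R.add.nat_pow_Suc S.add.nat_pow_Suc)
  have "p ! i \<in> carrier R" if "i < length p" for i using assms that by auto
  thus ?thesis by (auto simp: poly_deriv_def ap)
qed

lemma (in cring) subring_eval_image:
  assumes A: "subring A R" and x: "x \<in> carrier R"
  shows "subring {eval g x | g. set g \<subseteq> A} R"
proof (rule subringI)
  have Ac: "set g \<subseteq> carrier R" if "set g \<subseteq> A" for g using that subringE(1)[OF A] by auto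
  show "{eval g x |g. set g \<subseteq> A} \<subseteq> carrier R" using eval_in_carrier[OF Ac x] by auto
  show "\<one> \<in> {eval g x |g. set g \<subseteq> A}"
    using subringE(3)[OF A] x by (auto intro!: exI[of _ "[\<one>]"])
  fix y assume "y \<in> {eval g x |g. set g \<subseteq> A}"
  then obtain g where g: "set g \<subseteq> A" "y = eval g x" by auto
  have mm: "eval g x \<otimes> eval h x \<in> {eval g x |g. set g \<subseteq> A}" if "set g \<subseteq> A" "set h \<subseteq> A" for g h
  proof -
    have "eval (poly_mult g h) x = eval g x \<otimes> eval h x" using eval_poly_mult[OF Ac Ac x] that by simp
    moreover have "set (poly_mult g h) \<subseteq> A" using polynomial_incl[OF poly_mult_is_polynomial[OF A that]] .
    ultimately show ?thesis by (metis (mono_tags, lifting) mem_Collect_eq)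
  qed
  have aa: "eval g x \<oplus> eval h x \<in> {eval g x |g. set g \<subseteq> A}" if "set g \<subseteq> A" "set h \<subseteq> A" for g h
  proof -
    have "eval (poly_add g h) x = eval g x \<oplus> eval h x" using eval_poly_add[OF Ac Ac x] that by simp
    moreover have "set (poly_add g h) \<subseteq> A" using polynomial_incl[OF poly_add_is_polynomial[OF A that]] .
    ultimately show ?thesis by (metis (mono_tags, lifting) mem_Collect_eq)
  qed
  show "\<ominus> y \<in> {eval g x |g. set g \<subseteq> A}"
  proof -
    have m: "set [\<ominus> \<one>] \<subseteq> A" using subringE(3,5)[OF A] by simp
    have "y \<in> carrier R" using eval_in_carrier[OF Ac x] g by simp
    hence "\<ominus> y = eval [\<ominus> \<one>] x \<otimes> eval g x" using x g by (simp add: l_minus)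
    thus ?thesis using mm[OF m g(1)] by simp
  qed
  fix z assume z: "z \<in> {eval g x |g. set g \<subseteq> A}"
  then obtain h where h: "set h \<subseteq> A" "z = eval h x" by auto
  show "y \<otimes> z \<in> {eval g x |g. set g \<subseteq> A}" using mm[OF g(1) h(1)] g h by simp
  show "y \<oplus> z \<in> {eval g x |g. set g \<subseteq> A}" using aa[OF g(1) h(1)] g h by simp
qed

text \<open>\<open>G\<close> is the graph of a valued embedding into \<open>E\<close> of a field between \<open>F\<close> and its completion \<open>C\<close>.\<close>

locale hensel_graph = completed_field F v C w \<iota> + E: valring E B
  for F :: "('a, 'm) ring_scheme" (structure) and v and C :: "'b ring" and w \<iota>
    and E :: "'c ring" and B +
  fixes \<phi> :: "'a \<Rightarrow> 'c" and G :: "('b \<times> 'c) set"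
  assumes hensB: "henselian E B"
    and G_carrier: "(x, y) \<in> G \<Longrightarrow> x \<in> carrier C \<and> y \<in> carrier E"
    and G_base: "z \<in> carrier F \<Longrightarrow> (\<iota> z, \<phi> z) \<in> G"
    and G_one: "(\<one>\<^bsub>C\<^esub>, \<one>\<^bsub>E\<^esub>) \<in> G"
    and G_add: "(x, y) \<in> G \<Longrightarrow> (x', y') \<in> G \<Longrightarrow> (x \<oplus>\<^bsub>C\<^esub> x', y \<oplus>\<^bsub>E\<^esub> y') \<in> G"
    and G_mult: "(x, y) \<in> G \<Longrightarrow> (x', y') \<in> G \<Longrightarrow> (x \<otimes>\<^bsub>C\<^esub> x', y \<otimes>\<^bsub>E\<^esub> y') \<in> G"
    and G_minus: "(x, y) \<in> G \<Longrightarrow> (\<ominus>\<^bsub>C\<^esub> x, \<ominus>\<^bsub>E\<^esub> y) \<in> G"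
    and G_inv: "(x, y) \<in> G \<Longrightarrow> x \<noteq> \<zero>\<^bsub>C\<^esub> \<Longrightarrow> (inv\<^bsub>C\<^esub> x, inv\<^bsub>E\<^esub> y) \<in> G"
    and G_nz: "(x, y) \<in> G \<Longrightarrow> x = \<zero>\<^bsub>C\<^esub> \<longleftrightarrow> y = \<zero>\<^bsub>E\<^esub>"
    and G_val: "(x, y) \<in> G \<Longrightarrow> x \<in> vge C w 0 \<longleftrightarrow> y \<in> B"
begin

abbreviation "PP \<equiv> RDirProd C E"
abbreviation "VO \<equiv> vge C w 0"

sublocale CV: valring C "vge C w 0" by (rule C.valring)

sublocale P: cring PP
  by (intro RDirProd_cring C.is_cring E.is_cring)

sublocale Fst: ring_hom_ring PP C fst
  by (intro ring_hom_ringI2 RDirProd_fst_hom P.ring_axioms C.ring_axioms)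

sublocale Snd: ring_hom_ring PP E snd
  by (intro ring_hom_ringI2 RDirProd_snd_hom P.ring_axioms E.ring_axioms)

lemma G_diff: "(x, y) \<in> G \<Longrightarrow> (x', y') \<in> G \<Longrightarrow> (x \<ominus>\<^bsub>C\<^esub> x', y \<ominus>\<^bsub>E\<^esub> y') \<in> G"
  unfolding a_minus_def by (intro G_add G_minus)

lemma PP_minus: "x \<in> carrier C \<Longrightarrow> y \<in> carrier E \<Longrightarrow> \<ominus>\<^bsub>PP\<^esub> (x, y) = (\<ominus>\<^bsub>C\<^esub> x, \<ominus>\<^bsub>E\<^esub> y)"
  by (rule P.minus_equality) (auto simp: RDirProd_simps C.l_neg E.l_neg)

lemma G_subring: "subring G PP"
proof (rule P.subringI)
  show "G \<subseteq> carrier PP" using G_carrier by (auto simp: RDirProd_simps)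
  show "\<one>\<^bsub>PP\<^esub> \<in> G" using G_one by (simp add: RDirProd_simps)
  fix h assume h: "h \<in> G"
  then obtain x y where [simp]: "h = (x, y)" by (cases h)
  show "\<ominus>\<^bsub>PP\<^esub> h \<in> G" using h G_carrier[of x y] G_minus by (simp add: PP_minus)
  fix k assume k: "k \<in> G"
  then obtain x' y' where [simp]: "k = (x', y')" by (cases k)
  show "h \<otimes>\<^bsub>PP\<^esub> k \<in> G" "h \<oplus>\<^bsub>PP\<^esub> k \<in> G" using h k G_mult G_add by (auto simp: RDirProd_simps)
qed

lemma G_zero: "(\<zero>\<^bsub>C\<^esub>, \<zero>\<^bsub>E\<^esub>) \<in> G"
  using subringE(2)[OF G_subring] by (simp add: RDirProd_simps)

lemma G_unit: "(x, y) \<in> G \<Longrightarrow> x \<in> CV.UA \<longleftrightarrow> y \<in> E.UA"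
  using G_val[of x y] G_nz[of x y] G_inv[of x y] G_val[of "inv\<^bsub>C\<^esub> x" "inv\<^bsub>E\<^esub> y"]
  by (cases "x = \<zero>\<^bsub>C\<^esub>") (auto simp: CV.U_iff E.U_iff)

lemma G_max: "(x, y) \<in> G \<Longrightarrow> x \<in> CV.MA \<longleftrightarrow> y \<in> E.MA"
  using G_unit G_val by auto

text \<open>A polynomial over the product ring is a polynomial over C together with one over E. With
  coefficients in \<open>G\<close>, the second is the image of the first, so both are evaluated at
  once.\<close>

lemma eval_PP:
  assumes "set g \<subseteq> carrier C \<times> carrier E" "b \<in> carrier C" "b' \<in> carrier E"
  shows "P.eval g (b, b') = (C.eval (map fst g) b, E.eval (map snd g) b')"
  using Fst.eval_hom'[of "(b, b')" g] Snd.eval_hom'[of "(b, b')" g] assms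
  by (metis RDirProd_simps(1) SigmaI fst_conv prod.collapse snd_conv)

lemma G_list: "set g \<subseteq> G \<Longrightarrow> set g \<subseteq> carrier C \<times> carrier E"
  using G_carrier by auto

lemma G_eval:
  assumes "set g \<subseteq> G" "(c, c') \<in> G"
  shows "(C.eval (map fst g) c, E.eval (map snd g) c') \<in> G"
  using P.subring_eval[OF G_subring assms] eval_PP[OF G_list[OF assms(1)]] G_carrier[OF assms(2)] by metis

lemma G_eval_deriv:
  assumes "set g \<subseteq> G" "(c, c') \<in> G"
  shows "(C.eval (poly_deriv C (map fst g)) c, E.eval (poly_deriv E (map snd g)) c') \<in> G"
proof -
  have g: "set g \<subseteq> carrier PP" using G_list[OF assms(1)] by (simp add: RDirProd_simps)
  have "set (poly_deriv PP g) \<subseteq> G" using P.subring_poly_deriv[OF G_subring assms(1)] .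
  from G_eval[OF this assms(2)] show ?thesis
    unfolding Fst.hom_poly_deriv[OF g] Snd.hom_poly_deriv[OF g] .
qed

end

text \<open>
  A simple root \<open>b\<close> over the domain of the graph together with the corresponding root \<open>b'\<close> in \<open>E\<close>.
\<close>

locale hensel_step = hensel_graph F v C w \<iota> E B \<phi> G
  for F :: "('a, 'm) ring_scheme" (structure) and v and C :: "'b ring" and w \<iota>
    and E :: "'c ring" and B \<phi> G +
  fixes p :: "('b \<times> 'c) list" and a a' b b'
  assumes pG: "set p \<subseteq> G" and pO: "set (map fst p) \<subseteq> vge C w 0"
    and pnz: "p \<noteq> []" "fst (hd p) \<noteq> \<zero>\<^bsub>C\<^esub>"
    and aG: "(a, a') \<in> G" and aO: "a \<in> vge C w 0"
    and da: "C.eval (poly_deriv C (map fst p)) a \<in> CV.UA"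
    and b: "b \<in> vge C w 0" "C.eval (map fst p) b = \<zero>\<^bsub>C\<^esub>" "b \<ominus>\<^bsub>C\<^esub> a \<in> CV.MA"
    and b': "b' \<in> B" "E.eval (map snd p) b' = \<zero>\<^bsub>E\<^esub>" "b' \<ominus>\<^bsub>E\<^esub> a' \<in> E.MA"
begin

lemma pB: "set (map snd p) \<subseteq> B"
  using pG pO G_val by fastforce

lemma bc: "b \<in> carrier C" "b' \<in> carrier E"
  using C.vge_carrier[OF b(1)] E.A_carrier[OF b'(1)] by auto

text \<open>If c from F is N-close to b, then p(c) is divisible by an element \<pi> of value N, and
  the graph carries this divisibility to E. Taylor expansion at c' reads 0 = p(c') + (b' - c') U
  with a unit U, so \<pi>' divides b' - c'. Closeness in E is expressed by divisibility because its
  valuation may have any rank.\<close>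

lemma approximants:
  assumes N: "1 \<le> N"
  shows "\<exists>c c' \<pi> \<pi>' s. (c, c') \<in> G \<and> (\<pi>, \<pi>') \<in> G \<and> \<pi> \<noteq> \<zero>\<^bsub>C\<^esub> \<and> w \<pi> = N \<and> c \<in> VO \<and> c' \<in> B \<and>
    b \<ominus>\<^bsub>C\<^esub> c \<in> vge C w N \<and> s \<in> B \<and> b' \<ominus>\<^bsub>E\<^esub> c' = \<pi>' \<otimes>\<^bsub>E\<^esub> s"
proof -
  obtain x where x: "x \<in> carrier F" "b \<ominus>\<^bsub>C\<^esub> \<iota> x \<in> vge C w N" using dense[OF bc(1), of N] by (elim bexE)
  define c where "c = \<iota> x"
  define c' where "c' = \<phi> x"
  have cG: "(c, c') \<in> G" unfolding c_def c'_def using G_base x by simp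
  have cc: "c \<in> carrier C" "c' \<in> carrier E" "a \<in> carrier C" "a' \<in> carrier E"
    using G_carrier cG aG by auto
  have bcN: "b \<ominus>\<^bsub>C\<^esub> c \<in> vge C w N" using x by (simp add: c_def)
  have "c = b \<ominus>\<^bsub>C\<^esub> (b \<ominus>\<^bsub>C\<^esub> c)" using cc bc by algebra
  hence cO: "c \<in> VO" using C.vge_diff[OF b(1) C.vge_mono[OF bcN]] N by simp
  have c'B: "c' \<in> B" using G_val[OF cG] cO by simp
  obtain y where y: "y \<in> carrier F" "y \<noteq> \<zero>" "v y = N" using v_surj by blast
  define \<pi> where "\<pi> = \<iota> y"
  define \<pi>' where "\<pi>' = \<phi> y"
  have \<pi>G: "(\<pi>, \<pi>') \<in> G" "\<pi> \<noteq> \<zero>\<^bsub>C\<^esub>" "w \<pi> = N" unfolding \<pi>_def \<pi>'_def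
    using G_base y w_emb[OF y(1,2)] by auto
  have \<pi>c: "\<pi> \<in> carrier C" "\<pi>' \<in> carrier E" using G_carrier \<pi>G by auto
  define e where "e = C.eval (map fst p) c"
  have eG: "(e, E.eval (map snd p) c') \<in> G" unfolding e_def by (rule G_eval[OF pG cG])
  have eN: "e \<in> vge C w N"
  proof -
    obtain r where r: "r \<in> VO" "C.eval (map fst p) c \<ominus>\<^bsub>C\<^esub> C.eval (map fst p) b = (c \<ominus>\<^bsub>C\<^esub> b) \<otimes>\<^bsub>C\<^esub> r"
      using C.eval_diff[OF C.subring_vge pO b(1) cO] by blast
    have "c \<ominus>\<^bsub>C\<^esub> b = \<ominus>\<^bsub>C\<^esub> (b \<ominus>\<^bsub>C\<^esub> c)" using cc bc by algebra
    hence "c \<ominus>\<^bsub>C\<^esub> b \<in> vge C w N" using C.vge_minus[OF bcN] by simp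
    hence "(c \<ominus>\<^bsub>C\<^esub> b) \<otimes>\<^bsub>C\<^esub> r \<in> vge C w N" using C.vge_mult0r r by blast
    moreover have "e = C.eval (map fst p) c \<ominus>\<^bsub>C\<^esub> C.eval (map fst p) b"
      unfolding b(2) e_def[symmetric] using G_carrier[OF eG] by (simp add: a_minus_def)
    ultimately show ?thesis using r by simp
  qed
  define q where "q = e \<otimes>\<^bsub>C\<^esub> inv\<^bsub>C\<^esub> \<pi>"
  define q' where "q' = E.eval (map snd p) c' \<otimes>\<^bsub>E\<^esub> inv\<^bsub>E\<^esub> \<pi>'"
  have qG: "(q, q') \<in> G" unfolding q_def q'_def by (intro G_mult eG G_inv \<pi>G)
  have "q \<in> VO" unfolding q_def
    by (rule C.v_div_closed[OF _ \<pi>c(1) \<pi>G(2) eN]) (use G_carrier[OF eG] \<pi>G in auto)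
  hence q'B: "q' \<in> B" using G_val[OF qG] by simp
  have \<pi>'nz: "\<pi>' \<noteq> \<zero>\<^bsub>E\<^esub>" using G_nz[OF \<pi>G(1)] \<pi>G(2) by simp
  note i = E.inv_nz[OF \<pi>c(2) \<pi>'nz]
  have evc: "E.eval (map snd p) c' = \<pi>' \<otimes>\<^bsub>E\<^esub> q'"
  proof -
    have k: "E.eval (map snd p) c' \<in> carrier E" "inv\<^bsub>E\<^esub> \<pi>' \<in> carrier E" using G_carrier[OF eG] i by auto
    have "\<pi>' \<otimes>\<^bsub>E\<^esub> q' = E.eval (map snd p) c' \<otimes>\<^bsub>E\<^esub> (\<pi>' \<otimes>\<^bsub>E\<^esub> inv\<^bsub>E\<^esub> \<pi>')"
      unfolding q'_def using k \<pi>c by algebra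
    thus ?thesis using k i by simp
  qed
  define h where "h = b' \<ominus>\<^bsub>E\<^esub> c'"
  have hM: "h \<in> E.MA"
  proof -
    have "a \<ominus>\<^bsub>C\<^esub> c = (b \<ominus>\<^bsub>C\<^esub> c) \<ominus>\<^bsub>C\<^esub> (b \<ominus>\<^bsub>C\<^esub> a)" using cc bc by algebra
    moreover have "b \<ominus>\<^bsub>C\<^esub> a \<in> vge C w 1" using b(3) C.M_iff by simp
    ultimately have "a \<ominus>\<^bsub>C\<^esub> c \<in> vge C w 1" using C.vge_diff[OF C.vge_mono[OF bcN N]] by simp
    hence "a \<ominus>\<^bsub>C\<^esub> c \<in> CV.MA" using C.M_iff by simp
    hence m: "a' \<ominus>\<^bsub>E\<^esub> c' \<in> E.MA" using G_max[OF G_diff[OF aG cG]] by simp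
    have "h = (b' \<ominus>\<^bsub>E\<^esub> a') \<oplus>\<^bsub>E\<^esub> (a' \<ominus>\<^bsub>E\<^esub> c')" unfolding h_def using cc bc by algebra
    thus ?thesis using E.M_add[OF b'(3) m] by simp
  qed
  have ac: "c \<ominus>\<^bsub>C\<^esub> a \<in> CV.MA"
  proof -
    have "c \<ominus>\<^bsub>C\<^esub> a = (b \<ominus>\<^bsub>C\<^esub> a) \<ominus>\<^bsub>C\<^esub> (b \<ominus>\<^bsub>C\<^esub> c)" using cc bc by algebra
    moreover have "b \<ominus>\<^bsub>C\<^esub> a \<in> vge C w 1" using b(3) C.M_iff by simp
    ultimately have "c \<ominus>\<^bsub>C\<^esub> a \<in> vge C w 1" using C.vge_diff[OF _ C.vge_mono[OF bcN N]] by simp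
    thus ?thesis using C.M_iff by simp
  qed
  have "C.eval (poly_deriv C (map fst p)) c \<in> CV.UA"
    using CV.eval_M_congr[OF C.subring_poly_deriv[OF C.subring_vge pO] aO cO ac] da by simp
  hence DU: "E.eval (poly_deriv E (map snd p)) c' \<in> E.UA"
    using G_unit[OF G_eval_deriv[OF pG cG]] by simp
  obtain r where r: "r \<in> B" "E.eval (map snd p) (c' \<oplus>\<^bsub>E\<^esub> h) = E.eval (map snd p) c' \<oplus>\<^bsub>E\<^esub>
      h \<otimes>\<^bsub>E\<^esub> E.eval (poly_deriv E (map snd p)) c' \<oplus>\<^bsub>E\<^esub> h \<otimes>\<^bsub>E\<^esub> h \<otimes>\<^bsub>E\<^esub> r"
    using E.eval_taylor[OF E.sub pB c'B, of h] hM by blast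
  define D where "D = E.eval (poly_deriv E (map snd p)) c'"
  define U where "U = D \<oplus>\<^bsub>E\<^esub> h \<otimes>\<^bsub>E\<^esub> r"
  have UU: "U \<in> E.UA" unfolding U_def D_def by (intro E.U_add_M DU E.M_multr r hM)
  have ec: "h \<in> carrier E" "D \<in> carrier E" "r \<in> carrier E" "q' \<in> carrier E" "U \<in> carrier E" "inv\<^bsub>E\<^esub> U \<in> carrier E"
    using hM DU r q'B UU E.U_inv E.A_carrier unfolding D_def by auto
  have ch: "c' \<oplus>\<^bsub>E\<^esub> h = b'" unfolding h_def using cc bc by algebra
  have "\<zero>\<^bsub>E\<^esub> = \<pi>' \<otimes>\<^bsub>E\<^esub> q' \<oplus>\<^bsub>E\<^esub> h \<otimes>\<^bsub>E\<^esub> D \<oplus>\<^bsub>E\<^esub> h \<otimes>\<^bsub>E\<^esub> h \<otimes>\<^bsub>E\<^esub> r"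
    using r(2) unfolding ch b'(2) evc D_def .
  also have "\<dots> = \<pi>' \<otimes>\<^bsub>E\<^esub> q' \<oplus>\<^bsub>E\<^esub> h \<otimes>\<^bsub>E\<^esub> U" unfolding U_def using ec \<pi>c by algebra
  finally have z: "\<pi>' \<otimes>\<^bsub>E\<^esub> q' \<oplus>\<^bsub>E\<^esub> h \<otimes>\<^bsub>E\<^esub> U = \<zero>\<^bsub>E\<^esub>" by simp
  have Ui: "U \<otimes>\<^bsub>E\<^esub> inv\<^bsub>E\<^esub> U = \<one>\<^bsub>E\<^esub>" using E.U_inv[OF UU] by simp
  have "\<pi>' \<otimes>\<^bsub>E\<^esub> (\<ominus>\<^bsub>E\<^esub> (q' \<otimes>\<^bsub>E\<^esub> inv\<^bsub>E\<^esub> U)) =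
      h \<otimes>\<^bsub>E\<^esub> (U \<otimes>\<^bsub>E\<^esub> inv\<^bsub>E\<^esub> U) \<ominus>\<^bsub>E\<^esub> (\<pi>' \<otimes>\<^bsub>E\<^esub> q' \<oplus>\<^bsub>E\<^esub> h \<otimes>\<^bsub>E\<^esub> U) \<otimes>\<^bsub>E\<^esub> inv\<^bsub>E\<^esub> U"
    using ec \<pi>c by algebra
  also have "\<dots> = h" unfolding Ui z using ec by (simp add: a_minus_def)
  finally have hh: "h = \<pi>' \<otimes>\<^bsub>E\<^esub> (\<ominus>\<^bsub>E\<^esub> (q' \<otimes>\<^bsub>E\<^esub> inv\<^bsub>E\<^esub> U))" by simp
  have "\<ominus>\<^bsub>E\<^esub> (q' \<otimes>\<^bsub>E\<^esub> inv\<^bsub>E\<^esub> U) \<in> B" using q'B E.U_inv[OF UU] by (intro E.A_minus E.A_mult) auto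
  thus ?thesis using cG \<pi>G cO c'B bcN hh unfolding h_def by blast
qed

text \<open>
  Approximating \<open>b\<close> by elements of \<open>F\<close>, on which both embeddings are given, shows that \<open>g(b)\<close> and \<open>g(b')\<close>
  have the same value as soon as \<open>g(b) \<noteq> 0\<close>.
\<close>

lemma eval_transfer:
  assumes g: "set g \<subseteq> G" and nz: "C.eval (map fst g) b \<noteq> \<zero>\<^bsub>C\<^esub>"
  shows "E.eval (map snd g) b' \<noteq> \<zero>\<^bsub>E\<^esub> \<and> (C.eval (map fst g) b \<in> VO \<longleftrightarrow> E.eval (map snd g) b' \<in> B)"
proof -
  define Xa where "Xa = C.eval (map fst g) b"
  define Y where "Y = E.eval (map snd g) b'"
  have gc: "set (map fst g) \<subseteq> carrier C" "set (map snd g) \<subseteq> carrier E" using G_list[OF g] by auto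
  have Xc: "Xa \<in> carrier C" "Y \<in> carrier E" "Xa \<noteq> \<zero>\<^bsub>C\<^esub>"
    unfolding Xa_def Y_def using C.eval_in_carrier[OF gc(1) bc(1)] E.eval_in_carrier[OF gc(2) bc(2)] nz by auto
  have "\<exists>m. set (map fst g) \<subseteq> vge C w m"
    using gc(1)
  proof (induct g)
    case (Cons k g)
    then obtain m where m: "set (map fst g) \<subseteq> vge C w m" by auto
    obtain n where n: "fst k \<in> vge C w n" using C.vge_exists[of "fst k"] Cons(2) by auto
    have "set (map fst (k # g)) \<subseteq> vge C w (min m n)" using m n C.vge_mono[of _ _ "min m n"] by auto
    thus ?case by blast
  qed auto
  then obtain m where m: "set (map fst g) \<subseteq> vge C w m" by blast
  \<comment> \<open>An element of F that scales the coefficients of g into the valuation ring, where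
    \<open>eval_diff\<close> applies.\<close>
  obtain y where y: "y \<in> carrier F" "y \<noteq> \<zero>" "v y = - m" using v_surj by blast
  define \<kappa> where "\<kappa> = \<iota> y"
  define \<kappa>' where "\<kappa>' = \<phi> y"
  have \<kappa>G: "(\<kappa>, \<kappa>') \<in> G" "\<kappa> \<noteq> \<zero>\<^bsub>C\<^esub>" "w \<kappa> = - m" unfolding \<kappa>_def \<kappa>'_def
    using G_base y w_emb[OF y(1,2)] by auto
  have \<kappa>c: "\<kappa> \<in> carrier C" "\<kappa>' \<in> carrier E" using G_carrier \<kappa>G by auto
  define g1 where "g1 = map (\<lambda>z. (\<kappa>, \<kappa>') \<otimes>\<^bsub>PP\<^esub> z) g"
  have g1f: "map fst g1 = map (\<lambda>z. \<kappa> \<otimes>\<^bsub>C\<^esub> z) (map fst g)" "map snd g1 = map (\<lambda>z. \<kappa>' \<otimes>\<^bsub>E\<^esub> z) (map snd g)"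
    by (auto simp: g1_def RDirProd_def DirProd_def monoid.defs)
  have g1G: "set g1 \<subseteq> G" using g G_mult[OF \<kappa>G(1)] by (auto simp: g1_def RDirProd_simps)
  have g1O: "set (map fst g1) \<subseteq> VO"
  proof
    fix z assume "z \<in> set (map fst g1)"
    then obtain u where u: "u \<in> set (map fst g)" "z = \<kappa> \<otimes>\<^bsub>C\<^esub> u" unfolding g1f by auto
    have "\<kappa> \<in> vge C w (- m)" using \<kappa>G \<kappa>c by (simp add: vge_def)
    from C.vge_mult[OF this, of u m] show "z \<in> VO" using u m by auto
  qed
  have g1B: "set (map snd g1) \<subseteq> B" using g1G g1O G_val by fastforce
  have ev: "C.eval (map (\<lambda>z. k \<otimes>\<^bsub>C\<^esub> z) l) z = k \<otimes>\<^bsub>C\<^esub> C.eval l z"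
    if "k \<in> carrier C" "set l \<subseteq> carrier C" "z \<in> carrier C" for k l z
    using that(2)
  proof (induct l)
    case (Cons u l)
    have "C.eval l z \<in> carrier C" using Cons that C.eval_in_carrier by auto
    thus ?case using Cons that by (simp add: C.r_distr C.m_assoc)
  qed (use that in simp)
  have ev': "E.eval (map (\<lambda>z. k \<otimes>\<^bsub>E\<^esub> z) l) z = k \<otimes>\<^bsub>E\<^esub> E.eval l z"
    if "k \<in> carrier E" "set l \<subseteq> carrier E" "z \<in> carrier E" for k l z
    using that(2)
  proof (induct l)
    case (Cons u l)
    have "E.eval l z \<in> carrier E" using Cons that E.eval_in_carrier by auto
    thus ?case using Cons that by (simp add: E.r_distr E.m_assoc)
  qed (use that in simp)
  define k where "k = w Xa"
  \<comment> \<open>So close to b that g(c) and g(b) have the same value k: undoing the scaling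
    changes the accuracy from N to N + m, which has to exceed k.\<close>
  define N where "N = max 1 (k - m + 1)"
  have N: "1 \<le> N" "k + 1 \<le> N + m" by (auto simp: N_def)
  obtain c c' \<pi> \<pi>' s where c: "(c, c') \<in> G" "(\<pi>, \<pi>') \<in> G" "\<pi> \<noteq> \<zero>\<^bsub>C\<^esub>" "w \<pi> = N" "c \<in> VO" "c' \<in> B"
    "b \<ominus>\<^bsub>C\<^esub> c \<in> vge C w N" "s \<in> B" "b' \<ominus>\<^bsub>E\<^esub> c' = \<pi>' \<otimes>\<^bsub>E\<^esub> s"
    using approximants[OF N(1)] by blast
  define x where "x = C.eval (map fst g) c"
  define x' where "x' = E.eval (map snd g) c'"
  have xG: "(x, x') \<in> G" unfolding x_def x'_def by (rule G_eval[OF g c(1)])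
  have cc: "c \<in> carrier C" "c' \<in> carrier E" "\<pi> \<in> carrier C" "\<pi>' \<in> carrier E" "x \<in> carrier C" "x' \<in> carrier E"
    using G_carrier c xG by blast+
  obtain r where r: "r \<in> VO" "C.eval (map fst g1) b \<ominus>\<^bsub>C\<^esub> C.eval (map fst g1) c = (b \<ominus>\<^bsub>C\<^esub> c) \<otimes>\<^bsub>C\<^esub> r"
    using C.eval_diff[OF C.subring_vge g1O c(5) b(1)] by blast
  have 1: "\<kappa> \<otimes>\<^bsub>C\<^esub> Xa \<ominus>\<^bsub>C\<^esub> \<kappa> \<otimes>\<^bsub>C\<^esub> x \<in> vge C w N"
    using C.vge_mult0r[OF c(7) r(1)] r(2) unfolding g1f ev[OF \<kappa>c(1) gc(1) bc(1)] ev[OF \<kappa>c(1) gc(1) cc(1)] Xa_def x_def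
    by simp
  have i: "inv\<^bsub>C\<^esub> \<kappa> \<in> vge C w m" using C.vge_inv[OF \<kappa>c(1) \<kappa>G(2)] \<kappa>G(3) by simp
  have ii: "inv\<^bsub>C\<^esub> \<kappa> \<otimes>\<^bsub>C\<^esub> \<kappa> = \<one>\<^bsub>C\<^esub>" "inv\<^bsub>C\<^esub> \<kappa> \<in> carrier C" using C.inv_closed_nz[OF \<kappa>c(1) \<kappa>G(2)] by auto
  have "Xa \<ominus>\<^bsub>C\<^esub> x = (inv\<^bsub>C\<^esub> \<kappa> \<otimes>\<^bsub>C\<^esub> \<kappa>) \<otimes>\<^bsub>C\<^esub> (Xa \<ominus>\<^bsub>C\<^esub> x)" unfolding ii using Xc cc by simp
  also have "\<dots> = (\<kappa> \<otimes>\<^bsub>C\<^esub> Xa \<ominus>\<^bsub>C\<^esub> \<kappa> \<otimes>\<^bsub>C\<^esub> x) \<otimes>\<^bsub>C\<^esub> inv\<^bsub>C\<^esub> \<kappa>" using Xc cc ii(2) \<kappa>c by algebra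
  finally have 2: "Xa \<ominus>\<^bsub>C\<^esub> x \<in> vge C w (N + m)" using C.vge_mult[OF 1 i] by simp
  have "x \<ominus>\<^bsub>C\<^esub> Xa = \<ominus>\<^bsub>C\<^esub> (Xa \<ominus>\<^bsub>C\<^esub> x)" using Xc cc by algebra
  hence 3: "x \<ominus>\<^bsub>C\<^esub> Xa \<in> vge C w (w Xa + 1)" using C.vge_mono[OF C.vge_minus[OF 2] N(2)] by (simp add: k_def)
  have x: "x \<noteq> \<zero>\<^bsub>C\<^esub>" "w x = k" using C.v_close[OF Xc(1,3) cc(5) 3] by (auto simp: k_def)
  obtain r' where r': "r' \<in> B" "E.eval (map snd g1) b' \<ominus>\<^bsub>E\<^esub> E.eval (map snd g1) c' = (b' \<ominus>\<^bsub>E\<^esub> c') \<otimes>\<^bsub>E\<^esub> r'"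
    using E.eval_diff[OF E.sub g1B c(6) b'(1)] by blast
  have 4: "\<kappa>' \<otimes>\<^bsub>E\<^esub> Y \<ominus>\<^bsub>E\<^esub> \<kappa>' \<otimes>\<^bsub>E\<^esub> x' = \<pi>' \<otimes>\<^bsub>E\<^esub> s \<otimes>\<^bsub>E\<^esub> r'"
    using r'(2) unfolding g1f ev'[OF \<kappa>c(2) gc(2) bc(2)] ev'[OF \<kappa>c(2) gc(2) cc(2)] c(9) Y_def x'_def .
  \<comment> \<open>Of positive value by the choice of N. Hence \<theta>' lies in the maximal ideal,
    and g(b') = g(c') (1 + \<theta>' s r') with a unit as second factor.\<close>
  define \<theta> where "\<theta> = \<pi> \<otimes>\<^bsub>C\<^esub> inv\<^bsub>C\<^esub> (\<kappa> \<otimes>\<^bsub>C\<^esub> x)"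
  define \<theta>' where "\<theta>' = \<pi>' \<otimes>\<^bsub>E\<^esub> inv\<^bsub>E\<^esub> (\<kappa>' \<otimes>\<^bsub>E\<^esub> x')"
  have \<kappa>x: "\<kappa> \<otimes>\<^bsub>C\<^esub> x \<noteq> \<zero>\<^bsub>C\<^esub>" "\<kappa> \<otimes>\<^bsub>C\<^esub> x \<in> carrier C" "w (\<kappa> \<otimes>\<^bsub>C\<^esub> x) = k - m"
    using C.mult_nz x \<kappa>G \<kappa>c cc C.v_mult by auto
  have \<kappa>xG: "(\<kappa> \<otimes>\<^bsub>C\<^esub> x, \<kappa>' \<otimes>\<^bsub>E\<^esub> x') \<in> G" by (rule G_mult[OF \<kappa>G(1) xG])
  have \<theta>G: "(\<theta>, \<theta>') \<in> G" unfolding \<theta>_def \<theta>'_def by (intro G_mult c G_inv \<kappa>xG \<kappa>x)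
  have "\<theta> \<in> vge C w 1" unfolding \<theta>_def
    by (rule C.v_div_closed[where n = N]) (use cc \<kappa>x c N in \<open>auto simp: vge_def\<close>)
  hence \<theta>M: "\<theta>' \<in> E.MA" using G_max[OF \<theta>G] C.M_iff by simp
  have \<kappa>x': "\<kappa>' \<otimes>\<^bsub>E\<^esub> x' \<noteq> \<zero>\<^bsub>E\<^esub>" using G_nz[OF \<kappa>xG] \<kappa>x by simp
  have \<kappa>'nz: "\<kappa>' \<noteq> \<zero>\<^bsub>E\<^esub>" using G_nz[OF \<kappa>G(1)] \<kappa>G(2) by simp
  have \<theta>c: "\<theta>' \<in> carrier E" "s \<in> carrier E" "r' \<in> carrier E" using \<theta>M c r' E.A_carrier by auto
  have "\<theta>' \<otimes>\<^bsub>E\<^esub> (\<kappa>' \<otimes>\<^bsub>E\<^esub> x') = \<pi>'"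
    unfolding \<theta>'_def using E.inv_nz[OF _ \<kappa>x'] cc \<kappa>c by (simp add: E.m_assoc)
  hence "\<kappa>' \<otimes>\<^bsub>E\<^esub> Y \<ominus>\<^bsub>E\<^esub> \<kappa>' \<otimes>\<^bsub>E\<^esub> x' = \<theta>' \<otimes>\<^bsub>E\<^esub> (\<kappa>' \<otimes>\<^bsub>E\<^esub> x') \<otimes>\<^bsub>E\<^esub> s \<otimes>\<^bsub>E\<^esub> r'" using 4 by simp
  moreover have "\<kappa>' \<otimes>\<^bsub>E\<^esub> Y = (\<kappa>' \<otimes>\<^bsub>E\<^esub> Y \<ominus>\<^bsub>E\<^esub> \<kappa>' \<otimes>\<^bsub>E\<^esub> x') \<oplus>\<^bsub>E\<^esub> \<kappa>' \<otimes>\<^bsub>E\<^esub> x'" using Xc cc \<kappa>c by algebra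
  ultimately have "\<kappa>' \<otimes>\<^bsub>E\<^esub> Y = \<theta>' \<otimes>\<^bsub>E\<^esub> (\<kappa>' \<otimes>\<^bsub>E\<^esub> x') \<otimes>\<^bsub>E\<^esub> s \<otimes>\<^bsub>E\<^esub> r' \<oplus>\<^bsub>E\<^esub> \<kappa>' \<otimes>\<^bsub>E\<^esub> x'" by simp
  also have "\<dots> = \<kappa>' \<otimes>\<^bsub>E\<^esub> (x' \<otimes>\<^bsub>E\<^esub> (\<one>\<^bsub>E\<^esub> \<oplus>\<^bsub>E\<^esub> \<theta>' \<otimes>\<^bsub>E\<^esub> s \<otimes>\<^bsub>E\<^esub> r'))" using \<theta>c \<kappa>c cc by algebra
  finally have Yeq: "Y = x' \<otimes>\<^bsub>E\<^esub> (\<one>\<^bsub>E\<^esub> \<oplus>\<^bsub>E\<^esub> \<theta>' \<otimes>\<^bsub>E\<^esub> s \<otimes>\<^bsub>E\<^esub> r')"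
    using E.m_lcancel[OF \<kappa>'nz \<kappa>c(2)] Xc cc \<theta>c by simp
  define u where "u = \<one>\<^bsub>E\<^esub> \<oplus>\<^bsub>E\<^esub> \<theta>' \<otimes>\<^bsub>E\<^esub> s \<otimes>\<^bsub>E\<^esub> r'"
  have oneU: "\<one>\<^bsub>E\<^esub> \<in> E.UA" using G_unit[OF G_one] CV.A_one by (auto simp: CV.U_iff)
  have u: "u \<in> E.UA" unfolding u_def by (intro E.U_add_M oneU E.M_multr r' c \<theta>M)
  note ui = E.U_inv[OF u]
  have uc: "u \<in> carrier E" "inv\<^bsub>E\<^esub> u \<in> carrier E" using ui E.A_carrier by auto
  have "x' \<noteq> \<zero>\<^bsub>E\<^esub>" using G_nz[OF xG] x by simp
  hence Ynz: "Y \<noteq> \<zero>\<^bsub>E\<^esub>" unfolding Yeq u_def[symmetric] using E.integral[of x' u] cc uc ui by auto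
  have "x' = Y \<otimes>\<^bsub>E\<^esub> inv\<^bsub>E\<^esub> u" unfolding Yeq u_def[symmetric] using ui cc uc by (simp add: E.m_assoc)
  hence "Y \<in> B \<longleftrightarrow> x' \<in> B" using Yeq u_def ui E.A_mult by metis
  also have "\<dots> \<longleftrightarrow> x \<in> VO" using G_val[OF xG] by simp
  also have "\<dots> \<longleftrightarrow> Xa \<in> VO" using x cc Xc by (simp add: vge_def k_def)
  finally show ?thesis using Ynz by (simp add: Xa_def Y_def)
qed

text \<open>The subring of the product generated by \<open>G\<close> and \<open>(b, b')\<close>. By
  \<open>extended_graph\<close> it is again a graph.\<close>

definition Ext where "Ext = {P.eval g (b, b') | g. set g \<subseteq> G}"

lemma Ext_subring: "subring Ext PP"
  unfolding Ext_def by (rule P.subring_eval_image[OF G_subring]) (use bc in \<open>simp add: RDirProd_simps\<close>)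

lemma Ext_transfer: "(Xa, Y) \<in> Ext \<Longrightarrow> Xa \<noteq> \<zero>\<^bsub>C\<^esub> \<Longrightarrow> Y \<noteq> \<zero>\<^bsub>E\<^esub> \<and> (Xa \<in> VO \<longleftrightarrow> Y \<in> B)"
proof -
  assume "(Xa, Y) \<in> Ext" and nz: "Xa \<noteq> \<zero>\<^bsub>C\<^esub>"
  then obtain g where g: "set g \<subseteq> G" "P.eval g (b, b') = (Xa, Y)" by (auto simp: Ext_def)
  thus ?thesis using eval_transfer[OF g(1)] eval_PP[OF G_list[OF g(1)] bc] nz by simp
qed

lemma G_Ext: "G \<subseteq> Ext"
proof
  fix z assume z: "z \<in> G"
  hence "z \<in> carrier PP" using subringE(1)[OF G_subring] by auto
  hence "P.eval [z] (b, b') = z" by simp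
  thus "z \<in> Ext" using z by (auto simp: Ext_def intro!: exI[of _ "[z]"])
qed

lemma root_Ext: "(b, b') \<in> Ext"
proof -
  have "P.eval [\<one>\<^bsub>PP\<^esub>, \<zero>\<^bsub>PP\<^esub>] (b, b') = (b, b')" using bc by (simp add: RDirProd_simps)
  thus ?thesis using G_one G_zero by (auto simp: Ext_def RDirProd_simps intro!: exI[of _ "[\<one>\<^bsub>PP\<^esub>, \<zero>\<^bsub>PP\<^esub>]"])
qed

text \<open>
  The second projection of \<open>Ext\<close> is a simple algebraic extension and hence a field. So if \<open>(0, y)\<close> with
  \<open>y \<noteq> 0\<close> were in \<open>Ext\<close>, then so would be \<open>(0, 1)\<close> and \<open>(-1, 0)\<close>, which \<open>Ext_transfer\<close> excludes. In this
  way no minimal polynomials are needed.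
\<close>

lemma Ext_snd_inverse:
  assumes XY: "(Xa, Y) \<in> Ext" "Y \<noteq> \<zero>\<^bsub>E\<^esub>"
  shows "\<exists>Z. (Z, inv\<^bsub>E\<^esub> Y) \<in> Ext"
proof -
  define L where "L = snd ` G"
  have Lc: "L \<subseteq> carrier E" using G_carrier by (auto simp: L_def)
  have LS: "subring L E" unfolding L_def using Snd.img_is_subring[OF G_subring] .
  have Lf: "subfield L E"
  proof (rule E.subfieldI'[OF LS])
    fix k assume "k \<in> L - {\<zero>\<^bsub>E\<^esub>}"
    then obtain x where x: "(x, k) \<in> G" "k \<noteq> \<zero>\<^bsub>E\<^esub>" by (auto simp: L_def)
    thus "inv\<^bsub>E\<^esub> k \<in> L" using G_inv[OF x(1)] G_nz[OF x(1)] by (force simp: L_def)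
  qed
  have "snd (hd p) \<noteq> \<zero>\<^bsub>E\<^esub>"
  proof -
    have "hd p \<in> G" using pG pnz(1) by (cases p) auto
    thus ?thesis using G_nz[of "fst (hd p)" "snd (hd p)"] pnz(2) by simp
  qed
  hence pp: "map snd p \<in> carrier (univ_poly E L)" "map snd p \<noteq> []"
    using pG pnz(1) by (auto simp: univ_poly_carrier_iff L_def hd_map)
  have alg: "E.algebraic L b'" using E.algebraicI[OF pp b'(2)] by (simp add: over_def)
  define S where "S = E.simple_extension L b'"
  have Sf: "subfield S E" unfolding S_def
    using E.simple_extension_is_subfield[OF Lf bc(2)] alg by (simp add: over_def)
  obtain g where g: "set g \<subseteq> G" "Y = E.eval (map snd g) b'"
    using XY eval_PP[OF G_list bc] by (auto simp: Ext_def)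
  have LSi: "L \<subseteq> S" "b' \<in> S" unfolding S_def
    using E.simple_extension_incl[OF Lc bc(2)] E.simple_extension_mem[OF LS bc(2)] by auto
  have "set (map snd g) \<subseteq> S" using g LSi by (auto simp: L_def)
  hence "Y \<in> S" using g E.subring_eval[OF subfieldE(1)[OF Sf] _ LSi(2)] by simp
  hence "inv\<^bsub>E\<^esub> Y \<in> S" using E.subfield_m_inv(1)[OF Sf] XY by auto
  then obtain q where q: "q \<in> carrier (univ_poly E L)" "inv\<^bsub>E\<^esub> Y = E.eval q b'"
    unfolding S_def E.simple_extension_as_eval_img[OF Lc bc(2)] by (elim imageE)
  hence q: "set q \<subseteq> L" "inv\<^bsub>E\<^esub> Y = E.eval q b'" by (auto simp: univ_poly_carrier_iff)
  define q1 where "q1 = map (\<lambda>y. (SOME z. z \<in> G \<and> snd z = y)) q"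
  have q1: "\<And>y. y \<in> set q \<Longrightarrow> (SOME z. z \<in> G \<and> snd z = y) \<in> G \<and> snd (SOME z. z \<in> G \<and> snd z = y) = y"
  proof -
    fix y assume "y \<in> set q"
    hence "\<exists>z. z \<in> G \<and> snd z = y" using q by (force simp: L_def)
    thus "(SOME z. z \<in> G \<and> snd z = y) \<in> G \<and> snd (SOME z. z \<in> G \<and> snd z = y) = y" by (rule someI_ex)
  qed
  have q1G: "set q1 \<subseteq> G" using q1 by (auto simp: q1_def)
  have "map snd q1 = q" unfolding q1_def using q1 by (simp add: map_idI)
  hence "P.eval q1 (b, b') = (C.eval (map fst q1) b, inv\<^bsub>E\<^esub> Y)" using eval_PP[OF G_list[OF q1G] bc] q by simp
  thus ?thesis using q1G by (auto simp: Ext_def intro!: exI[of _ "C.eval (map fst q1) b"] exI[of _ q1])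
qed

lemma Ext_carrier: "(Xa, Y) \<in> Ext \<Longrightarrow> Xa \<in> carrier C \<and> Y \<in> carrier E"
  using subringE(1)[OF Ext_subring] by (auto simp: RDirProd_simps)

lemma Ext_mult: "(Xa, Y) \<in> Ext \<Longrightarrow> (Xa', Y') \<in> Ext \<Longrightarrow> (Xa \<otimes>\<^bsub>C\<^esub> Xa', Y \<otimes>\<^bsub>E\<^esub> Y') \<in> Ext"
  using subringE(6)[OF Ext_subring, of "(Xa, Y)" "(Xa', Y')"] by (simp add: RDirProd_simps)

lemma Ext_add: "(Xa, Y) \<in> Ext \<Longrightarrow> (Xa', Y') \<in> Ext \<Longrightarrow> (Xa \<oplus>\<^bsub>C\<^esub> Xa', Y \<oplus>\<^bsub>E\<^esub> Y') \<in> Ext"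
  using subringE(7)[OF Ext_subring, of "(Xa, Y)" "(Xa', Y')"] by (simp add: RDirProd_simps)

lemma Ext_minus: "(Xa, Y) \<in> Ext \<Longrightarrow> (\<ominus>\<^bsub>C\<^esub> Xa, \<ominus>\<^bsub>E\<^esub> Y) \<in> Ext"
  using subringE(5)[OF Ext_subring, of "(Xa, Y)"] Ext_carrier[of Xa Y] by (simp add: PP_minus)

lemma Ext_diff: "(Xa, Y) \<in> Ext \<Longrightarrow> (Xa', Y') \<in> Ext \<Longrightarrow> (Xa \<ominus>\<^bsub>C\<^esub> Xa', Y \<ominus>\<^bsub>E\<^esub> Y') \<in> Ext"
  unfolding a_minus_def by (intro Ext_add Ext_minus)

lemma Ext_nz: assumes "(Xa, Y) \<in> Ext" shows "Xa = \<zero>\<^bsub>C\<^esub> \<longleftrightarrow> Y = \<zero>\<^bsub>E\<^esub>"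
proof
  assume "Y = \<zero>\<^bsub>E\<^esub>"
  thus "Xa = \<zero>\<^bsub>C\<^esub>" using Ext_transfer[OF assms] by blast
next
  assume Xa: "Xa = \<zero>\<^bsub>C\<^esub>"
  show "Y = \<zero>\<^bsub>E\<^esub>"
  proof (rule ccontr)
    assume Y: "Y \<noteq> \<zero>\<^bsub>E\<^esub>"
    obtain Z where Z: "(Z, inv\<^bsub>E\<^esub> Y) \<in> Ext" using Ext_snd_inverse[OF assms Y] by blast
    have c: "Y \<in> carrier E" "Z \<in> carrier C" using Ext_carrier assms Z by auto
    have "(\<zero>\<^bsub>C\<^esub>, \<one>\<^bsub>E\<^esub>) \<in> Ext" using Ext_mult[OF assms Z] Xa c E.inv_nz[OF c(1) Y] by simp
    from Ext_diff[OF _ this] G_one G_Ext have "(\<one>\<^bsub>C\<^esub> \<ominus>\<^bsub>C\<^esub> \<zero>\<^bsub>C\<^esub>, \<one>\<^bsub>E\<^esub> \<ominus>\<^bsub>E\<^esub> \<one>\<^bsub>E\<^esub>) \<in> Ext" by blast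
    hence "(\<one>\<^bsub>C\<^esub>, \<zero>\<^bsub>E\<^esub>) \<in> Ext" by (simp add: a_minus_def E.r_neg)
    thus False using Ext_transfer by force
  qed
qed

lemma Ext_inv: assumes "(Xa, Y) \<in> Ext" "Xa \<noteq> \<zero>\<^bsub>C\<^esub>" shows "(inv\<^bsub>C\<^esub> Xa, inv\<^bsub>E\<^esub> Y) \<in> Ext"
proof -
  have Y: "Y \<noteq> \<zero>\<^bsub>E\<^esub>" using Ext_nz[OF assms(1)] assms(2) by simp
  obtain Z where Z: "(Z, inv\<^bsub>E\<^esub> Y) \<in> Ext" using Ext_snd_inverse[OF assms(1) Y] by blast
  have c: "Xa \<in> carrier C" "Y \<in> carrier E" "Z \<in> carrier C" using Ext_carrier assms Z by auto
  have "(Xa \<otimes>\<^bsub>C\<^esub> Z, \<one>\<^bsub>E\<^esub>) \<in> Ext" using Ext_mult[OF assms(1) Z] c E.inv_nz[OF c(2) Y] by simp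
  from Ext_diff[OF this] G_one G_Ext have "(Xa \<otimes>\<^bsub>C\<^esub> Z \<ominus>\<^bsub>C\<^esub> \<one>\<^bsub>C\<^esub>, \<one>\<^bsub>E\<^esub> \<ominus>\<^bsub>E\<^esub> \<one>\<^bsub>E\<^esub>) \<in> Ext" by blast
  hence "Xa \<otimes>\<^bsub>C\<^esub> Z \<ominus>\<^bsub>C\<^esub> \<one>\<^bsub>C\<^esub> = \<zero>\<^bsub>C\<^esub>" using Ext_nz by (simp add: a_minus_def E.r_neg)
  hence "Xa \<otimes>\<^bsub>C\<^esub> Z = \<one>\<^bsub>C\<^esub>" using c by simp
  hence "Z = inv\<^bsub>C\<^esub> Xa" using c by (metis C.inv_char C.m_comm)
  thus ?thesis using Z by simp
qed

lemma extended_graph: "hensel_graph F v C w \<iota> E B \<phi> Ext"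
proof (intro hensel_graph.intro hensel_graph_axioms.intro completed_field_axioms E.valring_axioms hensB)
  fix x y assume xy: "(x, y) \<in> Ext"
  show "x \<in> VO \<longleftrightarrow> y \<in> B"
    using Ext_transfer[OF xy] Ext_nz[OF xy] CV.A_zero E.A_zero by (cases "x = \<zero>\<^bsub>C\<^esub>") auto
qed (use Ext_carrier Ext_mult Ext_add Ext_minus Ext_inv Ext_nz G_one G_base G_Ext in auto)

end

lemma field_hom_inv:
  assumes "field R" "field S" "h \<in> ring_hom R S" "x \<in> carrier R" "x \<noteq> \<zero>\<^bsub>R\<^esub>"
  shows "h x \<noteq> \<zero>\<^bsub>S\<^esub>" "h (inv\<^bsub>R\<^esub> x) = inv\<^bsub>S\<^esub> (h x)"
proof -
  interpret R: field R by fact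
  interpret S: field S by fact
  interpret h: ring_hom_ring R S h by (intro ring_hom_ringI2 assms R.ring_axioms S.ring_axioms)
  have i: "inv\<^bsub>R\<^esub> x \<in> carrier R" "x \<otimes>\<^bsub>R\<^esub> inv\<^bsub>R\<^esub> x = \<one>\<^bsub>R\<^esub>" using R.field_Units assms by auto
  have e: "h x \<otimes>\<^bsub>S\<^esub> h (inv\<^bsub>R\<^esub> x) = \<one>\<^bsub>S\<^esub>" using h.hom_mult[OF assms(4) i(1)] i by simp
  show "h x \<noteq> \<zero>\<^bsub>S\<^esub>" using e assms i by force
  have "h (inv\<^bsub>R\<^esub> x) \<otimes>\<^bsub>S\<^esub> h x = \<one>\<^bsub>S\<^esub>" using e assms i by (simp add: S.m_comm)
  thus "h (inv\<^bsub>R\<^esub> x) = inv\<^bsub>S\<^esub> (h x)" using e assms i by (metis S.inv_char h.hom_closed)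
qed

section \<open>Operations of a subfield\<close>

context field
begin

lemma subfield_field: "subfield L R \<Longrightarrow> field (R\<lparr>carrier := L\<rparr>)"
  using subfield_iff(2) .

lemma restrict_a_inv:
  assumes "subfield L R" "x \<in> L" shows "\<ominus>\<^bsub>R\<lparr>carrier := L\<rparr>\<^esub> x = \<ominus> x"
proof -
  interpret L: field "R\<lparr>carrier := L\<rparr>" by (rule subfield_field[OF assms(1)])
  have "\<ominus> x \<in> L" "x \<in> carrier R"
    using subringE(5)[OF subfieldE(1)[OF assms(1)]] subfieldE(3)[OF assms(1)] assms by blast+
  thus ?thesis using L.minus_equality[of "\<ominus> x" x] assms by (simp add: l_neg)
qed

lemma restrict_minus:
  "subfield L R \<Longrightarrow> x \<in> L \<Longrightarrow> y \<in> L \<Longrightarrow> x \<ominus>\<^bsub>R\<lparr>carrier := L\<rparr>\<^esub> y = x \<ominus> y"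
  by (simp add: a_minus_def restrict_a_inv)

lemma restrict_inv:
  assumes "subfield L R" "x \<in> L" "x \<noteq> \<zero>" shows "inv\<^bsub>R\<lparr>carrier := L\<rparr>\<^esub> x = inv x"
proof -
  interpret L: field "R\<lparr>carrier := L\<rparr>" by (rule subfield_field[OF assms(1)])
  have i: "inv x \<in> L" "x \<in> carrier R" "x \<otimes> inv x = \<one>"
    using subfield_m_inv[OF assms(1), of x] assms subfieldE(3)[OF assms(1)] by blast+
  have "inv x \<otimes> x = \<one>" using i assms(3) field_Units by auto
  thus ?thesis using L.inv_char[of x "inv x"] i assms by simp
qed

lemma subring_restrict:
  assumes L: "subfield L R" and A: "subring A R" shows "subring (L \<inter> A) (R\<lparr>carrier := L\<rparr>)"
proof -
  interpret L: field "R\<lparr>carrier := L\<rparr>" by (rule subfield_field[OF L])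
  note l = subringE[OF subfieldE(1)[OF L]] and a = subringE[OF A]
  show ?thesis by (rule L.subringI) (auto simp: restrict_a_inv[OF L] l(2-) a(2-))
qed

end

section \<open>Henselian subfields of the completion\<close>

context completed_field
begin

interpretation CV: valring C "vge C w 0" by (rule C.valring)

text \<open>C already contains the roots that Hensel's lemma provides, so a subfield is henselian as
  soon as it contains those lying over its own approximate roots. In this form the property passes
  to intersections.\<close>

definition hensel_closed :: "'b set \<Rightarrow> bool" where
  "hensel_closed L \<longleftrightarrow> subfield L C \<and> \<iota> ` carrier F \<subseteq> L \<and>
     (\<forall>p a b. set p \<subseteq> L \<inter> vge C w 0 \<and> (p \<noteq> [] \<longrightarrow> hd p \<noteq> \<zero>\<^bsub>C\<^esub>) \<and> a \<in> L \<inter> vge C w 0 \<and>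
        C.eval (poly_deriv C p) a \<in> CV.UA \<and> b \<in> vge C w 0 \<and> C.eval p b = \<zero>\<^bsub>C\<^esub> \<and> b \<ominus>\<^bsub>C\<^esub> a \<in> CV.MA
        \<longrightarrow> b \<in> L)"

lemma hensel_closedD:
  assumes "hensel_closed L" "set p \<subseteq> L \<inter> vge C w 0" "p \<noteq> [] \<longrightarrow> hd p \<noteq> \<zero>\<^bsub>C\<^esub>" "a \<in> L \<inter> vge C w 0"
    "C.eval (poly_deriv C p) a \<in> CV.UA" "b \<in> vge C w 0" "C.eval p b = \<zero>\<^bsub>C\<^esub>" "b \<ominus>\<^bsub>C\<^esub> a \<in> CV.MA"
  shows "b \<in> L"
  using assms unfolding hensel_closed_def by blast

lemma hensel_root:
  assumes "set p \<subseteq> vge C w 0" "p \<noteq> [] \<longrightarrow> hd p \<noteq> \<zero>\<^bsub>C\<^esub>" "a \<in> vge C w 0"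
    "C.eval p a \<in> CV.MA" "C.eval (poly_deriv C p) a \<in> CV.UA"
  shows "\<exists>b\<in>vge C w 0. C.eval p b = \<zero>\<^bsub>C\<^esub> \<and> b \<ominus>\<^bsub>C\<^esub> a \<in> CV.MA"
proof -
  have "p \<in> carrier (univ_poly C (vge C w 0))" using assms by (simp add: univ_poly_carrier_iff)
  thus ?thesis using henselian_completion assms(3-5) unfolding henselian_def by blast
qed

lemma hensel_closed_Inter:
  assumes "\<And>L. L \<in> S \<Longrightarrow> hensel_closed L" "S \<noteq> {}" shows "hensel_closed (\<Inter>S)"
proof -
  have sf: "\<And>L. L \<in> S \<Longrightarrow> subfield L C" using assms(1) by (simp add: hensel_closed_def)
  have "subfield (\<Inter>S) C"
  proof (rule C.subfieldI')
    show "subring (\<Inter>S) C" using C.subring_Inter[of S] subfieldE(1)[OF sf] assms(2) by auto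
    fix k assume "k \<in> \<Inter>S - {\<zero>\<^bsub>C\<^esub>}"
    thus "inv\<^bsub>C\<^esub> k \<in> \<Inter>S" using C.subfield_m_inv(1)[OF sf] by auto
  qed
  moreover have "\<iota> ` carrier F \<subseteq> \<Inter>S" using assms(1) by (auto simp: hensel_closed_def)
  moreover have "b \<in> \<Inter>S" if "set p \<subseteq> \<Inter>S \<inter> vge C w 0" "p \<noteq> [] \<longrightarrow> hd p \<noteq> \<zero>\<^bsub>C\<^esub>" "a \<in> \<Inter>S \<inter> vge C w 0"
    "C.eval (poly_deriv C p) a \<in> CV.UA" "b \<in> vge C w 0" "C.eval p b = \<zero>\<^bsub>C\<^esub>" "b \<ominus>\<^bsub>C\<^esub> a \<in> CV.MA" for p a b
  proof
    fix L assume L: "L \<in> S"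
    show "b \<in> L" by (rule hensel_closedD[OF assms(1)[OF L] _ that(2) _ that(4-7)]) (use that L in auto)
  qed
  ultimately show ?thesis unfolding hensel_closed_def by blast
qed

lemma hensel_closed_carrier: "hensel_closed (carrier C)"
  unfolding hensel_closed_def using C.carrier_is_subfield emb_closed C.vge_carrier by blast

lemma hensel_closed_henselian:
  assumes L: "hensel_closed L" shows "henselian (C\<lparr>carrier := L\<rparr>) (L \<inter> vge C w 0)"
proof -
  have sf: "subfield L C" using L by (simp add: hensel_closed_def)
  have Lc: "x \<in> L \<Longrightarrow> x \<in> carrier C" for x using subfieldE(3)[OF sf] by auto
  note sr = subfieldE(1)[OF sf]
  interpret LF: field "C\<lparr>carrier := L\<rparr>" by (rule C.subfield_field[OF sf])
  have vr: "valuation_ring (C\<lparr>carrier := L\<rparr>) (L \<inter> vge C w 0)"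
    unfolding valuation_ring_def
  proof (intro conjI ballI LF.field_axioms C.subring_restrict[OF sf C.subring_vge])
    fix x assume "x \<in> carrier (C\<lparr>carrier := L\<rparr>) - {\<zero>\<^bsub>C\<lparr>carrier := L\<rparr>\<^esub>}"
    hence x: "x \<in> L" "x \<noteq> \<zero>\<^bsub>C\<^esub>" by auto
    show "x \<in> L \<inter> vge C w 0 \<or> inv\<^bsub>C\<lparr>carrier := L\<rparr>\<^esub> x \<in> L \<inter> vge C w 0"
      using CV.val[OF Lc[OF x(1)] x(2)] C.restrict_inv[OF sf x] C.subfield_m_inv(1)[OF sf, of x] x by auto
  qed
  have U: "subring_units (C\<lparr>carrier := L\<rparr>) (L \<inter> vge C w 0) = L \<inter> CV.UA"
  proof -
    have "x \<in> Units (C\<lparr>carrier := L \<inter> vge C w 0\<rparr>) \<longleftrightarrow> x \<in> L \<inter> CV.UA" for x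
      using C.subring_units_iff[OF C.subring_inter[OF sr C.subring_vge], of x] CV.U_iff[of x]
        C.subfield_m_inv(1)[OF sf, of x] by auto
    thus ?thesis by auto
  qed
  show ?thesis
    unfolding henselian_def
  proof (intro conjI ballI impI vr)
    fix p a assume p: "p \<in> carrier (univ_poly (C\<lparr>carrier := L\<rparr>) (L \<inter> vge C w 0))" and a: "a \<in> L \<inter> vge C w 0"
      and r: "ring.eval (C\<lparr>carrier := L\<rparr>) p a \<in> L \<inter> vge C w 0 - subring_units (C\<lparr>carrier := L\<rparr>) (L \<inter> vge C w 0) \<and>
        ring.eval (C\<lparr>carrier := L\<rparr>) (poly_deriv (C\<lparr>carrier := L\<rparr>) p) a
          \<in> subring_units (C\<lparr>carrier := L\<rparr>) (L \<inter> vge C w 0)"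
    have p': "set p \<subseteq> L \<inter> vge C w 0" "p \<noteq> [] \<longrightarrow> hd p \<noteq> \<zero>\<^bsub>C\<^esub>"
      using p by (auto simp: univ_poly_carrier_iff)
    have r': "C.eval p a \<in> CV.MA" "C.eval (poly_deriv C p) a \<in> CV.UA"
      using r unfolding U C.eval_consistent[OF sr] poly_deriv_consistent by auto
    obtain b where b: "b \<in> vge C w 0" "C.eval p b = \<zero>\<^bsub>C\<^esub>" "b \<ominus>\<^bsub>C\<^esub> a \<in> CV.MA"
      using hensel_root[of p a] p' a r' by blast
    have bL: "b \<in> L" by (rule hensel_closedD[OF L p' a r'(2) b])
    have "b \<ominus>\<^bsub>C\<^esub> a \<in> L" using subringE(5,7)[OF sr] bL a by (auto simp: a_minus_def)
    hence "b \<ominus>\<^bsub>C\<lparr>carrier := L\<rparr>\<^esub> a \<in> L \<inter> vge C w 0 - (L \<inter> CV.UA)"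
      using b(3) bL a C.restrict_minus[OF sf, of b a] by auto
    thus "\<exists>b\<in>L \<inter> vge C w 0. ring.eval (C\<lparr>carrier := L\<rparr>) p b = \<zero>\<^bsub>C\<lparr>carrier := L\<rparr>\<^esub> \<and>
        b \<ominus>\<^bsub>C\<lparr>carrier := L\<rparr>\<^esub> a \<in> L \<inter> vge C w 0 - subring_units (C\<lparr>carrier := L\<rparr>) (L \<inter> vge C w 0)"
      unfolding U C.eval_consistent[OF sr] using b bL by (intro bexI[of _ b]) auto
  qed
qed

lemma hom_graph:
  fixes E :: "'z ring"
  assumes L: "subfield L C" "\<iota> ` carrier F \<subseteq> L" and E: "henselian E B"
    and \<psi>: "\<psi> \<in> valued_hom (C\<lparr>carrier := L\<rparr>) (L \<inter> vge C w 0) E B" "\<And>x. x \<in> carrier F \<Longrightarrow> \<psi> (\<iota> x) = \<phi> x"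
  shows "hensel_graph F v C w \<iota> E B \<phi> {(x, \<psi> x) | x. x \<in> L}"
proof -
  have Ev: "valring E B" using E by (simp add: henselian_def valuation_ring_valring)
  interpret E: valring E B by (rule Ev)
  interpret LF: field "C\<lparr>carrier := L\<rparr>" by (rule C.subfield_field[OF L(1)])
  have h: "\<psi> \<in> ring_hom (C\<lparr>carrier := L\<rparr>) E" using \<psi>(1) by (simp add: valued_hom_def)
  interpret h: ring_hom_ring "C\<lparr>carrier := L\<rparr>" E \<psi>
    by (intro ring_hom_ringI2 h LF.ring_axioms E.ring_axioms)
  note l = subringE[OF subfieldE(1)[OF L(1)]]
  show ?thesis
  proof (intro hensel_graph.intro hensel_graph_axioms.intro completed_field_axioms Ev E)
    fix x y assume "(x, y) \<in> {(x, \<psi> x) | x. x \<in> L}"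
    hence x: "x \<in> L" "y = \<psi> x" by auto
    show "x \<in> carrier C \<and> y \<in> carrier E" using x l(1) h.hom_closed by auto
    have "\<psi> (\<ominus>\<^bsub>C\<^esub> x) = \<ominus>\<^bsub>E\<^esub> y" using x h.hom_a_inv[of x] C.restrict_a_inv[OF L(1)] by simp
    thus "(\<ominus>\<^bsub>C\<^esub> x, \<ominus>\<^bsub>E\<^esub> y) \<in> {(x, \<psi> x) | x. x \<in> L}" using x l(5) by auto
    show "x = \<zero>\<^bsub>C\<^esub> \<longleftrightarrow> y = \<zero>\<^bsub>E\<^esub>"
      using x h.hom_zero field_hom_inv(1)[OF LF.field_axioms E.field_axioms h] by auto
    show "x \<in> vge C w 0 \<longleftrightarrow> y \<in> B" using \<psi>(1) x by (auto simp: valued_hom_def)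
    show "(inv\<^bsub>C\<^esub> x, inv\<^bsub>E\<^esub> y) \<in> {(x, \<psi> x) | x. x \<in> L}" if nz: "x \<noteq> \<zero>\<^bsub>C\<^esub>"
      using x nz field_hom_inv(2)[OF LF.field_axioms E.field_axioms h, of x] C.restrict_inv[OF L(1) x(1) nz]
        C.subfield_m_inv(1)[OF L(1), of x] by force
    fix x' y' assume "(x', y') \<in> {(x, \<psi> x) | x. x \<in> L}"
    hence x': "x' \<in> L" "y' = \<psi> x'" by auto
    show "(x \<oplus>\<^bsub>C\<^esub> x', y \<oplus>\<^bsub>E\<^esub> y') \<in> {(x, \<psi> x) | x. x \<in> L}"
      "(x \<otimes>\<^bsub>C\<^esub> x', y \<otimes>\<^bsub>E\<^esub> y') \<in> {(x, \<psi> x) | x. x \<in> L}"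
      using x x' l h.hom_add[of x x'] h.hom_mult[of x x'] by force+
  next
    show "(\<one>\<^bsub>C\<^esub>, \<one>\<^bsub>E\<^esub>) \<in> {(x, \<psi> x) | x. x \<in> L}" using l(3) h.hom_one by force
    show "\<And>z. z \<in> carrier F \<Longrightarrow> (\<iota> z, \<phi> z) \<in> {(x, \<psi> x) | x. x \<in> L}" using \<psi>(2) L(2) by force
  qed
qed

text \<open>At a simple root b over the equaliser, both homomorphisms give roots of the same
  polynomial over E in the same residue class, and \<open>hensel_root_unique\<close> identifies
  them.\<close>

lemma hom_unique:
  fixes E :: "'z ring"
  assumes L: "hensel_closed L" and E: "henselian E B"
    and \<psi>: "\<psi> \<in> valued_hom (C\<lparr>carrier := L\<rparr>) (L \<inter> vge C w 0) E B" "\<And>x. x \<in> carrier F \<Longrightarrow> \<psi> (\<iota> x) = \<phi> x"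
    and \<psi>': "\<psi>' \<in> valued_hom (C\<lparr>carrier := L\<rparr>) (L \<inter> vge C w 0) E B" "\<And>x. x \<in> carrier F \<Longrightarrow> \<psi>' (\<iota> x) = \<phi> x"
  shows "hensel_closed {x \<in> L. \<psi> x = \<psi>' x}"
proof -
  have sf: "subfield L C" "\<iota> ` carrier F \<subseteq> L" using L by (simp_all add: hensel_closed_def)
  define G where "G = {(x, \<psi> x) | x. x \<in> L}"
  define G' where "G' = {(x, \<psi>' x) | x. x \<in> L}"
  interpret G: hensel_graph F v C w \<iota> E B \<phi> G unfolding G_def by (rule hom_graph[OF sf E \<psi>])
  interpret G': hensel_graph F v C w \<iota> E B \<phi> G' unfolding G'_def by (rule hom_graph[OF sf E \<psi>'])
  note l = subringE[OF subfieldE(1)[OF sf(1)]]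
  have GI: "(x, \<psi> x) \<in> G" "(x, \<psi>' x) \<in> G'" if "x \<in> L" for x using that by (auto simp: G_def G'_def)
  have GE: "(x, y) \<in> G \<Longrightarrow> y = \<psi> x" "(x, y) \<in> G' \<Longrightarrow> y = \<psi>' x" for x y by (auto simp: G_def G'_def)
  let ?L = "{x \<in> L. \<psi> x = \<psi>' x}"
  have sub: "subfield ?L C"
  proof (rule C.subfieldI'[OF C.subringI])
    show "?L \<subseteq> carrier C" using l(1) by auto
    show "\<one>\<^bsub>C\<^esub> \<in> ?L" using l(3) GE(1)[OF G.G_one] GE(2)[OF G'.G_one] by simp
    fix x assume x: "x \<in> ?L"
    show "\<ominus>\<^bsub>C\<^esub> x \<in> ?L"
      using x l(5)[of x] GE(1)[OF G.G_minus[OF GI(1)], of x] GE(2)[OF G'.G_minus[OF GI(2)], of x] by auto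
    fix y assume y: "y \<in> ?L"
    show "x \<oplus>\<^bsub>C\<^esub> y \<in> ?L" using x y l(7) GE(1)[OF G.G_add[OF GI(1) GI(1)]] GE(2)[OF G'.G_add[OF GI(2) GI(2)]]
      by (metis (mono_tags, lifting) mem_Collect_eq)
    show "x \<otimes>\<^bsub>C\<^esub> y \<in> ?L" using x y l(6) GE(1)[OF G.G_mult[OF GI(1) GI(1)]] GE(2)[OF G'.G_mult[OF GI(2) GI(2)]]
      by (metis (mono_tags, lifting) mem_Collect_eq)
  next
    fix x assume x: "x \<in> ?L - {\<zero>\<^bsub>C\<^esub>}"
    thus "inv\<^bsub>C\<^esub> x \<in> ?L"
      using C.subfield_m_inv(1)[OF sf(1), of x] GE(1)[OF G.G_inv[OF GI(1), of x]] GE(2)[OF G'.G_inv[OF GI(2), of x]]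
      by auto
  qed
  moreover have "\<iota> ` carrier F \<subseteq> ?L" using sf(2) \<psi>(2) \<psi>'(2) by auto
  moreover have "b \<in> ?L" if h: "set p \<subseteq> ?L \<inter> vge C w 0" "p \<noteq> [] \<longrightarrow> hd p \<noteq> \<zero>\<^bsub>C\<^esub>" "a \<in> ?L \<inter> vge C w 0"
    "C.eval (poly_deriv C p) a \<in> CV.UA" "b \<in> vge C w 0" "C.eval p b = \<zero>\<^bsub>C\<^esub>" "b \<ominus>\<^bsub>C\<^esub> a \<in> CV.MA" for p a b
  proof -
    have pO: "set p \<subseteq> L \<inter> vge C w 0" "a \<in> L \<inter> vge C w 0" using h by auto
    have bL: "b \<in> L" by (rule hensel_closedD[OF L pO(1) h(2) pO(2) h(4-7)])
    define g where "g = map (\<lambda>x. (x, \<psi> x)) p"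
    have gG: "set g \<subseteq> G" "set g \<subseteq> G'" using h(1) by (auto simp: g_def G_def G'_def)
    have gf: "map fst g = p" by (simp add: g_def map_idI)
    define p' where "p' = map snd g"
    have p'B: "set p' \<subseteq> B" using gG G.G_val h(1) by (fastforce simp: p'_def g_def G_def)
    note ev = GE(1)[OF G.G_eval[OF gG(1) GI(1)[OF bL]]] GE(2)[OF G'.G_eval[OF gG(2) GI(2)[OF bL]]]
    have z: "\<psi> \<zero>\<^bsub>C\<^esub> = \<zero>\<^bsub>E\<^esub>" "\<psi>' \<zero>\<^bsub>C\<^esub> = \<zero>\<^bsub>E\<^esub>" using GE(1)[OF G.G_zero] GE(2)[OF G'.G_zero] by simp_all
    have r: "G.E.eval p' (\<psi> b) = \<zero>\<^bsub>E\<^esub>" "G.E.eval p' (\<psi>' b) = \<zero>\<^bsub>E\<^esub>" using ev z h(6) gf by (simp_all add: p'_def)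
    have B: "\<psi> b \<in> B" "\<psi>' b \<in> B" using G.G_val[OF GI(1)[OF bL]] G'.G_val[OF GI(2)[OF bL]] h(5) by simp_all
    have aL: "a \<in> L" "\<psi> a = \<psi>' a" using h(3) by auto
    have m: "\<psi> b \<ominus>\<^bsub>E\<^esub> \<psi> a \<in> G.E.MA" "\<psi>' b \<ominus>\<^bsub>E\<^esub> \<psi> a \<in> G.E.MA"
      using G.G_max[OF G.G_diff[OF GI(1)[OF bL] GI(1)[OF aL(1)]]]
        G'.G_max[OF G'.G_diff[OF GI(2)[OF bL] GI(2)[OF aL(1)]]] h(7) aL(2) by simp_all
    have c: "\<psi> b \<in> carrier E" "\<psi>' b \<in> carrier E" "\<psi> a \<in> carrier E"
      using G.G_carrier[OF GI(1)[OF bL]] G'.G_carrier[OF GI(2)[OF bL]] G.G_carrier[OF GI(1)[OF aL(1)]] by simp_all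
    have "\<psi>' b \<ominus>\<^bsub>E\<^esub> \<psi> b = (\<psi>' b \<ominus>\<^bsub>E\<^esub> \<psi> a) \<oplus>\<^bsub>E\<^esub> \<ominus>\<^bsub>E\<^esub> (\<psi> b \<ominus>\<^bsub>E\<^esub> \<psi> a)" using c by algebra
    hence mm: "\<psi>' b \<ominus>\<^bsub>E\<^esub> \<psi> b \<in> G.E.MA" using G.E.M_add[OF m(2) G.E.M_minus[OF m(1)]] by simp
    have "C.eval (poly_deriv C p) b \<in> CV.UA"
      using CV.eval_M_congr[OF C.subring_poly_deriv[OF C.subring_vge] _ h(5) h(7)] h(1,3,4) by auto
    hence u: "G.E.eval (poly_deriv E p') (\<psi> b) \<in> G.E.UA"
      using G.G_unit[OF G.G_eval_deriv[OF gG(1) GI(1)[OF bL]]] gf by (simp add: p'_def)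
    show ?thesis using G.E.hensel_root_unique[OF p'B B r mm u] bL by simp
  qed
  ultimately show ?thesis unfolding hensel_closed_def by blast
qed

text \<open>Chains have upper bounds, as Zorn's lemma requires: every closure condition involves at
  most two pairs, and these lie in a common member of the chain.\<close>

lemma hensel_graph_Union:
  fixes E :: "'z ring"
  assumes E: "henselian E B" and ne: "\<C> \<noteq> {}" and ch: "subset.chain {G. hensel_graph F v C w \<iota> E B \<phi> G} \<C>"
  shows "hensel_graph F v C w \<iota> E B \<phi> (\<Union>\<C>)"
proof -
  have g: "\<And>G. G \<in> \<C> \<Longrightarrow> hensel_graph F v C w \<iota> E B \<phi> G" using ch by (auto simp: subset.chain_def)
  have two: "\<exists>G\<in>\<C>. a \<in> G \<and> b \<in> G" if "a \<in> \<Union>\<C>" "b \<in> \<Union>\<C>" for a b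
  proof -
    obtain G G' where G: "G \<in> \<C>" "a \<in> G" "G' \<in> \<C>" "b \<in> G'" using \<open>a \<in> \<Union>\<C>\<close> \<open>b \<in> \<Union>\<C>\<close> by blast
    have "G \<subseteq> G' \<or> G' \<subseteq> G" using subset_chain_def ch G by metis
    thus ?thesis using G by blast
  qed
  have Ev: "valring E B" using E by (simp add: henselian_def valuation_ring_valring)
  show ?thesis
  proof (intro hensel_graph.intro hensel_graph_axioms.intro completed_field_axioms Ev E)
    fix x y assume xy: "(x, y) \<in> \<Union>\<C>"
    then obtain G where G: "G \<in> \<C>" "(x, y) \<in> G" by blast
    interpret G: hensel_graph F v C w \<iota> E B \<phi> G by (rule g[OF G(1)])
    show "x \<in> carrier C \<and> y \<in> carrier E" by (rule G.G_carrier[OF G(2)])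
    show "(\<ominus>\<^bsub>C\<^esub> x, \<ominus>\<^bsub>E\<^esub> y) \<in> \<Union>\<C>" using G.G_minus[OF G(2)] G(1) by blast
    show "x = \<zero>\<^bsub>C\<^esub> \<longleftrightarrow> y = \<zero>\<^bsub>E\<^esub>" by (rule G.G_nz[OF G(2)])
    show "x \<in> vge C w 0 \<longleftrightarrow> y \<in> B" by (rule G.G_val[OF G(2)])
    show "(inv\<^bsub>C\<^esub> x, inv\<^bsub>E\<^esub> y) \<in> \<Union>\<C>" if "x \<noteq> \<zero>\<^bsub>C\<^esub>" using G.G_inv[OF G(2) that] G(1) by blast
    fix x' y' assume "(x', y') \<in> \<Union>\<C>"
    from two[OF xy this] obtain G' where G': "G' \<in> \<C>" "(x, y) \<in> G'" "(x', y') \<in> G'" by blast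
    interpret G': hensel_graph F v C w \<iota> E B \<phi> G' by (rule g[OF G'(1)])
    show "(x \<oplus>\<^bsub>C\<^esub> x', y \<oplus>\<^bsub>E\<^esub> y') \<in> \<Union>\<C>" using G'.G_add[OF G'(2,3)] G'(1) by blast
    show "(x \<otimes>\<^bsub>C\<^esub> x', y \<otimes>\<^bsub>E\<^esub> y') \<in> \<Union>\<C>" using G'.G_mult[OF G'(2,3)] G'(1) by blast
  next
    obtain G where G: "G \<in> \<C>" using ne by blast
    interpret G: hensel_graph F v C w \<iota> E B \<phi> G by (rule g[OF G])
    show "(\<one>\<^bsub>C\<^esub>, \<one>\<^bsub>E\<^esub>) \<in> \<Union>\<C>" using G.G_one G by blast
    show "\<And>z. z \<in> carrier F \<Longrightarrow> (\<iota> z, \<phi> z) \<in> \<Union>\<C>" using G.G_base G by blast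
  qed
qed

lemma base_graph:
  fixes E :: "'z ring"
  assumes E: "henselian E B" and \<phi>: "\<phi> \<in> valued_hom F (vge F v 0) E B"
  shows "hensel_graph F v C w \<iota> E B \<phi> {(\<iota> x, \<phi> x) | x. x \<in> carrier F}"
proof -
  have Ev: "valring E B" using E by (simp add: henselian_def valuation_ring_valring)
  interpret E: valring E B by (rule Ev)
  have h: "\<phi> \<in> ring_hom F E" using \<phi> by (simp add: valued_hom_def)
  interpret h: ring_hom_ring F E \<phi> by (intro ring_hom_ringI2 h ring_axioms E.ring_axioms)
  let ?G = "{(\<iota> x, \<phi> x) | x. x \<in> carrier F}"
  have I: "x \<in> carrier F \<Longrightarrow> a = \<iota> x \<Longrightarrow> b = \<phi> x \<Longrightarrow> (a, b) \<in> ?G" for x a b by auto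
  show ?thesis
  proof (intro hensel_graph.intro hensel_graph_axioms.intro completed_field_axioms Ev E)
    fix x y assume "(x, y) \<in> ?G"
    then obtain z where z: "z \<in> carrier F" "x = \<iota> z" "y = \<phi> z" by auto
    show "x \<in> carrier C \<and> y \<in> carrier E" using z emb_closed by auto
    show "(\<ominus>\<^bsub>C\<^esub> x, \<ominus>\<^bsub>E\<^esub> y) \<in> ?G" by (rule I[of "\<ominus> z"]) (use z in auto)
    show "x = \<zero>\<^bsub>C\<^esub> \<longleftrightarrow> y = \<zero>\<^bsub>E\<^esub>"
      using z w_emb[of z] field_hom_inv(1)[OF field_axioms E.field_axioms h, of z] by (cases "z = \<zero>") auto
    show "x \<in> vge C w 0 \<longleftrightarrow> y \<in> B" using \<phi> z emb_vge by (auto simp: valued_hom_def)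
    show "(inv\<^bsub>C\<^esub> x, inv\<^bsub>E\<^esub> y) \<in> ?G" if nz: "x \<noteq> \<zero>\<^bsub>C\<^esub>"
    proof (rule I[of "inv z"])
      have zn: "z \<noteq> \<zero>" using nz z by auto
      show "inv z \<in> carrier F" using inv_closed_nz[OF z(1) zn] by simp
      show "inv\<^bsub>C\<^esub> x = \<iota> (inv z)" using field_hom_inv(2)[OF field_axioms C.field_axioms hom z(1) zn] z by simp
      show "inv\<^bsub>E\<^esub> y = \<phi> (inv z)" using field_hom_inv(2)[OF field_axioms E.field_axioms h z(1) zn] z by simp
    qed
    fix x' y' assume "(x', y') \<in> ?G"
    then obtain z' where z': "z' \<in> carrier F" "x' = \<iota> z'" "y' = \<phi> z'" by auto
    show "(x \<oplus>\<^bsub>C\<^esub> x', y \<oplus>\<^bsub>E\<^esub> y') \<in> ?G" by (rule I[of "z \<oplus> z'"]) (use z z' in auto)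
    show "(x \<otimes>\<^bsub>C\<^esub> x', y \<otimes>\<^bsub>E\<^esub> y') \<in> ?G" by (rule I[of "z \<otimes> z'"]) (use z z' in auto)
  next
    show "(\<one>\<^bsub>C\<^esub>, \<one>\<^bsub>E\<^esub>) \<in> ?G" by (rule I[of \<one>]) auto
    show "\<And>z. z \<in> carrier F \<Longrightarrow> (\<iota> z, \<phi> z) \<in> ?G" by auto
  qed
qed

text \<open>A root missing from the domain of M would have a counterpart in the henselian ring of E,
  and \<open>hensel_step\<close> would extend M by this pair.\<close>

lemma maximal_graph_hensel_closed:
  assumes M: "hensel_graph F v C w \<iota> E B \<phi> M" "\<And>G. hensel_graph F v C w \<iota> E B \<phi> G \<Longrightarrow> M \<subseteq> G \<Longrightarrow> G = M"
  shows "hensel_closed (fst ` M)"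
proof -
  interpret M: hensel_graph F v C w \<iota> E B \<phi> M by (rule M(1))
  have "subfield (fst ` M) C"
  proof (rule C.subfieldI')
    show "subring (fst ` M) C" using M.Fst.img_is_subring[OF M.G_subring] .
    fix k assume "k \<in> fst ` M - {\<zero>\<^bsub>C\<^esub>}"
    then obtain y where "(k, y) \<in> M" "k \<noteq> \<zero>\<^bsub>C\<^esub>" by auto
    from M.G_inv[OF this] show "inv\<^bsub>C\<^esub> k \<in> fst ` M" by force
  qed
  moreover have "\<iota> ` carrier F \<subseteq> fst ` M" using M.G_base by force
  moreover have "b \<in> fst ` M" if h: "set p \<subseteq> fst ` M \<inter> vge C w 0" "p \<noteq> [] \<longrightarrow> hd p \<noteq> \<zero>\<^bsub>C\<^esub>" "a \<in> fst ` M \<inter> vge C w 0"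
    "C.eval (poly_deriv C p) a \<in> CV.UA" "b \<in> vge C w 0" "C.eval p b = \<zero>\<^bsub>C\<^esub>" "b \<ominus>\<^bsub>C\<^esub> a \<in> CV.MA" for p a b
  proof -
    obtain a' where a': "(a, a') \<in> M" using h(3) by auto
    define g where "g = map (\<lambda>x. (x, SOME y. (x, y) \<in> M)) p"
    have gG: "set g \<subseteq> M"
    proof
      fix z assume "z \<in> set g"
      then obtain x where x: "x \<in> set p" "z = (x, SOME y. (x, y) \<in> M)" by (auto simp: g_def)
      have "x \<in> fst ` M" using x h(1) by blast
      hence "\<exists>y. (x, y) \<in> M" by force
      thus "z \<in> M" using x someI_ex[of "\<lambda>y. (x, y) \<in> M"] by simp
    qed
    have gf: "map fst g = p" by (simp add: g_def map_idI)
    have Uz: "\<zero>\<^bsub>C\<^esub> \<notin> CV.UA" using CV.U_iff[of "\<zero>\<^bsub>C\<^esub>"] by blast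
    have pne: "p \<noteq> []"
    proof
      assume "p = []"
      hence "\<zero>\<^bsub>C\<^esub> \<in> CV.UA" using h(4) by (simp add: poly_deriv_single)
      thus False using Uz by simp
    qed
    hence gne: "g \<noteq> []" by (simp add: g_def)
    have hg: "fst (hd g) \<noteq> \<zero>\<^bsub>C\<^esub>" using h(2) pne by (simp add: g_def hd_map)
    have gB: "set (map snd g) \<subseteq> B" using gG h(1) gf M.G_val by fastforce
    have shd: "snd (hd g) \<noteq> \<zero>\<^bsub>E\<^esub>"
    proof -
      have "hd g \<in> M" using gG gne by (cases g) auto
      thus ?thesis using M.G_nz[of "fst (hd g)" "snd (hd g)"] hg by simp
    qed
    hence pp: "map snd g \<in> carrier (univ_poly E B)" using gB gne by (auto simp: univ_poly_carrier_iff hd_map)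
    have aO: "a \<in> vge C w 0" "a' \<in> B" using h(3) M.G_val[OF a'] by auto
    have pO: "set p \<subseteq> vge C w 0" using h(1) by auto
    have "C.eval p a \<notin> CV.UA"
    proof -
      have "C.eval p b \<notin> CV.UA" unfolding h(6) by (rule Uz)
      thus ?thesis using CV.eval_M_congr[OF pO aO(1) h(5,7)] by simp
    qed
    hence "C.eval p a \<in> CV.MA" using CV.eval_A[OF pO aO(1)] by simp
    hence ev: "M.E.eval (map snd g) a' \<in> M.E.MA" using M.G_max[OF M.G_eval[OF gG a']] gf by simp
    have du: "M.E.eval (poly_deriv E (map snd g)) a' \<in> M.E.UA"
      using M.G_unit[OF M.G_eval_deriv[OF gG a']] gf h(4) by simp
    obtain b' where b': "b' \<in> B" "M.E.eval (map snd g) b' = \<zero>\<^bsub>E\<^esub>" "b' \<ominus>\<^bsub>E\<^esub> a' \<in> M.E.MA"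
      using M.hensB pp aO(2) ev du unfolding henselian_def by blast
    interpret st: hensel_step F v C w \<iota> E B \<phi> M g a a' b b'
      by (unfold_locales) (use gG gf pO gne hg a' aO h b' in auto)
    have "st.Ext = M" by (rule M(2)[OF st.extended_graph st.G_Ext])
    thus ?thesis using st.root_Ext by force
  qed
  ultimately show ?thesis unfolding hensel_closed_def by blast
qed

text \<open>
  The henselisation is realised as the smallest henselian subfield of the completion. Homomorphisms out
  of it are unique because equalisers are henselian, and exist because a maximal partial embedding is
  defined on a henselian subfield.
\<close>

definition hensel_hull :: "'b set" where
  "hensel_hull = \<Inter>{L. hensel_closed L}"

lemma hensel_hull: "hensel_closed hensel_hull"
  unfolding hensel_hull_def by (rule hensel_closed_Inter) (use hensel_closed_carrier in auto)

lemma hensel_hull_hom_exists: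
  fixes E :: "'z ring"
  assumes E: "henselian E B" and \<phi>: "\<phi> \<in> valued_hom F (vge F v 0) E B"
  shows "\<exists>\<psi>. \<psi> \<in> valued_hom (C\<lparr>carrier := hensel_hull\<rparr>) (hensel_hull \<inter> vge C w 0) E B \<and>
    \<psi> \<in> extensional hensel_hull \<and> (\<forall>x\<in>carrier F. \<psi> (\<iota> x) = \<phi> x)"
proof -
  have "\<exists>M\<in>{G. hensel_graph F v C w \<iota> E B \<phi> G}. \<forall>X'\<in>{G. hensel_graph F v C w \<iota> E B \<phi> G}. M \<subseteq> X' \<longrightarrow> X' = M"
    by (rule subset_Zorn_nonempty) (use base_graph[OF assms] hensel_graph_Union[OF E] in auto)
  then obtain M where M: "hensel_graph F v C w \<iota> E B \<phi> M" "\<And>G. hensel_graph F v C w \<iota> E B \<phi> G \<Longrightarrow> M \<subseteq> G \<Longrightarrow> G = M"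
    by blast
  interpret M: hensel_graph F v C w \<iota> E B \<phi> M by (rule M(1))
  have HM: "hensel_hull \<subseteq> fst ` M"
    unfolding hensel_hull_def using maximal_graph_hensel_closed[OF M] by blast
  define \<psi> where "\<psi> = (\<lambda>x\<in>hensel_hull. SOME y. (x, y) \<in> M)"
  have \<psi>M: "(x, \<psi> x) \<in> M" if "x \<in> hensel_hull" for x
  proof -
    have "x \<in> fst ` M" using that HM by blast
    hence "\<exists>y. (x, y) \<in> M" by force
    thus ?thesis using someI_ex[of "\<lambda>y. (x, y) \<in> M"] that by (simp add: \<psi>_def)
  qed
  have uniq: "\<psi> x = y" if "x \<in> hensel_hull" "(x, y) \<in> M" for x y
  proof -
    note c = M.G_carrier[OF that(2)] M.G_carrier[OF \<psi>M[OF that(1)]]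
    have "(x \<ominus>\<^bsub>C\<^esub> x, \<psi> x \<ominus>\<^bsub>E\<^esub> y) \<in> M" by (rule M.G_diff[OF \<psi>M[OF that(1)] that(2)])
    from M.G_nz[OF this] c have "\<psi> x \<ominus>\<^bsub>E\<^esub> y = \<zero>\<^bsub>E\<^esub>" by (simp add: a_minus_def C.r_neg)
    thus ?thesis using c by simp
  qed
  have sf: "subfield hensel_hull C" "\<iota> ` carrier F \<subseteq> hensel_hull"
    using hensel_hull by (simp_all add: hensel_closed_def)
  note l = subringE[OF subfieldE(1)[OF sf(1)]]
  have "\<psi> \<in> ring_hom (C\<lparr>carrier := hensel_hull\<rparr>) E"
    by (rule ring_hom_memI)
      (use \<psi>M M.G_carrier l in \<open>auto intro!: uniq intro: M.G_add M.G_mult M.G_one\<close>)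
  moreover have "\<forall>x\<in>hensel_hull. \<psi> x \<in> B \<longleftrightarrow> x \<in> hensel_hull \<inter> vge C w 0" using M.G_val[OF \<psi>M] by auto
  moreover have "\<forall>x\<in>carrier F. \<psi> (\<iota> x) = \<phi> x" using uniq sf(2) M.G_base by auto
  moreover have "\<psi> \<in> extensional hensel_hull" by (simp add: \<psi>_def)
  ultimately show ?thesis by (intro exI[of _ \<psi>]) (auto simp: valued_hom_def)
qed

end

text \<open>\<open>Delta\<close> quantifies over all henselisations, so only existence turns
  membership into anisotropy over a concrete field.\<close>

theorem (in valued_field) henselisation_exists:
  "\<exists>(H :: (nat \<Rightarrow> 'a) ring) B \<iota>. henselisation F (val_ring F v) H B \<iota>"
proof -
  interpret CF: completed_field F v compl vcompl emb by (rule completion)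
  let ?L = "CF.hensel_hull"
  let ?H = "compl\<lparr>carrier := ?L\<rparr>"
  let ?B = "?L \<inter> vge compl vcompl 0"
  have sf: "subfield ?L compl" "emb ` carrier F \<subseteq> ?L"
    using CF.hensel_hull by (simp_all add: CF.hensel_closed_def)
  have "henselisation F (val_ring F v) ?H ?B emb"
    unfolding henselisation_def
  proof (intro conjI allI impI)
    show "henselian ?H ?B" by (rule CF.hensel_closed_henselian[OF CF.hensel_hull])
    have "emb \<in> ring_hom F ?H" using emb_hom sf(2) by (auto simp: ring_hom_def)
    moreover have "\<forall>x\<in>carrier F. emb x \<in> ?B \<longleftrightarrow> x \<in> vge F v 0" using CF.emb_vge sf(2) by auto
    ultimately show "emb \<in> valued_hom F (val_ring F v) ?H ?B" by (simp add: valued_hom_def val_ring_eq_vge)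
    fix E :: "(nat \<Rightarrow> 'a) ring" and D \<phi>
    assume "henselian E D \<and> \<phi> \<in> valued_hom F (val_ring F v) E D"
    hence E: "henselian E D" "\<phi> \<in> valued_hom F (vge F v 0) E D" by (auto simp: val_ring_eq_vge)
    obtain \<psi> where \<psi>: "\<psi> \<in> valued_hom ?H ?B E D" "\<psi> \<in> extensional ?L" "\<forall>x\<in>carrier F. \<psi> (emb x) = \<phi> x"
      using CF.hensel_hull_hom_exists[OF E] by blast
    show "\<exists>!\<psi>. \<psi> \<in> valued_hom ?H ?B E D \<and> \<psi> \<in> extensional (carrier ?H) \<and> (\<forall>x\<in>carrier F. \<psi> (emb x) = \<phi> x)"
    proof (rule ex1I[of _ \<psi>])
      fix \<psi>' assume \<psi>': "\<psi>' \<in> valued_hom ?H ?B E D \<and> \<psi>' \<in> extensional (carrier ?H) \<and> (\<forall>x\<in>carrier F. \<psi>' (emb x) = \<phi> x)"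
      have "CF.hensel_closed {x \<in> ?L. \<psi>' x = \<psi> x}"
        by (rule CF.hom_unique[OF CF.hensel_hull E(1)]) (use \<psi> \<psi>' in auto)
      hence "?L \<subseteq> {x \<in> ?L. \<psi>' x = \<psi> x}" unfolding CF.hensel_hull_def by blast
      thus "\<psi>' = \<psi>" using \<psi> \<psi>' by (intro extensionalityI[of \<psi>' ?L \<psi>]) auto
    qed (use \<psi> in auto)
  qed
  thus ?thesis by blast
qed

section \<open>Quadratic spaces\<close>

text \<open>Covers V over F as well as the coordinate spaces over henselisations and
  completions.\<close>

locale qspace = field F + V: module F V for F :: "('a, 'm) ring_scheme" (structure) and V :: "('a, 'v, 'n) module_scheme" (structure) +
  fixes q :: "'v \<Rightarrow> 'a"
  assumes q_closed [simp, intro]: "x \<in> carrier V \<Longrightarrow> q x \<in> carrier F"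
    and q_smult: "a \<in> carrier F \<Longrightarrow> x \<in> carrier V \<Longrightarrow> q (a \<odot>\<^bsub>V\<^esub> x) = a \<otimes> a \<otimes> q x"
    and polar_add_l: "\<lbrakk>x \<in> carrier V; y \<in> carrier V; z \<in> carrier V\<rbrakk> \<Longrightarrow>
       polar F V q (x \<oplus>\<^bsub>V\<^esub> y) z = polar F V q x z \<oplus> polar F V q y z"
    and polar_smult_l: "\<lbrakk>a \<in> carrier F; x \<in> carrier V; z \<in> carrier V\<rbrakk> \<Longrightarrow>
       polar F V q (a \<odot>\<^bsub>V\<^esub> x) z = a \<otimes> polar F V q x z"
begin

abbreviation bq where "bq \<equiv> polar F V q"

lemma polar_closed [simp, intro]: "x \<in> carrier V \<Longrightarrow> y \<in> carrier V \<Longrightarrow> bq x y \<in> carrier F"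
  by (simp add: polar_def)

lemma polar_sym: assumes "x \<in> carrier V" "y \<in> carrier V" shows "bq x y = bq y x"
proof -
  have c: "q (y \<oplus>\<^bsub>V\<^esub> x) \<in> carrier F" "q x \<in> carrier F" "q y \<in> carrier F" using assms by auto
  show ?thesis unfolding polar_def using assms c V.a_comm[OF assms] by (simp, algebra)
qed

lemma polar_add_r: "\<lbrakk>x \<in> carrier V; y \<in> carrier V; z \<in> carrier V\<rbrakk> \<Longrightarrow> bq z (x \<oplus>\<^bsub>V\<^esub> y) = bq z x \<oplus> bq z y"
  using polar_add_l polar_sym V.a_closed by metis

lemma polar_smult_r: "\<lbrakk>a \<in> carrier F; x \<in> carrier V; z \<in> carrier V\<rbrakk> \<Longrightarrow> bq z (a \<odot>\<^bsub>V\<^esub> x) = a \<otimes> bq z x"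
  using polar_smult_l polar_sym V.smult_closed by metis

lemma q_add: assumes "x \<in> carrier V" "y \<in> carrier V" shows "q (x \<oplus>\<^bsub>V\<^esub> y) = q x \<oplus> q y \<oplus> bq x y"
proof -
  have c: "q (x \<oplus>\<^bsub>V\<^esub> y) \<in> carrier F" "q x \<in> carrier F" "q y \<in> carrier F" using assms by auto
  show ?thesis unfolding polar_def using c by algebra
qed

lemma q_zero [simp]: "q \<zero>\<^bsub>V\<^esub> = \<zero>"
  using q_smult[of \<zero> "\<zero>\<^bsub>V\<^esub>"] by simp

lemma polar_zero_l [simp]: "x \<in> carrier V \<Longrightarrow> bq \<zero>\<^bsub>V\<^esub> x = \<zero>"
  using polar_smult_l[of \<zero> "\<zero>\<^bsub>V\<^esub>" x] by simp

lemma polar_zero_r [simp]: "x \<in> carrier V \<Longrightarrow> bq x \<zero>\<^bsub>V\<^esub> = \<zero>"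
  using polar_zero_l polar_sym by (metis V.zero_closed)

lemma polar_self: assumes "x \<in> carrier V" shows "bq x x = q x \<oplus> q x"
proof -
  have c: "q x \<in> carrier F" using assms by auto
  have "x \<oplus>\<^bsub>V\<^esub> x = (\<one> \<oplus> \<one>) \<odot>\<^bsub>V\<^esub> x" using assms by (simp add: V.smult_l_distr)
  hence "q (x \<oplus>\<^bsub>V\<^esub> x) = (\<one> \<oplus> \<one>) \<otimes> (\<one> \<oplus> \<one>) \<otimes> q x" using q_smult assms by simp
  moreover have "(\<one> \<oplus> \<one>) \<otimes> (\<one> \<oplus> \<one>) \<otimes> q x \<ominus> q x \<ominus> q x = q x \<oplus> q x" using c by algebra
  ultimately show ?thesis by (simp add: polar_def)
qed

lemma q_lin2: assumes "a \<in> carrier F" "b \<in> carrier F" "x \<in> carrier V" "y \<in> carrier V"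
  shows "q (a \<odot>\<^bsub>V\<^esub> x \<oplus>\<^bsub>V\<^esub> b \<odot>\<^bsub>V\<^esub> y) = a \<otimes> a \<otimes> q x \<oplus> b \<otimes> b \<otimes> q y \<oplus> a \<otimes> b \<otimes> bq x y"
proof -
  have "bq (a \<odot>\<^bsub>V\<^esub> x) (b \<odot>\<^bsub>V\<^esub> y) = a \<otimes> b \<otimes> bq x y"
    using assms by (simp add: polar_smult_l polar_smult_r m_assoc m_lcomm)
  thus ?thesis using assms by (simp add: q_add q_smult)
qed

definition comb2 where "comb2 a x b y = a \<odot>\<^bsub>V\<^esub> x \<oplus>\<^bsub>V\<^esub> b \<odot>\<^bsub>V\<^esub> y"

lemma comb2_closed [simp]: "\<lbrakk>a \<in> carrier F; b \<in> carrier F; x \<in> carrier V; y \<in> carrier V\<rbrakk> \<Longrightarrow> comb2 a x b y \<in> carrier V"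
  by (simp add: comb2_def)

lemma comb2_add: "\<lbrakk>a \<in> carrier F; b \<in> carrier F; c \<in> carrier F; d \<in> carrier F; x \<in> carrier V; y \<in> carrier V\<rbrakk> \<Longrightarrow>
    comb2 a x b y \<oplus>\<^bsub>V\<^esub> comb2 c x d y = comb2 (a \<oplus> c) x (b \<oplus> d) y"
  by (simp add: comb2_def V.smult_l_distr V.a_ac)

lemma comb2_smult: "\<lbrakk>a \<in> carrier F; b \<in> carrier F; c \<in> carrier F; x \<in> carrier V; y \<in> carrier V\<rbrakk> \<Longrightarrow>
    c \<odot>\<^bsub>V\<^esub> comb2 a x b y = comb2 (c \<otimes> a) x (c \<otimes> b) y"
  by (simp add: comb2_def V.smult_r_distr V.smult_assoc1)

text \<open>Three independent vectors are the form in which dimension at least 3 is handed to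
  coordinate spaces over other fields.\<close>

definition indep3 where
  "indep3 e0 e1 e2 \<longleftrightarrow> e0 \<in> carrier V \<and> e1 \<in> carrier V \<and> e2 \<in> carrier V \<and>
     (\<forall>a\<in>carrier F. \<forall>b\<in>carrier F. \<forall>c\<in>carrier F.
        a \<odot>\<^bsub>V\<^esub> e0 \<oplus>\<^bsub>V\<^esub> b \<odot>\<^bsub>V\<^esub> e1 \<oplus>\<^bsub>V\<^esub> c \<odot>\<^bsub>V\<^esub> e2 = \<zero>\<^bsub>V\<^esub> \<longrightarrow> a = \<zero> \<and> b = \<zero> \<and> c = \<zero>)"

lemma comb2_zero [simp]: "\<lbrakk>x \<in> carrier V; y \<in> carrier V\<rbrakk> \<Longrightarrow> comb2 \<zero> x \<zero> y = \<zero>\<^bsub>V\<^esub>"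
  by (simp add: comb2_def)

lemma indep3_not_in_plane:
  assumes e: "indep3 e0 e1 e2" and x: "x \<in> carrier V" and y: "y \<in> carrier V"
  shows "\<exists>e\<in>{e0, e1, e2}. \<forall>s\<in>carrier F. \<forall>r\<in>carrier F. e \<noteq> comb2 s x r y"
proof (rule ccontr)
  assume "\<not> ?thesis"
  then obtain s0 r0 s1 r1 s2 r2 where sr: "s0 \<in> carrier F" "r0 \<in> carrier F" "e0 = comb2 s0 x r0 y"
    "s1 \<in> carrier F" "r1 \<in> carrier F" "e1 = comb2 s1 x r1 y"
    "s2 \<in> carrier F" "r2 \<in> carrier F" "e2 = comb2 s2 x r2 y" by auto
  have rel: "a = \<zero> \<and> b = \<zero> \<and> c = \<zero>" if "a \<in> carrier F" "b \<in> carrier F" "c \<in> carrier F"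
    "a \<otimes> s0 \<oplus> b \<otimes> s1 \<oplus> c \<otimes> s2 = \<zero>" "a \<otimes> r0 \<oplus> b \<otimes> r1 \<oplus> c \<otimes> r2 = \<zero>" for a b c
  proof -
    have "a \<odot>\<^bsub>V\<^esub> e0 \<oplus>\<^bsub>V\<^esub> b \<odot>\<^bsub>V\<^esub> e1 \<oplus>\<^bsub>V\<^esub> c \<odot>\<^bsub>V\<^esub> e2 = \<zero>\<^bsub>V\<^esub>"
      using sr that x y by (simp add: comb2_smult comb2_add)
    thus ?thesis using e that unfolding indep3_def by blast
  qed
  \<comment> \<open>The cross product of the two coefficient vectors is a relation, so all 2 x 2
    minors vanish. This makes \<open>(r1, - r0, 0)\<close> a relation, whence r0 = r1 = 0, and then
    \<open>(s1, - s0, 0)\<close> is one, whence s0 = 0 and e0 = 0.\<close>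
  have k: "s0 \<otimes> r1 \<ominus> s1 \<otimes> r0 = \<zero>"
  proof -
    have "s1 \<otimes> r2 \<ominus> s2 \<otimes> r1 = \<zero> \<and> s2 \<otimes> r0 \<ominus> s0 \<otimes> r2 = \<zero> \<and> s0 \<otimes> r1 \<ominus> s1 \<otimes> r0 = \<zero>"
      by (rule rel) (use sr(1,2,4,5,7,8) in \<open>simp, simp, simp, algebra, algebra\<close>)
    thus ?thesis by simp
  qed
  have "r1 = \<zero> \<and> \<ominus> r0 = \<zero> \<and> \<zero> = \<zero>"
  proof (rule rel)
    have "r1 \<otimes> s0 \<oplus> \<ominus> r0 \<otimes> s1 \<oplus> \<zero> \<otimes> s2 = s0 \<otimes> r1 \<ominus> s1 \<otimes> r0" using sr(1,2,4,5,7,8) by algebra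
    thus "r1 \<otimes> s0 \<oplus> \<ominus> r0 \<otimes> s1 \<oplus> \<zero> \<otimes> s2 = \<zero>" using k by simp
    show "r1 \<otimes> r0 \<oplus> \<ominus> r0 \<otimes> r1 \<oplus> \<zero> \<otimes> r2 = \<zero>" using sr(1,2,4,5,7,8) by algebra
  qed (use sr in auto)
  hence r: "r0 = \<zero>" "r1 = \<zero>" using sr(2) by (auto simp: minus_eq minus_minus) 
  have "s1 = \<zero> \<and> \<ominus> s0 = \<zero> \<and> \<zero> = \<zero>"
    by (rule rel) (use sr(1,2,4,5,7,8) r in \<open>simp, simp, simp, algebra, simp\<close>)
  hence s: "s0 = \<zero>" using sr(1) by auto
  have "\<one> = \<zero> \<and> \<zero> = \<zero> \<and> \<zero> = \<zero>"
    by (rule rel) (use sr(1,2,4,5,7,8) r s in auto)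
  thus False by simp
qed

text \<open>Take y with b(x, y) = 1 and u orthogonal to x with q(u) nonzero. Adding a multiple of x
  to u changes b(u, y) but not q(u), and adding a multiple of x to y changes q(y) but not the
  pairing with u. So the pairing and the product of norms can be prescribed independently.\<close>

theorem isotropic_represents:
  assumes reg: "regular F V q" and e: "indep3 e0 e1 e2"
    and x: "x \<in> carrier V" "x \<noteq> \<zero>\<^bsub>V\<^esub>" "q x = \<zero>" and k: "k \<in> carrier F"
  shows "\<exists>y z. y \<in> carrier V \<and> z \<in> carrier V \<and> bq y z = \<one> \<and> q y \<otimes> q z = k"
proof -
  obtain y0 where y0: "y0 \<in> carrier V" "bq x y0 \<noteq> \<zero>" using reg x unfolding regular_def by blast
  have i: "inv (bq x y0) \<in> carrier F" "inv (bq x y0) \<otimes> bq x y0 = \<one>"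
    using field_Units y0 x(1) polar_closed by auto
  define y where "y = inv (bq x y0) \<odot>\<^bsub>V\<^esub> y0"
  have y: "y \<in> carrier V" "bq x y = \<one>" unfolding y_def using i y0 x by (simp_all add: polar_smult_r)
  have yx: "bq y x = \<one>" using polar_sym y x by metis
  have xx: "bq x x = \<zero>" using polar_self x by simp
  \<comment> \<open>Otherwise the orthogonal space of x is totally isotropic. By dimension 3 it
    contains a nonzero u that is also orthogonal to y, and such a u is orthogonal to all of V,
    against regularity.\<close>
  have "\<exists>u\<in>carrier V. bq x u = \<zero> \<and> q u \<noteq> \<zero>"
  proof (rule ccontr)
    assume "\<not> ?thesis"
    hence tot: "\<And>u. u \<in> carrier V \<Longrightarrow> bq x u = \<zero> \<Longrightarrow> q u = \<zero>" by blast
    obtain d where d: "d \<in> carrier V" "\<And>s r. s \<in> carrier F \<Longrightarrow> r \<in> carrier F \<Longrightarrow> d \<noteq> comb2 s x r y"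
      using indep3_not_in_plane[OF e x(1) y(1)] e unfolding indep3_def by blast
    define p where "p = bq x d"
    define r where "r = bq d y \<ominus> p \<otimes> bq y y"
    define u where "u = d \<oplus>\<^bsub>V\<^esub> (\<ominus> p \<odot>\<^bsub>V\<^esub> y \<oplus>\<^bsub>V\<^esub> \<ominus> r \<odot>\<^bsub>V\<^esub> x)"
    have c: "p \<in> carrier F" "r \<in> carrier F" "u \<in> carrier V" "bq y y \<in> carrier F" "bq d y \<in> carrier F"
      using d x y by (auto simp: p_def r_def u_def)
    have xu: "bq x u = \<zero>"
    proof -
      have "bq x u = p \<oplus> (\<ominus> p \<otimes> \<one> \<oplus> \<ominus> r \<otimes> \<zero>)"
        using d x y c by (simp add: u_def polar_add_r polar_smult_r xx p_def)
      thus ?thesis using c by (simp add: r_neg)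
    qed
    have "bq u y = bq d y \<oplus> (\<ominus> p \<otimes> bq y y \<oplus> \<ominus> r \<otimes> \<one>)"
      using d x y c by (simp add: u_def polar_add_l polar_smult_l)
    also have "\<dots> = \<zero>" unfolding r_def using c by algebra
    finally have uy: "bq u y = \<zero>" .
    have u0: "u \<noteq> \<zero>\<^bsub>V\<^esub>"
    proof
      assume z: "u = \<zero>\<^bsub>V\<^esub>"
      have cc: "comb2 r x p y \<oplus>\<^bsub>V\<^esub> (\<ominus> p \<odot>\<^bsub>V\<^esub> y \<oplus>\<^bsub>V\<^esub> \<ominus> r \<odot>\<^bsub>V\<^esub> x) = \<zero>\<^bsub>V\<^esub>"
      proof -
        have "\<ominus> p \<odot>\<^bsub>V\<^esub> y \<oplus>\<^bsub>V\<^esub> \<ominus> r \<odot>\<^bsub>V\<^esub> x = comb2 (\<ominus> r) x (\<ominus> p) y"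
          using c x y by (simp add: comb2_def V.a_comm)
        thus ?thesis using c x y by (simp add: comb2_add r_neg)
      qed
      hence "comb2 r x p y = d"
        using z c d x y unfolding u_def
        by (metis V.a_closed V.smult_closed V.add.r_cancel comb2_closed a_inv_closed)
      thus False using d(2)[OF c(2,1)] by simp
    qed
    have "q u = \<zero>" by (rule tot[OF c(3) xu])
    then obtain z where z: "z \<in> carrier V" "bq u z \<noteq> \<zero>" using reg c u0 unfolding regular_def by blast
    \<comment> \<open>z corrected along y so as to be orthogonal to x; as u is orthogonal to y, the
      pairing with u does not change.\<close>
    define t where "t = z \<oplus>\<^bsub>V\<^esub> \<ominus> bq x z \<odot>\<^bsub>V\<^esub> y"
    have xz: "bq x z \<in> carrier F" using x z by simp
    have t: "t \<in> carrier V" "bq x t = \<zero>" "bq u t = bq u z"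
      using z x y c xz uy by (simp_all add: t_def polar_add_r polar_smult_r r_neg)
    have "q (u \<oplus>\<^bsub>V\<^esub> t) = \<zero>" by (rule tot) (use t c xu x in \<open>simp_all add: polar_add_r\<close>)
    moreover have "q t = \<zero>" by (rule tot[OF t(1,2)])
    ultimately have "bq u t = \<zero>" using q_add[OF c(3) t(1)] \<open>q u = \<zero>\<close> polar_closed[OF c(3) t(1)] by simp
    thus False using t z by simp
  qed
  then obtain u where u: "u \<in> carrier V" "bq x u = \<zero>" "q u \<noteq> \<zero>" by blast
  have ux: "bq u x = \<zero>" using u x polar_sym by metis
  have iu: "inv (q u) \<in> carrier F" "q u \<otimes> inv (q u) = \<one>" using field_Units u by auto
  \<comment> \<open>\<mu> brings the pairing of u and y to 1, and \<alpha> brings q(y) to k /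
    q(u).\<close>
  define \<mu> where "\<mu> = \<one> \<ominus> bq u y"
  define \<alpha> where "\<alpha> = k \<otimes> inv (q u) \<ominus> q y"
  have c: "\<mu> \<in> carrier F" "\<alpha> \<in> carrier F" "bq u y \<in> carrier F" "q y \<in> carrier F" "q u \<in> carrier F"
    using u y iu k by (auto simp: \<mu>_def \<alpha>_def)
  define X' where "X' = u \<oplus>\<^bsub>V\<^esub> \<mu> \<odot>\<^bsub>V\<^esub> x"
  define Y' where "Y' = y \<oplus>\<^bsub>V\<^esub> \<alpha> \<odot>\<^bsub>V\<^esub> x"
  have XY: "X' \<in> carrier V" "Y' \<in> carrier V" using u y x c by (auto simp: X'_def Y'_def)
  have "bq X' x = \<zero>" using u x c ux xx by (simp add: X'_def polar_add_l polar_smult_l)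
  moreover have "bq X' y = bq u y \<oplus> \<mu> \<otimes> \<one>" using u x y c by (simp add: X'_def polar_add_l polar_smult_l)
  moreover have "bq u y \<oplus> \<mu> \<otimes> \<one> = \<one>" unfolding \<mu>_def using c by algebra
  ultimately have 1: "bq X' Y' = \<one>" using XY x y c by (simp add: Y'_def polar_add_r polar_smult_r)
  have 2: "q X' = q u" using u x c by (simp add: X'_def q_add q_smult polar_smult_r ux)
  have "q Y' = q y \<oplus> \<alpha>" using y x c by (simp add: Y'_def q_add q_smult polar_smult_r yx)
  also have "\<dots> = k \<otimes> inv (q u)" unfolding \<alpha>_def using c k iu(1) by algebra
  finally have "q X' \<otimes> q Y' = k \<otimes> (q u \<otimes> inv (q u))" using 2 c k iu(1) by (simp, algebra)
  hence "q X' \<otimes> q Y' = k" using iu k by simp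
  thus ?thesis using 1 XY by blast
qed

primrec vec :: "(nat \<Rightarrow> 'v) \<Rightarrow> (nat \<Rightarrow> 'a) \<Rightarrow> nat \<Rightarrow> 'v" where
  "vec e x 0 = \<zero>\<^bsub>V\<^esub>"
| "vec e x (Suc n) = vec e x n \<oplus>\<^bsub>V\<^esub> x n \<odot>\<^bsub>V\<^esub> e n"

lemma vec_closed: "(\<And>i. i < n \<Longrightarrow> e i \<in> carrier V) \<Longrightarrow> (\<And>i. i < n \<Longrightarrow> x i \<in> carrier F) \<Longrightarrow> vec e x n \<in> carrier V"
  by (induct n) auto

lemma vec_cong: "(\<And>i. i < n \<Longrightarrow> x i = y i) \<Longrightarrow> vec e x n = vec e y n"
  by (induct n) auto

lemma vec_add:
  assumes "\<And>i. i < n \<Longrightarrow> e i \<in> carrier V" "\<And>i. i < n \<Longrightarrow> x i \<in> carrier F" "\<And>i. i < n \<Longrightarrow> y i \<in> carrier F"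
  shows "vec e (\<lambda>i. x i \<oplus> y i) n = vec e x n \<oplus>\<^bsub>V\<^esub> vec e y n"
  using assms
proof (induct n)
  case (Suc n)
  have "vec e x n \<in> carrier V" "vec e y n \<in> carrier V" using Suc(2-4) by (auto intro!: vec_closed)
  thus ?case using Suc by (simp add: V.smult_l_distr V.a_ac)
qed simp

lemma vec_smult:
  assumes "\<And>i. i < n \<Longrightarrow> e i \<in> carrier V" "\<And>i. i < n \<Longrightarrow> x i \<in> carrier F" "c \<in> carrier F"
  shows "vec e (\<lambda>i. c \<otimes> x i) n = c \<odot>\<^bsub>V\<^esub> vec e x n"
  using assms
proof (induct n)
  case (Suc n)
  have "vec e x n \<in> carrier V" using Suc(2-4) by (auto intro!: vec_closed)
  thus ?case using Suc by (simp add: V.smult_r_distr V.smult_assoc1)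
qed simp

lemma polar_vec_l:
  assumes "\<And>i. i < n \<Longrightarrow> e i \<in> carrier V" "\<And>i. i < n \<Longrightarrow> x i \<in> carrier F" "z \<in> carrier V"
    and "\<And>i. i < n \<Longrightarrow> bq (e i) z = \<zero>"
  shows "bq (vec e x n) z = \<zero>"
  using assms
proof (induct n)
  case (Suc n)
  have "vec e x n \<in> carrier V" using Suc(2-4) by (auto intro!: vec_closed)
  thus ?case using Suc by (simp add: polar_add_l polar_smult_l)
qed simp

end

section \<open>Bounds for norms and pairings in terms of coordinates\<close>

locale valued_qspace = qspace F V q + valued_field F v
  for F :: "('a, 'm) ring_scheme" (structure) and V :: "('a, 'v, 'n) module_scheme" (structure) and q and v
begin

lemma polar_vec_vge:
  assumes "\<And>i. i < n \<Longrightarrow> e i \<in> carrier V" "\<And>i. i < n \<Longrightarrow> x i \<in> vge F v N" "z \<in> carrier V"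
    and "\<And>i. i < n \<Longrightarrow> bq (e i) z \<in> vge F v m"
  shows "bq (vec e x n) z \<in> vge F v (N + m)"
  using assms
proof (induct n)
  case (Suc n)
  have xc: "i < Suc n \<Longrightarrow> x i \<in> carrier F" for i using vge_carrier[OF Suc(3)] .
  have c: "vec e x n \<in> carrier V" "x n \<in> carrier F" using Suc(2) xc by (auto intro!: vec_closed)
  have "x n \<otimes> bq (e n) z \<in> vge F v (N + m)" using Suc by (intro vge_mult) auto
  thus ?case using Suc c by (simp add: polar_add_l polar_smult_l vge_add)
qed simp

lemma q_vec_vge:
  assumes "\<And>i. i < n \<Longrightarrow> e i \<in> carrier V" "\<And>i. i < n \<Longrightarrow> x i \<in> vge F v N"
    and "\<And>i j. i < n \<Longrightarrow> j < n \<Longrightarrow> bq (e i) (e j) \<in> vge F v m" "\<And>i. i < n \<Longrightarrow> q (e i) \<in> vge F v m"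
  shows "q (vec e x n) \<in> vge F v (N + N + m)"
  using assms
proof (induct n)
  case (Suc n)
  have xc: "i < Suc n \<Longrightarrow> x i \<in> carrier F" for i using vge_carrier[OF Suc(3)] .
  have c: "vec e x n \<in> carrier V" "x n \<in> carrier F" using Suc(2) xc by (auto intro!: vec_closed)
  have 1: "bq (vec e x n) (e n) \<in> vge F v (N + m)" using Suc(2-5) by (intro polar_vec_vge) auto
  have 2: "x n \<otimes> bq (vec e x n) (e n) \<in> vge F v (N + (N + m))" using Suc(3)[of n] by (intro vge_mult 1) auto
  have 3: "x n \<otimes> x n \<otimes> q (e n) \<in> vge F v (N + N + m)" using Suc by (intro vge_mult) auto
  have "q (vec e x (Suc n)) = q (vec e x n) \<oplus> x n \<otimes> x n \<otimes> q (e n) \<oplus> x n \<otimes> bq (vec e x n) (e n)"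
    using c Suc(2)[of n] by (simp add: q_add q_smult polar_smult_r)
  thus ?case using Suc 2 3 by (simp add: vge_add algebra_simps)
qed simp

end

lemma quadratic_form_qspace:
  assumes "quadratic_form F V q" shows "qspace F V q"
proof -
  have vs: "vectorspace F V" using assms by (simp add: quadratic_form_def)
  interpret VS: vectorspace F V by (rule vs)
  show ?thesis
    by unfold_locales (use assms in \<open>auto simp: quadratic_form_def numeral_2_eq_2 Pi_def\<close>)
qed

section \<open>Quadratic forms given by coefficients\<close>

definition cform :: "('a, 'm) ring_scheme \<Rightarrow> (nat \<Rightarrow> 'a) \<Rightarrow> (nat \<Rightarrow> nat \<Rightarrow> 'a) \<Rightarrow> nat \<Rightarrow> (nat \<Rightarrow> 'a) \<Rightarrow> 'a" where
  "cform L a B n x = (\<Oplus>\<^bsub>L\<^esub>i\<in>{..<n}. a i \<otimes>\<^bsub>L\<^esub> x i [^]\<^bsub>L\<^esub> (2::nat)) \<oplus>\<^bsub>L\<^esub>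
     (\<Oplus>\<^bsub>L\<^esub>p\<in>{(i, j). i < j \<and> j < n}. B (fst p) (snd p) \<otimes>\<^bsub>L\<^esub> (x (fst p) \<otimes>\<^bsub>L\<^esub> x (snd p)))"

lemma ext_form_cform:
  "ext_form F V q L \<phi> x = cform L (\<lambda>i. \<phi> (q (chosen_basis F V ! i)))
     (\<lambda>i j. \<phi> (polar F V q (chosen_basis F V ! i) (chosen_basis F V ! j))) (length (chosen_basis F V)) x"
  by (simp add: ext_form_def cform_def Let_def)

lemma pairs_Suc: "{(i, j). i < j \<and> j < Suc n} = {(i, j). i < j \<and> j < n} \<union> (\<lambda>i. (i, n)) ` {..<n}"
  by auto

lemma finite_pairs: "finite {(i::nat, j::nat). i < j \<and> j < n}"
  by (rule finite_subset[of _ "{..<n} \<times> {..<n}"]) auto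

context field
begin

text \<open>When \<open>B\<close> holds the pairings of basis vectors, this is the pairing of the
  k-th basis vector with a vector in the span of the first n.\<close>

definition clin where "clin B k n x = (\<Oplus>i\<in>{..<n}. B i k \<otimes> x i)" for B :: "nat \<Rightarrow> nat \<Rightarrow> 'a"

text \<open>The polar form of \<open>cform\<close> (see \<open>polar_cform\<close>), by recursion on
  the dimension. The doubled term comes from b(e, e) = 2 q(e).\<close>

primrec cpol :: "(nat \<Rightarrow> 'a) \<Rightarrow> (nat \<Rightarrow> nat \<Rightarrow> 'a) \<Rightarrow> nat \<Rightarrow> (nat \<Rightarrow> 'a) \<Rightarrow> (nat \<Rightarrow> 'a) \<Rightarrow> 'a" where
  "cpol a B 0 x y = \<zero>"
| "cpol a B (Suc n) x y = cpol a B n x y \<oplus> (a n \<otimes> (x n \<otimes> y n) \<oplus> a n \<otimes> (x n \<otimes> y n) \<oplus>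
     (x n \<otimes> clin B n n y \<oplus> y n \<otimes> clin B n n x))"

lemma finsum_lessThan_Suc:
  assumes "\<And>i. i < Suc n \<Longrightarrow> f i \<in> carrier R"
  shows "finsum R f {..<Suc n} = finsum R f {..<n} \<oplus> f n"
  using assms by (simp add: lessThan_Suc Pi_def finsum_insert a_comm)

lemma clin_closed: "(\<And>i. i < n \<Longrightarrow> B i k \<in> carrier R) \<Longrightarrow> (\<And>i. i < n \<Longrightarrow> x i \<in> carrier R) \<Longrightarrow> clin B k n x \<in> carrier R"
  unfolding clin_def by (intro finsum_closed) auto

lemma clin_lin:
  assumes "\<And>i. i < n \<Longrightarrow> B i k \<in> carrier R" "\<And>i. i < n \<Longrightarrow> x i \<in> carrier R" "\<And>i. i < n \<Longrightarrow> y i \<in> carrier R"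
    and "c \<in> carrier R"
  shows "clin B k n (\<lambda>i. c \<otimes> x i \<oplus> y i) = c \<otimes> clin B k n x \<oplus> clin B k n y"
  using assms(1-3)
proof (induct n)
  case (Suc n)
  have c: "clin B k n x \<in> carrier R" "clin B k n y \<in> carrier R" "B n k \<in> carrier R" "x n \<in> carrier R" "y n \<in> carrier R"
    using Suc(2-4) by (auto intro!: clin_closed)
  have IH: "clin B k n (\<lambda>i. c \<otimes> x i \<oplus> y i) = c \<otimes> clin B k n x \<oplus> clin B k n y" using Suc by auto
  have u: "clin B k (Suc n) z = clin B k n z \<oplus> B n k \<otimes> z n" if "\<And>i. i < Suc n \<Longrightarrow> z i \<in> carrier R" for z
    unfolding clin_def using Suc(2) that by (intro finsum_lessThan_Suc) auto
  have "clin B k (Suc n) (\<lambda>i. c \<otimes> x i \<oplus> y i) = (c \<otimes> clin B k n x \<oplus> clin B k n y) \<oplus> B n k \<otimes> (c \<otimes> x n \<oplus> y n)"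
    using u[of "\<lambda>i. c \<otimes> x i \<oplus> y i"] IH Suc(2-4) assms(4) by simp
  also have "\<dots> = c \<otimes> (clin B k n x \<oplus> B n k \<otimes> x n) \<oplus> (clin B k n y \<oplus> B n k \<otimes> y n)"
    using c assms(4) by algebra
  finally show ?case using u[of x] u[of y] Suc(3,4) by simp
qed (simp add: clin_def assms(4))

lemma cform_Suc:
  assumes "\<And>i. i < Suc n \<Longrightarrow> a i \<in> carrier R" "\<And>i j. i < Suc n \<Longrightarrow> j < Suc n \<Longrightarrow> B i j \<in> carrier R"
    "\<And>i. i < Suc n \<Longrightarrow> x i \<in> carrier R"
  shows "cform R a B (Suc n) x = cform R a B n x \<oplus> (a n \<otimes> (x n \<otimes> x n) \<oplus> x n \<otimes> clin B n n x)"
proof -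
  let ?f = "\<lambda>p. B (fst p) (snd p) \<otimes> (x (fst p) \<otimes> x (snd p))"
  let ?P = "{(i, j). i < j \<and> j < n}"
  have A: "(\<Oplus>i\<in>{..<Suc n}. a i \<otimes> x i [^] (2::nat)) = (\<Oplus>i\<in>{..<n}. a i \<otimes> x i [^] (2::nat)) \<oplus> a n \<otimes> (x n \<otimes> x n)"
    using assms by (subst finsum_lessThan_Suc) (auto simp: numeral_2_eq_2)
  have "finsum R ?f {(i, j). i < j \<and> j < Suc n} = finsum R ?f ?P \<oplus> finsum R ?f ((\<lambda>i. (i, n)) ` {..<n})"
    unfolding pairs_Suc using assms by (intro finsum_Un_disjoint finite_pairs) auto
  also have "finsum R ?f ((\<lambda>i. (i, n)) ` {..<n}) = (\<Oplus>i\<in>{..<n}. B i n \<otimes> (x i \<otimes> x n))"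
    using assms by (subst finsum_reindex) (auto simp: inj_on_def)
  also have "\<dots> = (\<Oplus>i\<in>{..<n}. x n \<otimes> (B i n \<otimes> x i))"
    by (rule finsum_cong') (use assms in \<open>auto simp: m_ac\<close>)
  also have "\<dots> = x n \<otimes> clin B n n x"
    unfolding clin_def using assms by (subst finsum_rdistr) auto
  finally have Bs: "finsum R ?f {(i, j). i < j \<and> j < Suc n} = finsum R ?f ?P \<oplus> x n \<otimes> clin B n n x" .
  have c: "finsum R ?f ?P \<in> carrier R" "(\<Oplus>i\<in>{..<n}. a i \<otimes> x i [^] (2::nat)) \<in> carrier R" 
    using assms by (auto intro!: finsum_closed)
  have d: "clin B n n x \<in> carrier R" "x n \<in> carrier R" "a n \<in> carrier R" using assms by (auto intro!: clin_closed)
  have *: "(r \<oplus> s) \<oplus> (t \<oplus> u) = (r \<oplus> t) \<oplus> (s \<oplus> u)"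
    if "r \<in> carrier R" "s \<in> carrier R" "t \<in> carrier R" "u \<in> carrier R" for r s t u
    using that by algebra
  show ?thesis unfolding cform_def A Bs by (rule *) (use c d in auto)
qed

lemma cform_closed:
  assumes "\<And>i. i < n \<Longrightarrow> a i \<in> carrier R" "\<And>i j. i < n \<Longrightarrow> j < n \<Longrightarrow> B i j \<in> carrier R"
    "\<And>i. i < n \<Longrightarrow> x i \<in> carrier R"
  shows "cform R a B n x \<in> carrier R"
  using assms unfolding cform_def by (intro a_closed finsum_closed) auto

lemma cform_zero [simp]: "cform R a B 0 x = \<zero>"
  by (simp add: cform_def)

lemma cform_cong: "(\<And>i. i < n \<Longrightarrow> x i = y i) \<Longrightarrow> (\<And>i. i < n \<Longrightarrow> a i \<in> carrier R) \<Longrightarrow>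
    (\<And>i j. i < n \<Longrightarrow> j < n \<Longrightarrow> B i j \<in> carrier R) \<Longrightarrow> (\<And>i. i < n \<Longrightarrow> y i \<in> carrier R) \<Longrightarrow>
    cform R a B n x = cform R a B n y"
  unfolding cform_def by (intro arg_cong2[where f = "(\<oplus>)"] finsum_cong') auto

lemma cpol_step_identity:
  assumes "A \<in> carrier R" "c \<in> carrier R" "x \<in> carrier R" "y \<in> carrier R" "z \<in> carrier R"
    "u \<in> carrier R" "l \<in> carrier R" "m \<in> carrier R" "p \<in> carrier R" "s \<in> carrier R"
  shows "(c \<otimes> p \<oplus> s) \<oplus> (A \<otimes> ((c \<otimes> x \<oplus> y) \<otimes> z) \<oplus> A \<otimes> ((c \<otimes> x \<oplus> y) \<otimes> z) \<oplus> ((c \<otimes> x \<oplus> y) \<otimes> u \<oplus> z \<otimes> (c \<otimes> l \<oplus> m))) =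
    c \<otimes> (p \<oplus> (A \<otimes> (x \<otimes> z) \<oplus> A \<otimes> (x \<otimes> z) \<oplus> (x \<otimes> u \<oplus> z \<otimes> l))) \<oplus>
    (s \<oplus> (A \<otimes> (y \<otimes> z) \<oplus> A \<otimes> (y \<otimes> z) \<oplus> (y \<otimes> u \<oplus> z \<otimes> m)))"
proof -
  have 1: "A \<otimes> ((c \<otimes> x \<oplus> y) \<otimes> z) = c \<otimes> (A \<otimes> (x \<otimes> z)) \<oplus> A \<otimes> (y \<otimes> z)" using assms by algebra
  have 2: "(c \<otimes> x \<oplus> y) \<otimes> u \<oplus> z \<otimes> (c \<otimes> l \<oplus> m) = c \<otimes> (x \<otimes> u \<oplus> z \<otimes> l) \<oplus> (y \<otimes> u \<oplus> z \<otimes> m)"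
    using assms by algebra
  have 3: "(c \<otimes> p \<oplus> s) \<oplus> ((c \<otimes> d \<oplus> e) \<oplus> (c \<otimes> d \<oplus> e) \<oplus> (c \<otimes> f \<oplus> g)) =
    c \<otimes> (p \<oplus> (d \<oplus> d \<oplus> f)) \<oplus> (s \<oplus> (e \<oplus> e \<oplus> g))"
    if "d \<in> carrier R" "e \<in> carrier R" "f \<in> carrier R" "g \<in> carrier R" for d e f g
    using that assms(2,9,10) by algebra
  show ?thesis unfolding 1 2 by (rule 3) (use assms in auto)
qed

lemma cform_step_identity:
  assumes "A \<in> carrier R" "c \<in> carrier R" "x \<in> carrier R" "y \<in> carrier R"
    "u \<in> carrier R" "w \<in> carrier R" "p \<in> carrier R" "r \<in> carrier R" "s \<in> carrier R"
  shows "(c \<otimes> c \<otimes> p \<oplus> r \<oplus> c \<otimes> s) \<oplus> (A \<otimes> ((c \<otimes> x \<oplus> y) \<otimes> (c \<otimes> x \<oplus> y)) \<oplus> (c \<otimes> x \<oplus> y) \<otimes> (c \<otimes> u \<oplus> w)) =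
    c \<otimes> c \<otimes> (p \<oplus> (A \<otimes> (x \<otimes> x) \<oplus> x \<otimes> u)) \<oplus> (r \<oplus> (A \<otimes> (y \<otimes> y) \<oplus> y \<otimes> w)) \<oplus>
    c \<otimes> (s \<oplus> (A \<otimes> (x \<otimes> y) \<oplus> A \<otimes> (x \<otimes> y) \<oplus> (x \<otimes> w \<oplus> y \<otimes> u)))"
proof -
  have 1: "A \<otimes> ((c \<otimes> x \<oplus> y) \<otimes> (c \<otimes> x \<oplus> y)) =
    c \<otimes> c \<otimes> (A \<otimes> (x \<otimes> x)) \<oplus> A \<otimes> (y \<otimes> y) \<oplus> c \<otimes> (A \<otimes> (x \<otimes> y) \<oplus> A \<otimes> (x \<otimes> y))" using assms by algebra
  have 2: "(c \<otimes> x \<oplus> y) \<otimes> (c \<otimes> u \<oplus> w) = c \<otimes> c \<otimes> (x \<otimes> u) \<oplus> y \<otimes> w \<oplus> c \<otimes> (x \<otimes> w \<oplus> y \<otimes> u)"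
    using assms by algebra
  have 3: "(k \<otimes> p \<oplus> r \<oplus> c \<otimes> s) \<oplus> ((k \<otimes> d \<oplus> e \<oplus> c \<otimes> f) \<oplus> (k \<otimes> d' \<oplus> e' \<oplus> c \<otimes> f')) =
    k \<otimes> (p \<oplus> (d \<oplus> d')) \<oplus> (r \<oplus> (e \<oplus> e')) \<oplus> c \<otimes> (s \<oplus> (f \<oplus> f'))"
    if "k \<in> carrier R" "d \<in> carrier R" "e \<in> carrier R" "f \<in> carrier R" "d' \<in> carrier R" "e' \<in> carrier R" "f' \<in> carrier R"
    for k d e f d' e' f'
    using that assms(2,7,8,9) by algebra
  show ?thesis unfolding 1 2 by (rule 3) (use assms in auto)
qed

text \<open>Vectors c x + y treat additivity and homogeneity together. All claims go through one
  induction, since the expansion of \<open>cform\<close> involves \<open>cpol\<close>.\<close>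

lemma cpol_props:
  assumes "\<And>i. i < n \<Longrightarrow> a i \<in> carrier R" "\<And>i j. i < n \<Longrightarrow> j < n \<Longrightarrow> B i j \<in> carrier R"
    "\<And>i. i < n \<Longrightarrow> x i \<in> carrier R" "\<And>i. i < n \<Longrightarrow> y i \<in> carrier R" "\<And>i. i < n \<Longrightarrow> z i \<in> carrier R" "c \<in> carrier R"
  shows "cpol a B n x y \<in> carrier R"
    and "cpol a B n (\<lambda>i. c \<otimes> x i \<oplus> y i) z = c \<otimes> cpol a B n x z \<oplus> cpol a B n y z"
    and "cform R a B n (\<lambda>i. c \<otimes> x i \<oplus> y i) = c \<otimes> c \<otimes> cform R a B n x \<oplus> cform R a B n y \<oplus> c \<otimes> cpol a B n x y"
proof -
  have "cpol a B n x y \<in> carrier R \<and> cpol a B n x z \<in> carrier R \<and> cpol a B n y z \<in> carrier R \<and>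
    cpol a B n (\<lambda>i. c \<otimes> x i \<oplus> y i) z = c \<otimes> cpol a B n x z \<oplus> cpol a B n y z \<and>
    cform R a B n (\<lambda>i. c \<otimes> x i \<oplus> y i) = c \<otimes> c \<otimes> cform R a B n x \<oplus> cform R a B n y \<oplus> c \<otimes> cpol a B n x y"
    using assms(1-5)
  proof (induct n)
    case (Suc n)
    note S = Suc(2-6)
    have IH: "cpol a B n x y \<in> carrier R" "cpol a B n x z \<in> carrier R" "cpol a B n y z \<in> carrier R"
      "cpol a B n (\<lambda>i. c \<otimes> x i \<oplus> y i) z = c \<otimes> cpol a B n x z \<oplus> cpol a B n y z"
      "cform R a B n (\<lambda>i. c \<otimes> x i \<oplus> y i) = c \<otimes> c \<otimes> cform R a B n x \<oplus> cform R a B n y \<oplus> c \<otimes> cpol a B n x y"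
      using Suc by auto
    have l: "clin B n n x \<in> carrier R" "clin B n n y \<in> carrier R" "clin B n n z \<in> carrier R"
      "a n \<in> carrier R" "x n \<in> carrier R" "y n \<in> carrier R" "z n \<in> carrier R"
      using S by (auto intro!: clin_closed)
    have ll: "clin B n n (\<lambda>i. c \<otimes> x i \<oplus> y i) = c \<otimes> clin B n n x \<oplus> clin B n n y"
      by (rule clin_lin) (use S assms(6) in auto)
    have cf: "cform R a B n x \<in> carrier R" "cform R a B n y \<in> carrier R"
      by (rule cform_closed, use S in auto)+
    note cc = assms(6)
    have E1: "cpol a B (Suc n) (\<lambda>i. c \<otimes> x i \<oplus> y i) z = c \<otimes> cpol a B (Suc n) x z \<oplus> cpol a B (Suc n) y z"
      unfolding cpol.simps IH ll by (rule cpol_step_identity) (use l IH(1-3) cc in auto)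
    have E2: "cform R a B (Suc n) (\<lambda>i. c \<otimes> x i \<oplus> y i) = c \<otimes> c \<otimes> cform R a B (Suc n) x \<oplus> cform R a B (Suc n) y \<oplus> c \<otimes> cpol a B (Suc n) x y"
    proof -
      define p where "p = cform R a B n x"
      define r where "r = cform R a B n y"
      define s where "s = cpol a B n x y"
      define u where "u = clin B n n x"
      define w where "w = clin B n n y"
      have k: "p \<in> carrier R" "r \<in> carrier R" "s \<in> carrier R" "u \<in> carrier R" "w \<in> carrier R"
        using cf IH l by (auto simp: p_def r_def s_def u_def w_def)
      have "cform R a B (Suc n) (\<lambda>i. c \<otimes> x i \<oplus> y i) = (c \<otimes> c \<otimes> p \<oplus> r \<oplus> c \<otimes> s) \<oplus>
          (a n \<otimes> ((c \<otimes> x n \<oplus> y n) \<otimes> (c \<otimes> x n \<oplus> y n)) \<oplus> (c \<otimes> x n \<oplus> y n) \<otimes> (c \<otimes> u \<oplus> w))"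
        using S cc by (subst cform_Suc) (auto simp: IH ll p_def r_def s_def u_def w_def)
      also have "\<dots> = c \<otimes> c \<otimes> (p \<oplus> (a n \<otimes> (x n \<otimes> x n) \<oplus> x n \<otimes> u)) \<oplus> (r \<oplus> (a n \<otimes> (y n \<otimes> y n) \<oplus> y n \<otimes> w)) \<oplus>
          c \<otimes> (s \<oplus> (a n \<otimes> (x n \<otimes> y n) \<oplus> a n \<otimes> (x n \<otimes> y n) \<oplus> (x n \<otimes> w \<oplus> y n \<otimes> u)))"
        by (rule cform_step_identity) (use k l(4-7) cc in auto)
      finally show ?thesis using cform_Suc[of n a B x] cform_Suc[of n a B y] S
        by (simp add: p_def r_def s_def u_def w_def)
    qed
    show ?case using E1 E2 IH l by simp
  qed (simp add: assms(6))
  thus "cpol a B n x y \<in> carrier R"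
    "cpol a B n (\<lambda>i. c \<otimes> x i \<oplus> y i) z = c \<otimes> cpol a B n x z \<oplus> cpol a B n y z"
    "cform R a B n (\<lambda>i. c \<otimes> x i \<oplus> y i) = c \<otimes> c \<otimes> cform R a B n x \<oplus> cform R a B n y \<oplus> c \<otimes> cpol a B n x y"
    by auto
qed

lemma cpol_cong: "(\<And>i. i < n \<Longrightarrow> x i = x' i) \<Longrightarrow> (\<And>i. i < n \<Longrightarrow> y i = y' i) \<Longrightarrow> 
   (\<And>i. i < n \<Longrightarrow> x' i \<in> carrier R) \<Longrightarrow> (\<And>i. i < n \<Longrightarrow> y' i \<in> carrier R) \<Longrightarrow> 
   (\<And>i j. i < n \<Longrightarrow> j < n \<Longrightarrow> B i j \<in> carrier R) \<Longrightarrow> cpol a B n x y = cpol a B n x' y'"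
proof (induct n)
  case (Suc n)
  have "clin B n n x = clin B n n x'" "clin B n n y = clin B n n y'"
    unfolding clin_def by (rule finsum_cong', use Suc in auto)+
  thus ?case using Suc by simp
qed simp

lemma func_space_simps:
  "carrier (func_space S) = S \<rightarrow>\<^sub>E carrier R" "\<zero>\<^bsub>func_space S\<^esub> = (\<lambda>i\<in>S. \<zero>)"
  "x \<oplus>\<^bsub>func_space S\<^esub> y = (\<lambda>i\<in>S. x i \<oplus> y i)" "c \<odot>\<^bsub>func_space S\<^esub> x = (\<lambda>i\<in>S. c \<otimes> x i)"
  by (simp_all add: func_space_def)

lemma
  assumes "\<And>i. i < n \<Longrightarrow> a i \<in> carrier R" "\<And>i j. i < n \<Longrightarrow> j < n \<Longrightarrow> B i j \<in> carrier R"
  shows cform_qspace: "qspace R (func_space {..<n}) (cform R a B n)"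
    and polar_cform: "x \<in> carrier (func_space {..<n}) \<Longrightarrow> y \<in> carrier (func_space {..<n}) \<Longrightarrow>
      polar R (func_space {..<n}) (cform R a B n) x y = cpol a B n x y"
proof -
  let ?V = "func_space {..<n}"
  have cx: "x i \<in> carrier R" if "x \<in> carrier ?V" "i < n" for x i using that by (auto simp: func_space_simps)
  have pol: "polar R ?V (cform R a B n) x y = cpol a B n x y" if xy: "x \<in> carrier ?V" "y \<in> carrier ?V" for x y
  proof -
    note c = cx[OF xy(1)] cx[OF xy(2)]
    have "cform R a B n (x \<oplus>\<^bsub>?V\<^esub> y) = cform R a B n (\<lambda>i. \<one> \<otimes> x i \<oplus> y i)"
      by (rule cform_cong) (use c assms in \<open>auto simp: func_space_simps\<close>)
    also have "\<dots> = \<one> \<otimes> \<one> \<otimes> cform R a B n x \<oplus> cform R a B n y \<oplus> \<one> \<otimes> cpol a B n x y"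
      by (rule cpol_props(3)) (use c assms in auto)
    finally have e: "cform R a B n (x \<oplus>\<^bsub>?V\<^esub> y) = cform R a B n x \<oplus> cform R a B n y \<oplus> cpol a B n x y"
      using c assms by (simp add: cform_closed cpol_props(1)[where c = \<one> and z = x])
    have k: "cform R a B n x \<in> carrier R" "cform R a B n y \<in> carrier R" "cpol a B n x y \<in> carrier R"
      using c assms by (auto intro!: cform_closed cpol_props(1)[where c = \<one> and z = x])
    show ?thesis unfolding polar_def e using k by algebra
  qed
  thus "x \<in> carrier ?V \<Longrightarrow> y \<in> carrier ?V \<Longrightarrow> polar R ?V (cform R a B n) x y = cpol a B n x y" .
  interpret V: module R ?V by (rule func_space_is_module)
  show "qspace R ?V (cform R a B n)"
  proof unfold_locales
    fix x assume "x \<in> carrier ?V"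
    thus "cform R a B n x \<in> carrier R" using cx assms by (auto intro!: cform_closed)
    fix c assume c: "c \<in> carrier R"
    note xc = cx[OF \<open>x \<in> carrier ?V\<close>]
    have "cform R a B n (c \<odot>\<^bsub>?V\<^esub> x) = cform R a B n (\<lambda>i. c \<otimes> x i \<oplus> \<zero>)"
      by (rule cform_cong) (use xc c assms in \<open>auto simp: func_space_simps\<close>)
    also have "\<dots> = c \<otimes> c \<otimes> cform R a B n x \<oplus> cform R a B n (\<lambda>i. \<zero>) \<oplus> c \<otimes> cpol a B n x (\<lambda>i. \<zero>)"
      by (rule cpol_props(3)) (use xc c assms in auto)
    also have "cform R a B n (\<lambda>i. \<zero>) = \<zero>"
    proof -
      have "(\<Oplus>i\<in>{..<n}. a i \<otimes> \<zero> [^] (2::nat)) = \<zero>"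
        by (rule add.finprod_one_eqI) (use assms in \<open>simp add: numeral_2_eq_2\<close>)
      moreover have "(\<Oplus>p\<in>{(i, j). i < j \<and> j < n}. B (fst p) (snd p) \<otimes> (\<zero> \<otimes> \<zero>)) = \<zero>"
        by (rule add.finprod_one_eqI) (use assms in auto)
      ultimately show ?thesis by (simp add: cform_def)
    qed
    also have "cpol a B n x (\<lambda>i. \<zero>) = \<zero>"
    proof -
      have "clin B k m (\<lambda>i. \<zero>) = \<zero>" if "m \<le> n" "k < n" for k m
        unfolding clin_def using that assms by (intro add.finprod_one_eqI) auto
      hence "m \<le> n \<Longrightarrow> cpol a B m x (\<lambda>i. \<zero>) = \<zero>" for m
        using xc assms by (induct m) (auto simp: clin_closed)
      thus ?thesis by simp
    qed
    finally show "cform R a B n (c \<odot>\<^bsub>?V\<^esub> x) = c \<otimes> c \<otimes> cform R a B n x"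
      using c xc assms by (simp add: cform_closed)
  next
    fix x y z assume xyz: "x \<in> carrier ?V" "y \<in> carrier ?V" "z \<in> carrier ?V"
    note xc = cx[OF xyz(1)] cx[OF xyz(2)] cx[OF xyz(3)]
    have "polar R ?V (cform R a B n) (x \<oplus>\<^bsub>?V\<^esub> y) z = cpol a B n (x \<oplus>\<^bsub>?V\<^esub> y) z" using pol xyz by simp
    also have "\<dots> = cpol a B n (\<lambda>i. \<one> \<otimes> x i \<oplus> y i) z"
      by (rule cpol_cong) (use xc assms in \<open>auto simp: func_space_simps\<close>)
    also have "\<dots> = \<one> \<otimes> cpol a B n x z \<oplus> cpol a B n y z" by (rule cpol_props(2)) (use xc assms in auto)
    finally show "polar R ?V (cform R a B n) (x \<oplus>\<^bsub>?V\<^esub> y) z = polar R ?V (cform R a B n) x z \<oplus> polar R ?V (cform R a B n) y z"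
      using pol xyz cpol_props(1)[where c = \<one> and z = x and n = n and a = a and B = B and x = x and y = z] xc assms by simp
  next
    fix c x z assume c: "c \<in> carrier R" and xz: "x \<in> carrier ?V" "z \<in> carrier ?V"
    note xc = cx[OF xz(1)] cx[OF xz(2)]
    have z0: "m \<le> n \<Longrightarrow> cpol a B m (\<lambda>i. \<zero>) z = \<zero>" for m
    proof (induct m)
      case (Suc m)
      have "clin B m m (\<lambda>i. \<zero>) = \<zero>" unfolding clin_def using Suc assms by (intro add.finprod_one_eqI) auto
      moreover have "clin B m m z \<in> carrier R" using Suc assms xc by (intro clin_closed) auto
      ultimately show ?case using Suc assms xc by simp
    qed simp
    have "polar R ?V (cform R a B n) (c \<odot>\<^bsub>?V\<^esub> x) z = cpol a B n (c \<odot>\<^bsub>?V\<^esub> x) z" using pol xz c by simp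
    also have "\<dots> = cpol a B n (\<lambda>i. c \<otimes> x i \<oplus> \<zero>) z"
      by (rule cpol_cong) (use xc c assms in \<open>auto simp: func_space_simps\<close>)
    also have "\<dots> = c \<otimes> cpol a B n x z \<oplus> cpol a B n (\<lambda>i. \<zero>) z" by (rule cpol_props(2)) (use xc c assms in auto)
    finally show "polar R ?V (cform R a B n) (c \<odot>\<^bsub>?V\<^esub> x) z = c \<otimes> polar R ?V (cform R a B n) x z"
      using pol xz z0[of n] cpol_props(1)[where c = c and z = x and n = n and a = a and B = B and x = x and y = z] xc c assms by simp
  qed
qed

end

lemma (in qspace) q_vec_cform:
  assumes "\<And>i. i < n \<Longrightarrow> e i \<in> carrier V" "\<And>i. i < n \<Longrightarrow> x i \<in> carrier F"
  shows "q (vec e x n) = cform F (\<lambda>i. q (e i)) (\<lambda>i j. bq (e i) (e j)) n x"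
  using assms
proof (induct n)
  case (Suc n)
  have c: "vec e x n \<in> carrier V" "x n \<in> carrier F" "e n \<in> carrier V" using Suc(2-3) by (auto intro!: vec_closed)
  have l: "m \<le> n \<Longrightarrow> bq (vec e x m) (e n) = clin (\<lambda>i j. bq (e i) (e j)) n m x" for m
  proof (induct m)
    case 0 thus ?case using c by (simp add: clin_def)
  next
    case (Suc m)
    have "vec e x m \<in> carrier V" using Suc(2) \<open>\<And>i. i < Suc n \<Longrightarrow> e i \<in> carrier V\<close> \<open>\<And>i. i < Suc n \<Longrightarrow> x i \<in> carrier F\<close>
      by (auto intro!: vec_closed)
    moreover have "clin (\<lambda>i j. bq (e i) (e j)) n (Suc m) x = clin (\<lambda>i j. bq (e i) (e j)) n m x \<oplus> bq (e m) (e n) \<otimes> x m"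
      unfolding clin_def using Suc(2) \<open>\<And>i. i < Suc n \<Longrightarrow> e i \<in> carrier V\<close> \<open>\<And>i. i < Suc n \<Longrightarrow> x i \<in> carrier F\<close>
      by (intro finsum_lessThan_Suc) auto
    ultimately show ?case using Suc \<open>\<And>i. i < Suc n \<Longrightarrow> e i \<in> carrier V\<close> \<open>\<And>i. i < Suc n \<Longrightarrow> x i \<in> carrier F\<close> c
      by (simp add: polar_add_l polar_smult_l m_comm)
  qed
  have "q (vec e x (Suc n)) = q (vec e x n) \<oplus> x n \<otimes> x n \<otimes> q (e n) \<oplus> x n \<otimes> bq (vec e x n) (e n)"
    using c by (simp add: q_add q_smult polar_smult_r)
  also have "\<dots> = q (vec e x n) \<oplus> (q (e n) \<otimes> (x n \<otimes> x n) \<oplus> x n \<otimes> clin (\<lambda>i j. bq (e i) (e j)) n n x)"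
  proof -
    have k: "q (vec e x n) \<in> carrier F" "q (e n) \<in> carrier F" "bq (vec e x n) (e n) \<in> carrier F" using c by auto
    show ?thesis unfolding l[OF order_refl, symmetric] using k c(2) by algebra
  qed
  also have "\<dots> = cform F (\<lambda>i. q (e i)) (\<lambda>i j. bq (e i) (e j)) (Suc n) x"
    using Suc by (subst cform_Suc) auto
  finally show ?case .
qed simp

lemma cform_hom:
  assumes F: "field F" and L: "field L" and h: "h \<in> ring_hom F L"
    and "\<And>i. i < n \<Longrightarrow> a i \<in> carrier F" "\<And>i j. i < n \<Longrightarrow> j < n \<Longrightarrow> B i j \<in> carrier F" "\<And>i. i < n \<Longrightarrow> x i \<in> carrier F"
  shows "cform L (\<lambda>i. h (a i)) (\<lambda>i j. h (B i j)) n (\<lambda>i. h (x i)) = h (cform F a B n x)"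
proof -
  interpret F: field F by fact
  interpret L: field L by fact
  interpret h: ring_hom_ring F L h by (intro ring_hom_ringI2 h F.ring_axioms L.ring_axioms)
  show ?thesis using assms(4-6)
  proof (induct n)
    case (Suc n)
    have cl: "k < Suc n \<Longrightarrow> m \<le> n \<Longrightarrow> L.clin (\<lambda>i j. h (B i j)) k m (\<lambda>i. h (x i)) = h (F.clin B k m x)" for k m
    proof (induct m)
      case (Suc m)
      have "F.clin B k m x \<in> carrier F" by (rule F.clin_closed) (use Suc \<open>\<And>i j. i < Suc n \<Longrightarrow> j < Suc n \<Longrightarrow> B i j \<in> carrier F\<close> \<open>\<And>i. i < Suc n \<Longrightarrow> x i \<in> carrier F\<close> in auto)
      moreover have "F.clin B k (Suc m) x = F.clin B k m x \<oplus>\<^bsub>F\<^esub> B m k \<otimes>\<^bsub>F\<^esub> x m"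
        unfolding F.clin_def by (rule F.finsum_lessThan_Suc) (use Suc \<open>\<And>i j. i < Suc n \<Longrightarrow> j < Suc n \<Longrightarrow> B i j \<in> carrier F\<close> \<open>\<And>i. i < Suc n \<Longrightarrow> x i \<in> carrier F\<close> in auto)
      moreover have "L.clin (\<lambda>i j. h (B i j)) k (Suc m) (\<lambda>i. h (x i)) = L.clin (\<lambda>i j. h (B i j)) k m (\<lambda>i. h (x i)) \<oplus>\<^bsub>L\<^esub> h (B m k) \<otimes>\<^bsub>L\<^esub> h (x m)"
        unfolding L.clin_def by (rule L.finsum_lessThan_Suc) (use Suc \<open>\<And>i j. i < Suc n \<Longrightarrow> j < Suc n \<Longrightarrow> B i j \<in> carrier F\<close> \<open>\<And>i. i < Suc n \<Longrightarrow> x i \<in> carrier F\<close> in auto)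
      ultimately show ?case using Suc \<open>\<And>i j. i < Suc n \<Longrightarrow> j < Suc n \<Longrightarrow> B i j \<in> carrier F\<close> \<open>\<And>i. i < Suc n \<Longrightarrow> x i \<in> carrier F\<close> by simp
    qed (simp add: F.clin_def L.clin_def)
    have "F.clin B n n x \<in> carrier F" "cform F a B n x \<in> carrier F" if "True"
      by (rule F.clin_closed, use Suc in auto) (rule F.cform_closed, use Suc in auto)
    hence c: "F.clin B n n x \<in> carrier F" "cform F a B n x \<in> carrier F" by auto
    have "cform L (\<lambda>i. h (a i)) (\<lambda>i j. h (B i j)) (Suc n) (\<lambda>i. h (x i)) =
      cform L (\<lambda>i. h (a i)) (\<lambda>i j. h (B i j)) n (\<lambda>i. h (x i)) \<oplus>\<^bsub>L\<^esub> (h (a n) \<otimes>\<^bsub>L\<^esub> (h (x n) \<otimes>\<^bsub>L\<^esub> h (x n)) \<oplus>\<^bsub>L\<^esub>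
        h (x n) \<otimes>\<^bsub>L\<^esub> L.clin (\<lambda>i j. h (B i j)) n n (\<lambda>i. h (x i)))"
      by (rule L.cform_Suc) (use Suc in auto)
    also have "\<dots> = h (cform F a B (Suc n) x)"
      using Suc c cl[of n n] by (simp add: F.cform_Suc)
    finally show ?case .
  qed (simp add: F.cform_zero L.cform_zero)
qed

section \<open>Coordinates in the chosen basis\<close>

locale qform = qspace F V q for F :: "('a, 'm) ring_scheme" (structure) and V :: "('a, 'v, 'n) module_scheme" (structure) and q +
  assumes qf: "quadratic_form F V q"
begin

abbreviation "nn \<equiv> length (chosen_basis F V)"
abbreviation "ee \<equiv> (\<lambda>i. chosen_basis F V ! i)"

lemma vs: "vectorspace F V" using qf by (simp add: quadratic_form_def)

lemma chosen_basis: "distinct (chosen_basis F V)" "vectorspace.basis F V (set (chosen_basis F V))"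
proof -
  interpret VS: vectorspace F V by (rule vs)
  have "VS.fin_dim" using qf by (simp add: quadratic_form_def)
  then obtain b where b: "finite b" "VS.basis b" using VS.finite_basis_exists by blast
  obtain bs where "set bs = b" "distinct bs" using finite_distinct_list[OF b(1)] by blast
  hence "\<exists>bs. distinct bs \<and> VS.basis (set bs)" using b by blast
  hence "distinct (chosen_basis F V) \<and> VS.basis (set (chosen_basis F V))"
    unfolding chosen_basis_def by (rule someI_ex)
  thus "distinct (chosen_basis F V)" "VS.basis (set (chosen_basis F V))" by auto
qed

lemma ee_closed: "i < nn \<Longrightarrow> ee i \<in> carrier V"
proof -
  interpret VS: vectorspace F V by (rule vs)
  show "i < nn \<Longrightarrow> ee i \<in> carrier V" using chosen_basis(2) unfolding VS.basis_def by auto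
qed

lemma nn_dim: "nn = vectorspace.dim F V"
proof -
  interpret VS: vectorspace F V by (rule vs)
  show ?thesis using VS.dim_basis[of "set (chosen_basis F V)"] chosen_basis by (simp add: distinct_card)
qed

lemma lincomb_vec:
  assumes "k \<le> nn" "c \<in> carrier V \<rightarrow> carrier F"
  shows "V.lincomb c (ee ` {..<k}) = vec ee (\<lambda>i. c (ee i)) k"
  using assms(1)
proof (induct k)
  case 0
  thus ?case by (simp add: V.lincomb_def)
next
  case (Suc k)
  have cl: "ee ` {..<k} \<subseteq> carrier V" "ee k \<in> carrier V" using ee_closed Suc by auto
  have n: "ee k \<notin> ee ` {..<k}" using chosen_basis(1) Suc(2) by (auto simp: nth_eq_iff_index_eq)
  have "V.lincomb c (insert (ee k) (ee ` {..<k})) = c (ee k) \<odot>\<^bsub>V\<^esub> ee k \<oplus>\<^bsub>V\<^esub> V.lincomb c (ee ` {..<k})"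
    unfolding V.lincomb_def using cl n assms(2) by (intro V.finsum_insert) auto
  moreover have "ee ` {..<Suc k} = insert (ee k) (ee ` {..<k})" by (auto simp: lessThan_Suc)
  moreover have "V.lincomb c (ee ` {..<k}) \<in> carrier V" using cl assms(2) by (intro V.lincomb_closed) auto
  ultimately show ?case using Suc cl assms(2) V.a_comm by (auto simp: Pi_def)
qed

lemma ee_image: "ee ` {..<nn} = set (chosen_basis F V)"
  by (auto simp: set_conv_nth)

lemma coords_exist:
  assumes "z \<in> carrier V" shows "\<exists>x. (\<forall>i. x i \<in> carrier F) \<and> z = vec ee x nn"
proof -
  interpret VS: vectorspace F V by (rule vs)
  have b: "V.gen_set (set (chosen_basis F V))" "set (chosen_basis F V) \<subseteq> carrier V"
    using chosen_basis(2) unfolding VS.basis_def by auto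
  obtain c where c: "c \<in> set (chosen_basis F V) \<rightarrow> carrier F" "z = V.lincomb c (set (chosen_basis F V))"
    using V.finite_in_span[of "set (chosen_basis F V)" z] b assms by auto
  define c' where "c' = (\<lambda>w. if w \<in> set (chosen_basis F V) then c w else \<zero>)"
  have c': "c' \<in> carrier V \<rightarrow> carrier F" "\<And>w. c' w \<in> carrier F" using c(1) by (auto simp: c'_def)
  have "z = V.lincomb c' (ee ` {..<nn})"
    unfolding ee_image c(2) by (rule V.lincomb_cong) (use b c in \<open>auto simp: c'_def\<close>)
  hence "z = vec ee (\<lambda>i. c' (ee i)) nn" using lincomb_vec[OF order_refl c'(1)] by simp
  thus ?thesis using c'(2) by (intro exI[of _ "\<lambda>i. c' (ee i)"]) auto
qed

lemma vec_zero_imp: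
  assumes "\<And>i. i < nn \<Longrightarrow> x i \<in> carrier F" "vec ee x nn = \<zero>\<^bsub>V\<^esub>" "i < nn" shows "x i = \<zero>"
proof -
  interpret VS: vectorspace F V by (rule vs)
  define c where "c = (\<lambda>w. if w \<in> set (chosen_basis F V) then x (THE i. i < nn \<and> ee i = w) else \<zero>)"
  have ce: "c (ee j) = x j" if "j < nn" for j
  proof -
    have "(THE i. i < nn \<and> ee i = ee j) = j"
      using chosen_basis(1) that by (intro the_equality) (auto simp: nth_eq_iff_index_eq)
    thus ?thesis using that by (simp add: c_def)
  qed
  have cc: "c \<in> carrier V \<rightarrow> carrier F"
  proof
    fix w show "c w \<in> carrier F"
    proof (cases "w \<in> set (chosen_basis F V)")
      case True
      then obtain j where "j < nn" "w = ee j" by (auto simp: in_set_conv_nth)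
      thus ?thesis using ce assms(1) by simp
    qed (simp add: c_def)
  qed
  have "V.lincomb c (ee ` {..<nn}) = vec ee (\<lambda>i. c (ee i)) nn" by (rule lincomb_vec[OF order_refl cc])
  also have "\<dots> = \<zero>\<^bsub>V\<^esub>" using vec_cong[of nn "\<lambda>i. c (ee i)" x ee] ce assms(2) by simp
  finally have z: "V.lincomb c (set (chosen_basis F V)) = \<zero>\<^bsub>V\<^esub>" unfolding ee_image .
  have b: "V.lin_indpt (set (chosen_basis F V))" "set (chosen_basis F V) \<subseteq> carrier V"
    using chosen_basis(2) unfolding VS.basis_def by auto
  show ?thesis
  proof (rule ccontr)
    assume "x i \<noteq> \<zero>"
    hence "c (ee i) \<noteq> \<zero>" using ce assms(3) by simp
    hence "V.lin_dep (set (chosen_basis F V))"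
      unfolding V.lin_dep_def using z cc b(2) assms(3) by (intro exI[of _ "set (chosen_basis F V)"] exI[of _ c] exI[of _ "ee i"]) auto
    thus False using b(1) by simp
  qed
qed

end

section \<open>Integral pairs\<close>

text \<open>This is 1 - 4 k. For b(x, y) = 1 and k = q(x) q(y) it is minus the Gram determinant of b
  on x, y.\<close>

definition (in ring) disc where "disc k = \<one> \<ominus> (k \<oplus> k \<oplus> k \<oplus> k)"

lemma (in ring) disc_closed [simp]: "k \<in> carrier R \<Longrightarrow> disc k \<in> carrier R"
  by (simp add: disc_def)

definition unit_at :: "('a, 'm) ring_scheme \<Rightarrow> ('a \<Rightarrow> int) \<Rightarrow> 'a \<Rightarrow> bool" where
  "unit_at F v x \<longleftrightarrow> x \<in> carrier F \<and> x \<noteq> \<zero>\<^bsub>F\<^esub> \<and> v x = 0"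

context valued_field
begin

lemma unit_at_close:
  assumes "unit_at F v x" "y \<in> carrier F" "y \<ominus> x \<in> vge F v 1" shows "unit_at F v y"
  using v_close[of x y] assms by (auto simp: unit_at_def)

lemma unit_at_mult: "unit_at F v x \<Longrightarrow> unit_at F v y \<Longrightarrow> unit_at F v (x \<otimes> y)"
  using mult_nz v_mult by (auto simp: unit_at_def)

lemma unit_at_vge: "unit_at F v x \<Longrightarrow> x \<in> vge F v 0"
  by (simp add: unit_at_def vge_def)

lemma unit_at_one [simp]: "unit_at F v \<one>"
  by (simp add: unit_at_def)

lemma unit_at_inv: "unit_at F v x \<Longrightarrow> unit_at F v (inv x)"
  using inv_closed_nz[of x] v_inv[of x] by (auto simp: unit_at_def)

lemma disc_close:
  assumes "k \<in> carrier F" "k' \<in> carrier F" "k' \<ominus> k \<in> vge F v 1"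
  shows "disc k' \<ominus> disc k \<in> vge F v 1"
proof -
  have "disc k' \<ominus> disc k = \<ominus> ((k' \<ominus> k) \<oplus> (k' \<ominus> k) \<oplus> (k' \<ominus> k) \<oplus> (k' \<ominus> k))"
    unfolding disc_def using assms(1,2) by algebra
  thus ?thesis using assms(3) by (simp add: vge_minus vge_add)
qed

text \<open>Only residues matter: b and its inverse are congruent to 1, so division by b^2 keeps the
  product in the residue class of k.\<close>

lemma normalised_pair_close:
  assumes k: "unit_at F v k" "unit_at F v (disc k)" and P: "P \<in> carrier F" "P \<ominus> k \<in> vge F v 1"
    and b: "b \<in> carrier F" "b \<ominus> \<one> \<in> vge F v 1"
  shows "b \<noteq> \<zero>" "unit_at F v (P \<otimes> (inv b \<otimes> inv b))" "unit_at F v (disc (P \<otimes> (inv b \<otimes> inv b)))"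
proof -
  have ub: "unit_at F v b" by (rule unit_at_close[OF unit_at_one b])
  thus b0: "b \<noteq> \<zero>" by (simp add: unit_at_def)
  define i where "i = inv b"
  have ui: "unit_at F v i" unfolding i_def by (rule unit_at_inv[OF ub])
  have c: "i \<in> carrier F" "k \<in> carrier F" using ui k by (auto simp: unit_at_def)
  have bi: "b \<otimes> i = \<one>" unfolding i_def using inv_closed_nz[OF b(1) b0] by simp
  have "i \<ominus> b \<otimes> i = \<ominus> (i \<otimes> (b \<ominus> \<one>))" using c b(1) by algebra
  hence i1: "i \<ominus> \<one> \<in> vge F v 1"
    unfolding bi using vge_minus[OF vge_mult0[OF unit_at_vge[OF ui] b(2)]] by simp
  have "P \<otimes> (i \<otimes> i) \<ominus> k = (P \<ominus> k) \<otimes> (i \<otimes> i) \<oplus> k \<otimes> ((i \<ominus> \<one>) \<otimes> i \<oplus> (i \<ominus> \<one>))"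
    using c P(1) by algebra
  moreover have "(P \<ominus> k) \<otimes> (i \<otimes> i) \<in> vge F v 1"
    by (rule vge_mult0r[OF P(2) unit_at_vge[OF unit_at_mult[OF ui ui]]])
  moreover have "k \<otimes> ((i \<ominus> \<one>) \<otimes> i \<oplus> (i \<ominus> \<one>)) \<in> vge F v 1"
    by (intro vge_mult0[OF unit_at_vge[OF k(1)]] vge_add vge_mult0r[OF i1 unit_at_vge[OF ui]] i1)
  ultimately have d: "P \<otimes> (i \<otimes> i) \<ominus> k \<in> vge F v 1" using vge_add by simp
  have Pc: "P \<otimes> (i \<otimes> i) \<in> carrier F" using P c by simp
  show "unit_at F v (P \<otimes> (inv b \<otimes> inv b))" using unit_at_close[OF k(1) Pc d] by (simp add: i_def)
  show "unit_at F v (disc (P \<otimes> (inv b \<otimes> inv b)))"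
    using unit_at_close[OF k(2) _ disc_close[OF c(2) Pc d]] Pc by (simp add: i_def)
qed

end

context valued_qspace
begin

lemma gram_bound:
  fixes n :: nat
  assumes "\<And>i. i < n \<Longrightarrow> e i \<in> carrier V" "finite Z" "Z \<subseteq> carrier V"
  shows "\<exists>m. m \<le> 0 \<and> (\<forall>i<n. q (e i) \<in> vge F v m) \<and> (\<forall>i<n. \<forall>j<n. bq (e i) (e j) \<in> vge F v m) \<and>
    (\<forall>i<n. \<forall>z\<in>Z. bq (e i) z \<in> vge F v m)"
proof -
  define S where "S = (\<lambda>i. q (e i)) ` {..<n} \<union> (\<lambda>(i, j). bq (e i) (e j)) ` ({..<n} \<times> {..<n}) \<union>
    (\<lambda>(i, z). bq (e i) z) ` ({..<n} \<times> Z)"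
  have S: "finite S" "S \<subseteq> carrier F" unfolding S_def
    by (intro finite_UnI finite_imageI finite_cartesian_product finite_lessThan assms(2)) (use assms(1,3) in auto)
  have "\<exists>m\<le>0. \<forall>s\<in>S. s \<in> vge F v m" using S
  proof (induct S rule: finite_induct)
    case (insert s S)
    then obtain m where m: "m \<le> 0" "\<forall>s\<in>S. s \<in> vge F v m" by auto
    obtain k where "s \<in> vge F v k" using vge_exists[of s] insert(4) by auto
    hence "\<forall>s\<in>insert s S. s \<in> vge F v (min m k)" using m vge_mono[of _ _ "min m k"] by auto
    thus ?case using m by (intro exI[of _ "min m k"]) auto
  qed auto
  then obtain m where m: "m \<le> 0" "\<And>s. s \<in> S \<Longrightarrow> s \<in> vge F v m" by blast
  show ?thesis by (rule exI[of _ m]) (use m in \<open>auto simp: S_def intro!: m(2)\<close>)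
qed

lemma pair_continuous:
  assumes e: "\<And>i. i < n \<Longrightarrow> e i \<in> carrier V" and yz: "y \<in> carrier V" "z \<in> carrier V"
  shows "\<exists>N\<ge>0. \<forall>d d'. (\<forall>i<n. d i \<in> vge F v N) \<longrightarrow> (\<forall>i<n. d' i \<in> vge F v N) \<longrightarrow>
    bq (y \<oplus>\<^bsub>V\<^esub> vec e d n) (z \<oplus>\<^bsub>V\<^esub> vec e d' n) \<ominus> bq y z \<in> vge F v 1 \<and>
    q (y \<oplus>\<^bsub>V\<^esub> vec e d n) \<otimes> q (z \<oplus>\<^bsub>V\<^esub> vec e d' n) \<ominus> q y \<otimes> q z \<in> vge F v 1"
proof -
  obtain m where m: "m \<le> 0" "\<And>i. i < n \<Longrightarrow> q (e i) \<in> vge F v m"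
    "\<And>i j. i < n \<Longrightarrow> j < n \<Longrightarrow> bq (e i) (e j) \<in> vge F v m"
    "\<And>i. i < n \<Longrightarrow> bq (e i) y \<in> vge F v m" "\<And>i. i < n \<Longrightarrow> bq (e i) z \<in> vge F v m"
    using gram_bound[of n e "{y, z}"] e yz by auto
  obtain k1 where k1: "q y \<in> vge F v k1" using vge_exists yz by blast
  obtain k2 where k2: "q z \<in> vge F v k2" using vge_exists yz by blast
  define k where "k = min 0 (min k1 k2)"
  have k: "q y \<in> vge F v k" "q z \<in> vge F v k" "k \<le> 0" using k1 k2 vge_mono by (auto simp: k_def)
  \<comment> \<open>Norms and pairings of basis vectors have value at least m, so a perturbation of
    level N changes q(y) and q(z) by terms of value at least N + m = 1 - k. Multiplied by a norm of
    value at least k, the change still has value at least 1.\<close>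
  define N where "N = 1 - m - k"
  have N0: "N \<ge> 0" using m(1) k(3) by (simp add: N_def)
  have small: "q (w \<oplus>\<^bsub>V\<^esub> vec e d n) \<ominus> q w \<in> vge F v (1 - k) \<and> bq (vec e d n) w \<in> vge F v 1"
    if d: "\<forall>i<n. d i \<in> vge F v N" and w: "w \<in> carrier V" "\<And>i. i < n \<Longrightarrow> bq (e i) w \<in> vge F v m" for w d
  proof -
    have dc: "\<And>i. i < n \<Longrightarrow> d i \<in> carrier F" using d vge_carrier by blast
    have vc: "vec e d n \<in> carrier V" using e dc by (rule vec_closed)
    have 1: "bq (vec e d n) w \<in> vge F v (N + m)" using e d w by (intro polar_vec_vge) auto
    have 2: "q (vec e d n) \<in> vge F v (N + N + m)" using e d m by (intro q_vec_vge) auto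
    have k': "q w \<in> carrier F" "q (vec e d n) \<in> carrier F" "bq (vec e d n) w \<in> carrier F" using w vc by auto
    have "q (w \<oplus>\<^bsub>V\<^esub> vec e d n) = q w \<oplus> q (vec e d n) \<oplus> bq (vec e d n) w"
      using q_add[OF w(1) vc] polar_sym[OF w(1) vc] by simp
    hence "q (w \<oplus>\<^bsub>V\<^esub> vec e d n) \<ominus> q w = q (vec e d n) \<oplus> bq (vec e d n) w" using k' by (simp, algebra)
    moreover have "q (vec e d n) \<in> vge F v (1 - k)" by (rule vge_mono[OF 2]) (use N0 in \<open>simp add: N_def\<close>)
    moreover have "bq (vec e d n) w \<in> vge F v (1 - k)" by (rule vge_mono[OF 1]) (simp add: N_def)
    moreover have "bq (vec e d n) w \<in> vge F v 1" by (rule vge_mono[OF 1]) (use k in \<open>simp add: N_def\<close>)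
    ultimately show ?thesis using vge_add by simp
  qed
  show ?thesis
  proof (intro exI[of _ N] conjI N0 allI impI)
    fix d d' assume d: "\<forall>i<n. d i \<in> vge F v N" and d': "\<forall>i<n. d' i \<in> vge F v N"
    have dc: "\<And>i. i < n \<Longrightarrow> d i \<in> carrier F" "\<And>i. i < n \<Longrightarrow> d' i \<in> carrier F" using d d' vge_carrier by blast+
    define Y where "Y = vec e d n"
    define Z where "Z = vec e d' n"
    have vc: "Y \<in> carrier V" "Z \<in> carrier V" unfolding Y_def Z_def using e dc by (auto intro: vec_closed)
    have s: "q (y \<oplus>\<^bsub>V\<^esub> Y) \<ominus> q y \<in> vge F v (1 - k)" "q (z \<oplus>\<^bsub>V\<^esub> Z) \<ominus> q z \<in> vge F v (1 - k)"
      "bq Y z \<in> vge F v 1" "bq Z y \<in> vge F v 1"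
      unfolding Y_def Z_def using small[OF d yz(1) m(4)] small[OF d' yz(2) m(5)] small[OF d yz(2) m(5)] small[OF d' yz(1) m(4)] by auto
    have "bq Z (e i) \<in> vge F v (N + m)" if "i < n" for i
      unfolding Z_def using e d' m(3) that by (intro polar_vec_vge) auto
    hence "bq (e i) Z \<in> vge F v (N + m)" if "i < n" for i using polar_sym[OF e vc(2)] that by simp
    hence YZ: "bq Y Z \<in> vge F v (N + (N + m))" unfolding Y_def using e d vc(2) by (intro polar_vec_vge) auto
    have YZ: "bq Y Z \<in> vge F v 1" by (rule vge_mono[OF YZ]) (use N0 k in \<open>simp add: N_def\<close>)
    have bc: "bq y z \<in> carrier F" "bq y Z \<in> carrier F" "bq Y z \<in> carrier F" "bq Y Z \<in> carrier F" using yz vc by auto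
    have "bq (y \<oplus>\<^bsub>V\<^esub> Y) (z \<oplus>\<^bsub>V\<^esub> Z) = (bq y z \<oplus> bq y Z) \<oplus> (bq Y z \<oplus> bq Y Z)"
      using yz vc bc by (simp add: polar_add_l polar_add_r a_ac)
    hence "bq (y \<oplus>\<^bsub>V\<^esub> Y) (z \<oplus>\<^bsub>V\<^esub> Z) \<ominus> bq y z = bq y Z \<oplus> bq Y z \<oplus> bq Y Z" using bc by (simp, algebra)
    moreover have "bq y Z \<in> vge F v 1" using s(4) polar_sym[OF yz(1) vc(2)] by simp
    ultimately show "bq (y \<oplus>\<^bsub>V\<^esub> vec e d n) (z \<oplus>\<^bsub>V\<^esub> vec e d' n) \<ominus> bq y z \<in> vge F v 1"
      using s YZ vge_add by (simp add: Y_def Z_def)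
    define A where "A = q (y \<oplus>\<^bsub>V\<^esub> Y)"
    define B where "B = q (z \<oplus>\<^bsub>V\<^esub> Z)"
    have c: "A \<in> carrier F" "B \<in> carrier F" "q y \<in> carrier F" "q z \<in> carrier F"
      using yz vc by (auto simp: A_def B_def)
    have sA: "A \<ominus> q y \<in> vge F v (1 - k)" "B \<ominus> q z \<in> vge F v (1 - k)" using s by (auto simp: A_def B_def)
    have "B = (B \<ominus> q z) \<oplus> q z" using c by algebra
    moreover have "B \<ominus> q z \<in> vge F v k" by (rule vge_mono[OF sA(2)]) (use k in simp)
    ultimately have Bk: "B \<in> vge F v k" using vge_add[OF _ k(2)] by metis
    have "A \<otimes> B \<ominus> q y \<otimes> q z = (A \<ominus> q y) \<otimes> B \<oplus> (B \<ominus> q z) \<otimes> q y" using c by algebra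
    moreover have "(A \<ominus> q y) \<otimes> B \<in> vge F v 1" "(B \<ominus> q z) \<otimes> q y \<in> vge F v 1"
      using vge_mult[OF sA(1) Bk] vge_mult[OF sA(2) k(1)] by simp_all
    ultimately show "q (y \<oplus>\<^bsub>V\<^esub> vec e d n) \<otimes> q (z \<oplus>\<^bsub>V\<^esub> vec e d' n) \<ominus> q y \<otimes> q z \<in> vge F v 1"
      using vge_add by (simp add: A_def B_def Y_def Z_def)
  qed
qed

text \<open>For \<open>b(y, z) = 1\<close>, the element \<open>c = - q(y) q(z)\<close> of \<open>S(q)\<close> satisfies \<open>1 + 4 c = disc (q(y) q(z))\<close>.\<close>

definition gpair where
  "gpair y z \<longleftrightarrow> y \<in> carrier V \<and> z \<in> carrier V \<and> bq y z = \<one> \<and> unit_at F v (q y \<otimes> q z) \<and> unit_at F v (disc (q y \<otimes> q z))"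

lemma gpair_normalise:
  assumes "y \<in> carrier V" "z \<in> carrier V" "bq y z \<noteq> \<zero>"
    "unit_at F v (q y \<otimes> q z \<otimes> (inv (bq y z) \<otimes> inv (bq y z)))"
    "unit_at F v (disc (q y \<otimes> q z \<otimes> (inv (bq y z) \<otimes> inv (bq y z))))"
  shows "gpair y (inv (bq y z) \<odot>\<^bsub>V\<^esub> z)"
proof -
  have c: "bq y z \<in> carrier F" "q y \<in> carrier F" "q z \<in> carrier F" using assms by auto
  note i = inv_closed_nz[OF c(1) assms(3)]
  have ic: "inv (bq y z) \<in> carrier F" using i by simp
  have "q y \<otimes> (inv (bq y z) \<otimes> inv (bq y z) \<otimes> q z) = q y \<otimes> q z \<otimes> (inv (bq y z) \<otimes> inv (bq y z))"
    using c ic by algebra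
  thus ?thesis using assms i by (simp add: gpair_def q_smult polar_smult_r)
qed

text \<open>The unit conditions depend on residues only and are therefore open. Just the equation
  b(y, z) = 1 is lost under perturbation, and scaling Z restores it.\<close>

lemma gpair_close:
  assumes g: "gpair y z" and e: "\<And>i. i < n \<Longrightarrow> e i \<in> carrier V"
  shows "\<exists>N\<ge>0. \<forall>d d'. (\<forall>i<n. d i \<in> vge F v N) \<longrightarrow> (\<forall>i<n. d' i \<in> vge F v N) \<longrightarrow>
    (let Y = y \<oplus>\<^bsub>V\<^esub> vec e d n; Z = z \<oplus>\<^bsub>V\<^esub> vec e d' n in gpair Y (inv (bq Y Z) \<odot>\<^bsub>V\<^esub> Z))"
proof -
  have c: "y \<in> carrier V" "z \<in> carrier V" "bq y z = \<one>" "unit_at F v (q y \<otimes> q z)" "unit_at F v (disc (q y \<otimes> q z))"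
    using g by (auto simp: gpair_def)
  obtain N where N: "N \<ge> 0" "\<And>d d'. (\<forall>i<n. d i \<in> vge F v N) \<Longrightarrow> (\<forall>i<n. d' i \<in> vge F v N) \<Longrightarrow>
    bq (y \<oplus>\<^bsub>V\<^esub> vec e d n) (z \<oplus>\<^bsub>V\<^esub> vec e d' n) \<ominus> \<one> \<in> vge F v 1 \<and>
    q (y \<oplus>\<^bsub>V\<^esub> vec e d n) \<otimes> q (z \<oplus>\<^bsub>V\<^esub> vec e d' n) \<ominus> q y \<otimes> q z \<in> vge F v 1"
    using pair_continuous[where n = n and e = e, OF e c(1,2)] unfolding c(3) by blast
  show ?thesis
  proof (intro exI[of _ N] conjI N(1) allI impI)
    fix d d' assume d: "\<forall>i<n. d i \<in> vge F v N" and d': "\<forall>i<n. d' i \<in> vge F v N"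
    have dc: "\<And>i. i < n \<Longrightarrow> d i \<in> carrier F" "\<And>i. i < n \<Longrightarrow> d' i \<in> carrier F" using d d' vge_carrier by blast+
    define Y where "Y = y \<oplus>\<^bsub>V\<^esub> vec e d n"
    define Z where "Z = z \<oplus>\<^bsub>V\<^esub> vec e d' n"
    have vc: "Y \<in> carrier V" "Z \<in> carrier V" unfolding Y_def Z_def by (auto intro!: V.a_closed vec_closed e dc c)
    note close = N(2)[OF d d', folded Y_def Z_def]
    note np = normalised_pair_close[OF c(4,5) _ conjunct2[OF close] polar_closed[OF vc] conjunct1[OF close]]
    have "gpair Y (inv (bq Y Z) \<odot>\<^bsub>V\<^esub> Z)" by (rule gpair_normalise[OF vc]) (use np vc in auto)
    thus "let Y = y \<oplus>\<^bsub>V\<^esub> vec e d n; Z = z \<oplus>\<^bsub>V\<^esub> vec e d' n in gpair Y (inv (bq Y Z) \<odot>\<^bsub>V\<^esub> Z)"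
      by (simp add: Y_def Z_def Let_def)
  qed
qed

end

section \<open>Extension of scalars\<close>

lemma (in field) func_space_unit_vec:
  assumes x: "x \<in> carrier (func_space {..<n})"
    and Q: "qspace R (func_space {..<n}) Q"
  shows "qspace.vec (func_space {..<n}) (\<lambda>i. \<lambda>j\<in>{..<n}. if j = i then \<one> else \<zero>) x n = x"
proof -
  interpret q: qspace R "func_space {..<n}" Q by (rule Q)
  let ?e = "\<lambda>i. \<lambda>j\<in>{..<n}. if j = i then \<one> else \<zero>"
  have xc: "i < n \<Longrightarrow> x i \<in> carrier R" for i using x by (auto simp: func_space_simps)
  have "k \<le> n \<Longrightarrow> q.vec ?e x k = (\<lambda>j\<in>{..<n}. if j < k then x j else \<zero>)" for k
    by (induct k) (auto simp: func_space_simps fun_eq_iff xc less_Suc_eq restrict_def)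
  from this[OF order_refl] show ?thesis using x by (auto simp: func_space_simps fun_eq_iff restrict_def PiE_def extensional_def)
qed

lemma (in field) func_space_indep3:
  fixes n :: nat
  assumes "3 \<le> n" and Q: "qspace R (func_space {..<n}) Q"
  shows "qspace.indep3 R (func_space {..<n}) (\<lambda>j\<in>{..<n}. if j = 0 then \<one> else \<zero>)
    (\<lambda>j\<in>{..<n}. if j = 1 then \<one> else \<zero>) (\<lambda>j\<in>{..<n}. if j = 2 then \<one> else \<zero>)"
proof -
  interpret q: qspace R "func_space {..<n}" Q by (rule Q)
  have E: "f = \<zero> \<and> g = \<zero> \<and> h = \<zero>" if c: "f \<in> carrier R" "g \<in> carrier R" "h \<in> carrier R"
    and z: "f \<odot>\<^bsub>func_space {..<n}\<^esub> (\<lambda>j\<in>{..<n}. if j = 0 then \<one> else \<zero>) \<oplus>\<^bsub>func_space {..<n}\<^esub>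
      g \<odot>\<^bsub>func_space {..<n}\<^esub> (\<lambda>j\<in>{..<n}. if j = 1 then \<one> else \<zero>) \<oplus>\<^bsub>func_space {..<n}\<^esub>
      h \<odot>\<^bsub>func_space {..<n}\<^esub> (\<lambda>j\<in>{..<n}. if j = 2 then \<one> else \<zero>) = \<zero>\<^bsub>func_space {..<n}\<^esub>" for f g h
    using fun_cong[OF z, of 0] fun_cong[OF z, of 1] fun_cong[OF z, of 2] c assms(1)
    by (simp add: func_space_simps)
  show ?thesis unfolding q.indep3_def using E by (auto simp: func_space_simps)
qed

context qform
begin

abbreviation "ES L \<equiv> ext_space F V L"
abbreviation "EF L \<phi> \<equiv> ext_form F V q L \<phi>"

text \<open>The vector \<open>vv x\<close> of V regarded over the larger field, in
  coordinates.\<close>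

definition emv :: "('a \<Rightarrow> 'l) \<Rightarrow> (nat \<Rightarrow> 'a) \<Rightarrow> nat \<Rightarrow> 'l" where
  "emv \<phi> x = (\<lambda>i\<in>{..<nn}. \<phi> (x i))"

abbreviation "vv x \<equiv> vec ee x nn"

lemma vv_closed: "(\<And>i. x i \<in> carrier F) \<Longrightarrow> vv x \<in> carrier V"
  by (rule vec_closed[OF ee_closed]) auto

context
  fixes L :: "('l, 'k) ring_scheme" and \<phi>
  assumes L: "field L" and h: "\<phi> \<in> ring_hom F L"
begin

interpretation L: field L by (rule L)
interpretation h: ring_hom_ring F L \<phi> by (intro ring_hom_ringI2 h ring_axioms L.ring_axioms)

lemma ext_coeffs: "i < nn \<Longrightarrow> \<phi> (q (ee i)) \<in> carrier L"
  "i < nn \<Longrightarrow> j < nn \<Longrightarrow> \<phi> (bq (ee i) (ee j)) \<in> carrier L"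
  using ee_closed by auto

lemma ext_space_eq: "ES L = L.func_space {..<nn}"
  by (simp add: ext_space_def)

lemma ext_form_eq: "EF L \<phi> = cform L (\<lambda>i. \<phi> (q (ee i))) (\<lambda>i j. \<phi> (bq (ee i) (ee j))) nn"
  by (rule ext) (rule ext_form_cform)

lemma ext_qspace: "qspace L (ES L) (EF L \<phi>)"
  unfolding ext_space_eq ext_form_eq by (rule L.cform_qspace) (use ext_coeffs in auto)

lemma emv_closed: "(\<And>i. x i \<in> carrier F) \<Longrightarrow> emv \<phi> x \<in> carrier (ES L)"
  by (auto simp: ext_space_eq L.func_space_simps emv_def)

lemma ext_form_emv:
  assumes "\<And>i. x i \<in> carrier F" shows "EF L \<phi> (emv \<phi> x) = \<phi> (q (vv x))"
proof -
  have "EF L \<phi> (emv \<phi> x) = cform L (\<lambda>i. \<phi> (q (ee i))) (\<lambda>i j. \<phi> (bq (ee i) (ee j))) nn (\<lambda>i. \<phi> (x i))"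
    unfolding ext_form_eq by (rule L.cform_cong) (use assms ext_coeffs in \<open>auto simp: emv_def\<close>)
  also have "\<dots> = \<phi> (cform F (\<lambda>i. q (ee i)) (\<lambda>i j. bq (ee i) (ee j)) nn x)"
    by (rule cform_hom[OF field_axioms L h]) (use assms ee_closed in auto)
  also have "cform F (\<lambda>i. q (ee i)) (\<lambda>i j. bq (ee i) (ee j)) nn x = q (vv x)"
    by (rule q_vec_cform[symmetric]) (use assms ee_closed in auto)
  finally show ?thesis .
qed

lemma emv_add:
  assumes "\<And>i. x i \<in> carrier F" "\<And>i. y i \<in> carrier F"
  shows "emv \<phi> x \<oplus>\<^bsub>ES L\<^esub> emv \<phi> y = emv \<phi> (\<lambda>i. x i \<oplus> y i)"
  using assms by (auto simp: ext_space_eq L.func_space_simps emv_def fun_eq_iff)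

lemma polar_emv:
  assumes "\<And>i. x i \<in> carrier F" "\<And>i. y i \<in> carrier F"
  shows "polar L (ES L) (EF L \<phi>) (emv \<phi> x) (emv \<phi> y) = \<phi> (bq (vv x) (vv y))"
proof -
  have v: "vv (\<lambda>i. x i \<oplus> y i) = vv x \<oplus>\<^bsub>V\<^esub> vv y" by (rule vec_add) (use assms ee_closed in auto)
  have "vv x \<oplus>\<^bsub>V\<^esub> vv y \<in> carrier V" using vv_closed[OF assms(1)] vv_closed[OF assms(2)] by simp
  hence c: "q (vv x) \<in> carrier F" "q (vv y) \<in> carrier F" "q (vv x \<oplus>\<^bsub>V\<^esub> vv y) \<in> carrier F"
    using vv_closed[OF assms(1)] vv_closed[OF assms(2)] by auto
  have "EF L \<phi> (emv \<phi> (\<lambda>i. x i \<oplus> y i)) = \<phi> (q (vv x \<oplus>\<^bsub>V\<^esub> vv y))"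
    by (subst ext_form_emv) (use assms v in auto)
  thus ?thesis unfolding polar_def emv_add[OF assms] ext_form_emv[OF assms(1)] ext_form_emv[OF assms(2)]
    using c by (simp add: a_minus_def)
qed

lemma ext_indep3:
  assumes "3 \<le> nn"
  shows "\<exists>e0 e1 e2. qspace.indep3 L (ES L) e0 e1 e2"
  unfolding ext_space_eq using L.func_space_indep3[OF assms ext_qspace[unfolded ext_space_eq]] by blast

end

section \<open>Consequences of anisotropy at the places of Delta\<close>

lemma Delta_henselisation:
  assumes "v \<in> Delta F K V q"
  shows "\<exists>(H :: (nat \<Rightarrow> 'a) ring) B \<iota>. henselisation F (val_ring F v) H B \<iota> \<and> anisotropic H (ES H) (EF H \<iota>)"
proof -
  have v: "v \<in> valuations F K" using assms by (simp add: Delta_def)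
  interpret valued_field F v by (rule valuations_valued_field[OF field_axioms v])
  show ?thesis using henselisation_exists assms unfolding Delta_def by blast
qed

lemma Delta_anisotropic:
  assumes v: "v \<in> Delta F K V q" and x: "x \<in> carrier V" "q x = \<zero>" shows "x = \<zero>\<^bsub>V\<^esub>"
proof -
  obtain H :: "(nat \<Rightarrow> 'a) ring" and B \<iota> where H: "henselisation F (val_ring F v) H B \<iota>" "anisotropic H (ES H) (EF H \<iota>)"
    using Delta_henselisation[OF v] by blast
  have Hf: "field H" using H(1) by (auto simp: henselisation_def henselian_def valuation_ring_def)
  have h: "\<iota> \<in> ring_hom F H" using H(1) by (auto simp: henselisation_def valued_hom_def)
  interpret H: field H by (rule Hf)
  interpret h: ring_hom_ring F H \<iota> by (intro ring_hom_ringI2 h ring_axioms H.ring_axioms)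
  obtain c where c: "\<And>i. c i \<in> carrier F" "x = vv c" using coords_exist[OF x(1)] by blast
  have "EF H \<iota> (emv \<iota> c) = \<zero>\<^bsub>H\<^esub>" using ext_form_emv[OF Hf h c(1)] x c(2) by simp
  hence z: "emv \<iota> c = \<zero>\<^bsub>ES H\<^esub>" using H(2) emv_closed[OF Hf h c(1)] by (simp add: anisotropic_def)
  have "c i = \<zero>" if "i < nn" for i
  proof -
    have "\<iota> (c i) = \<zero>\<^bsub>H\<^esub>"
      using fun_cong[OF z, of i] that by (simp add: ext_space_eq[OF Hf h] H.func_space_simps emv_def)
    thus ?thesis using field_hom_inv(1)[OF field_axioms Hf h c(1)] by blast
  qed
  hence "vv c = vv (\<lambda>_. \<zero>)" by (intro vec_cong) auto
  also have "\<dots> = \<zero>\<^bsub>V\<^esub>"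
  proof -
    have "vec ee (\<lambda>_. \<zero>) m = \<zero>\<^bsub>V\<^esub>" if "m \<le> nn" for m using that by (induct m) (auto simp: ee_closed)
    thus ?thesis by simp
  qed
  finally show ?thesis using c by simp
qed

text \<open>
  If \<open>v (q x q y) > 2 v (b x y)\<close>, then \<open>q x q y s\<^sup>2 / b\<^sup>2 - s + 1\<close> has a root \<open>s\<close> in the henselisation
  by Hensel's lemma, and \<open>x - (q x / b) s y\<close> is isotropic.
\<close>

lemma Delta_bound:
  assumes v: "v \<in> Delta F K V q" and xy: "x \<in> carrier V" "y \<in> carrier V" "bq x y \<noteq> \<zero>"
    and nz: "q x \<noteq> \<zero>" "q y \<noteq> \<zero>"
  shows "v (q x) + v (q y) \<le> 2 * v (bq x y)"
proof (rule ccontr)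
  assume neg: "\<not> ?thesis"
  have vV: "v \<in> valuations F K" using v by (simp add: Delta_def)
  interpret valued_field F v by (rule valuations_valued_field[OF field_axioms vV])
  obtain H :: "(nat \<Rightarrow> 'a) ring" and B \<iota> where H: "henselisation F (val_ring F v) H B \<iota>" "anisotropic H (ES H) (EF H \<iota>)"
    using Delta_henselisation[OF v] by blast
  have hB: "henselian H B" and vh: "\<iota> \<in> valued_hom F (vge F v 0) H B"
    using H(1) by (auto simp: henselisation_def val_ring_eq_vge)
  have h: "\<iota> \<in> ring_hom F H" using vh by (simp add: valued_hom_def)
  interpret H: valring H B using hB by (simp add: henselian_def valuation_ring_valring)
  have Hf: "field H" by (rule H.field_axioms)
  interpret h: ring_hom_ring F H \<iota> by (intro ring_hom_ringI2 h ring_axioms H.ring_axioms)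
  define A where "A = q x"
  define D where "D = q y"
  define b where "b = bq x y"
  have c: "A \<in> carrier F" "D \<in> carrier F" "b \<in> carrier F" "A \<noteq> \<zero>" "D \<noteq> \<zero>" "b \<noteq> \<zero>"
    using xy nz by (auto simp: A_def D_def b_def)
  note i = inv_closed_nz[OF c(3,6)]
  define \<kappa> where "\<kappa> = A \<otimes> D \<otimes> (inv b \<otimes> inv b)"
  have \<kappa>: "\<kappa> \<in> carrier F" "\<kappa> \<noteq> \<zero>" "1 \<le> v \<kappa>"
    using c i neg by (auto simp: \<kappa>_def mult_nz v_mult v_inv A_def[symmetric] D_def[symmetric] b_def[symmetric])
  have \<kappa>b: "\<kappa> \<otimes> (b \<otimes> b) = A \<otimes> D"
  proof -
    have ic: "inv b \<in> carrier F" using i by simp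
    have "\<kappa> \<otimes> (b \<otimes> b) = A \<otimes> D \<otimes> ((b \<otimes> inv b) \<otimes> (b \<otimes> inv b))" unfolding \<kappa>_def using c ic by algebra
    thus ?thesis using i c by simp
  qed
  have \<kappa>B: "\<iota> \<kappa> \<in> B" using vh \<kappa> by (auto simp: valued_hom_def vge_def)
  have \<kappa>M: "\<iota> \<kappa> \<in> H.MA"
  proof -
    have "inv \<kappa> \<notin> vge F v 0" using \<kappa> inv_closed_nz[OF \<kappa>(1,2)] v_inv[OF \<kappa>(1,2)] by (simp add: vge_def)
    hence "\<iota> (inv \<kappa>) \<notin> B" using vh inv_closed_nz[OF \<kappa>(1,2)] by (auto simp: valued_hom_def)
    hence "inv\<^bsub>H\<^esub> (\<iota> \<kappa>) \<notin> B" using field_hom_inv(2)[OF field_axioms Hf h \<kappa>(1,2)] by simp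
    thus ?thesis using \<kappa>B H.U_iff by simp
  qed
  define k where "k = \<iota> \<kappa>"
  have kc: "k \<in> carrier H" using \<kappa> by (simp add: k_def)
  \<comment> \<open>Modulo the maximal ideal this is 1 - X, with the simple root 1.\<close>
  define p where "p = [k, \<ominus>\<^bsub>H\<^esub> \<one>\<^bsub>H\<^esub>, \<one>\<^bsub>H\<^esub>]"
  have k0: "k \<noteq> \<zero>\<^bsub>H\<^esub>" unfolding k_def using field_hom_inv(1)[OF field_axioms Hf h \<kappa>(1,2)] .
  have pp: "p \<in> carrier (univ_poly H B)" "set p \<subseteq> B"
    using \<kappa>B k0 H.A_one H.A_minus by (auto simp: univ_poly_carrier_iff p_def k_def)
  have ev: "H.eval p s = k \<otimes>\<^bsub>H\<^esub> (s \<otimes>\<^bsub>H\<^esub> s) \<ominus>\<^bsub>H\<^esub> s \<oplus>\<^bsub>H\<^esub> \<one>\<^bsub>H\<^esub>" if "s \<in> carrier H" for s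
    using that kc by (simp add: p_def numeral_2_eq_2 H.l_minus a_minus_def H.a_assoc)
  have pd: "H.eval (poly_deriv H p) \<one>\<^bsub>H\<^esub> = \<ominus>\<^bsub>H\<^esub> \<one>\<^bsub>H\<^esub> \<oplus>\<^bsub>H\<^esub> (k \<oplus>\<^bsub>H\<^esub> k)"
  proof -
    have "poly_deriv H p = [k \<oplus>\<^bsub>H\<^esub> k, \<ominus>\<^bsub>H\<^esub> \<one>\<^bsub>H\<^esub>]"
      using kc by (simp add: p_def poly_deriv_Cons poly_deriv_single H.add.nat_pow_Suc numeral_2_eq_2)
    thus ?thesis using kc by (simp add: H.a_comm)
  qed
  have oneU: "\<ominus>\<^bsub>H\<^esub> \<one>\<^bsub>H\<^esub> \<in> H.UA"
  proof -
    have "\<one>\<^bsub>H\<^esub> = (\<ominus>\<^bsub>H\<^esub> \<one>\<^bsub>H\<^esub>) \<otimes>\<^bsub>H\<^esub> (\<ominus>\<^bsub>H\<^esub> \<one>\<^bsub>H\<^esub>)" by (simp add: H.l_minus)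
    moreover have "\<one>\<^bsub>H\<^esub> \<in> H.UA" using H.A_one by (simp add: H.U_iff)
    ultimately show ?thesis using H.U_cancel[of "\<ominus>\<^bsub>H\<^esub> \<one>\<^bsub>H\<^esub>" "\<ominus>\<^bsub>H\<^esub> \<one>\<^bsub>H\<^esub>"] H.A_one H.A_minus by metis
  qed
  have kM: "k \<in> H.MA" using \<kappa>M by (simp add: k_def)
  have "H.eval p \<one>\<^bsub>H\<^esub> = k" using ev[of "\<one>\<^bsub>H\<^esub>"] kc by (simp, algebra)
  moreover have "H.eval (poly_deriv H p) \<one>\<^bsub>H\<^esub> \<in> H.UA" unfolding pd by (intro H.U_add_M oneU H.M_add kM)
  ultimately obtain s where s: "s \<in> B" "H.eval p s = \<zero>\<^bsub>H\<^esub>"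
    using hB pp(1) H.A_one kM unfolding henselian_def by metis
  have sc: "s \<in> carrier H" using s H.A_carrier by simp
  have root: "k \<otimes>\<^bsub>H\<^esub> (s \<otimes>\<^bsub>H\<^esub> s) \<ominus>\<^bsub>H\<^esub> s \<oplus>\<^bsub>H\<^esub> \<one>\<^bsub>H\<^esub> = \<zero>\<^bsub>H\<^esub>" using s ev[OF sc] by simp
  interpret E: qspace H "ES H" "EF H \<iota>" by (rule ext_qspace[OF Hf h])
  obtain cx where cx: "\<And>i. cx i \<in> carrier F" "x = vv cx" using coords_exist[OF xy(1)] by blast
  obtain cy where cy: "\<And>i. cy i \<in> carrier F" "y = vv cy" using coords_exist[OF xy(2)] by blast
  define X' where "X' = emv \<iota> cx"
  define Y' where "Y' = emv \<iota> cy"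
  have XY: "X' \<in> carrier (ES H)" "Y' \<in> carrier (ES H)" "EF H \<iota> X' = \<iota> A" "EF H \<iota> Y' = \<iota> D" "E.bq X' Y' = \<iota> b"
    unfolding X'_def Y'_def A_def D_def b_def
    using emv_closed[OF Hf h cx(1)] emv_closed[OF Hf h cy(1)] ext_form_emv[OF Hf h cx(1)] ext_form_emv[OF Hf h cy(1)]
      polar_emv[OF Hf h cx(1) cy(1)] cx(2) cy(2) by auto
  define t where "t = \<ominus>\<^bsub>H\<^esub> (\<iota> (A \<otimes> inv b) \<otimes>\<^bsub>H\<^esub> s)"
  define a1 where "a1 = \<iota> A"
  define d1 where "d1 = \<iota> D"
  define b1 where "b1 = \<iota> b"
  define j where "j = \<iota> (inv b)"
  have hc: "a1 \<in> carrier H" "d1 \<in> carrier H" "b1 \<in> carrier H" "j \<in> carrier H" "t \<in> carrier H"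
    using c i sc by (auto simp: a1_def d1_def b1_def j_def t_def)
  have jb: "j \<otimes>\<^bsub>H\<^esub> b1 = \<one>\<^bsub>H\<^esub>" unfolding j_def b1_def using i c h.hom_mult[of "inv b" b] by simp
  have kk: "k \<otimes>\<^bsub>H\<^esub> (b1 \<otimes>\<^bsub>H\<^esub> b1) = a1 \<otimes>\<^bsub>H\<^esub> d1" unfolding k_def b1_def a1_def d1_def using \<kappa>b \<kappa> c by (metis h.hom_mult m_closed)
  have te: "t = \<ominus>\<^bsub>H\<^esub> (a1 \<otimes>\<^bsub>H\<^esub> j \<otimes>\<^bsub>H\<^esub> s)" using c i by (simp add: t_def a1_def j_def)
  have tb: "t \<otimes>\<^bsub>H\<^esub> b1 = \<ominus>\<^bsub>H\<^esub> (a1 \<otimes>\<^bsub>H\<^esub> s)"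
  proof -
    have "t \<otimes>\<^bsub>H\<^esub> b1 = \<ominus>\<^bsub>H\<^esub> (a1 \<otimes>\<^bsub>H\<^esub> s \<otimes>\<^bsub>H\<^esub> (j \<otimes>\<^bsub>H\<^esub> b1))" unfolding te using hc sc by algebra
    thus ?thesis unfolding jb using hc sc by simp
  qed
  have td: "t \<otimes>\<^bsub>H\<^esub> d1 = \<ominus>\<^bsub>H\<^esub> (k \<otimes>\<^bsub>H\<^esub> b1 \<otimes>\<^bsub>H\<^esub> s)"
  proof -
    have "t \<otimes>\<^bsub>H\<^esub> d1 = \<ominus>\<^bsub>H\<^esub> ((a1 \<otimes>\<^bsub>H\<^esub> d1) \<otimes>\<^bsub>H\<^esub> j \<otimes>\<^bsub>H\<^esub> s)" unfolding te using hc sc by algebra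
    also have "\<dots> = \<ominus>\<^bsub>H\<^esub> (k \<otimes>\<^bsub>H\<^esub> b1 \<otimes>\<^bsub>H\<^esub> s \<otimes>\<^bsub>H\<^esub> (j \<otimes>\<^bsub>H\<^esub> b1))" unfolding kk[symmetric] using hc sc kc by algebra
    finally show ?thesis unfolding jb using hc sc kc by simp
  qed
  define Z where "Z = X' \<oplus>\<^bsub>ES H\<^esub> t \<odot>\<^bsub>ES H\<^esub> Y'"
  have Zc: "Z \<in> carrier (ES H)" using XY hc by (simp add: Z_def)
  have "EF H \<iota> Z = a1 \<oplus>\<^bsub>H\<^esub> t \<otimes>\<^bsub>H\<^esub> t \<otimes>\<^bsub>H\<^esub> d1 \<oplus>\<^bsub>H\<^esub> t \<otimes>\<^bsub>H\<^esub> b1"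
    unfolding Z_def using XY hc by (simp add: E.q_add E.q_smult E.polar_smult_r a1_def d1_def b1_def)
  also have "\<dots> = a1 \<oplus>\<^bsub>H\<^esub> (t \<otimes>\<^bsub>H\<^esub> (t \<otimes>\<^bsub>H\<^esub> d1)) \<oplus>\<^bsub>H\<^esub> t \<otimes>\<^bsub>H\<^esub> b1" using hc by (simp add: H.m_assoc)
  also have "t \<otimes>\<^bsub>H\<^esub> (t \<otimes>\<^bsub>H\<^esub> d1) = \<ominus>\<^bsub>H\<^esub> ((t \<otimes>\<^bsub>H\<^esub> b1) \<otimes>\<^bsub>H\<^esub> (k \<otimes>\<^bsub>H\<^esub> s))"
    unfolding td using hc kc sc by algebra
  also have "a1 \<oplus>\<^bsub>H\<^esub> \<ominus>\<^bsub>H\<^esub> ((t \<otimes>\<^bsub>H\<^esub> b1) \<otimes>\<^bsub>H\<^esub> (k \<otimes>\<^bsub>H\<^esub> s)) \<oplus>\<^bsub>H\<^esub> t \<otimes>\<^bsub>H\<^esub> b1 =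
      a1 \<otimes>\<^bsub>H\<^esub> (k \<otimes>\<^bsub>H\<^esub> (s \<otimes>\<^bsub>H\<^esub> s) \<ominus>\<^bsub>H\<^esub> s \<oplus>\<^bsub>H\<^esub> \<one>\<^bsub>H\<^esub>)"
    unfolding tb using hc kc sc by algebra
  also have "\<dots> = \<zero>\<^bsub>H\<^esub>" unfolding root using hc by simp
  finally have "Z = \<zero>\<^bsub>ES H\<^esub>" using H(2) Zc by (simp add: anisotropic_def)
  \<comment> \<open>Anisotropy forces Z = 0, so X' is a multiple of Y'. Pairing with Y' then gives 1
    = 2 k s, although the right-hand side lies in the maximal ideal.\<close>
  hence "E.bq Z Y' = \<zero>\<^bsub>H\<^esub>" "E.bq Z X' = \<zero>\<^bsub>H\<^esub>" using XY by simp_all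
  moreover have "E.bq Y' X' = b1" using E.polar_sym XY by (simp add: b1_def)
  ultimately have e1: "b1 \<oplus>\<^bsub>H\<^esub> t \<otimes>\<^bsub>H\<^esub> (d1 \<oplus>\<^bsub>H\<^esub> d1) = \<zero>\<^bsub>H\<^esub>" and e2: "(a1 \<oplus>\<^bsub>H\<^esub> a1) \<oplus>\<^bsub>H\<^esub> t \<otimes>\<^bsub>H\<^esub> b1 = \<zero>\<^bsub>H\<^esub>"
    unfolding Z_def using XY hc
    by (simp_all add: E.polar_add_l E.polar_smult_l E.polar_self a1_def d1_def b1_def)
  have bnz: "a1 \<noteq> \<zero>\<^bsub>H\<^esub>" "b1 \<noteq> \<zero>\<^bsub>H\<^esub>" unfolding a1_def b1_def
    using field_hom_inv(1)[OF field_axioms Hf h] c by blast+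
  have "b1 \<otimes>\<^bsub>H\<^esub> (\<one>\<^bsub>H\<^esub> \<ominus>\<^bsub>H\<^esub> (k \<oplus>\<^bsub>H\<^esub> k) \<otimes>\<^bsub>H\<^esub> s) = b1 \<oplus>\<^bsub>H\<^esub> (t \<otimes>\<^bsub>H\<^esub> d1 \<oplus>\<^bsub>H\<^esub> t \<otimes>\<^bsub>H\<^esub> d1)"
    unfolding td using hc kc sc by algebra
  also have "\<dots> = \<zero>\<^bsub>H\<^esub>" using e1 hc by (simp add: H.r_distr)
  finally have "\<one>\<^bsub>H\<^esub> \<ominus>\<^bsub>H\<^esub> (k \<oplus>\<^bsub>H\<^esub> k) \<otimes>\<^bsub>H\<^esub> s = \<zero>\<^bsub>H\<^esub>" using bnz(2) hc(3) kc sc H.integral by blast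
  hence "\<one>\<^bsub>H\<^esub> = (k \<oplus>\<^bsub>H\<^esub> k) \<otimes>\<^bsub>H\<^esub> s" using kc sc by simp
  moreover have "(k \<oplus>\<^bsub>H\<^esub> k) \<otimes>\<^bsub>H\<^esub> s \<in> H.MA" by (intro H.M_multr s H.M_add kM)
  moreover have "\<one>\<^bsub>H\<^esub> \<in> H.UA" using H.A_one by (simp add: H.U_iff)
  ultimately show False by simp
qed

end

section \<open>Local and generic pairs\<close>

lemma (in field) cform_coeff_cong:
  assumes "\<And>i. i < n \<Longrightarrow> a i = a' i" "\<And>i j. i < n \<Longrightarrow> j < n \<Longrightarrow> B i j = B' i j"
    "\<And>i. i < n \<Longrightarrow> a' i \<in> carrier R" "\<And>i j. i < n \<Longrightarrow> j < n \<Longrightarrow> B' i j \<in> carrier R" "\<And>i. i < n \<Longrightarrow> x i \<in> carrier R"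
  shows "cform R a B n x = cform R a' B' n x"
  unfolding cform_def by (intro arg_cong2[where f = "(\<oplus>)"] finsum_cong') (use assms in auto)

text \<open>The two discriminants are -3 and 5, with sum 2. If both vanished, the characteristic
  would be 2, where they equal 1. A constant invariant is wanted because nonzero constants are units
  at every place.\<close>

lemma (in field) disc_const_exists: "\<exists>k\<in>{\<one>, \<ominus> \<one>}. disc k \<noteq> \<zero>"
proof (rule ccontr)
  assume "\<not> ?thesis"
  hence z: "disc \<one> = \<zero>" "disc (\<ominus> \<one>) = \<zero>" by auto
  have "\<one> = (\<one> \<oplus> \<one>) \<otimes> (disc (\<ominus> \<one>) \<ominus> \<one> \<ominus> \<one>) \<oplus> (disc \<one> \<oplus> disc (\<ominus> \<one>)) \<ominus> (\<one> \<oplus> \<one> \<oplus> \<one> \<oplus> \<one> \<oplus> \<one>) \<oplus> \<zero>" if "\<one> \<oplus> \<one> = \<zero>"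
  proof -
    have "disc \<one> = \<one> \<ominus> ((\<one> \<oplus> \<one>) \<oplus> (\<one> \<oplus> \<one>))" unfolding disc_def by algebra
    hence "disc \<one> = \<one>" unfolding that by (simp add: a_minus_def)
    thus ?thesis using z by simp
  qed
  moreover have "\<one> \<oplus> \<one> = disc (\<ominus> \<one>) \<oplus> disc \<one>" unfolding disc_def by algebra
  ultimately have 2: "\<one> \<oplus> \<one> = \<zero>" using z by simp
  have "disc \<one> = \<one> \<ominus> ((\<one> \<oplus> \<one>) \<oplus> (\<one> \<oplus> \<one>))" unfolding disc_def by algebra
  hence "disc \<one> = \<one>" unfolding 2 by (simp add: a_minus_def)
  thus False using z by simp
qed

lemma (in field) minus_one_nonzero: "\<ominus> \<one> \<noteq> \<zero>"
  by (metis minus_minus minus_zero one_closed zero_not_one)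

text \<open>\<open>nondegenerate\<close> ranges over fields whose elements have type
  \<open>nat \<Rightarrow> 'a\<close>. Constant functions make F itself one of them.\<close>

definition copy :: "('a, 'm) ring_scheme \<Rightarrow> (nat \<Rightarrow> 'a) ring" where
  "copy F = \<lparr>carrier = (\<lambda>x _. x) ` carrier F, mult = (\<lambda>s t _. s 0 \<otimes>\<^bsub>F\<^esub> t 0), one = (\<lambda>_. \<one>\<^bsub>F\<^esub>),
     zero = (\<lambda>_. \<zero>\<^bsub>F\<^esub>), add = (\<lambda>s t _. s 0 \<oplus>\<^bsub>F\<^esub> t 0)\<rparr>"

lemma (in field) copy_field: "field (copy R)" and copy_hom: "(\<lambda>x _. x) \<in> ring_hom R (copy R)"
proof -
  show h: "(\<lambda>x _. x) \<in> ring_hom R (copy R)" by (rule ring_hom_memI) (auto simp: copy_def)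
  have "inj_on (\<lambda>x (_::nat). x) (carrier R)" by (rule inj_onI) (metis)
  hence "(\<lambda>x _. x) \<in> ring_iso R (copy R)" using h by (simp add: ring_iso_def bij_betw_def copy_def)
  from ring_iso_imp_img_field[OF this] show "field (copy R)" by (simp add: copy_def)
qed

context qform
begin

lemma nondegenerate_regular:
  fixes L :: "(nat \<Rightarrow> 'a) ring"
  assumes "nondegenerate F V q" "field L" "\<phi> \<in> ring_hom F L"
  shows "regular L (ES L) (EF L \<phi>)"
  using assms by (simp add: nondegenerate_def)

lemma emv_nonzero:
  assumes L: "field L" and h: "\<phi> \<in> ring_hom F L" and c: "\<And>i. c i \<in> carrier F" and nz: "vv c \<noteq> \<zero>\<^bsub>V\<^esub>"
  shows "emv \<phi> c \<noteq> \<zero>\<^bsub>ES L\<^esub>"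
proof
  assume z: "emv \<phi> c = \<zero>\<^bsub>ES L\<^esub>"
  interpret L: field L by (rule L)
  have "c i = \<zero>" if "i < nn" for i
  proof -
    have "\<phi> (c i) = \<zero>\<^bsub>L\<^esub>"
      using fun_cong[OF z, of i] that by (simp add: ext_space_eq[OF L h] L.func_space_simps emv_def)
    thus ?thesis using field_hom_inv(1)[OF field_axioms L h c] by blast
  qed
  hence "vv c = vv (\<lambda>_. \<zero>)" by (intro vec_cong) auto
  also have "\<dots> = \<zero>\<^bsub>V\<^esub>"
  proof -
    have "vec ee (\<lambda>_. \<zero>) m = \<zero>\<^bsub>V\<^esub>" if "m \<le> nn" for m using that by (induct m) (auto simp: ee_closed)
    thus ?thesis by simp
  qed
  finally show False using nz by simp
qed

text \<open>
  Outside \<open>\<Delta>\<^sub>K q\<close> the form is isotropic over the completion, hence represents there a plane with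
  prescribed invariant; the plane is then approximated over \<open>F\<close>.
\<close>

lemma local_pair:
  assumes nd: "nondegenerate F V q" and n3: "3 \<le> nn" and K: "subfield K F"
    and v: "v \<in> valuations F K" "v \<notin> Delta F K V q"
  shows "\<exists>y z. valued_qspace.gpair F V q v y z"
proof -
  interpret valued_field F v by (rule valuations_valued_field[OF field_axioms v(1)])
  interpret vq: valued_qspace F V q v by unfold_locales
  interpret CF: completed_field F v compl vcompl emb by (rule completion)
  have Cf: "field compl" by (rule CF.C.field_axioms)
  note h = CF.hom
  obtain H :: "(nat \<Rightarrow> 'a) ring" and B \<iota> where H: "henselisation F (val_ring F v) H B \<iota>" "\<not> anisotropic H (ES H) (EF H \<iota>)"
    using v by (auto simp: Delta_def)
  obtain W where W: "W \<in> carrier (ES H)" "EF H \<iota> W = \<zero>\<^bsub>H\<^esub>" "W \<noteq> \<zero>\<^bsub>ES H\<^esub>"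
    using H(2) by (auto simp: anisotropic_def)
  have hH: "\<iota> \<in> ring_hom F H" and Hf: "field H"
    using H(1) by (auto simp: henselisation_def valued_hom_def henselian_def valuation_ring_def)
  interpret H: field H by (rule Hf)
  have embv: "emb \<in> valued_hom F (val_ring F v) compl (vge compl vcompl 0)"
    using CF.hom CF.emb_vge by (simp add: valued_hom_def val_ring_eq_vge)
  \<comment> \<open>The completion is a henselian extension of F, so the universal property embeds H
    into it and carries the isotropic vector W along.\<close>
  have "\<forall>(E :: (nat \<Rightarrow> 'a) ring) C \<phi>. henselian E C \<and> \<phi> \<in> valued_hom F (val_ring F v) E C \<longrightarrow>
        (\<exists>!\<psi>. \<psi> \<in> valued_hom H B E C \<and> \<psi> \<in> extensional (carrier H) \<and> (\<forall>x\<in>carrier F. \<psi> (\<iota> x) = \<phi> x))"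
    using H(1) unfolding henselisation_def by (elim conjE)
  from this[rule_format, OF conjI[OF CF.henselian_completion embv]]
  obtain \<psi> where \<psi>0: "\<psi> \<in> valued_hom H B compl (vge compl vcompl 0)" "\<forall>x\<in>carrier F. \<psi> (\<iota> x) = emb x"
    by (elim ex1E conjE)
  have \<psi>: "\<psi> \<in> ring_hom H compl" "\<And>x. x \<in> carrier F \<Longrightarrow> \<psi> (\<iota> x) = emb x"
    using \<psi>0 by (simp_all add: valued_hom_def)
  define X' where "X' = (\<lambda>i\<in>{..<nn}. \<psi> (W i))"
  have Wc: "i < nn \<Longrightarrow> W i \<in> carrier H" for i using W(1) by (auto simp: ext_space_eq[OF Hf hH] H.func_space_simps)
  have Wp: "i < nn \<Longrightarrow> \<psi> (W i) \<in> carrier compl" for i using ring_hom_closed[OF \<psi>(1) Wc] .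
  have X'c: "X' \<in> carrier (ES compl)" using Wp by (auto simp: X'_def ext_space_eq[OF Cf h] CF.C.func_space_simps)
  interpret E: qspace compl "ES compl" "EF compl emb" by (rule ext_qspace[OF Cf h])
  interpret E: valued_qspace compl "ES compl" "EF compl emb" vcompl
    by (intro valued_qspace.intro E.qspace_axioms CF.C.valued_field_axioms)
  have qc: "i < nn \<Longrightarrow> q (ee i) \<in> carrier F" "i < nn \<Longrightarrow> j < nn \<Longrightarrow> bq (ee i) (ee j) \<in> carrier F" for i j
    using ee_closed by auto
  have "EF compl emb X' = cform compl (\<lambda>i. emb (q (ee i))) (\<lambda>i j. emb (bq (ee i) (ee j))) nn (\<lambda>i. \<psi> (W i))"
    unfolding ext_form_eq[OF Cf h] by (rule CF.C.cform_cong) (use qc Wp CF.emb_closed in \<open>auto simp: X'_def\<close>)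
  also have "\<dots> = cform compl (\<lambda>i. \<psi> (\<iota> (q (ee i)))) (\<lambda>i j. \<psi> (\<iota> (bq (ee i) (ee j)))) nn (\<lambda>i. \<psi> (W i))"
    by (rule CF.C.cform_coeff_cong) (use qc Wp CF.emb_closed \<psi>(2) in auto)
  also have "\<dots> = \<psi> (cform H (\<lambda>i. \<iota> (q (ee i))) (\<lambda>i j. \<iota> (bq (ee i) (ee j))) nn W)"
    by (rule cform_hom[OF Hf Cf \<psi>(1)]) (use qc Wc ring_hom_closed[OF hH] in auto)
  also have "\<dots> = \<psi> \<zero>\<^bsub>H\<^esub>" using W(2) unfolding ext_form_eq[OF Hf hH] by simp
  also have "\<dots> = \<zero>\<^bsub>compl\<^esub>" by (rule ring_hom_zero[OF \<psi>(1) H.ring_axioms CF.C.ring_axioms])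
  finally have X'0: "EF compl emb X' = \<zero>\<^bsub>compl\<^esub>" .
  have X'nz: "X' \<noteq> \<zero>\<^bsub>ES compl\<^esub>"
  proof
    assume z: "X' = \<zero>\<^bsub>ES compl\<^esub>"
    have "W i = \<zero>\<^bsub>H\<^esub>" if i: "i < nn" for i
    proof -
      have "\<psi> (W i) = \<zero>\<^bsub>compl\<^esub>"
        using fun_cong[OF z, of i] i by (simp add: X'_def ext_space_eq[OF Cf h] CF.C.func_space_simps)
      thus ?thesis using field_hom_inv(1)[OF Hf Cf \<psi>(1) Wc[OF i]] by blast
    qed
    hence "W = \<zero>\<^bsub>ES H\<^esub>" using W(1)
      by (auto simp: ext_space_eq[OF Hf hH] H.func_space_simps fun_eq_iff restrict_def PiE_def extensional_def)
    thus False using W(3) by simp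
  qed
  \<comment> \<open>The invariant to be represented is taken from K, so that it and its discriminant
    are units at v.\<close>
  obtain k0 where k0: "k0 \<in> {\<one>, \<ominus> \<one>}" "disc k0 \<noteq> \<zero>" using disc_const_exists by blast
  have k0K: "k0 \<in> K" "disc k0 \<in> K"
    using k0(1) subringE[OF subfieldE(1)[OF K]] by (auto simp: disc_def a_minus_def)
  have k0c: "k0 \<in> carrier F" "k0 \<noteq> \<zero>" using k0(1) minus_one_nonzero one_not_zero by (metis a_inv_closed insertE one_closed singletonD)+
  have u: "unit_at F v k0" "unit_at F v (disc k0)"
    using valuations_const[OF v(1)] k0K k0 k0c by (auto simp: unit_at_def)
  obtain e0 e1 e2 where e: "E.indep3 e0 e1 e2" using ext_indep3[OF Cf h n3] by blast
  obtain Y Z where YZ: "Y \<in> carrier (ES compl)" "Z \<in> carrier (ES compl)" "E.bq Y Z = \<one>\<^bsub>compl\<^esub>"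
    "EF compl emb Y \<otimes>\<^bsub>compl\<^esub> EF compl emb Z = emb k0"
    using E.isotropic_represents[OF nondegenerate_regular[OF nd Cf h] e X'c X'nz X'0 CF.emb_closed[OF k0c(1)]] by blast
  let ?U = "\<lambda>i. \<lambda>j\<in>{..<nn}. if j = i then \<one>\<^bsub>compl\<^esub> else \<zero>\<^bsub>compl\<^esub>"
  have Uc: "?U i \<in> carrier (ES compl)" for i by (auto simp: ext_space_eq[OF Cf h] CF.C.func_space_simps)
  obtain N where N: "\<And>d d'. (\<forall>i<nn. d i \<in> vge compl vcompl N) \<Longrightarrow> (\<forall>i<nn. d' i \<in> vge compl vcompl N) \<Longrightarrow>
    E.bq (Y \<oplus>\<^bsub>ES compl\<^esub> E.vec ?U d nn) (Z \<oplus>\<^bsub>ES compl\<^esub> E.vec ?U d' nn) \<ominus>\<^bsub>compl\<^esub> \<one>\<^bsub>compl\<^esub> \<in> vge compl vcompl 1 \<and>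
    EF compl emb (Y \<oplus>\<^bsub>ES compl\<^esub> E.vec ?U d nn) \<otimes>\<^bsub>compl\<^esub> EF compl emb (Z \<oplus>\<^bsub>ES compl\<^esub> E.vec ?U d' nn)
      \<ominus>\<^bsub>compl\<^esub> emb k0 \<in> vge compl vcompl 1"
    using E.pair_continuous[where n = nn and e = ?U, OF Uc YZ(1,2)] unfolding YZ(3,4) by blast
  \<comment> \<open>Density in each coordinate: a small perturbation along the unit vectors moves
    any vector over the completion into the image of V.\<close>
  have appr: "\<exists>c d. (\<forall>i. c i \<in> carrier F) \<and> (\<forall>i<nn. d i \<in> vge compl vcompl N) \<and> Y \<oplus>\<^bsub>ES compl\<^esub> E.vec ?U d nn = emv emb c"
    if Y: "Y \<in> carrier (ES compl)" for Y
  proof -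
    have Yi: "i < nn \<Longrightarrow> Y i \<in> carrier compl" for i using Y by (auto simp: ext_space_eq[OF Cf h] CF.C.func_space_simps)
    have "\<exists>x\<in>carrier F. i < nn \<longrightarrow> Y i \<ominus>\<^bsub>compl\<^esub> emb x \<in> vge compl vcompl N" for i
      using CF.dense[OF Yi, of i N] by (cases "i < nn") auto
    then obtain c where c: "\<And>i. c i \<in> carrier F" "\<And>i. i < nn \<Longrightarrow> Y i \<ominus>\<^bsub>compl\<^esub> emb (c i) \<in> vge compl vcompl N" by metis
    define d where "d = (\<lambda>i\<in>{..<nn}. emb (c i) \<ominus>\<^bsub>compl\<^esub> Y i)"
    have dv: "d i \<in> vge compl vcompl N" if i: "i < nn" for i
    proof -
      have "emb (c i) \<ominus>\<^bsub>compl\<^esub> Y i = \<ominus>\<^bsub>compl\<^esub> (Y i \<ominus>\<^bsub>compl\<^esub> emb (c i))"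
        using Yi[OF i] CF.emb_closed[OF c(1)] by algebra
      thus ?thesis using CF.C.vge_minus[OF c(2)[OF i]] i by (simp add: d_def)
    qed
    have dc: "d \<in> carrier (ES compl)"
      using CF.C.vge_carrier[OF dv] by (auto simp: ext_space_eq[OF Cf h] CF.C.func_space_simps d_def)
    have "E.vec ?U d nn = d"
      using CF.C.func_space_unit_vec[of d nn "EF compl emb"] dc E.qspace_axioms unfolding ext_space_eq[OF Cf h] by simp
    moreover have "Y i \<oplus>\<^bsub>compl\<^esub> (emb (c i) \<ominus>\<^bsub>compl\<^esub> Y i) = emb (c i)" if "i < nn" for i
      using Yi[OF that] CF.emb_closed[OF c(1)] by algebra
    hence "Y \<oplus>\<^bsub>ES compl\<^esub> d = emv emb c"
      by (auto simp: ext_space_eq[OF Cf h] CF.C.func_space_simps emv_def d_def fun_eq_iff)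
    ultimately have "Y \<oplus>\<^bsub>ES compl\<^esub> E.vec ?U d nn = emv emb c" by simp
    thus ?thesis using c(1) dv by (intro exI[of _ c] exI[of _ d]) auto
  qed
  obtain cy dy where cy: "\<And>i. cy i \<in> carrier F" "\<forall>i<nn. dy i \<in> vge compl vcompl N"
    "Y \<oplus>\<^bsub>ES compl\<^esub> E.vec ?U dy nn = emv emb cy" using appr[OF YZ(1)] by blast
  obtain cz dz where cz: "\<And>i. cz i \<in> carrier F" "\<forall>i<nn. dz i \<in> vge compl vcompl N"
    "Z \<oplus>\<^bsub>ES compl\<^esub> E.vec ?U dz nn = emv emb cz" using appr[OF YZ(2)] by blast
  define y where "y = vv cy"
  define z where "z = vv cz"
  have yz: "y \<in> carrier V" "z \<in> carrier V" unfolding y_def z_def using vv_closed cy(1) cz(1) by auto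
  have c: "q y \<in> carrier F" "q z \<in> carrier F" "bq y z \<in> carrier F" using yz by auto
  note cl = N[OF cy(2) cz(2), unfolded cy(3) cz(3) polar_emv[OF Cf h cy(1) cz(1)] ext_form_emv[OF Cf h cy(1)] ext_form_emv[OF Cf h cz(1)],
      folded y_def z_def]
  have "emb (bq y z \<ominus> \<one>) = emb (bq y z) \<ominus>\<^bsub>compl\<^esub> \<one>\<^bsub>compl\<^esub>" "emb (q y \<otimes> q z \<ominus> k0) = emb (q y) \<otimes>\<^bsub>compl\<^esub> emb (q z) \<ominus>\<^bsub>compl\<^esub> emb k0"
    using c k0c by (simp_all add: a_minus_def)
  hence cl': "bq y z \<ominus> \<one> \<in> vge F v 1" "q y \<otimes> q z \<ominus> k0 \<in> vge F v 1"
    using cl CF.emb_vge[of "bq y z \<ominus> \<one>" 1] CF.emb_vge[of "q y \<otimes> q z \<ominus> k0" 1] c k0c by auto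
  note np = normalised_pair_close[OF u _ cl'(2) c(3) cl'(1)]
  show ?thesis using vq.gpair_normalise[OF yz] np c by blast
qed

text \<open>Settles the case without any places. If q is isotropic over F,
  \<open>isotropic_represents\<close> applies. If it is anisotropic and 2 is nonzero, two orthogonal
  vectors of norms A and D lead to the discriminant - D / A. In characteristic 2 the discriminant is
  1, and what remains is to exclude b = 0.\<close>

lemma generic_pair:
  assumes nd: "nondegenerate F V q" and n3: "3 \<le> nn"
  shows "\<exists>y z. y \<in> carrier V \<and> z \<in> carrier V \<and> bq y z = \<one> \<and> q y \<otimes> q z \<noteq> \<zero> \<and> disc (q y \<otimes> q z) \<noteq> \<zero>"
proof -
  define L where "L = copy F"
  define h where "h = (\<lambda>(x::'a) (_::nat). x)"
  have Lf: "field L" and hh: "h \<in> ring_hom F L" unfolding L_def h_def using copy_field copy_hom by auto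
  interpret L: field L by (rule Lf)
  interpret h: ring_hom_ring F L h by (intro ring_hom_ringI2 hh ring_axioms L.ring_axioms)
  have hinj: "h x = h y \<Longrightarrow> x = y" for x y by (simp add: h_def fun_eq_iff)
  have hsurj: "s \<in> carrier L \<Longrightarrow> \<exists>x\<in>carrier F. s = h x" for s by (auto simp: L_def copy_def h_def)
  show ?thesis
  proof (cases "\<exists>x\<in>carrier V. x \<noteq> \<zero>\<^bsub>V\<^esub> \<and> q x = \<zero>")
    case True
    then obtain c where c: "\<And>i. c i \<in> carrier F" "vv c \<noteq> \<zero>\<^bsub>V\<^esub>" "q (vv c) = \<zero>" using coords_exist by metis
    interpret E: qspace L "ES L" "EF L h" by (rule ext_qspace[OF Lf hh])
    obtain e0 e1 e2 where e: "E.indep3 e0 e1 e2" using ext_indep3[OF Lf hh n3] by blast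
    obtain k0 where k0: "k0 \<in> {\<one>, \<ominus> \<one>}" "disc k0 \<noteq> \<zero>" using disc_const_exists by blast
    have k0c: "k0 \<in> carrier F" "k0 \<noteq> \<zero>" using k0(1) minus_one_nonzero one_not_zero by (metis a_inv_closed insertE one_closed singletonD)+
    have X: "emv h c \<in> carrier (ES L)" "emv h c \<noteq> \<zero>\<^bsub>ES L\<^esub>" "EF L h (emv h c) = \<zero>\<^bsub>L\<^esub>"
      using emv_closed[OF Lf hh c(1)] emv_nonzero[OF Lf hh c(1,2)] ext_form_emv[OF Lf hh c(1)] c(3) by auto
    obtain Y Z where YZ: "Y \<in> carrier (ES L)" "Z \<in> carrier (ES L)" "E.bq Y Z = \<one>\<^bsub>L\<^esub>" "EF L h Y \<otimes>\<^bsub>L\<^esub> EF L h Z = h k0"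
      using E.isotropic_represents[OF nondegenerate_regular[OF nd Lf hh] e X h.hom_closed[OF k0c(1)]] by blast
    have pre: "\<exists>c. (\<forall>i. c i \<in> carrier F) \<and> Y = emv h c" if Y: "Y \<in> carrier (ES L)" for Y
    proof -
      have "\<exists>x\<in>carrier F. i < nn \<longrightarrow> Y i = h x" for i
        using hsurj[of "Y i"] Y by (cases "i < nn") (auto simp: ext_space_eq[OF Lf hh] L.func_space_simps PiE_def Pi_def)
      then obtain c where "\<And>i. c i \<in> carrier F" "\<And>i. i < nn \<Longrightarrow> Y i = h (c i)" by metis
      thus ?thesis using Y
        by (intro exI[of _ c]) (auto simp: emv_def ext_space_eq[OF Lf hh] L.func_space_simps fun_eq_iff PiE_def extensional_def)
    qed
    obtain cy where cy: "\<And>i. cy i \<in> carrier F" "Y = emv h cy" using pre[OF YZ(1)] by blast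
    obtain cz where cz: "\<And>i. cz i \<in> carrier F" "Z = emv h cz" using pre[OF YZ(2)] by blast
    have vc: "vv cy \<in> carrier V" "vv cz \<in> carrier V" using vv_closed cy cz by auto
    have "h (bq (vv cy) (vv cz)) = h \<one>" using YZ(3) polar_emv[OF Lf hh cy(1) cz(1)] cy(2) cz(2) by simp
    moreover have "h (q (vv cy) \<otimes> q (vv cz)) = h k0"
      using YZ(4) ext_form_emv[OF Lf hh cy(1)] ext_form_emv[OF Lf hh cz(1)] cy(2) cz(2) vc by simp
    ultimately have "bq (vv cy) (vv cz) = \<one>" "q (vv cy) \<otimes> q (vv cz) = k0" using hinj by blast+
    thus ?thesis using vc k0 k0c by blast
  next
    case False
    hence an: "\<And>x. x \<in> carrier V \<Longrightarrow> q x = \<zero> \<Longrightarrow> x = \<zero>\<^bsub>V\<^esub>" by blast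
    define f where "f = (\<lambda>k. vv (\<lambda>i. if i = k then \<one> else \<zero>))"
    have fc: "f k \<in> carrier V" for k unfolding f_def by (rule vv_closed) auto
    have f01: "a = \<zero> \<and> b = \<zero>" if "a \<in> carrier F" "b \<in> carrier F" "a \<odot>\<^bsub>V\<^esub> f 0 \<oplus>\<^bsub>V\<^esub> b \<odot>\<^bsub>V\<^esub> f 1 = \<zero>\<^bsub>V\<^esub>" for a b
    proof -
      let ?c = "\<lambda>i::nat. a \<otimes> (if i = 0 then \<one> else \<zero>) \<oplus> b \<otimes> (if i = 1 then \<one> else \<zero>)"
      have "vv ?c = a \<odot>\<^bsub>V\<^esub> f 0 \<oplus>\<^bsub>V\<^esub> b \<odot>\<^bsub>V\<^esub> f 1"
        unfolding f_def using that(1,2) ee_closed by (subst vec_add) (auto simp: vec_smult)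
      hence "vv ?c = \<zero>\<^bsub>V\<^esub>" using that by simp
      hence z: "i < nn \<Longrightarrow> ?c i = \<zero>" for i by (rule vec_zero_imp[rotated 1]) (use that(1,2) in auto)
      have "0 < nn" "1 < nn" using n3 by linarith+
      thus ?thesis using that(1,2) z[of 0] z[of 1] by simp
    qed
    show ?thesis
    proof (cases "\<one> \<oplus> \<one> = \<zero>")
      case False
      define A where "A = q (f 0)"
      have f0: "f 0 \<noteq> \<zero>\<^bsub>V\<^esub>" using f01[of \<one> \<zero>] fc by auto
      have A: "A \<in> carrier F" "A \<noteq> \<zero>" using an f0 fc by (auto simp: A_def)
      define w where "w = A \<oplus> A"
      have "w = (\<one> \<oplus> \<one>) \<otimes> A" unfolding w_def using A(1) by (simp add: l_distr)
      hence wf: "w = \<zero> \<Longrightarrow> (\<one> \<oplus> \<one>) \<otimes> A = \<zero>" by simp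
      have w: "w \<in> carrier F" "w \<noteq> \<zero>" using A(1) integral[OF wf add.m_closed[OF one_closed one_closed] A(1)] A(2) False by (auto simp: w_def)
      have i: "inv w \<in> carrier F" "inv w \<noteq> \<zero>" "w \<otimes> inv w = \<one>" using field_Units w Units_inv_Units by auto
      define p where "p = bq (f 0) (f 1)"
      have p: "p \<in> carrier F" using fc by (simp add: p_def)
      have bfw: "bq (f 0) (f 0) = w" using fc by (simp add: polar_self w_def A_def)
      \<comment> \<open>Gram-Schmidt: the component of f 1 along f 0 is removed, where b(f 0, f 0) =
        w.\<close>
      define y where "y = f 1 \<oplus>\<^bsub>V\<^esub> \<ominus> (p \<otimes> inv w) \<odot>\<^bsub>V\<^esub> f 0"
      have yc: "y \<in> carrier V" using fc p i by (simp add: y_def)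
      have "bq (f 0) y = p \<ominus> p \<otimes> (w \<otimes> inv w)"
      proof -
        have "bq (f 0) y = p \<oplus> \<ominus> (p \<otimes> inv w) \<otimes> w"
          unfolding y_def using bfw fc p i by (simp add: polar_add_r polar_smult_r p_def[symmetric] del: One_nat_def)
        also have "\<dots> = p \<ominus> p \<otimes> (w \<otimes> inv w)" using p i(1) w(1) by algebra
        finally show ?thesis .
      qed
      hence by0: "bq (f 0) y = \<zero>" using i p by (simp add: a_minus_def r_neg)
      have lin: "a \<odot>\<^bsub>V\<^esub> f 0 \<oplus>\<^bsub>V\<^esub> y \<noteq> \<zero>\<^bsub>V\<^esub>" if a: "a \<in> carrier F" for a
      proof
        assume z: "a \<odot>\<^bsub>V\<^esub> f 0 \<oplus>\<^bsub>V\<^esub> y = \<zero>\<^bsub>V\<^esub>"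
        have "(a \<ominus> p \<otimes> inv w) \<odot>\<^bsub>V\<^esub> f 0 \<oplus>\<^bsub>V\<^esub> \<one> \<odot>\<^bsub>V\<^esub> f 1 = a \<odot>\<^bsub>V\<^esub> f 0 \<oplus>\<^bsub>V\<^esub> y"
          using fc a p i by (simp add: y_def a_minus_def V.smult_l_distr V.a_ac)
        thus False using z f01[of "a \<ominus> p \<otimes> inv w" \<one>] a p i by simp
      qed
      define D where "D = q y"
      have D: "D \<in> carrier F" "D \<noteq> \<zero>" using an[OF yc] lin[of \<zero>] yc fc by (auto simp: D_def)
      have s: "f 0 \<oplus>\<^bsub>V\<^esub> y \<noteq> \<zero>\<^bsub>V\<^esub>" using lin[of \<one>] fc by simp
      have qs: "q (f 0 \<oplus>\<^bsub>V\<^esub> y) = A \<oplus> D" using fc yc by0 A D by (simp add: q_add A_def D_def)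
      have AD: "A \<oplus> D \<noteq> \<zero>" using an s fc yc qs by force
      \<comment> \<open>Scaled to b(f 0, z) = 1. The product of the norms of f 0 and z becomes (A +
        D) / (4 A).\<close>
      define z where "z = inv w \<odot>\<^bsub>V\<^esub> (f 0 \<oplus>\<^bsub>V\<^esub> y)"
      have z: "z \<in> carrier V" using fc yc i by (simp add: z_def)
      have 1: "bq (f 0) z = \<one>"
        unfolding z_def using fc yc i by0 w by (simp add: polar_smult_r polar_add_r bfw m_comm)
      have qz: "q z = inv w \<otimes> inv w \<otimes> (A \<oplus> D)" unfolding z_def using fc yc i qs by (simp add: q_smult)
      define P where "P = q (f 0) \<otimes> q z"
      have P: "P = A \<otimes> (inv w \<otimes> inv w \<otimes> (A \<oplus> D))" by (simp add: P_def qz A_def)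
      have "inv w \<otimes> inv w \<otimes> (A \<oplus> D) \<noteq> \<zero>"
        using integral[of "inv w \<otimes> inv w" "A \<oplus> D"] integral[of "inv w" "inv w"] i AD A D by auto
      hence P0: "P \<noteq> \<zero>" unfolding P using integral[of A "inv w \<otimes> inv w \<otimes> (A \<oplus> D)"] A D i by auto
      have "disc P \<otimes> A = A \<ominus> (w \<otimes> inv w) \<otimes> (w \<otimes> inv w) \<otimes> (A \<oplus> D)"
      proof -
        define e where "e = A \<otimes> inv w"
        define s where "s = A \<oplus> D"
        have c: "e \<in> carrier F" "s \<in> carrier F" using A D i by (auto simp: e_def s_def)
        have Pc: "P \<in> carrier F" using A D i by (simp add: P)
        have 1: "w \<otimes> inv w = e \<oplus> e" unfolding e_def w_def using A i by (simp add: l_distr w_def)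
        have 2: "A \<otimes> P = e \<otimes> e \<otimes> s" unfolding P e_def s_def[symmetric] using A(1) i(1) c(2) by (simp add: m_ac)
        have "disc P \<otimes> A = A \<ominus> (A \<otimes> P \<oplus> A \<otimes> P \<oplus> A \<otimes> P \<oplus> A \<otimes> P)" unfolding disc_def using Pc A(1) by (simp add: a_minus_def r_distr r_minus m_comm[of _ A] minus_add a_assoc)
        also have "\<dots> = A \<ominus> (e \<oplus> e) \<otimes> (e \<oplus> e) \<otimes> s" unfolding 2 using c A(1) by algebra
        finally show ?thesis unfolding 1 s_def .
      qed
      also have "\<dots> = A \<ominus> (A \<oplus> D)" unfolding i(3) using A D by simp
      also have "\<dots> = \<ominus> D" using A(1) D(1) by algebra
      finally have e: "disc P \<otimes> A = \<ominus> D" .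
      have "disc P \<noteq> \<zero>"
      proof
        assume "disc P = \<zero>"
        hence "\<ominus> D = \<zero>" using e A by simp
        thus False using D by (metis minus_minus minus_zero)
      qed
      thus ?thesis using 1 P0 fc z unfolding P_def by blast
    next
      case char2: True
      have dbl: "x \<oplus> x = \<zero>" if "x \<in> carrier F" for x
      proof -
        have "x \<oplus> x = (\<one> \<oplus> \<one>) \<otimes> x" using that by (simp add: l_distr)
        thus ?thesis using char2 that by simp
      qed
      show ?thesis
      proof (cases "\<exists>y\<in>carrier V. \<exists>z\<in>carrier V. bq y z \<noteq> \<zero>")
        case True
        then obtain y z where yz: "y \<in> carrier V" "z \<in> carrier V" "bq y z \<noteq> \<zero>" by blast
        have i: "inv (bq y z) \<in> carrier F" "inv (bq y z) \<noteq> \<zero>" "inv (bq y z) \<otimes> bq y z = \<one>"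
          using field_Units yz Units_inv_Units by auto
        define u where "u = inv (bq y z) \<odot>\<^bsub>V\<^esub> z"
        have u: "u \<in> carrier V" "bq y u = \<one>" using yz i by (auto simp: u_def polar_smult_r)
        have "y \<noteq> \<zero>\<^bsub>V\<^esub>" "u \<noteq> \<zero>\<^bsub>V\<^esub>" using u yz by auto
        hence "q y \<noteq> \<zero>" "q u \<noteq> \<zero>" using an u yz by auto
        hence nz: "q y \<otimes> q u \<noteq> \<zero>" using integral[of "q y" "q u"] u yz by auto
        have "q y \<otimes> q u \<in> carrier F" using u yz by simp
        hence "disc (q y \<otimes> q u) = \<one>" by (simp add: disc_def dbl a_minus_def)
        thus ?thesis using nz u yz by fastforce
      next
        case False
        hence b0: "\<And>y z. y \<in> carrier V \<Longrightarrow> z \<in> carrier V \<Longrightarrow> bq y z = \<zero>" by blast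
        \<comment> \<open>Frobenius, read as a field extension of F. Along it all norms become
          squares, so the additive form q acquires an isotropic vector, and with b = 0 this
          contradicts regularity over the extension.\<close>
        define g where "g = (\<lambda>x. h (x \<otimes> x))"
        have gh: "g \<in> ring_hom F L"
        proof (rule ring_hom_memI)
          fix x y assume xy: "x \<in> carrier F" "y \<in> carrier F"
          show "g x \<in> carrier L" using xy by (simp add: g_def)
          have "(x \<otimes> y) \<otimes> (x \<otimes> y) = (x \<otimes> x) \<otimes> (y \<otimes> y)" using xy by algebra
          thus "g (x \<otimes> y) = g x \<otimes>\<^bsub>L\<^esub> g y" using xy by (simp add: g_def)
          have "(x \<oplus> y) \<otimes> (x \<oplus> y) = (x \<otimes> x \<oplus> y \<otimes> y) \<oplus> (x \<otimes> y \<oplus> x \<otimes> y)" using xy by algebra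
          hence "(x \<oplus> y) \<otimes> (x \<oplus> y) = x \<otimes> x \<oplus> y \<otimes> y" using dbl[of "x \<otimes> y"] xy by simp
          thus "g (x \<oplus> y) = g x \<oplus>\<^bsub>L\<^esub> g y" using xy by (simp add: g_def)
        qed (simp add: g_def)
        interpret E: qspace L "ES L" "EF L g" by (rule ext_qspace[OF Lf gh])
        let ?c = "\<lambda>k i::nat. if i = k then \<one> else \<zero>"
        have cc: "?c k i \<in> carrier F" for k i by simp
        have g0: "g \<zero> = \<zero>\<^bsub>L\<^esub>" "g \<one> = \<one>\<^bsub>L\<^esub>" by (simp_all add: g_def)
        have U: "emv g (?c k) \<in> carrier (ES L)" "EF L g (emv g (?c k)) = g (q (f k))" for k
          using emv_closed[OF Lf gh cc] ext_form_emv[OF Lf gh cc] by (auto simp: f_def)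
        have Upol: "E.bq (emv g (?c k)) (emv g (?c l)) = \<zero>\<^bsub>L\<^esub>" for k l
          using polar_emv[OF Lf gh, of "?c k" "?c l"] b0[OF fc fc, of k l] cc by (simp add: f_def g0)
        have Ue: "emv g (?c k) = (\<lambda>j\<in>{..<nn}. if j = k then \<one>\<^bsub>L\<^esub> else \<zero>\<^bsub>L\<^esub>)" for k
          by (auto simp: emv_def g0 fun_eq_iff)
        have all0: "E.bq W (emv g (?c l)) = \<zero>\<^bsub>L\<^esub>" if W: "W \<in> carrier (ES L)" for W l
        proof -
          have "E.vec (\<lambda>k. emv g (?c k)) W nn = W" unfolding Ue
            using L.func_space_unit_vec[of W nn "EF L g"] W E.qspace_axioms unfolding ext_space_eq[OF Lf gh] by simp
          moreover have "E.bq (E.vec (\<lambda>k. emv g (?c k)) W nn) (emv g (?c l)) = \<zero>\<^bsub>L\<^esub>"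
            by (rule E.polar_vec_l) (use U Upol W in \<open>auto simp: ext_space_eq[OF Lf gh] L.func_space_simps\<close>)
          ultimately show ?thesis by simp
        qed
        define a where "a = h (q (f 1))"
        define b where "b = h (q (f 0))"
        have ab: "a \<in> carrier L" "b \<in> carrier L" using fc by (auto simp: a_def b_def)
        \<comment> \<open>The two basis vectors have norms b^2 and a^2 here, so this combination has
          norm 2 a^2 b^2 = 0.\<close>
        define Y where "Y = a \<odot>\<^bsub>ES L\<^esub> emv g (?c 0) \<oplus>\<^bsub>ES L\<^esub> b \<odot>\<^bsub>ES L\<^esub> emv g (?c 1)"
        have Yc: "Y \<in> carrier (ES L)" using U ab by (simp add: Y_def)
        have gq: "g (q (f 0)) = b \<otimes>\<^bsub>L\<^esub> b" "g (q (f 1)) = a \<otimes>\<^bsub>L\<^esub> a" using fc by (simp_all add: g_def a_def b_def)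
        have "EF L g Y = a \<otimes>\<^bsub>L\<^esub> a \<otimes>\<^bsub>L\<^esub> (b \<otimes>\<^bsub>L\<^esub> b) \<oplus>\<^bsub>L\<^esub> b \<otimes>\<^bsub>L\<^esub> b \<otimes>\<^bsub>L\<^esub> (a \<otimes>\<^bsub>L\<^esub> a) \<oplus>\<^bsub>L\<^esub> a \<otimes>\<^bsub>L\<^esub> b \<otimes>\<^bsub>L\<^esub> \<zero>\<^bsub>L\<^esub>"
          unfolding Y_def E.q_lin2[OF ab U(1) U(1)] U(2) Upol gq ..
        also have "\<dots> = (\<one>\<^bsub>L\<^esub> \<oplus>\<^bsub>L\<^esub> \<one>\<^bsub>L\<^esub>) \<otimes>\<^bsub>L\<^esub> (a \<otimes>\<^bsub>L\<^esub> a \<otimes>\<^bsub>L\<^esub> (b \<otimes>\<^bsub>L\<^esub> b))" using ab by (simp add: L.l_distr L.r_distr L.m_ac)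
        also have "\<one>\<^bsub>L\<^esub> \<oplus>\<^bsub>L\<^esub> \<one>\<^bsub>L\<^esub> = \<zero>\<^bsub>L\<^esub>" using char2 h.hom_add[of \<one> \<one>] by simp
        finally have Y0: "EF L g Y = \<zero>\<^bsub>L\<^esub>" using ab by simp
        have "q (f 0) \<noteq> \<zero>" using an[OF fc, of 0] f01[of \<one> \<zero>] fc by auto
        hence "b \<noteq> \<zero>\<^bsub>L\<^esub>" using hinj[of "q (f 0)" \<zero>] by (auto simp: b_def)
        hence Ynz: "Y \<noteq> \<zero>\<^bsub>ES L\<^esub>"
        proof -
          have "Y 1 = b" unfolding Y_def Ue using n3 ab by (simp add: ext_space_eq[OF Lf gh] L.func_space_simps)
          moreover have "\<zero>\<^bsub>ES L\<^esub> 1 = \<zero>\<^bsub>L\<^esub>" using n3 by (simp add: ext_space_eq[OF Lf gh] L.func_space_simps)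
          ultimately show ?thesis using \<open>b \<noteq> \<zero>\<^bsub>L\<^esub>\<close> by auto
        qed
        obtain W where W: "W \<in> carrier (ES L)" "E.bq Y W \<noteq> \<zero>\<^bsub>L\<^esub>"
          using nondegenerate_regular[OF nd Lf gh] Yc Ynz Y0 unfolding regular_def by blast
        have "E.bq W Y = \<zero>\<^bsub>L\<^esub>" unfolding Y_def using W U ab all0[OF W(1)] by (simp add: E.polar_add_r E.polar_smult_r)
        thus ?thesis using W E.polar_sym[OF W(1) Yc] by simp
      qed
    qed
  qed
qed

end

section \<open>Places of good reduction\<close>

context qspace
begin

lemma vec_zero: "(\<And>i. i < n \<Longrightarrow> e i \<in> carrier V) \<Longrightarrow> vec e (\<lambda>_. \<zero>) n = \<zero>\<^bsub>V\<^esub>"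
  by (induct n) auto

lemma vec_diff:
  assumes e: "\<And>i. i < m \<Longrightarrow> e i \<in> carrier V" and "\<And>i. i < m \<Longrightarrow> x i \<in> carrier F" "\<And>i. i < m \<Longrightarrow> y i \<in> carrier F"
  shows "vec e y m \<oplus>\<^bsub>V\<^esub> vec e (\<lambda>i. x i \<ominus> y i) m = vec e x m"
proof -
  have "vec e y m \<oplus>\<^bsub>V\<^esub> vec e (\<lambda>i. x i \<ominus> y i) m = vec e (\<lambda>i. y i \<oplus> (x i \<ominus> y i)) m"
    by (rule vec_add[symmetric]) (use assms in auto)
  also have "\<dots> = vec e x m"
  proof (rule vec_cong)
    fix i assume "i < m"
    hence "x i \<in> carrier F" "y i \<in> carrier F" using assms by auto
    thus "y i \<oplus> (x i \<ominus> y i) = x i" by algebra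
  qed
  finally show ?thesis .
qed

lemma polar_vec_r:
  assumes "\<And>i. i < n \<Longrightarrow> e i \<in> carrier V" "\<And>i. i < n \<Longrightarrow> x i \<in> carrier F" "z \<in> carrier V"
    and "\<And>i. i < n \<Longrightarrow> bq z (e i) = \<zero>"
  shows "bq z (vec e x n) = \<zero>"
  using polar_vec_l[of n e x z] polar_sym[of z] vec_closed[of n e x] assms by simp

lemma polar_comb2_l:
  "\<lbrakk>a \<in> carrier F; b \<in> carrier F; x \<in> carrier V; y \<in> carrier V; z \<in> carrier V\<rbrakk> \<Longrightarrow> bq (comb2 a x b y) z = a \<otimes> bq x z \<oplus> b \<otimes> bq y z"
  by (simp add: comb2_def polar_add_l polar_smult_l)

lemma polar_comb2_r:
  "\<lbrakk>a \<in> carrier F; b \<in> carrier F; x \<in> carrier V; y \<in> carrier V; z \<in> carrier V\<rbrakk> \<Longrightarrow> bq z (comb2 a x b y) = a \<otimes> bq z x \<oplus> b \<otimes> bq z y"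
  by (simp add: comb2_def polar_add_r polar_smult_r)

lemma q_comb2:
  "\<lbrakk>a \<in> carrier F; b \<in> carrier F; x \<in> carrier V; y \<in> carrier V\<rbrakk> \<Longrightarrow> q (comb2 a x b y) = a \<otimes> a \<otimes> q x \<oplus> b \<otimes> b \<otimes> q y \<oplus> a \<otimes> b \<otimes> bq x y"
  by (simp add: comb2_def q_lin2)

definition plane where "plane x y = {comb2 s x r y | s r. s \<in> carrier F \<and> r \<in> carrier F}"

lemma plane_add: "\<lbrakk>x \<in> carrier V; y \<in> carrier V; a \<in> plane x y; b \<in> plane x y\<rbrakk> \<Longrightarrow> a \<oplus>\<^bsub>V\<^esub> b \<in> plane x y"
  unfolding plane_def using comb2_add by (smt (verit) a_closed mem_Collect_eq)

lemma plane_smult: "\<lbrakk>x \<in> carrier V; y \<in> carrier V; c \<in> carrier F; a \<in> plane x y\<rbrakk> \<Longrightarrow> c \<odot>\<^bsub>V\<^esub> a \<in> plane x y"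
  unfolding plane_def using comb2_smult by (smt (verit) m_closed mem_Collect_eq)

lemma plane_closed: "\<lbrakk>x \<in> carrier V; y \<in> carrier V; a \<in> plane x y\<rbrakk> \<Longrightarrow> a \<in> carrier V"
  by (auto simp: plane_def)

lemma add_smult_cancel:
  assumes "z \<in> carrier V" "c \<in> carrier F" "p \<in> carrier V"
  shows "(z \<oplus>\<^bsub>V\<^esub> c \<odot>\<^bsub>V\<^esub> p) \<oplus>\<^bsub>V\<^esub> (\<ominus> c) \<odot>\<^bsub>V\<^esub> p = z" "(\<ominus> \<one>) \<odot>\<^bsub>V\<^esub> z \<oplus>\<^bsub>V\<^esub> (z \<oplus>\<^bsub>V\<^esub> c \<odot>\<^bsub>V\<^esub> p) = c \<odot>\<^bsub>V\<^esub> p"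
proof -
  have "c \<odot>\<^bsub>V\<^esub> p \<oplus>\<^bsub>V\<^esub> (\<ominus> c) \<odot>\<^bsub>V\<^esub> p = \<zero>\<^bsub>V\<^esub>" using V.smult_l_distr[of c "\<ominus> c" p] assms by (simp add: r_neg)
  thus "(z \<oplus>\<^bsub>V\<^esub> c \<odot>\<^bsub>V\<^esub> p) \<oplus>\<^bsub>V\<^esub> (\<ominus> c) \<odot>\<^bsub>V\<^esub> p = z" using assms by (simp add: V.a_assoc)
  have "(\<ominus> \<one>) \<odot>\<^bsub>V\<^esub> z \<oplus>\<^bsub>V\<^esub> z = \<zero>\<^bsub>V\<^esub>" using V.smult_l_distr[of "\<ominus> \<one>" \<one> z] assms by (simp add: l_neg)
  thus "(\<ominus> \<one>) \<odot>\<^bsub>V\<^esub> z \<oplus>\<^bsub>V\<^esub> (z \<oplus>\<^bsub>V\<^esub> c \<odot>\<^bsub>V\<^esub> p) = c \<odot>\<^bsub>V\<^esub> p" using assms by (simp add: V.a_assoc[symmetric])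
qed

lemma not_plane_add:
  assumes "x \<in> carrier V" "y \<in> carrier V" "z \<in> carrier V" "z \<notin> plane x y" "c \<in> carrier F" "p \<in> plane x y"
  shows "z \<oplus>\<^bsub>V\<^esub> c \<odot>\<^bsub>V\<^esub> p \<notin> plane x y"
proof
  assume "z \<oplus>\<^bsub>V\<^esub> c \<odot>\<^bsub>V\<^esub> p \<in> plane x y"
  from plane_add[OF assms(1,2) this plane_smult[OF assms(1,2) a_inv_closed[OF assms(5)] assms(6)]]
  show False using add_smult_cancel(1)[OF assms(3,5) plane_closed[OF assms(1,2,6)]] assms(4) by simp
qed

lemma plane_add_not:
  assumes "x \<in> carrier V" "y \<in> carrier V" "z \<in> plane x y" "c \<in> carrier F" "c \<noteq> \<zero>" "p \<in> carrier V" "p \<notin> plane x y"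
  shows "z \<oplus>\<^bsub>V\<^esub> c \<odot>\<^bsub>V\<^esub> p \<notin> plane x y"
proof
  assume "z \<oplus>\<^bsub>V\<^esub> c \<odot>\<^bsub>V\<^esub> p \<in> plane x y"
  moreover have "(\<ominus> \<one>) \<odot>\<^bsub>V\<^esub> z \<in> plane x y" using plane_smult[OF assms(1,2) _ assms(3)] by simp
  ultimately have "c \<odot>\<^bsub>V\<^esub> p \<in> plane x y"
    using plane_add[OF assms(1,2)] add_smult_cancel(2)[OF plane_closed[OF assms(1,2,3)] assms(4,6)] by metis
  moreover have i: "inv c \<in> carrier F" "inv c \<otimes> c = \<one>" using field_Units assms by auto
  ultimately have "inv c \<odot>\<^bsub>V\<^esub> (c \<odot>\<^bsub>V\<^esub> p) \<in> plane x y" using plane_smult[OF assms(1,2)] by blast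
  moreover have "inv c \<odot>\<^bsub>V\<^esub> (c \<odot>\<^bsub>V\<^esub> p) = (inv c \<otimes> c) \<odot>\<^bsub>V\<^esub> p" using V.smult_assoc1[OF i(1) assms(4,6)] by simp
  ultimately show False using i(2) assms by simp
qed

end

section \<open>Perturbing one vector of a pair\<close>

context valued_qspace
begin

lemma gpair_open_l:
  assumes g: "gpair y z" and e: "\<And>i. i < n \<Longrightarrow> e i \<in> carrier V"
  shows "\<exists>N. \<forall>d. (\<forall>i<n. d i \<in> vge F v N) \<longrightarrow> (\<exists>z. gpair (y \<oplus>\<^bsub>V\<^esub> vec e d n) z)"
proof -
  obtain N where N: "\<And>d d'. (\<forall>i<n. d i \<in> vge F v N) \<Longrightarrow> (\<forall>i<n. d' i \<in> vge F v N) \<Longrightarrow>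
    (let Y = y \<oplus>\<^bsub>V\<^esub> vec e d n; Z = z \<oplus>\<^bsub>V\<^esub> vec e d' n in gpair Y (inv (bq Y Z) \<odot>\<^bsub>V\<^esub> Z))"
    using gpair_close[where n = n and e = e, OF g e] by blast
  show ?thesis
  proof (intro exI[of _ N] allI impI)
    fix d assume "\<forall>i<n. d i \<in> vge F v N"
    from N[OF this, of "\<lambda>_. \<zero>"] show "\<exists>z. gpair (y \<oplus>\<^bsub>V\<^esub> vec e d n) z" by (auto simp: Let_def)
  qed
qed

text \<open>Perturbations orthogonal to y keep b(y, z) = 1 exact. No scaling intervenes, so one and
  the same second vector can be adjusted for several places together.\<close>

lemma gpair_open_r:
  assumes g: "gpair y z" and e: "\<And>i. i < n \<Longrightarrow> e i \<in> carrier V" "\<And>i. i < n \<Longrightarrow> bq y (e i) = \<zero>"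
  shows "\<exists>N. \<forall>d. (\<forall>i<n. d i \<in> vge F v N) \<longrightarrow> gpair y (z \<oplus>\<^bsub>V\<^esub> vec e d n)"
proof -
  obtain N where N: "\<And>d d'. (\<forall>i<n. d i \<in> vge F v N) \<Longrightarrow> (\<forall>i<n. d' i \<in> vge F v N) \<Longrightarrow>
    (let Y = y \<oplus>\<^bsub>V\<^esub> vec e d n; Z = z \<oplus>\<^bsub>V\<^esub> vec e d' n in gpair Y (inv (bq Y Z) \<odot>\<^bsub>V\<^esub> Z))"
    using gpair_close[where n = n and e = e, OF g e(1)] by blast
  have yz: "y \<in> carrier V" "z \<in> carrier V" "bq y z = \<one>" using g by (auto simp: gpair_def)
  show ?thesis
  proof (intro exI[of _ N] allI impI)
    fix d assume d: "\<forall>i<n. d i \<in> vge F v N"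
    hence dc: "\<And>i. i < n \<Longrightarrow> d i \<in> carrier F" using vge_carrier by blast
    have vc: "vec e d n \<in> carrier V" using e dc by (auto intro: vec_closed)
    have "bq y (vec e d n) = \<zero>" by (rule polar_vec_r) (use e dc yz in auto)
    hence 1: "bq y (z \<oplus>\<^bsub>V\<^esub> vec e d n) = \<one>" using yz vc by (simp add: polar_add_r)
    have 2: "y \<oplus>\<^bsub>V\<^esub> vec e (\<lambda>_. \<zero>) n = y" using vec_zero[of n e] e yz by simp
    have "gpair y (inv \<one> \<odot>\<^bsub>V\<^esub> (z \<oplus>\<^bsub>V\<^esub> vec e d n))"
      using N[of "\<lambda>_. \<zero>", OF _ d] unfolding 2 Let_def 1 by simp
    thus "gpair y (z \<oplus>\<^bsub>V\<^esub> vec e d n)" using yz vc by simp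
  qed
qed

lemma gpair_open_l1:
  assumes g: "gpair y z" and e: "e \<in> carrier V"
  shows "\<exists>N. \<forall>d\<in>vge F v N. \<exists>z. gpair (y \<oplus>\<^bsub>V\<^esub> d \<odot>\<^bsub>V\<^esub> e) z"
proof -
  obtain N where N: "\<And>d. (\<forall>i<Suc 0. d i \<in> vge F v N) \<Longrightarrow> (\<exists>z. gpair (y \<oplus>\<^bsub>V\<^esub> vec (\<lambda>_. e) d (Suc 0)) z)"
    using gpair_open_l[where n = "Suc 0" and e = "\<lambda>_. e", OF g e] by blast
  have "vec (\<lambda>_. e) (\<lambda>_. d) (Suc 0) = d \<odot>\<^bsub>V\<^esub> e" if "d \<in> vge F v N" for d using vge_carrier[OF that] e by simp
  thus ?thesis using N[of "\<lambda>_. _"] by (intro exI[of _ N]) fastforce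
qed

lemma gpair_open_r1:
  assumes g: "gpair y z" and e: "e \<in> carrier V" "bq y e = \<zero>"
  shows "\<exists>N. \<forall>d\<in>vge F v N. gpair y (z \<oplus>\<^bsub>V\<^esub> d \<odot>\<^bsub>V\<^esub> e)"
proof -
  obtain N where N: "\<And>d. (\<forall>i<Suc 0. d i \<in> vge F v N) \<Longrightarrow> gpair y (z \<oplus>\<^bsub>V\<^esub> vec (\<lambda>_. e) d (Suc 0))"
    using gpair_open_r[where n = "Suc 0" and e = "\<lambda>_. e", OF g e] by blast
  have "vec (\<lambda>_. e) (\<lambda>_. d) (Suc 0) = d \<odot>\<^bsub>V\<^esub> e" if "d \<in> vge F v N" for d using vge_carrier[OF that] e by simp
  thus ?thesis using N[of "\<lambda>_. _"] by (intro exI[of _ N]) fastforce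
qed

end

lemma (in valued_field) unit_at_minus: "unit_at F v x \<Longrightarrow> unit_at F v (\<ominus> x)"
  using v_minus[of x] by (auto simp: unit_at_def)

lemma (in valued_field) unit_at_vge1:
  assumes "x \<in> vge F v 0" "\<not> unit_at F v x" shows "x \<in> vge F v 1"
  using assms by (auto simp: unit_at_def vge_def)

lemma (in qform) basis_not_in_plane:
  assumes n3: "3 \<le> nn" and x: "x \<in> carrier V" "y \<in> carrier V"
  shows "\<exists>i<nn. ee i \<notin> plane x y"
proof -
  have "indep3 (ee 0) (ee 1) (ee 2)"
    unfolding indep3_def
  proof (intro conjI ballI impI)
    have n: "0 < nn" "1 < nn" "2 < nn" using n3 by linarith+
    show cl: "ee 0 \<in> carrier V" "ee 1 \<in> carrier V" "ee 2 \<in> carrier V" using n by (auto intro: ee_closed)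
    fix a b c assume abc: "a \<in> carrier F" "b \<in> carrier F" "c \<in> carrier F"
      and z: "a \<odot>\<^bsub>V\<^esub> ee 0 \<oplus>\<^bsub>V\<^esub> b \<odot>\<^bsub>V\<^esub> ee 1 \<oplus>\<^bsub>V\<^esub> c \<odot>\<^bsub>V\<^esub> ee 2 = \<zero>\<^bsub>V\<^esub>"
    define d where "d = (\<lambda>i::nat. if i = 0 then a else if i = 1 then b else if i = 2 then c else \<zero>)"
    have dc: "d i \<in> carrier F" for i using abc by (simp add: d_def)
    have "vec ee d (3 + k) = \<zero>\<^bsub>V\<^esub>" if "3 + k \<le> nn" for k using that
    proof (induct k)
      case 0
      have "vec ee d (Suc (Suc (Suc 0))) = a \<odot>\<^bsub>V\<^esub> ee 0 \<oplus>\<^bsub>V\<^esub> b \<odot>\<^bsub>V\<^esub> ee 1 \<oplus>\<^bsub>V\<^esub> c \<odot>\<^bsub>V\<^esub> ee 2"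
        using cl abc by (simp add: d_def numeral_2_eq_2)
      thus ?case using z by (simp add: numeral_3_eq_3)
    next
      case (Suc k)
      have "3 + Suc k = Suc (3 + k)" "d (3 + k) = \<zero>" "ee (3 + k) \<in> carrier V"
        using ee_closed[of "3 + k"] Suc(2) by (simp_all add: d_def)
      thus ?case using Suc by (simp only: vec.simps) simp
    qed
    from this[of "nn - 3"] have v0: "vec ee d nn = \<zero>\<^bsub>V\<^esub>" using n3 by simp
    show "a = \<zero>" "b = \<zero>" "c = \<zero>"
      using vec_zero_imp[OF dc v0 n(1)] vec_zero_imp[OF dc v0 n(2)] vec_zero_imp[OF dc v0 n(3)] by (simp_all add: d_def)
  qed
  from indep3_not_in_plane[OF this x] obtain i where "i \<in> {0, 1, 2}" "ee i \<notin> plane x y"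
    unfolding plane_def by blast
  thus ?thesis using n3 by (intro exI[of _ i]) auto
qed

locale function_field_form = function_field F K + qform F V q
  for F :: "('a, 'm) ring_scheme" (structure) and K and V :: "('a, 'v, 'n) module_scheme" (structure) and q

lemma (in function_field_form) vq: "v \<in> valuations F K \<Longrightarrow> valued_qspace F V q v"
  using valuations_valued_field[OF field_axioms, of v K] by (intro valued_qspace.intro qspace_axioms)

text \<open>\<open>B\<close> is a finite set of places outside of which \<open>\<Delta>\<close> consists of places of good behaviour.\<close>

locale good_reduction = function_field_form F K V q
  for F :: "('a, 'm) ring_scheme" (structure) and K and V :: "('a, 'v, 'n) module_scheme" (structure) and q +
  fixes \<Delta> B :: "('a \<Rightarrow> int) set" and x0 y0
  assumes Delta_valuations: "\<Delta> \<subseteq> valuations F K"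
    and bound: "\<lbrakk>v \<in> \<Delta>; x \<in> carrier V; y \<in> carrier V; bq x y \<noteq> \<zero>; q x \<noteq> \<zero>; q y \<noteq> \<zero>\<rbrakk> \<Longrightarrow> v (q x) + v (q y) \<le> 2 * v (bq x y)"
    and aniso: "\<lbrakk>x \<in> carrier V; q x = \<zero>\<rbrakk> \<Longrightarrow> x = \<zero>\<^bsub>V\<^esub>"
    and B: "finite B" "B \<subseteq> valuations F K" "B \<noteq> {}"
    and xy0: "x0 \<in> carrier V" "y0 \<in> carrier V" "bq x0 y0 = \<one>" "disc (q x0 \<otimes> q y0) \<noteq> \<zero>"
    and good: "v \<in> \<Delta> - B \<Longrightarrow> unit_at F v (q x0) \<and> unit_at F v (q y0) \<and> unit_at F v (disc (q x0 \<otimes> q y0)) \<and>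
      (\<forall>i<nn. q (ee i) \<in> vge F v 0)"
begin

lemma vqD: "v \<in> \<Delta> - B \<Longrightarrow> valued_qspace F V q v"
  using vq Delta_valuations by blast

abbreviation int_at where "int_at v z \<equiv> z \<in> carrier V \<and> q z \<in> vge F v 0"

lemma int_at_polar:
  assumes v: "v \<in> \<Delta> - B" and x: "int_at v x" and y: "int_at v y"
  shows "bq x y \<in> vge F v 0"
proof (cases "bq x y = \<zero>")
  case False
  interpret v: valued_qspace F V q v by (rule vqD[OF v])
  have "q x \<noteq> \<zero>" "q y \<noteq> \<zero>" using aniso[of x] aniso[of y] x y False by auto
  thus ?thesis using bound[of v x y] v x y False by (auto simp: vge_def)
qed (simp add: vge_def)

lemma int_at_add: assumes "v \<in> \<Delta> - B" "int_at v x" "int_at v y" shows "int_at v (x \<oplus>\<^bsub>V\<^esub> y)"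
proof -
  interpret v: valued_qspace F V q v by (rule vqD[OF assms(1)])
  show ?thesis using assms int_at_polar[OF assms] by (simp add: q_add v.vge_add)
qed

lemma int_at_smult: assumes "v \<in> \<Delta> - B" "c \<in> vge F v 0" "int_at v x" shows "int_at v (c \<odot>\<^bsub>V\<^esub> x)"
proof -
  interpret v: valued_qspace F V q v by (rule vqD[OF assms(1)])
  show ?thesis using assms v.vge_mult0[OF v.vge_mult0[OF assms(2,2)]] v.vge_carrier[OF assms(2)] by (simp add: q_smult)
qed

lemma int_at_comb2:
  assumes "v \<in> \<Delta> - B" "c \<in> vge F v 0" "int_at v x" "d \<in> vge F v 0" "int_at v y" shows "int_at v (comb2 c x d y)"
  unfolding comb2_def by (intro int_at_add int_at_smult assms)

lemma int_at_vec:
  assumes v: "v \<in> \<Delta> - B" and "\<And>i. i < n \<Longrightarrow> int_at v (e i)" "\<And>i. i < n \<Longrightarrow> x i \<in> vge F v 0"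
  shows "int_at v (vec e x n)"
  using assms(2,3)
proof (induct n)
  case 0
  thus ?case by (simp add: vge_def)
next
  case (Suc n)
  have "int_at v (vec e x n)" using Suc by simp
  moreover have "int_at v (x n \<odot>\<^bsub>V\<^esub> e n)" by (rule int_at_smult[OF v]) (use Suc in auto)
  ultimately show ?case using int_at_add[OF v] by simp
qed

text \<open>The norms of x and y have nonnegative values, whose sum is at most 0 by
  \<open>bound\<close>.\<close>

lemma int_at_unit:
  assumes v: "v \<in> \<Delta> - B" and x: "int_at v x" and y: "int_at v y" and u: "unit_at F v (bq x y)"
  shows "unit_at F v (q x)"
proof -
  interpret v: valued_qspace F V q v by (rule vqD[OF v])
  have nz: "bq x y \<noteq> \<zero>" using u by (simp add: unit_at_def)
  have "q x \<noteq> \<zero>" "q y \<noteq> \<zero>" using aniso[of x] aniso[of y] x y nz by auto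
  thus ?thesis using bound[of v x y] v x y u nz by (auto simp: vge_def unit_at_def)
qed

abbreviation "a0 \<equiv> q x0"
abbreviation "d0 \<equiv> q y0"
abbreviation "D0 \<equiv> disc (a0 \<otimes> d0)"

text \<open>Up to the factor \<open>- D0\<close>, \<open>ux\<close> and \<open>uy\<close> form the
  basis of the plane dual to \<open>x0\<close> and \<open>y0\<close> with respect to b.\<close>

definition "ux = comb2 (d0 \<oplus> d0) x0 (\<ominus> \<one>) y0"
definition "uy = comb2 (\<ominus> \<one>) x0 (a0 \<oplus> a0) y0"

lemma base_closed: "a0 \<in> carrier F" "d0 \<in> carrier F" "D0 \<in> carrier F" "ux \<in> carrier V" "uy \<in> carrier V"
  using xy0 by (auto simp: ux_def uy_def)

lemma base_nonzero: "a0 \<noteq> \<zero>" "d0 \<noteq> \<zero>"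
  using aniso[of x0] aniso[of y0] xy0 by auto

lemma minus_D0: "\<ominus> D0 \<noteq> \<zero>"
  using base_closed(3) xy0(4) by (metis minus_minus minus_zero)

lemma base_polar: "bq x0 x0 = a0 \<oplus> a0" "bq y0 y0 = d0 \<oplus> d0" "bq y0 x0 = \<one>"
  using xy0 polar_self polar_sym[of y0 x0] by auto

lemma ux_polar: "bq ux x0 = \<ominus> D0" "bq ux y0 = \<zero>"
proof -
  note c = base_closed(1-3)
  have "bq ux x0 = (d0 \<oplus> d0) \<otimes> (a0 \<oplus> a0) \<oplus> \<ominus> \<one> \<otimes> \<one>"
    using xy0 by (simp add: ux_def polar_comb2_l base_polar)
  also have "\<dots> = \<ominus> D0" unfolding disc_def using c by algebra
  finally show "bq ux x0 = \<ominus> D0" .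
  have "bq ux y0 = (d0 \<oplus> d0) \<otimes> \<one> \<oplus> \<ominus> \<one> \<otimes> (d0 \<oplus> d0)"
    using xy0 by (simp add: ux_def polar_comb2_l base_polar)
  also have "\<dots> = \<zero>" using c by algebra
  finally show "bq ux y0 = \<zero>" .
qed

lemma uy_polar: "bq uy x0 = \<zero>" "bq uy y0 = \<ominus> D0"
proof -
  note c = base_closed(1-3)
  have "bq uy x0 = \<ominus> \<one> \<otimes> (a0 \<oplus> a0) \<oplus> (a0 \<oplus> a0) \<otimes> \<one>"
    using xy0 by (simp add: uy_def polar_comb2_l base_polar)
  also have "\<dots> = \<zero>" using c by algebra
  finally show "bq uy x0 = \<zero>" .
  have "bq uy y0 = \<ominus> \<one> \<otimes> \<one> \<oplus> (a0 \<oplus> a0) \<otimes> (d0 \<oplus> d0)"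
    using xy0 by (simp add: uy_def polar_comb2_l base_polar)
  also have "\<dots> = \<ominus> D0" unfolding disc_def using c by algebra
  finally show "bq uy y0 = \<ominus> D0" .
qed

lemma base_units:
  assumes v: "v \<in> \<Delta> - B" shows "unit_at F v a0" "unit_at F v d0" "unit_at F v D0" "unit_at F v (\<ominus> D0)"
proof -
  interpret v: valued_qspace F V q v by (rule vqD[OF v])
  show "unit_at F v a0" "unit_at F v d0" "unit_at F v D0" using good[OF v] by auto
  thus "unit_at F v (\<ominus> D0)" by (intro v.unit_at_minus)
qed

lemma base_int:
  assumes v: "v \<in> \<Delta> - B" shows "int_at v x0" "int_at v y0" "int_at v ux" "int_at v uy"
proof -
  interpret v: valued_qspace F V q v by (rule vqD[OF v])
  note u = base_units[OF v]
  show 1: "int_at v x0" "int_at v y0" using xy0 v.unit_at_vge[OF u(1)] v.unit_at_vge[OF u(2)] by auto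
  show "int_at v ux" "int_at v uy" unfolding ux_def uy_def
    by (intro int_at_comb2[OF v] 1 v.vge_add v.unit_at_vge u v.unit_at_minus v.unit_at_one)+
qed

lemma ee_int: "v \<in> \<Delta> - B \<Longrightarrow> i < nn \<Longrightarrow> int_at v (ee i)"
  using good ee_closed by auto

lemma plane_u: "ux \<in> plane x0 y0" "uy \<in> plane x0 y0"
  unfolding ux_def uy_def plane_def using base_closed by blast+

lemma denominator_polar:
  assumes g: "g \<in> carrier F"
  shows "bq (comb2 g x0 \<one> y0) uy = \<ominus> D0" "bq (comb2 g x0 \<one> y0) ux = g \<otimes> \<ominus> D0" "q (comb2 g x0 \<one> y0) \<noteq> \<zero>"
proof -
  let ?z = "comb2 g x0 \<one> y0"
  note c = base_closed
  have z: "?z \<in> carrier V" using g xy0 by simp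
  have "bq ?z uy = g \<otimes> bq uy x0 \<oplus> \<one> \<otimes> bq uy y0"
    using g xy0 c polar_sym[of uy] by (simp add: polar_comb2_l)
  thus b1: "bq ?z uy = \<ominus> D0" using g c by (simp add: uy_polar)
  have "bq ?z ux = g \<otimes> bq ux x0 \<oplus> \<one> \<otimes> bq ux y0"
    using g xy0 c polar_sym[of ux] by (simp add: polar_comb2_l)
  thus "bq ?z ux = g \<otimes> \<ominus> D0" using g c by (simp add: ux_polar)
  show "q ?z \<noteq> \<zero>" using aniso[OF z] b1 minus_D0 polar_zero_l[OF c(5)] by metis
qed

text \<open>
  The norm of \<open>g x0 + y0\<close> has only poles in \<open>\<Delta> - B\<close>, at least those of \<open>g\<^sup>2\<close>; this supplies
  strong approximation on the infinite set \<open>\<Delta>\<close>.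
\<close>

lemma denominator_bound:
  assumes v: "v \<in> \<Delta> - B" and g: "g \<in> carrier F"
  shows "v (q (comb2 g x0 \<one> y0)) \<le> 0" "g \<noteq> \<zero> \<Longrightarrow> v (q (comb2 g x0 \<one> y0)) \<le> 2 * v g"
proof -
  interpret v: valued_qspace F V q v by (rule vqD[OF v])
  let ?z = "comb2 g x0 \<one> y0"
  note c = base_closed
  note u = base_units[OF v, unfolded unit_at_def]
  have z: "?z \<in> carrier V" using g xy0 by simp
  note b1 = denominator_polar(1)[OF g] and b2 = denominator_polar(2)[OF g] and qz = denominator_polar(3)[OF g]
  \<comment> \<open>\<open>ux\<close> and \<open>uy\<close> have unit norm, so \<open>bound\<close>
    turns the pairings of z with them, of value v(g) and 0, into upper bounds for the value of
    q(z).\<close>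
  have "unit_at F v (q uy)"
    by (rule int_at_unit[OF v base_int(4)[OF v] base_int(2)[OF v]]) (simp add: uy_polar base_units[OF v])
  moreover have "unit_at F v (q ux)"
    by (rule int_at_unit[OF v base_int(3)[OF v] base_int(1)[OF v]]) (simp add: ux_polar base_units[OF v])
  ultimately have uu: "q ux \<noteq> \<zero>" "v (q ux) = 0" "q uy \<noteq> \<zero>" "v (q uy) = 0" by (auto simp: unit_at_def)
  show "v (q ?z) \<le> 0" using bound[of v ?z uy] v z c uu b1 u qz by auto
  assume g0: "g \<noteq> \<zero>"
  have "bq ?z ux \<noteq> \<zero>" "v (bq ?z ux) = v g" unfolding b2
    using v.mult_nz[of g "\<ominus> D0"] v.v_mult[of g "\<ominus> D0"] g g0 u by auto
  thus "v (q ?z) \<le> 2 * v g" using bound[of v ?z ux] v z c uu qz by auto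
qed

text \<open>Weak approximation gives h, whose defect is a finite set P of poles in
  \<open>\<Delta> - B'\<close>. The auxiliary g is given zeros on P and poles on B', and the answer
  is e h with e = a0 g^2 / Q, where Q is the norm of g x0 + y0.\<close>

theorem strong_approximation:
  assumes B': "B \<subseteq> B'" "finite B'" "B' \<subseteq> valuations F K" and f: "\<And>v. v \<in> B' \<Longrightarrow> f v \<in> carrier F"
  shows "\<exists>x\<in>carrier F. (\<forall>v\<in>B'. x \<ominus> f v \<in> vge F v (n v)) \<and> (\<forall>v\<in>\<Delta> - B'. x \<in> vge F v 0)"
proof -
  note c = base_closed
  obtain h where h: "h \<in> carrier F" "\<And>v. v \<in> B' \<Longrightarrow> h \<ominus> f v \<in> vge F v (n v)"
    using weak_approximation[where f = f and n = n, OF B'(2,3) f] by blast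
  define P where "P = {v \<in> \<Delta> - B'. h \<notin> vge F v 0}"
  have "finite P"
  proof (cases "h = \<zero>")
    case True
    thus ?thesis by (simp add: P_def vge_def)
  next
    case False
    show ?thesis
      by (rule finite_subset[OF _ finite_support[OF h(1) False]]) (use h Delta_valuations in \<open>auto simp: P_def vge_def\<close>)
  qed
  have "\<exists>k. h \<in> vge F v k" for v using h by (auto simp: vge_def)
  then obtain k where k: "\<And>v. h \<in> vge F v (k v)" by metis
  \<comment> \<open>Let v(g) = - M. From M >= - v(d0) follows v(g + d0) >= - M, and M > v(a0) makes
    a0 g^2 dominate in Q = a0 g^2 + (g + d0), so v(Q) = v(a0) - 2 M. Then e - 1 = - (g + d0) / Q has
    value at least M - v(a0), and this is at least n v - k v.\<close>
  define M where "M = (\<lambda>v. max (max 1 (v a0 + 1)) (max (- v d0) (n v - k v + v a0)))"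
  have "\<exists>g\<in>carrier F. g \<noteq> \<zero> \<and> v g = - M v" if "v \<in> B'" for v
    using valued_field.v_surj[OF valuations_valued_field[OF field_axioms, of v K], of "- M v"] B' that by blast
  then obtain G where G: "\<And>v. v \<in> B' \<Longrightarrow> G v \<in> carrier F \<and> G v \<noteq> \<zero> \<and> v (G v) = - M v" by metis
  have PB: "finite (B' \<union> P)" "B' \<union> P \<subseteq> valuations F K" using \<open>finite P\<close> B' Delta_valuations by (auto simp: P_def)
  have Gc: "(if v \<in> B' then G v else \<zero>) \<in> carrier F" for v using G by simp
  \<comment> \<open>On B' the accuracy \<open>1 - M v\<close> pins the value of g to
    \<open>- M v\<close>. On P the zero of g is at least as deep as the pole of h.\<close>
  obtain g where g: "g \<in> carrier F"
    and gB: "\<forall>v\<in>B' \<union> P. g \<ominus> (if v \<in> B' then G v else \<zero>) \<in> vge F v (if v \<in> B' then 1 - M v else max 0 (- k v))"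
    using weak_approximation[where f = "\<lambda>v. if v \<in> B' then G v else \<zero>"
      and n = "\<lambda>v. if v \<in> B' then 1 - M v else max 0 (- k v)", OF PB Gc] by blast
  have g1: "g \<noteq> \<zero> \<and> v g = - M v" if v: "v \<in> B'" for v
  proof -
    interpret v: valued_qspace F V q v using vq v B' by blast
    show ?thesis using v.v_close[of "G v" g] G[OF v] g bspec[OF gB, of v] v by simp
  qed
  have g0: "g \<noteq> \<zero>" using g1 B(3) B'(1) by blast
  have g2: "g \<in> vge F v (max 0 (- k v))" if v: "v \<in> P" for v
    using bspec[OF gB, of v] v g by (simp add: P_def a_minus_def)
  define Q where "Q = q (comb2 g x0 \<one> y0)"
  have Q: "Q = a0 \<otimes> (g \<otimes> g) \<oplus> (g \<oplus> d0)"
  proof -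
    have "Q = g \<otimes> g \<otimes> a0 \<oplus> \<one> \<otimes> \<one> \<otimes> d0 \<oplus> g \<otimes> \<one> \<otimes> \<one>" unfolding Q_def using g xy0 by (simp only: q_comb2 one_closed)
    thus ?thesis using g c by (simp add: m_ac a_ac)
  qed
  define s where "s = a0 \<otimes> (g \<otimes> g)"
  have sc: "s \<in> carrier F" "g \<oplus> d0 \<in> carrier F" using g c by (auto simp: s_def)
  have Qc: "Q \<in> carrier F" using sc by (simp add: Q s_def[symmetric])
  have Qnz: "Q \<noteq> \<zero>" unfolding Q_def by (rule denominator_polar(3)[OF g])
  have iQ: "inv Q \<in> carrier F" "Q \<otimes> inv Q = \<one>" using field_Units Qc Qnz by auto
  define e where "e = s \<otimes> inv Q"
  have ec: "e \<in> carrier F" using sc iQ by (simp add: e_def)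
  have e1: "e \<ominus> \<one> = \<ominus> ((g \<oplus> d0) \<otimes> inv Q)"
  proof -
    have "e \<ominus> Q \<otimes> inv Q = \<ominus> ((g \<oplus> d0) \<otimes> inv Q)"
      unfolding e_def Q s_def[symmetric] using sc iQ(1)[unfolded Q s_def[symmetric]] g c(2) by algebra
    thus ?thesis using iQ by simp
  qed
  show ?thesis
  proof (intro bexI[of _ "e \<otimes> h"] conjI ballI)
    show "e \<otimes> h \<in> carrier F" using ec h by simp
    fix v assume v: "v \<in> B'"
    interpret v: valued_qspace F V q v using vq v B' by blast
    have vs: "v s = v a0 - 2 * M v" "s \<noteq> \<zero>"
      unfolding s_def using v.v_mult[of a0 "g \<otimes> g"] v.v_mult[of g g] g c g1[OF v] base_nonzero v.mult_nz[of g g]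
        v.mult_nz[of a0 "g \<otimes> g"] by auto
    have gd: "g \<oplus> d0 \<in> vge F v (- M v)"
      by (rule v.vge_add) (use g g1[OF v] c in \<open>auto simp: vge_def M_def\<close>)
    have "v Q = v s" unfolding Q s_def[symmetric]
      by (rule v.v_add_strict(2)[OF sc(1) vs(2)], rule v.vge_mono[OF gd]) (simp add: vs M_def)
    hence "(g \<oplus> d0) \<otimes> inv Q \<in> vge F v (n v - k v)"
      by (intro v.v_div_closed[OF sc(2) Qc Qnz gd]) (simp add: vs M_def)
    hence "e \<ominus> \<one> \<in> vge F v (n v - k v)" unfolding e1 by (rule v.vge_minus)
    from v.vge_mult[OF this k[of v]] have 1: "(e \<ominus> \<one>) \<otimes> h \<in> vge F v (n v)" by simp
    have fc: "f v \<in> carrier F" using f v .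
    have "e \<otimes> h \<ominus> f v = (e \<ominus> \<one>) \<otimes> h \<oplus> (h \<ominus> f v)" using ec h(1) fc by algebra
    thus "e \<otimes> h \<ominus> f v \<in> vge F v (n v)" using v.vge_add[OF 1 h(2)[OF v]] by simp
  next
    fix v assume v: "v \<in> \<Delta> - B'"
    hence vB: "v \<in> \<Delta> - B" using B' by blast
    interpret v: valued_qspace F V q v by (rule vqD[OF vB])
    note db = denominator_bound[OF vB g, folded Q_def]
    have a0v: "a0 \<in> vge F v 0" by (rule v.unit_at_vge[OF base_units(1)[OF vB]])
    have e2: "e \<in> vge F v j" if "g \<otimes> g \<in> vge F v i" "i - v Q \<ge> j" for i j
      unfolding e_def s_def using that Qc Qnz g c v.vge_mult0[OF a0v that(1)] by (intro v.v_div_closed[where n = i]) auto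
    show "e \<otimes> h \<in> vge F v 0"
    proof (cases "v \<in> P")
      case True
      have "g \<otimes> g \<in> vge F v (max 0 (- k v) + max 0 (- k v))" by (rule v.vge_mult[OF g2[OF True] g2[OF True]])
      hence "e \<in> vge F v (max 0 (- k v) + max 0 (- k v))" by (rule e2) (use db in simp)
      from v.vge_mult[OF this k[of v]] show ?thesis by (rule v.vge_mono) simp
    next
      case False
      hence "h \<in> vge F v 0" using v by (simp add: P_def)
      moreover have "g \<otimes> g \<in> vge F v (2 * v g)" using v.vge_mult[of g "v g" g "v g"] g by (simp add: vge_def)
      hence "e \<in> vge F v 0" by (rule e2) (use db(2)[OF g0] in simp)
      ultimately show ?thesis using v.vge_mult0 by blast
    qed
  qed
qed

text \<open>Supplies nonzero step sizes for perturbations. An exact value is prescribed on B, and as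
  B is not empty, x cannot be zero.\<close>

lemma small_element: "\<exists>x\<in>carrier F. x \<noteq> \<zero> \<and> (\<forall>v\<in>B. x \<in> vge F v (n v)) \<and> (\<forall>v\<in>\<Delta> - B. x \<in> vge F v 0)"
proof -
  have "\<exists>g\<in>carrier F. g \<noteq> \<zero> \<and> v g = n v" if "v \<in> B" for v
    using valued_field.v_surj[OF valuations_valued_field[OF field_axioms, of v K], of "n v"] B that by blast
  then obtain G where G: "\<And>v. v \<in> B \<Longrightarrow> G v \<in> carrier F \<and> G v \<noteq> \<zero> \<and> v (G v) = n v" by metis
  obtain x where x: "x \<in> carrier F" "\<forall>v\<in>B. x \<ominus> G v \<in> vge F v (n v + 1)" "\<forall>v\<in>\<Delta> - B. x \<in> vge F v 0"
    using strong_approximation[OF order_refl B(1,2), where f = G and n = "\<lambda>v. n v + 1"] G by blast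
  have "x \<noteq> \<zero> \<and> v x = n v" if v: "v \<in> B" for v
  proof -
    interpret v: valued_qspace F V q v using vq v B by blast
    show ?thesis using v.v_close[of "G v" x] G[OF v] x v by auto
  qed
  thus ?thesis using x B(3) by (intro bexI[of _ x]) (auto simp: vge_def)
qed

end

section \<open>Pairs of vectors integral at almost all places\<close>

context good_reduction
begin

abbreviation gp where "gp v x y \<equiv> valued_qspace.gpair F V q v x y"

lemma gp_dest:
  assumes "v \<in> valuations F K" "gp v x y"
  shows "x \<in> carrier V" "y \<in> carrier V" "bq x y = \<one>"
  using assms(2) unfolding valued_qspace.gpair_def[OF vq[OF assms(1)]] by auto

lemma gp_perturb_l:
  assumes g: "\<And>v. v \<in> B \<Longrightarrow> \<exists>y. gp v x y" and e: "e \<in> carrier V"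
  shows "\<exists>n. \<forall>v\<in>B. \<forall>d\<in>vge F v (n v). \<exists>y. gp v (x \<oplus>\<^bsub>V\<^esub> d \<odot>\<^bsub>V\<^esub> e) y"
proof (rule bchoice, rule ballI)
  fix v assume v: "v \<in> B"
  interpret v: valued_qspace F V q v using vq v B by blast
  obtain y where "gp v x y" using g[OF v] by blast
  from v.gpair_open_l1[OF this e] show "\<exists>N. \<forall>d\<in>vge F v N. \<exists>y. gp v (x \<oplus>\<^bsub>V\<^esub> d \<odot>\<^bsub>V\<^esub> e) y" .
qed

lemma gp_perturb_r:
  assumes g: "\<And>v. v \<in> B \<Longrightarrow> gp v x y" and e: "e \<in> carrier V" "bq x e = \<zero>"
  shows "\<exists>n. \<forall>v\<in>B. \<forall>d\<in>vge F v (n v). gp v x (y \<oplus>\<^bsub>V\<^esub> d \<odot>\<^bsub>V\<^esub> e)"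
proof (rule bchoice, rule ballI)
  fix v assume v: "v \<in> B"
  interpret v: valued_qspace F V q v using vq v B by blast
  from v.gpair_open_r1[OF g[OF v] e] show "\<exists>N. \<forall>d\<in>vge F v N. gp v x (y \<oplus>\<^bsub>V\<^esub> d \<odot>\<^bsub>V\<^esub> e)" .
qed

lemma approx_coordinates:
  assumes f: "\<And>v i. v \<in> B \<Longrightarrow> f v i \<in> carrier F"
  shows "\<exists>x. (\<forall>i. x i \<in> carrier F) \<and> (\<forall>v\<in>B. \<forall>i. x i \<ominus> f v i \<in> vge F v (n v)) \<and> (\<forall>v\<in>\<Delta> - B. \<forall>i. x i \<in> vge F v 0)"
proof -
  have "\<exists>x\<in>carrier F. (\<forall>v\<in>B. x \<ominus> f v i \<in> vge F v (n v)) \<and> (\<forall>v\<in>\<Delta> - B. x \<in> vge F v 0)" for i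
    by (rule strong_approximation[where f = "\<lambda>v. f v i", OF order_refl B(1,2)]) (rule f)
  then obtain x where "\<And>i. x i \<in> carrier F \<and> (\<forall>v\<in>B. x i \<ominus> f v i \<in> vge F v (n v)) \<and> (\<forall>v\<in>\<Delta> - B. x i \<in> vge F v 0)" by metis
  thus ?thesis by (intro exI[of _ x]) auto
qed

text \<open>Decides at each place of P separately whether a correction is switched on (x a unit) or
  off (x in the maximal ideal), without disturbing the pairs given on B.\<close>

lemma binary_choice:
  assumes P: "finite P" "P \<subseteq> \<Delta> - B"
  obtains x where "x \<in> carrier F" "\<And>v. v \<in> B \<Longrightarrow> x \<in> vge F v (n v)" "\<And>v. v \<in> \<Delta> - B \<Longrightarrow> x \<in> vge F v 0"
    "\<And>v. v \<in> P \<Longrightarrow> c v \<Longrightarrow> x \<in> vge F v 1" "\<And>v. v \<in> P \<Longrightarrow> \<not> c v \<Longrightarrow> unit_at F v x"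
proof -
  define t where "t = (\<lambda>v. if v \<in> B \<or> c v then \<zero> else \<one>)"
  have tc: "t v \<in> carrier F" "t v \<in> vge F v 0" if "v \<in> valuations F K" for v
  proof -
    interpret v: valued_qspace F V q v by (rule vq[OF that])
    show "t v \<in> carrier F" "t v \<in> vge F v 0" by (simp_all add: t_def)
  qed
  have BP: "B \<subseteq> B \<union> P" "finite (B \<union> P)" "B \<union> P \<subseteq> valuations F K" using B P Delta_valuations by auto
  have tcB: "v \<in> B \<union> P \<Longrightarrow> t v \<in> carrier F" for v using tc(1) BP(3) by blast
  obtain x where x: "x \<in> carrier F" "\<And>v. v \<in> B \<union> P \<Longrightarrow> x \<ominus> t v \<in> vge F v (if v \<in> B then n v else 1)"
    "\<And>v. v \<in> \<Delta> - (B \<union> P) \<Longrightarrow> x \<in> vge F v 0"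
    using strong_approximation[where f = t and n = "\<lambda>v. if v \<in> B then n v else 1", OF BP tcB] by blast
  have P1: "x \<ominus> t v \<in> vge F v 1" if "v \<in> P" for v using x(2)[of v] that P by auto
  show ?thesis
  proof (rule that[OF x(1)])
    show "x \<in> vge F v (n v)" if v: "v \<in> B" for v using x(2)[of v] x(1) v by (simp add: t_def a_minus_def)
    show "x \<in> vge F v 1" if "v \<in> P" "c v" for v using P1[OF that(1)] that x(1) by (simp add: t_def a_minus_def)
  next
    fix v assume v: "v \<in> P" "\<not> c v"
    interpret v: valued_qspace F V q v using vq v BP(3) by blast
    show "unit_at F v x" using v.unit_at_close[OF v.unit_at_one x(1)] P1[OF v(1)] v P by (auto simp: t_def)
  next
    fix v assume v: "v \<in> \<Delta> - B"
    interpret v: valued_qspace F V q v by (rule vqD[OF v])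
    show "x \<in> vge F v 0"
    proof (cases "v \<in> P")
      case True
      have "x = (x \<ominus> t v) \<oplus> t v" using x(1) tcB[of v] True by (simp add: a_minus_def a_assoc l_neg)
      thus ?thesis using v.vge_add[OF v.vge_mono[OF P1[OF True], of 0] tc(2)] True BP(3) by auto
    qed (use x(3) v in blast)
  qed
qed

text \<open>
  An integral vector has unit norm at \<open>v \<in> \<Delta> - B\<close> once its pairing with some integral vector is a unit;
  here \<open>x0\<close> or \<open>y0\<close> serves.
\<close>

lemma first_vector:
  assumes n3: "3 \<le> nn" and g: "\<And>v. v \<in> B \<Longrightarrow> \<exists>x y. gp v x y"
  shows "\<exists>x\<in>carrier V. x \<notin> plane x0 y0 \<and> bq x x0 \<noteq> \<zero> \<and> (\<forall>v\<in>B. \<exists>y. gp v x y) \<and>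
    (\<forall>v\<in>\<Delta> - B. int_at v x \<and> (unit_at F v (bq x x0) \<or> unit_at F v (bq x y0)))"
proof -
  note c = base_closed
  have "\<exists>f N. (\<forall>i. f i \<in> carrier F) \<and> (\<forall>d. (\<forall>i<nn. d i \<in> vge F v N) \<longrightarrow> (\<exists>y. gp v (vv f \<oplus>\<^bsub>V\<^esub> vv d) y))" if v: "v \<in> B" for v
  proof -
    interpret v: valued_qspace F V q v using vq v B by blast
    obtain x y where xy: "gp v x y" using g[OF v] by blast
    obtain f where f: "\<forall>i. f i \<in> carrier F" "x = vv f" using coords_exist[of x] xy by (auto simp: v.gpair_def)
    from v.gpair_open_l[where n = nn and e = ee, OF xy ee_closed] show ?thesis using f by blast
  qed
  then obtain f n where f: "\<And>v i. v \<in> B \<Longrightarrow> f v i \<in> carrier F"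
    and n: "\<And>v d. v \<in> B \<Longrightarrow> (\<forall>i<nn. d i \<in> vge F v (n v)) \<Longrightarrow> \<exists>y. gp v (vv (f v) \<oplus>\<^bsub>V\<^esub> vv d) y" by metis
  obtain lc where l: "\<And>i. lc i \<in> carrier F" "\<And>v i. v \<in> B \<Longrightarrow> lc i \<ominus> f v i \<in> vge F v (n v)" "\<And>v i. v \<in> \<Delta> - B \<Longrightarrow> lc i \<in> vge F v 0"
    using approx_coordinates[where f = f and n = n, OF f] by metis
  define x1 where "x1 = vv lc"
  have x1: "x1 \<in> carrier V" "\<And>v. v \<in> \<Delta> - B \<Longrightarrow> int_at v x1" "\<And>v. v \<in> B \<Longrightarrow> \<exists>y. gp v x1 y"
  proof -
    show "x1 \<in> carrier V" unfolding x1_def using l by (intro vv_closed)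
    show "int_at v x1" if "v \<in> \<Delta> - B" for v
      unfolding x1_def by (rule int_at_vec[OF that]) (use ee_int[OF that] l(3)[OF that] in auto)
    show "\<exists>y. gp v x1 y" if v: "v \<in> B" for v
      using n[OF v, of "\<lambda>i. lc i \<ominus> f v i"] l(2)[OF v] vec_diff[of nn ee lc "f v", OF ee_closed l(1) f[OF v]] by (simp add: x1_def)
  qed
  \<comment> \<open>A small nonzero multiple of an integral vector can be added while keeping
    integrality on \<open>\<Delta> - B\<close> and the local pairs on B.\<close>
  have step: "\<exists>x'. \<exists>k\<in>carrier F. k \<noteq> \<zero> \<and> x' = x \<oplus>\<^bsub>V\<^esub> k \<odot>\<^bsub>V\<^esub> e \<and> x' \<in> carrier V \<and> (\<forall>v\<in>\<Delta> - B. int_at v x') \<and> (\<forall>v\<in>B. \<exists>y. gp v x' y)"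
    if x: "x \<in> carrier V" "\<And>v. v \<in> \<Delta> - B \<Longrightarrow> int_at v x" "\<And>v. v \<in> B \<Longrightarrow> \<exists>y. gp v x y"
      and e: "e \<in> carrier V" "\<And>v. v \<in> \<Delta> - B \<Longrightarrow> int_at v e" for x e
  proof -
    obtain n where n: "\<And>v d. v \<in> B \<Longrightarrow> d \<in> vge F v (n v) \<Longrightarrow> \<exists>y. gp v (x \<oplus>\<^bsub>V\<^esub> d \<odot>\<^bsub>V\<^esub> e) y"
      using gp_perturb_l[OF x(3) e(1)] by blast
    obtain k where k: "k \<in> carrier F" "k \<noteq> \<zero>" "\<And>v. v \<in> B \<Longrightarrow> k \<in> vge F v (n v)" "\<And>v. v \<in> \<Delta> - B \<Longrightarrow> k \<in> vge F v 0"
      using small_element[of n] by blast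
    show ?thesis
      by (intro exI[of _ "x \<oplus>\<^bsub>V\<^esub> k \<odot>\<^bsub>V\<^esub> e"] bexI[of _ k] conjI ballI int_at_add int_at_smult n) (use k x e in auto)
  qed
  obtain x2 where x2: "x2 \<in> carrier V" "\<And>v. v \<in> \<Delta> - B \<Longrightarrow> int_at v x2" "\<And>v. v \<in> B \<Longrightarrow> \<exists>y. gp v x2 y" "x2 \<notin> plane x0 y0"
  proof (cases "x1 \<in> plane x0 y0")
    case True
    obtain i where i: "i < nn" "ee i \<notin> plane x0 y0" using basis_not_in_plane[OF n3 xy0(1,2)] by blast
    obtain x' k where x': "k \<in> carrier F" "k \<noteq> \<zero>" "x' = x1 \<oplus>\<^bsub>V\<^esub> k \<odot>\<^bsub>V\<^esub> ee i" "x' \<in> carrier V" "\<And>v. v \<in> \<Delta> - B \<Longrightarrow> int_at v x'"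
      "\<And>v. v \<in> B \<Longrightarrow> \<exists>y. gp v x' y"
      using step[OF x1 ee_closed[OF i(1)] ee_int[OF _ i(1)]] by blast
    have "x' \<notin> plane x0 y0" unfolding x'(3) by (rule plane_add_not[OF xy0(1,2) True x'(1,2) ee_closed[OF i(1)] i(2)])
    thus ?thesis using that x'(4-6) by blast
  qed (use that x1 in blast)
  \<comment> \<open>\<open>ux\<close> lies in the plane and pairs with \<open>x0\<close> to
    \<open>- D0\<close>. Adding a multiple of it makes b(x, x0) nonzero and does not move x into the
    plane.\<close>
  obtain x3 where x3: "x3 \<in> carrier V" "\<And>v. v \<in> \<Delta> - B \<Longrightarrow> int_at v x3" "\<And>v. v \<in> B \<Longrightarrow> \<exists>y. gp v x3 y" "x3 \<notin> plane x0 y0" "bq x3 x0 \<noteq> \<zero>"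
  proof (cases "bq x2 x0 = \<zero>")
    case True
    obtain x' k where x': "k \<in> carrier F" "k \<noteq> \<zero>" "x' = x2 \<oplus>\<^bsub>V\<^esub> k \<odot>\<^bsub>V\<^esub> ux" "x' \<in> carrier V" "\<And>v. v \<in> \<Delta> - B \<Longrightarrow> int_at v x'"
      "\<And>v. v \<in> B \<Longrightarrow> \<exists>y. gp v x' y"
      using step[OF x2(1-3) c(4) base_int(3)] by blast
    have "x' \<notin> plane x0 y0" unfolding x'(3) by (rule not_plane_add[OF xy0(1,2) x2(1,4) x'(1) plane_u(1)])
    moreover have "bq x' x0 = k \<otimes> \<ominus> D0"
      unfolding x'(3) using x2 c xy0 x'(1) True by (simp add: polar_add_l polar_smult_l ux_polar)
    hence "bq x' x0 \<noteq> \<zero>" using integral[of k "\<ominus> D0"] x'(1,2) minus_D0 c(3) by auto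
    ultimately show ?thesis using that x'(4-6) by blast
  qed (use that x2 in blast)
  define A where "A = bq x3 x0"
  define C where "C = bq x3 y0"
  have AC: "A \<in> carrier F" "A \<noteq> \<zero>" "C \<in> carrier F" using x3 xy0 by (auto simp: A_def C_def)
  \<comment> \<open>Outside P the pairing A with \<open>x0\<close> is a unit already. On P the
    pairing with \<open>y0\<close> is made a unit by a multiple of \<open>uy\<close>, which is
    orthogonal to \<open>x0\<close> and so leaves A unchanged.\<close>
  define P where "P = {v \<in> \<Delta> - B. v A \<noteq> 0}"
  have P: "finite P" by (rule finite_subset[OF _ finite_support[OF AC(1,2)]]) (use Delta_valuations in \<open>auto simp: P_def\<close>)
  obtain n where n: "\<And>v d. v \<in> B \<Longrightarrow> d \<in> vge F v (n v) \<Longrightarrow> \<exists>y. gp v (x3 \<oplus>\<^bsub>V\<^esub> d \<odot>\<^bsub>V\<^esub> uy) y"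
    using gp_perturb_l[OF x3(3) c(5)] by blast
  have PB: "P \<subseteq> \<Delta> - B" by (auto simp: P_def)
  obtain \<delta> where \<delta>: "\<delta> \<in> carrier F" "\<And>v. v \<in> B \<Longrightarrow> \<delta> \<in> vge F v (n v)" "\<And>v. v \<in> \<Delta> - B \<Longrightarrow> \<delta> \<in> vge F v 0"
    "\<And>v. v \<in> P \<Longrightarrow> unit_at F v C \<Longrightarrow> \<delta> \<in> vge F v 1" "\<And>v. v \<in> P \<Longrightarrow> \<not> unit_at F v C \<Longrightarrow> unit_at F v \<delta>"
    by (rule binary_choice[OF P PB, of n "\<lambda>v. unit_at F v C"]) (rule that)
  define x where "x = x3 \<oplus>\<^bsub>V\<^esub> \<delta> \<odot>\<^bsub>V\<^esub> uy"
  have xA: "bq x x0 = A" and xC: "bq x y0 = C \<oplus> \<delta> \<otimes> \<ominus> D0"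
    unfolding x_def using x3 c xy0 \<delta>(1) by (simp_all add: polar_add_l polar_smult_l uy_polar A_def C_def)
  have xc: "x \<in> carrier V" using x3 \<delta> c by (simp add: x_def)
  show ?thesis
  proof (intro bexI[OF _ xc] conjI ballI)
    show "x \<in> carrier V" by (rule xc)
    show "x \<notin> plane x0 y0" unfolding x_def by (rule not_plane_add[OF xy0(1,2) x3(1,4) \<delta>(1) plane_u(2)])
    show "bq x x0 \<noteq> \<zero>" unfolding xA by (rule AC(2))
    show "\<exists>y. gp v x y" if v: "v \<in> B" for v
      unfolding x_def by (rule n[OF v]) (rule \<delta>(2)[OF v])
  next
    fix v assume v: "v \<in> \<Delta> - B"
    interpret v: valued_qspace F V q v by (rule vqD[OF v])
    have \<delta>0: "\<delta> \<in> vge F v 0" by (rule \<delta>(3)[OF v])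
    show "q x \<in> vge F v 0"
      using int_at_add[OF v x3(2)[OF v] int_at_smult[OF v \<delta>0 base_int(4)[OF v]]] by (simp add: x_def)
    show "unit_at F v (bq x x0) \<or> unit_at F v (bq x y0)"
    proof (cases "v \<in> P")
      case False
      thus ?thesis using AC v xA by (simp add: P_def unit_at_def)
    next
      case P: True
      note D = base_units(4)[OF v]
      have yc: "bq x y0 \<in> carrier F" unfolding xC using AC \<delta>(1) c by simp
      have "unit_at F v (bq x y0)"
      proof (cases "unit_at F v C")
        case True
        hence "\<delta> \<in> vge F v 1" by (rule \<delta>(4)[OF P])
        hence "\<delta> \<otimes> \<ominus> D0 \<in> vge F v 1" using v.vge_mult0r v.unit_at_vge[OF D] by blast
        moreover have "bq x y0 \<ominus> C = \<delta> \<otimes> \<ominus> D0" unfolding xC using AC(3) \<delta>(1) c(3) by algebra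
        ultimately show ?thesis using v.unit_at_close[OF True yc] by simp
      next
        case False
        have "C \<in> vge F v 0" unfolding C_def by (rule int_at_polar[OF v x3(2)[OF v] base_int(2)[OF v]])
        hence C1: "C \<in> vge F v 1" by (rule v.unit_at_vge1[OF _ False])
        have "unit_at F v \<delta>" using P False by (rule \<delta>(5))
        hence u: "unit_at F v (\<delta> \<otimes> \<ominus> D0)" using D by (rule v.unit_at_mult)
        have "bq x y0 \<ominus> \<delta> \<otimes> \<ominus> D0 = C" unfolding xC using AC(3) \<delta>(1) c(3) by algebra
        thus ?thesis using v.unit_at_close[OF u yc] C1 by simp
      qed
      thus ?thesis ..
    qed
  qed
qed


text \<open>Since b(x, y) = 1 is a unit, both norms are units by \<open>int_at_unit\<close>, and
  only the discriminant has to be checked.\<close>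

lemma gp_off_B:
  assumes v: "v \<in> \<Delta> - B" and x: "int_at v x" and y: "int_at v y" and b: "bq x y = \<one>"
    and D: "unit_at F v (disc (q x \<otimes> q y))"
  shows "gp v x y"
proof -
  interpret v: valued_qspace F V q v by (rule vqD[OF v])
  have "unit_at F v (q x)" using int_at_unit[OF v x y] b by simp
  moreover have "unit_at F v (q y)" using int_at_unit[OF v y x] b polar_sym[of x y] x y by simp
  ultimately show ?thesis using x y b D v.unit_at_mult by (simp add: v.gpair_def)
qed

text \<open>The vector is orthogonal to x, and together with x it spans the plane of x and y when 2
  q(x) is nonzero. That is why its norm exhibits the discriminant.\<close>

lemma reflected_vector:
  assumes x: "x \<in> carrier V" and y: "y \<in> carrier V" and b: "bq x y = \<one>"
  shows "q (comb2 (q x \<oplus> q x) y (\<ominus> \<one>) x) = \<ominus> (disc (q x \<otimes> q y) \<otimes> q x)"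
proof -
  define a where "a = q x"
  define d where "d = q y"
  have c: "a \<in> carrier F" "d \<in> carrier F" using x y by (auto simp: a_def d_def)
  have 1: "bq y x = \<one>" using b polar_sym x y by metis
  have "q (comb2 (a \<oplus> a) y (\<ominus> \<one>) x) = (a \<oplus> a) \<otimes> (a \<oplus> a) \<otimes> d \<oplus> \<ominus> \<one> \<otimes> \<ominus> \<one> \<otimes> a \<oplus> (a \<oplus> a) \<otimes> \<ominus> \<one> \<otimes> \<one>"
    using c x y by (simp only: q_comb2 a_closed a_inv_closed one_closed 1 a_def[symmetric] d_def[symmetric])
  also have "\<ominus> \<one> \<otimes> \<ominus> \<one> \<otimes> a = a" using c by algebra
  also have "(a \<oplus> a) \<otimes> \<ominus> \<one> \<otimes> \<one> = \<ominus> a \<ominus> a" using c by algebra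
  also have "(a \<oplus> a) \<otimes> (a \<oplus> a) \<otimes> d \<oplus> a \<oplus> (\<ominus> a \<ominus> a) = \<ominus> (disc (a \<otimes> d) \<otimes> a)"
    unfolding disc_def using c by algebra
  finally show ?thesis by (simp add: a_def d_def)
qed

text \<open>The solutions of b(x, y) = 1 form a coset of the orthogonal space of x. With a base
  point s and generators \<open>f i\<close> of that space, all integral on
  \<open>\<Delta> - B\<close>, coordinates can be approximated while the equation stays
  exact.\<close>

lemma second_vector:
  assumes x: "x \<in> carrier V" "bq x x0 \<noteq> \<zero>" and g: "\<And>v. v \<in> B \<Longrightarrow> \<exists>y. gp v x y"
    and xi: "\<And>v. v \<in> \<Delta> - B \<Longrightarrow> int_at v x" and xu: "\<And>v. v \<in> \<Delta> - B \<Longrightarrow> unit_at F v (bq x x0) \<or> unit_at F v (bq x y0)"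
  obtains u s y where "u \<in> plane x0 y0" "s \<in> plane x0 y0" "y \<in> carrier V" "q u \<noteq> \<zero>" "bq x u = \<zero>" "bq x s = \<one>"
    "\<And>v. v \<in> \<Delta> - B \<Longrightarrow> int_at v u" "\<And>v. v \<in> \<Delta> - B \<Longrightarrow> unit_at F v (q u)" "\<And>v. v \<in> \<Delta> - B \<Longrightarrow> int_at v s"
    "\<And>v. v \<in> \<Delta> - B \<Longrightarrow> int_at v y" "\<And>v. v \<in> B \<Longrightarrow> gp v x y"
proof -
  note c = base_closed
  define A where "A = bq x x0"
  define C where "C = bq x y0"
  have AC: "A \<in> carrier F" "A \<noteq> \<zero>" "C \<in> carrier F" using x xy0 by (auto simp: A_def C_def)
  \<comment> \<open>The vector of the plane orthogonal to x. Its pairings with \<open>ux\<close> and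
    \<open>uy\<close> are C and A up to sign and the factor \<open>D0\<close>; at each place of
    \<open>\<Delta> - B\<close> one of them is a unit, which makes q(u) a unit.\<close>
  define u where "u = comb2 C x0 (\<ominus> A) y0"
  have uc: "u \<in> carrier V" using AC xy0 by (simp add: u_def)
  have up: "u \<in> plane x0 y0" unfolding u_def plane_def using AC by blast
  have xu0: "bq x u = \<zero>"
  proof -
    have "bq x u = C \<otimes> A \<oplus> \<ominus> A \<otimes> C" unfolding u_def using AC xy0 x by (simp add: polar_comb2_r A_def C_def)
    also have "\<dots> = \<zero>" using AC by algebra
    finally show ?thesis .
  qed
  have uux: "bq u ux = C \<otimes> \<ominus> D0" and uuy: "bq u uy = \<ominus> A \<otimes> \<ominus> D0"
    unfolding u_def using AC(1,3) xy0(1,2) c by (simp_all add: polar_comb2_l ux_polar uy_polar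
      polar_sym[OF xy0(1) c(4)] polar_sym[OF xy0(2) c(4)] polar_sym[OF xy0(1) c(5)] polar_sym[OF xy0(2) c(5)])
  have "bq u uy \<noteq> \<zero>"
  proof
    assume "bq u uy = \<zero>"
    hence "A \<otimes> D0 = \<zero>" using AC c by (simp add: uuy l_minus r_minus)
    thus False using integral[of A D0] AC c xy0 by auto
  qed
  hence unz: "q u \<noteq> \<zero>" using aniso[OF uc] polar_zero_l[OF c(5)] by metis
  have ui: "int_at v u" "unit_at F v (q u)" if v: "v \<in> \<Delta> - B" for v
  proof -
    interpret v: valued_qspace F V q v by (rule vqD[OF v])
    have "A \<in> vge F v 0" "C \<in> vge F v 0" unfolding A_def C_def
      by (rule int_at_polar[OF v xi[OF v] base_int(1)[OF v]], rule int_at_polar[OF v xi[OF v] base_int(2)[OF v]])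
    thus 1: "int_at v u" unfolding u_def by (intro int_at_comb2[OF v] v.vge_minus base_int[OF v])
    have "unit_at F v (bq u uy) \<or> unit_at F v (bq u ux)"
      unfolding uux uuy using xu[OF v] v.unit_at_mult[OF _ base_units(4)[OF v]] v.unit_at_minus unfolding A_def C_def by blast
    thus "unit_at F v (q u)" using int_at_unit[OF v 1 base_int(3)[OF v]] int_at_unit[OF v 1 base_int(4)[OF v]] by blast
  qed
  define Q where "Q = q u"
  have Q: "Q = C \<otimes> C \<otimes> a0 \<oplus> A \<otimes> A \<otimes> d0 \<ominus> A \<otimes> C"
  proof -
    have "Q = C \<otimes> C \<otimes> a0 \<oplus> \<ominus> A \<otimes> \<ominus> A \<otimes> d0 \<oplus> C \<otimes> \<ominus> A \<otimes> \<one>"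
      unfolding Q_def u_def using AC xy0 by (simp only: q_comb2 a_inv_closed)
    also have "C \<otimes> \<ominus> A \<otimes> \<one> = C \<otimes> \<ominus> A" using AC by simp
    also have "C \<otimes> C \<otimes> a0 \<oplus> \<ominus> A \<otimes> \<ominus> A \<otimes> d0 \<oplus> C \<otimes> \<ominus> A = C \<otimes> C \<otimes> a0 \<oplus> A \<otimes> A \<otimes> d0 \<ominus> A \<otimes> C"
      using AC(1,3) c(1,2) by algebra
    finally show ?thesis .
  qed
  have Qc: "Q \<in> carrier F" "Q \<noteq> \<zero>" using unz uc by (auto simp: Q_def)
  have iQ: "inv Q \<in> carrier F" "Q \<otimes> inv Q = \<one>" using field_Units Qc by auto
  \<comment> \<open>The coefficients are chosen so that the pairing of x with the bracket is C^2 a0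
    + A^2 d0 - A C = Q. As Q is a unit on \<open>\<Delta> - B\<close>, dividing by it keeps s
    integral there.\<close>
  define s where "s = inv Q \<odot>\<^bsub>V\<^esub> comb2 (d0 \<otimes> A \<ominus> C) x0 (a0 \<otimes> C) y0"
  have sp: "s \<in> plane x0 y0" unfolding s_def using iQ(1) AC(1,3) c(1,2)
    by (intro plane_smult[OF xy0(1,2)]) (auto simp: plane_def)
  have sc: "s \<in> carrier V" by (rule plane_closed[OF xy0(1,2) sp])
  have xs: "bq x s = \<one>"
  proof -
    have "bq x s = inv Q \<otimes> ((d0 \<otimes> A \<ominus> C) \<otimes> A \<oplus> a0 \<otimes> C \<otimes> C)"
      unfolding s_def using AC(1,3) c(1,2) xy0(1,2) x(1) iQ(1) by (simp add: polar_smult_r polar_comb2_r A_def[symmetric] C_def[symmetric])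
    also have "(d0 \<otimes> A \<ominus> C) \<otimes> A \<oplus> a0 \<otimes> C \<otimes> C = Q" unfolding Q using AC(1,3) c(1,2) by algebra
    finally show ?thesis using iQ Qc(1) m_comm[of "inv Q" Q] by simp
  qed
  have si: "int_at v s" if v: "v \<in> \<Delta> - B" for v
  proof -
    interpret v: valued_qspace F V q v by (rule vqD[OF v])
    have 1: "A \<in> vge F v 0" "C \<in> vge F v 0" unfolding A_def C_def
      by (rule int_at_polar[OF v xi[OF v] base_int(1)[OF v]], rule int_at_polar[OF v xi[OF v] base_int(2)[OF v]])
    have 2: "a0 \<in> vge F v 0" "d0 \<in> vge F v 0" "inv Q \<in> vge F v 0"
      using base_units[OF v] v.unit_at_inv ui(2)[OF v] v.unit_at_vge by (auto simp: Q_def)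
    show ?thesis unfolding s_def
      by (intro int_at_smult[OF v] int_at_comb2[OF v] base_int[OF v] 2 v.vge_diff v.vge_mult0 1)
  qed
  \<comment> \<open>The basis vectors projected along s onto the orthogonal space of x; they remain
    integral because s is.\<close>
  define f where "f = (\<lambda>i. ee i \<oplus>\<^bsub>V\<^esub> (\<ominus> bq x (ee i)) \<odot>\<^bsub>V\<^esub> s)"
  have fc: "i < nn \<Longrightarrow> f i \<in> carrier V" for i unfolding f_def using ee_closed x sc by simp
  have xf: "i < nn \<Longrightarrow> bq x (f i) = \<zero>" for i
    unfolding f_def using ee_closed x sc xs by (simp add: polar_add_r polar_smult_r r_neg)
  have fi: "int_at v (f i)" if v: "v \<in> \<Delta> - B" and i: "i < nn" for v i
  proof -
    interpret v: valued_qspace F V q v by (rule vqD[OF v])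
    show ?thesis unfolding f_def
      by (intro int_at_add[OF v] int_at_smult[OF v] si[OF v] ee_int[OF v i] v.vge_minus int_at_polar[OF v xi[OF v]])
  qed
  \<comment> \<open>A vector with b(x, z) = 1 keeps its coordinates when it is written as s plus a
    combination of the \<open>f i\<close>: the multiples of s add up to zero.\<close>
  have vf: "s \<oplus>\<^bsub>V\<^esub> vec f d nn = z" if d: "\<And>i. d i \<in> carrier F" and z: "z = vv d" "bq x z = \<one>" for d z
  proof -
    have "vec f d m = vec ee d m \<oplus>\<^bsub>V\<^esub> (\<ominus> bq x (vec ee d m)) \<odot>\<^bsub>V\<^esub> s" if "m \<le> nn" for m
      using that
    proof (induct m)
      case 0
      thus ?case using x sc by simp
    next
      case (Suc m)
      define p where "p = vec ee d m"
      define e where "e = ee m"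
      have c: "p \<in> carrier V" "e \<in> carrier V" unfolding p_def e_def using Suc(2) d ee_closed by (auto intro!: vec_closed)
      have k: "bq x p \<in> carrier F" "bq x e \<in> carrier F" using c x by auto
      have IH: "vec f d m = p \<oplus>\<^bsub>V\<^esub> (\<ominus> bq x p) \<odot>\<^bsub>V\<^esub> s" using Suc by (simp add: p_def)
      have fm: "f m = e \<oplus>\<^bsub>V\<^esub> (\<ominus> bq x e) \<odot>\<^bsub>V\<^esub> s" by (simp add: f_def e_def)
      have "vec f d (Suc m) = (p \<oplus>\<^bsub>V\<^esub> (\<ominus> bq x p) \<odot>\<^bsub>V\<^esub> s) \<oplus>\<^bsub>V\<^esub> (d m \<odot>\<^bsub>V\<^esub> e \<oplus>\<^bsub>V\<^esub> (d m \<otimes> \<ominus> bq x e) \<odot>\<^bsub>V\<^esub> s)"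
        using c k d[of m] sc IH fm by (simp add: V.smult_r_distr V.smult_assoc1)
      also have "\<dots> = (p \<oplus>\<^bsub>V\<^esub> d m \<odot>\<^bsub>V\<^esub> e) \<oplus>\<^bsub>V\<^esub> ((\<ominus> bq x p) \<odot>\<^bsub>V\<^esub> s \<oplus>\<^bsub>V\<^esub> (d m \<otimes> \<ominus> bq x e) \<odot>\<^bsub>V\<^esub> s)"
        using c k d[of m] sc by (simp add: V.a_ac)
      also have "(\<ominus> bq x p) \<odot>\<^bsub>V\<^esub> s \<oplus>\<^bsub>V\<^esub> (d m \<otimes> \<ominus> bq x e) \<odot>\<^bsub>V\<^esub> s = (\<ominus> bq x p \<oplus> d m \<otimes> \<ominus> bq x e) \<odot>\<^bsub>V\<^esub> s"
        using k d[of m] sc by (simp add: V.smult_l_distr)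
      also have "\<ominus> bq x p \<oplus> d m \<otimes> \<ominus> bq x e = \<ominus> bq x (p \<oplus>\<^bsub>V\<^esub> d m \<odot>\<^bsub>V\<^esub> e)"
        using k c d[of m] x by (simp add: polar_add_r polar_smult_r minus_add r_minus)
      finally show ?case by (simp add: p_def e_def)
    qed
    from this[of nn] have v: "vec f d nn = z \<oplus>\<^bsub>V\<^esub> (\<ominus> \<one>) \<odot>\<^bsub>V\<^esub> s" using z by simp
    have zc: "z \<in> carrier V" unfolding z(1) using d by (intro vv_closed)
    have "s \<oplus>\<^bsub>V\<^esub> (z \<oplus>\<^bsub>V\<^esub> (\<ominus> \<one>) \<odot>\<^bsub>V\<^esub> s) = z \<oplus>\<^bsub>V\<^esub> \<one> \<odot>\<^bsub>V\<^esub> s \<oplus>\<^bsub>V\<^esub> (\<ominus> \<one>) \<odot>\<^bsub>V\<^esub> s"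
      using zc sc by (simp add: V.a_ac)
    thus ?thesis unfolding v using add_smult_cancel(1)[OF zc one_closed sc] by simp
  qed
  have "\<exists>d N. (\<forall>i. d i \<in> carrier F) \<and> (\<forall>d'. (\<forall>i<nn. d' i \<in> vge F v N) \<longrightarrow> gp v x ((s \<oplus>\<^bsub>V\<^esub> vec f d nn) \<oplus>\<^bsub>V\<^esub> vec f d' nn))"
    if v: "v \<in> B" for v
  proof -
    interpret v: valued_qspace F V q v using vq v B by blast
    obtain y where y: "gp v x y" using g[OF v] by blast
    hence y': "y \<in> carrier V" "bq x y = \<one>" by (auto simp: v.gpair_def)
    obtain d where d: "\<forall>i. d i \<in> carrier F" "y = vv d" using coords_exist[OF y'(1)] by blast
    have "s \<oplus>\<^bsub>V\<^esub> vec f d nn = y" by (rule vf) (use d y' in auto)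
    thus ?thesis using v.gpair_open_r[where n = nn and e = f, OF y fc xf] d(1) by metis
  qed
  then obtain d n where d: "\<And>v i. v \<in> B \<Longrightarrow> d v i \<in> carrier F"
    and n: "\<And>v d'. v \<in> B \<Longrightarrow> (\<forall>i<nn. d' i \<in> vge F v (n v)) \<Longrightarrow> gp v x ((s \<oplus>\<^bsub>V\<^esub> vec f (d v) nn) \<oplus>\<^bsub>V\<^esub> vec f d' nn)" by metis
  obtain lc where l: "\<And>i. lc i \<in> carrier F" "\<And>v i. v \<in> B \<Longrightarrow> lc i \<ominus> d v i \<in> vge F v (n v)" "\<And>v i. v \<in> \<Delta> - B \<Longrightarrow> lc i \<in> vge F v 0"
    using approx_coordinates[where f = d and n = n, OF d] by metis
  define y where "y = s \<oplus>\<^bsub>V\<^esub> vec f lc nn"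
  have yc: "y \<in> carrier V" unfolding y_def using fc l(1) sc by (intro V.a_closed vec_closed) auto
  have yi: "int_at v y" if v: "v \<in> \<Delta> - B" for v
    unfolding y_def by (intro int_at_add[OF v] si[OF v] int_at_vec[OF v] fi[OF v] l(3)[OF v])
  have yg: "gp v x y" if v: "v \<in> B" for v
  proof -
    have vc: "vec f (d v) nn \<in> carrier V" "vec f (\<lambda>i. lc i \<ominus> d v i) nn \<in> carrier V"
      using fc l(1) d[OF v] by (auto intro!: vec_closed)
    have "(s \<oplus>\<^bsub>V\<^esub> vec f (d v) nn) \<oplus>\<^bsub>V\<^esub> vec f (\<lambda>i. lc i \<ominus> d v i) nn = y"
      unfolding y_def using vec_diff[of nn f lc "d v", OF fc l(1) d[OF v]] vc sc by (simp add: V.a_assoc)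
    thus ?thesis using n[OF v, of "\<lambda>i. lc i \<ominus> d v i"] l(2)[OF v] by simp
  qed
  show ?thesis by (rule that[OF up sp yc unz xu0 xs ui(1) ui(2) si yi yg])
qed

end

section \<open>The pair with unit discriminant\<close>

lemma (in valued_field) unit_at_factor:
  assumes "unit_at F v (a \<otimes> b)" "a \<in> carrier F" "unit_at F v b" shows "unit_at F v a"
proof -
  have nz: "a \<noteq> \<zero>" using assms by (auto simp: unit_at_def)
  thus ?thesis using assms v_mult[of a b] by (auto simp: unit_at_def)
qed

context good_reduction
begin

lemma two_unit: assumes "\<one> \<oplus> \<one> \<noteq> \<zero>" "v \<in> valuations F K" shows "unit_at F v (\<one> \<oplus> \<one>)"
proof -
  have "\<one> \<oplus> \<one> \<in> K" using subringE[OF subfieldE(1)[OF K]] by auto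
  thus ?thesis using assms valuations_const[OF assms(2), of "\<one> \<oplus> \<one>"] by (simp add: unit_at_def)
qed

text \<open>
  With \<open>y' = 2 q(x) y - x\<close>, the discriminant is a unit where \<open>q(y')\<close> is. The component \<open>w\<close> of \<open>x\<close> orthogonal
  to \<open>x0\<close> and \<open>y0\<close> pairs with \<open>y'\<close> to a nonzero element, and at its finitely many zeros \<open>y\<close> is shifted by a
  multiple of \<open>u\<close> so that \<open>b(u, y')\<close> becomes a unit. As \<open>b(w, u) = 0\<close>, this leaves \<open>b(w, y')\<close> unchanged.
\<close>

theorem global_pair:
  assumes n3: "3 \<le> nn" and g: "\<And>v. v \<in> B \<Longrightarrow> \<exists>x y. gp v x y"
  shows "\<exists>x y. \<forall>v\<in>\<Delta> \<union> B. gp v x y"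
proof -
  note c = base_closed
  obtain x where x: "x \<in> carrier V" "x \<notin> plane x0 y0" "bq x x0 \<noteq> \<zero>" "\<And>v. v \<in> B \<Longrightarrow> \<exists>y. gp v x y"
    "\<And>v. v \<in> \<Delta> - B \<Longrightarrow> int_at v x" "\<And>v. v \<in> \<Delta> - B \<Longrightarrow> unit_at F v (bq x x0) \<or> unit_at F v (bq x y0)"
    using first_vector[OF n3 g] by metis
  obtain u s ya where us: "u \<in> plane x0 y0" "s \<in> plane x0 y0" "ya \<in> carrier V" "q u \<noteq> \<zero>" "bq x u = \<zero>" "bq x s = \<one>"
    and usi: "\<And>v. v \<in> \<Delta> - B \<Longrightarrow> int_at v u" "\<And>v. v \<in> \<Delta> - B \<Longrightarrow> unit_at F v (q u)" "\<And>v. v \<in> \<Delta> - B \<Longrightarrow> int_at v s"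
      "\<And>v. v \<in> \<Delta> - B \<Longrightarrow> int_at v ya" "\<And>v. v \<in> B \<Longrightarrow> gp v x ya"
    by (rule second_vector[OF x(1,3)], erule x(4), erule x(5), erule x(6), rule that)
  \<comment> \<open>The local condition contains the equation b(x, y) = 1 over F, and B is not
    empty.\<close>
  have bxy: "bq x y = \<one>" if "\<And>v. v \<in> B \<Longrightarrow> gp v x y" for y
    using B gp_dest(3)[OF _ that] by blast
  show ?thesis
  proof (cases "\<one> \<oplus> \<one> = \<zero>")
    \<comment> \<open>In characteristic 2 the discriminant is 1, so the pair from
      \<open>second_vector\<close> serves.\<close>
    case True
    have "k \<oplus> k = \<zero>" if "k \<in> carrier F" for k
    proof -
      have "k \<oplus> k = (\<one> \<oplus> \<one>) \<otimes> k" using that by (simp add: l_distr)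
      thus ?thesis using True that by simp
    qed
    hence "disc k = \<one>" if "k \<in> carrier F" for k using that by (simp add: disc_def a_minus_def)
    hence D: "disc (q x \<otimes> q ya) = \<one>" using x us by simp
    have "gp v x ya" if v: "v \<in> \<Delta> - B" for v
    proof -
      interpret v: valued_qspace F V q v by (rule vqD[OF v])
      show ?thesis by (rule gp_off_B[OF v x(5)[OF v] usi(4)[OF v] bxy[OF usi(5)]]) (auto simp: D)
    qed
    thus ?thesis using usi(5) by blast
  next
    case False
    have uc: "u \<in> carrier V" and sc: "s \<in> carrier V" using plane_closed[OF xy0(1,2)] us by auto
    define A where "A = bq x x0"
    define C where "C = bq x y0"
    define i where "i = inv D0"
    have AC: "A \<in> carrier F" "C \<in> carrier F" "i \<in> carrier F" "D0 \<otimes> i = \<one>"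
      using x xy0 field_Units c(3) by (auto simp: A_def C_def i_def)
    \<comment> \<open>Coordinates of the orthogonal projection p of x to the plane, from the inverse
      of the Gram matrix of \<open>x0\<close> and \<open>y0\<close>, whose determinant is
      \<open>- D0\<close>.\<close>
    define \<alpha> where "\<alpha> = (C \<ominus> (d0 \<oplus> d0) \<otimes> A) \<otimes> i"
    define \<beta> where "\<beta> = (A \<ominus> (a0 \<oplus> a0) \<otimes> C) \<otimes> i"
    define p where "p = comb2 \<alpha> x0 \<beta> y0"
    have ab: "\<alpha> \<in> carrier F" "\<beta> \<in> carrier F" using AC c by (auto simp: \<alpha>_def \<beta>_def)
    have pp: "p \<in> plane x0 y0" unfolding p_def plane_def using ab by blast
    have pc: "p \<in> carrier V" by (rule plane_closed[OF xy0(1,2) pp])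
    have px: "bq p x0 = A"
    proof -
      have "bq p x0 = \<alpha> \<otimes> (a0 \<oplus> a0) \<oplus> \<beta> \<otimes> \<one>" unfolding p_def using ab xy0 by (simp add: polar_comb2_l base_polar)
      also have "\<beta> \<otimes> \<one> = \<beta>" using ab by simp
      also have "\<alpha> \<otimes> (a0 \<oplus> a0) \<oplus> \<beta> = A \<otimes> (D0 \<otimes> i)" unfolding \<alpha>_def \<beta>_def disc_def using AC(1-3) c(1,2) by algebra
      finally show ?thesis using AC by simp
    qed
    have py: "bq p y0 = C"
    proof -
      have "bq p y0 = \<alpha> \<otimes> \<one> \<oplus> \<beta> \<otimes> (d0 \<oplus> d0)" unfolding p_def using ab xy0 by (simp add: polar_comb2_l base_polar)
      also have "\<alpha> \<otimes> \<one> = \<alpha>" using ab by simp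
      also have "\<alpha> \<oplus> \<beta> \<otimes> (d0 \<oplus> d0) = C \<otimes> (D0 \<otimes> i)" unfolding \<alpha>_def \<beta>_def disc_def using AC(1-3) c(1,2) by algebra
      finally show ?thesis using AC by simp
    qed
    define w where "w = x \<oplus>\<^bsub>V\<^esub> (\<ominus> \<one>) \<odot>\<^bsub>V\<^esub> p"
    have wc: "w \<in> carrier V" using x pc by (simp add: w_def)
    have "bq w x0 = A \<oplus> \<ominus> \<one> \<otimes> A" "bq w y0 = C \<oplus> \<ominus> \<one> \<otimes> C"
      unfolding w_def using x(1) pc xy0(1,2) by (simp_all add: polar_add_l polar_smult_l px py A_def C_def)
    hence w0: "bq w x0 = \<zero>" "bq w y0 = \<zero>" using AC by (simp_all add: l_minus r_neg)
    have wpl: "bq w z = \<zero>" if "z \<in> plane x0 y0" for z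
      using that wc xy0 by (auto simp: plane_def polar_comb2_r w0)
    have xwp: "x = w \<oplus>\<^bsub>V\<^esub> p" using add_smult_cancel(1)[OF x(1) _ pc, of "\<ominus> \<one>"] pc by (simp add: w_def)
    define W where "W = q w"
    \<comment> \<open>Here it matters that x was moved out of the plane, which is possible in
      dimension at least 3.\<close>
    have "w \<noteq> \<zero>\<^bsub>V\<^esub>" using xwp pp x(2) pc by auto
    hence W: "W \<in> carrier F" "W \<noteq> \<zero>" using aniso[OF wc] wc by (auto simp: W_def)
    have two: "k \<oplus> k \<noteq> \<zero>" if "k \<in> carrier F" "k \<noteq> \<zero>" for k
    proof
      assume "k \<oplus> k = \<zero>"
      hence "(\<one> \<oplus> \<one>) \<otimes> k = \<zero>" using that by (simp add: l_distr)
      thus False using integral[of "\<one> \<oplus> \<one>" k] that False by auto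
    qed
    have bww: "bq w w = W \<oplus> W" using polar_self[OF wc] by (simp add: W_def)
    have "bq w (w \<oplus>\<^bsub>V\<^esub> p) = W \<oplus> W" using wc pc W wpl[OF pp] by (simp add: polar_add_r bww)
    hence bwx: "bq w x = W \<oplus> W" "bq x w = W \<oplus> W" using xwp polar_sym[OF wc x(1)] by auto
    have wi: "int_at v w" if v: "v \<in> \<Delta> - B" for v
    proof -
      interpret v: valued_qspace F V q v by (rule vqD[OF v])
      have 1: "A \<in> vge F v 0" "C \<in> vge F v 0" unfolding A_def C_def
        by (rule int_at_polar[OF v x(5)[OF v] base_int(1)[OF v]], rule int_at_polar[OF v x(5)[OF v] base_int(2)[OF v]])
      have 2: "a0 \<in> vge F v 0" "d0 \<in> vge F v 0" "i \<in> vge F v 0" unfolding i_def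
        using base_units[OF v] v.unit_at_inv v.unit_at_vge by auto
      show ?thesis unfolding w_def p_def \<alpha>_def \<beta>_def
        by (intro int_at_add[OF v] int_at_smult[OF v] int_at_comb2[OF v] x(5)[OF v] base_int[OF v]
            v.vge_mult0 v.vge_diff v.vge_add v.vge_minus v.vge_one 1 2)
    qed
    \<comment> \<open>Orthogonal to x, so adding multiples of it to y keeps b(x, y) = 1. Its pairing
      with w is 2 W, which is nonzero, so it can move b(w, y') away from zero.\<close>
    define f where "f = w \<oplus>\<^bsub>V\<^esub> (\<ominus> (W \<oplus> W)) \<odot>\<^bsub>V\<^esub> s"
    have fc: "f \<in> carrier V" using wc sc W by (simp add: f_def)
    have xf: "bq x f = \<zero>" unfolding f_def using x(1) wc sc W us(6) by (simp add: polar_add_r polar_smult_r bwx r_neg)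
    have wf: "bq w f = W \<oplus> W" unfolding f_def using wc sc W by (simp add: polar_add_r polar_smult_r bww wpl[OF us(2)])
    have fi: "int_at v f" if v: "v \<in> \<Delta> - B" for v
    proof -
      interpret v: valued_qspace F V q v by (rule vqD[OF v])
      have "W \<in> vge F v 0" using wi[OF v] by (simp add: W_def)
      thus ?thesis unfolding f_def by (intro int_at_add[OF v] int_at_smult[OF v] wi[OF v] usi(3)[OF v] v.vge_minus v.vge_add)
    qed
    define a where "a = q x"
    have "x \<noteq> \<zero>\<^bsub>V\<^esub>" using us(6) polar_zero_l[OF sc] by auto
    hence a: "a \<in> carrier F" "a \<noteq> \<zero>" using aniso[OF x(1)] x(1) by (auto simp: a_def)
    have aa: "a \<oplus> a \<in> carrier F" "a \<oplus> a \<noteq> \<zero>" using a two by auto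
    define y' where "y' = (\<lambda>y. comb2 (a \<oplus> a) y (\<ominus> \<one>) x)"
    have y'c: "y \<in> carrier V \<Longrightarrow> y' y \<in> carrier V" for y using a x(1) by (simp add: y'_def)
    have rho: "bq w (y' y) = (a \<oplus> a) \<otimes> bq w y \<ominus> (W \<oplus> W)" if "y \<in> carrier V" for y
      unfolding y'_def using that a x(1) wc W by (simp add: polar_comb2_r bwx l_minus a_minus_def)
    obtain yb where yb: "yb \<in> carrier V" "\<And>v. v \<in> B \<Longrightarrow> gp v x yb" "\<And>v. v \<in> \<Delta> - B \<Longrightarrow> int_at v yb" "bq w (y' yb) \<noteq> \<zero>"
    proof (cases "bq w (y' ya) = \<zero>")
      case r0: True
      obtain n where n: "\<And>v d. v \<in> B \<Longrightarrow> d \<in> vge F v (n v) \<Longrightarrow> gp v x (ya \<oplus>\<^bsub>V\<^esub> d \<odot>\<^bsub>V\<^esub> f)"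
        using gp_perturb_r[OF usi(5) fc xf] by blast
      obtain k where k: "k \<in> carrier F" "k \<noteq> \<zero>" "\<And>v. v \<in> B \<Longrightarrow> k \<in> vge F v (n v)" "\<And>v. v \<in> \<Delta> - B \<Longrightarrow> k \<in> vge F v 0"
        using small_element[of n] by blast
      define yb where "yb = ya \<oplus>\<^bsub>V\<^esub> k \<odot>\<^bsub>V\<^esub> f"
      have ybc: "yb \<in> carrier V" using us fc k by (simp add: yb_def)
      have bc: "bq w ya \<in> carrier F" using wc us by simp
      have WW: "W \<oplus> W \<in> carrier F" using W by simp
      have "bq w yb = bq w ya \<oplus> k \<otimes> (W \<oplus> W)" unfolding yb_def using wc us(3) fc k(1) by (simp add: polar_add_r polar_smult_r wf)
      hence "bq w (y' yb) = (a \<oplus> a) \<otimes> (bq w ya \<oplus> k \<otimes> (W \<oplus> W)) \<ominus> (W \<oplus> W)" using rho[OF ybc] by simp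
      also have "\<dots> = ((a \<oplus> a) \<otimes> bq w ya \<ominus> (W \<oplus> W)) \<oplus> (a \<oplus> a) \<otimes> (k \<otimes> (W \<oplus> W))"
        using bc WW aa(1) k(1) by algebra
      also have "\<dots> = (a \<oplus> a) \<otimes> (k \<otimes> (W \<oplus> W))" using r0 rho[OF us(3)] aa(1) k(1) WW by simp
      finally have e: "bq w (y' yb) = (a \<oplus> a) \<otimes> (k \<otimes> (W \<oplus> W))" .
      have "k \<otimes> (W \<oplus> W) \<noteq> \<zero>" using integral[OF _ k(1) WW] k(2) two[OF W] by blast
      hence "bq w (y' yb) \<noteq> \<zero>" unfolding e using integral[OF _ aa(1), of "k \<otimes> (W \<oplus> W)"] aa(2) k(1) WW by blast
      moreover have "int_at v yb" if v: "v \<in> \<Delta> - B" for v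
        unfolding yb_def by (intro int_at_add[OF v] int_at_smult[OF v] usi(4)[OF v] fi[OF v] k(4)[OF v])
      moreover have "gp v x yb" if "v \<in> B" for v unfolding yb_def by (rule n[OF that k(3)[OF that]])
      ultimately show ?thesis using that ybc by blast
    qed (use that us(3) usi(4,5) in blast)
    define r where "r = bq w (y' yb)"
    have r: "r \<in> carrier F" "r \<noteq> \<zero>" using yb y'c wc by (auto simp: r_def)
    define P where "P = {v \<in> \<Delta> - B. v r \<noteq> 0}"
    have P: "finite P" by (rule finite_subset[OF _ finite_support[OF r]]) (use Delta_valuations in \<open>auto simp: P_def\<close>)
    have PB: "P \<subseteq> \<Delta> - B" by (auto simp: P_def)
    obtain n where n: "\<And>v d. v \<in> B \<Longrightarrow> d \<in> vge F v (n v) \<Longrightarrow> gp v x (yb \<oplus>\<^bsub>V\<^esub> d \<odot>\<^bsub>V\<^esub> u)"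
      using gp_perturb_r[OF yb(2) uc us(5)] by blast
    \<comment> \<open>At a place of P where b(u, yb) is a unit, t lies in the maximal ideal and
      preserves the residue. Where it is not, t is a unit, and so is the added term t Qu = 2 t
      q(u).\<close>
    obtain t where t: "t \<in> carrier F" "\<And>v. v \<in> B \<Longrightarrow> t \<in> vge F v (n v)" "\<And>v. v \<in> \<Delta> - B \<Longrightarrow> t \<in> vge F v 0"
      "\<And>v. v \<in> P \<Longrightarrow> unit_at F v (bq u yb) \<Longrightarrow> t \<in> vge F v 1" "\<And>v. v \<in> P \<Longrightarrow> \<not> unit_at F v (bq u yb) \<Longrightarrow> unit_at F v t"
      by (rule binary_choice[OF P PB, of n "\<lambda>v. unit_at F v (bq u yb)"]) (rule that)
    define y where "y = yb \<oplus>\<^bsub>V\<^esub> t \<odot>\<^bsub>V\<^esub> u"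
    have yc: "y \<in> carrier V" using yb uc t by (simp add: y_def)
    have yg: "gp v x y" if "v \<in> B" for v unfolding y_def by (rule n[OF that t(2)[OF that]])
    have xy: "bq x y = \<one>" by (rule bxy[OF yg])
    define Qu where "Qu = q u \<oplus> q u"
    have Qu: "Qu \<in> carrier F" using uc by (simp add: Qu_def)
    have wy: "bq w (y' y) = r"
    proof -
      have "bq w y = bq w yb" unfolding y_def using wc yb uc t(1) by (simp add: polar_add_r polar_smult_r wpl[OF us(1)])
      thus ?thesis using rho[OF yc] rho[OF yb(1)] by (simp add: r_def)
    qed
    have uy: "bq u y = bq u yb \<oplus> t \<otimes> Qu"
      unfolding y_def using uc yb t(1) by (simp add: polar_add_r polar_smult_r polar_self Qu_def)
    have uy': "bq u (y' y) = (a \<oplus> a) \<otimes> bq u y"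
      unfolding y'_def using uc yc x(1) a us(5) polar_sym[OF uc x(1)] by (simp add: polar_comb2_r)
    have "gp v x y" if v: "v \<in> \<Delta> - B" for v
    proof -
      interpret v: valued_qspace F V q v by (rule vqD[OF v])
      have vv: "v \<in> valuations F K" using v Delta_valuations by blast
      have av: "unit_at F v a" unfolding a_def
        by (rule int_at_unit[OF v x(5)[OF v] usi(3)[OF v]]) (simp add: us(6))
      have dbl: "unit_at F v (k \<oplus> k)" if "unit_at F v k" for k
      proof -
        have "k \<oplus> k = (\<one> \<oplus> \<one>) \<otimes> k" using that by (simp add: l_distr unit_at_def)
        thus ?thesis using v.unit_at_mult[OF two_unit[OF False vv] that] by simp
      qed
      have yi: "int_at v y" unfolding y_def by (intro int_at_add[OF v] int_at_smult[OF v] yb(3)[OF v] usi(1)[OF v] t(3)[OF v])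
      have y'i: "int_at v (y' y)" unfolding y'_def
        by (intro int_at_comb2[OF v] yi x(5)[OF v] v.vge_minus v.vge_one v.unit_at_vge[OF dbl[OF av]])
      have "unit_at F v (q (y' y))"
      proof (cases "v \<in> P")
        case False
        hence "unit_at F v (bq w (y' y))" unfolding wy using v r by (simp add: P_def unit_at_def)
        thus ?thesis using int_at_unit[OF v y'i wi[OF v]] polar_sym[OF wc y'c[OF yc]] by simp
      next
        case True
        have Quv: "unit_at F v Qu" unfolding Qu_def by (rule dbl[OF usi(2)[OF v]])
        have bc: "bq u y \<in> carrier F" "bq u yb \<in> carrier F" using uc yc yb by auto
        have "unit_at F v (bq u y)"
        proof (cases "unit_at F v (bq u yb)")
          case U: True
          have "t \<otimes> Qu \<in> vge F v 1" by (rule v.vge_mult0r[OF t(4)[OF True U] v.unit_at_vge[OF Quv]])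
          moreover have "bq u y \<ominus> bq u yb = t \<otimes> Qu" unfolding uy using bc t(1) Qu by algebra
          ultimately show ?thesis using v.unit_at_close[OF U bc(1)] by simp
        next
          case U: False
          have "bq u yb \<in> vge F v 1"
            by (rule v.unit_at_vge1[OF int_at_polar[OF v usi(1)[OF v] yb(3)[OF v]] U])
          moreover have "bq u y \<ominus> t \<otimes> Qu = bq u yb" unfolding uy using bc t(1) Qu by algebra
          ultimately show ?thesis using v.unit_at_close[OF v.unit_at_mult[OF t(5)[OF True U] Quv] bc(1)] by simp
        qed
        hence "unit_at F v (bq u (y' y))" unfolding uy' by (rule v.unit_at_mult[OF dbl[OF av]])
        thus ?thesis using int_at_unit[OF v y'i usi(1)[OF v]] polar_sym[OF uc y'c[OF yc]] by simp
      qed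
      hence "unit_at F v (\<ominus> (disc (q x \<otimes> q y) \<otimes> q x))"
        using reflected_vector[OF x(1) yc xy] by (simp add: y'_def a_def)
      hence "unit_at F v (\<ominus> (\<ominus> (disc (q x \<otimes> q y) \<otimes> q x)))" by (rule v.unit_at_minus)
      hence "unit_at F v (disc (q x \<otimes> q y) \<otimes> q x)" using x(1) yc by simp
      hence "unit_at F v (disc (q x \<otimes> q y))" by (rule v.unit_at_factor) (use x(1) yc av in \<open>auto simp: a_def\<close>)
      thus ?thesis by (rule gp_off_B[OF v x(5)[OF v] yi xy])
    qed
    thus ?thesis using yg by blast
  qed
qed

end

section \<open>Globalisation\<close>

lemma (in field) disc_minus: "k \<in> carrier R \<Longrightarrow> \<one> \<oplus> add_pow R (4::nat) (\<ominus> k) = disc k"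
proof -
  assume k: "k \<in> carrier R"
  have "add_pow R (4::nat) (\<ominus> k) = \<ominus> k \<oplus> \<ominus> k \<oplus> \<ominus> k \<oplus> \<ominus> k"
    using k by (simp add: numeral_eq_Suc)
  thus ?thesis unfolding disc_def using k by (simp, algebra)
qed

context qform
begin

lemma S_set_overI:
  assumes R: "subring R F" and x: "x \<in> carrier V" and y: "y \<in> carrier V" and b: "bq x y = \<one>"
    and k: "q x \<otimes> q y \<in> subring_units F R" and D: "disc (q x \<otimes> q y) \<in> subring_units F R"
  shows "\<ominus> (q x \<otimes> q y) \<in> S_set_over F R V q"
proof -
  define k where "k = q x \<otimes> q y"
  have kc: "k \<in> carrier F" using x y by (simp add: k_def)
  note kR = k[folded k_def, unfolded subring_units_iff[OF R]] and DR = D[folded k_def, unfolded subring_units_iff[OF R]]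
  note Rm = subringE[OF R]
  have iD: "inv (disc k) \<in> carrier F" using DR Rm(1) by blast
  have inv: "inv (\<ominus> k) = \<ominus> (inv k)"
  proof (rule comm_inv_char)
    have i: "inv k \<in> carrier F" "k \<otimes> inv k = \<one>" using field_Units kc kR by auto
    have "\<ominus> k \<otimes> \<ominus> (inv k) = k \<otimes> inv k" using kc i(1) by algebra
    thus "\<ominus> k \<otimes> \<ominus> (inv k) = \<one>" using i by simp
  qed (use kc kR field_Units in auto)
  have knz: "\<ominus> k \<noteq> \<zero>" using kR kc by (metis minus_minus minus_zero)
  have "\<ominus> k \<in> subring_units F R" unfolding subring_units_iff[OF R] inv using kR knz Rm(5) by blast
  moreover have "\<ominus> k \<in> Q_set F R"
    unfolding Q_set_def using D[folded k_def] kR Rm(5) disc_minus[OF kc] by simp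
  moreover have "\<ominus> k \<in> S_set F V q"
  proof -
    have "\<ominus> k \<in> Q_set F (carrier F)"
      unfolding Q_set_def disc_minus[OF kc] subring_units_iff[OF carrier_is_subring] 
      using kc iD DR disc_minus[OF kc] subring_units_iff[OF carrier_is_subring, of "disc k"] by simp
    moreover have "\<ominus> k = \<ominus> (q x \<otimes> q y) \<otimes> inv (bq x y [^] (2::nat))" using x y by (simp add: b k_def)
    moreover have "bq x y \<noteq> \<zero>" using b by simp
    ultimately show ?thesis unfolding S_set_def using x y by blast
  qed
  ultimately show ?thesis by (simp add: S_set_over_def k_def)
qed

text \<open>Scaling one vector by the inverse of b(x, y) normalises the pairing to 1 and turns the
  given element of S(q) into minus a product of norms.\<close>

lemma S_set_over_gpair:
  assumes v: "valued_qspace F V q v" and ne: "S_set_over F (val_ring F v) V q \<noteq> {}"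
  shows "\<exists>y z. valued_qspace.gpair F V q v y z"
proof -
  interpret v: valued_qspace F V q v by (rule v)
  obtain x y c where xy: "x \<in> carrier V" "y \<in> carrier V" "bq x y \<noteq> \<zero>"
    and c: "c = \<ominus> (q x \<otimes> q y) \<otimes> inv (bq x y [^] (2::nat))"
    and u: "c \<in> subring_units F (val_ring F v)" "\<one> \<oplus> add_pow F (4::nat) c \<in> subring_units F (val_ring F v)"
    using ne by (auto simp: S_set_over_def S_set_def Q_set_def)
  define b where "b = bq x y"
  define k where "k = q x \<otimes> q y \<otimes> (inv b \<otimes> inv b)"
  have b: "b \<in> carrier F" "b \<noteq> \<zero>" using xy by (auto simp: b_def)
  have i: "inv b \<in> carrier F" using v.inv_closed_nz[OF b] by simp
  have kc: "k \<in> carrier F" using xy i by (simp add: k_def)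
  have "inv (b [^] (2::nat)) = inv b \<otimes> inv b"
  proof (rule comm_inv_char)
    have "b [^] (2::nat) = b \<otimes> b" using b by (simp add: numeral_2_eq_2)
    hence "b [^] (2::nat) \<otimes> (inv b \<otimes> inv b) = (b \<otimes> inv b) \<otimes> (b \<otimes> inv b)" using b(1) i by (simp add: m_ac)
    thus "b [^] (2::nat) \<otimes> (inv b \<otimes> inv b) = \<one>" using v.inv_closed_nz[OF b] by simp
  qed (use b i in auto)
  hence ck: "c = \<ominus> k" unfolding c k_def b_def[symmetric] using xy i by (simp add: l_minus)
  have "unit_at F v c" using u(1) unfolding v.val_units_iff by (simp add: unit_at_def)
  hence 1: "unit_at F v k" using v.unit_at_minus[of c] kc by (simp add: ck)
  have 2: "unit_at F v (disc k)" using u(2) unfolding v.val_units_iff ck disc_minus[OF kc] by (simp add: unit_at_def)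
  show ?thesis using v.gpair_normalise[OF xy] 1 2 unfolding k_def b_def by blast
qed

end

lemma (in field) val_rings_subring:
  assumes "T \<subseteq> valuations R K" shows "subring (carrier R \<inter> (\<Inter>v\<in>T. val_ring R v)) R"
proof (rule subringI)
  have s: "v \<in> T \<Longrightarrow> subring (val_ring R v) R" for v
    unfolding val_ring_eq_vge using valued_field.subring_vge[OF valuations_valued_field[OF field_axioms, of v K]] assms by blast
  note sE = subringE[OF s]
  let ?A = "carrier R \<inter> (\<Inter>v\<in>T. val_ring R v)"
  show "?A \<subseteq> carrier R" by blast
  show "\<one> \<in> ?A" using sE(3) by blast
  show "\<And>h. h \<in> ?A \<Longrightarrow> \<ominus> h \<in> ?A" using sE(5) by blast
  show "\<And>h h'. h \<in> ?A \<Longrightarrow> h' \<in> ?A \<Longrightarrow> h \<otimes> h' \<in> ?A" using sE(6) by blast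
  show "\<And>h h'. h \<in> ?A \<Longrightarrow> h' \<in> ?A \<Longrightarrow> h \<oplus> h' \<in> ?A" using sE(7) by blast
qed

lemma (in field) val_rings_units:
  assumes T: "T \<subseteq> valuations R K" and x: "x \<in> carrier R" "x \<noteq> \<zero>" and u: "\<And>v. v \<in> T \<Longrightarrow> v x = 0"
  shows "x \<in> subring_units R (carrier R \<inter> (\<Inter>v\<in>T. val_ring R v))"
proof -
  have i: "inv x \<in> carrier R" using field_Units x by auto
  have "x \<in> val_ring R v \<and> inv x \<in> val_ring R v" if v: "v \<in> T" for v
  proof -
    interpret v: valued_field R v using valuations_valued_field[OF field_axioms, of v K] T v by blast
    show ?thesis using u[OF v] v.v_inv[OF x] x i by (auto simp: val_ring_def)
  qed
  thus ?thesis unfolding subring_units_iff[OF val_rings_subring[OF T]] using x i by blast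
qed

context function_field_form
begin

text \<open>Finitely many conditions, each open in the coordinates of both vectors; this is the case
  of empty Delta.\<close>

lemma finite_set_pair:
  assumes S: "finite S" "S \<subseteq> valuations F K" and g: "\<And>v. v \<in> S \<Longrightarrow> \<exists>y z. valued_qspace.gpair F V q v y z"
  shows "\<exists>y z. \<forall>v\<in>S. valued_qspace.gpair F V q v y z"
proof -
  have "\<exists>f h N. (\<forall>i. f i \<in> carrier F) \<and> (\<forall>i. h i \<in> carrier F) \<and>
    (\<forall>d d'. (\<forall>i<nn. d i \<in> vge F v N) \<longrightarrow> (\<forall>i<nn. d' i \<in> vge F v N) \<longrightarrow>
      (let Y = vv f \<oplus>\<^bsub>V\<^esub> vv d; Z = vv h \<oplus>\<^bsub>V\<^esub> vv d' in valued_qspace.gpair F V q v Y (inv (bq Y Z) \<odot>\<^bsub>V\<^esub> Z)))" if v: "v \<in> S" for v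
  proof -
    interpret v: valued_qspace F V q v using vq v S by blast
    obtain y z where yz: "v.gpair y z" using g[OF v] by blast
    hence c: "y \<in> carrier V" "z \<in> carrier V" by (auto simp: v.gpair_def)
    obtain f where f: "\<forall>i. f i \<in> carrier F" "y = vv f" using coords_exist[OF c(1)] by blast
    obtain h where h: "\<forall>i. h i \<in> carrier F" "z = vv h" using coords_exist[OF c(2)] by blast
    show ?thesis using v.gpair_close[where n = nn and e = ee, OF yz ee_closed] f h by blast
  qed
  then obtain f h n where f: "\<And>v i. v \<in> S \<Longrightarrow> f v i \<in> carrier F" and h: "\<And>v i. v \<in> S \<Longrightarrow> h v i \<in> carrier F"
    and n: "\<And>v d d'. v \<in> S \<Longrightarrow> (\<forall>i<nn. d i \<in> vge F v (n v)) \<Longrightarrow> (\<forall>i<nn. d' i \<in> vge F v (n v)) \<Longrightarrow>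
      (let Y = vv (f v) \<oplus>\<^bsub>V\<^esub> vv d; Z = vv (h v) \<oplus>\<^bsub>V\<^esub> vv d' in valued_qspace.gpair F V q v Y (inv (bq Y Z) \<odot>\<^bsub>V\<^esub> Z))" by metis
  have appr: "\<exists>c. (\<forall>i. c i \<in> carrier F) \<and> (\<forall>v\<in>S. \<forall>i::nat. c i \<ominus> f v i \<in> vge F v (n v))"
    if f: "\<And>v i. v \<in> S \<Longrightarrow> f v i \<in> carrier F" for f
  proof -
    have "\<exists>x\<in>carrier F. \<forall>v\<in>S. x \<ominus> f v i \<in> vge F v (n v)" for i
      by (rule weak_approximation[where f = "\<lambda>v. f v i", OF S]) (rule f)
    thus ?thesis by metis
  qed
  obtain c where c: "\<And>i. c i \<in> carrier F" "\<And>v i. v \<in> S \<Longrightarrow> c i \<ominus> f v i \<in> vge F v (n v)" using appr[of f] f by metis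
  obtain c' where c': "\<And>i. c' i \<in> carrier F" "\<And>v i. v \<in> S \<Longrightarrow> c' i \<ominus> h v i \<in> vge F v (n v)" using appr[of h] h by metis
  have "valued_qspace.gpair F V q v (vv c) (inv (bq (vv c) (vv c')) \<odot>\<^bsub>V\<^esub> vv c')" if v: "v \<in> S" for v
    using n[OF v, of "\<lambda>i. c i \<ominus> f v i" "\<lambda>i. c' i \<ominus> h v i"] c(2)[OF v] c'(2)[OF v]
      vec_diff[of nn ee c "f v", OF ee_closed c(1) f[OF v]] vec_diff[of nn ee c' "h v", OF ee_closed c'(1) h[OF v]]
    by (simp add: Let_def)
  thus ?thesis by blast
qed

text \<open>That the product of norms and the discriminant are nonzero is stated separately, because
  a valuation gives no information about zero and there may be no place at all.\<close>

theorem common_pair: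
  assumes nd: "nondegenerate F V q" and n3: "3 \<le> nn" and S: "finite S" "S \<subseteq> valuations F K"
    and ne: "\<And>v. v \<in> Delta F K V q \<Longrightarrow> S_set_over F (val_ring F v) V q \<noteq> {}"
  shows "\<exists>x y. x \<in> carrier V \<and> y \<in> carrier V \<and> bq x y = \<one> \<and> q x \<otimes> q y \<noteq> \<zero> \<and> disc (q x \<otimes> q y) \<noteq> \<zero> \<and>
    (\<forall>v\<in>Delta F K V q \<union> S. v (q x \<otimes> q y) = 0 \<and> v (disc (q x \<otimes> q y)) = 0)"
proof -
  define \<Delta> where "\<Delta> = Delta F K V q"
  have \<Delta>: "\<Delta> \<subseteq> valuations F K" by (auto simp: \<Delta>_def Delta_def)
  have loc: "\<exists>y z. valued_qspace.gpair F V q v y z" if v: "v \<in> valuations F K" for v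
  proof (cases "v \<in> \<Delta>")
    case True
    show ?thesis by (rule S_set_over_gpair[OF vq[OF v] ne]) (use True in \<open>simp add: \<Delta>_def\<close>)
  next
    case False
    show ?thesis by (rule local_pair[OF nd n3 K v]) (use False in \<open>simp add: \<Delta>_def\<close>)
  qed
  show ?thesis
  proof (cases "\<Delta> \<union> S = {}")
    case True
    \<comment> \<open>Without places no integrality is asked for, and any nondegenerate plane with
      nonzero product of norms will do.\<close>
    show ?thesis using generic_pair[OF nd n3] True unfolding \<Delta>_def by auto
  next
    case ne: False
    have "\<exists>x y. \<forall>v\<in>\<Delta> \<union> S. valued_qspace.gpair F V q v x y"
    proof (cases "\<Delta> = {}")
      case True
      show ?thesis using finite_set_pair[OF S] loc S(2) True by (metis Un_empty_left subsetD)
    next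
      case False
      \<comment> \<open>A single place of Delta makes q anisotropic over F and supplies the base
        pair of the plane.\<close>
      then obtain v0 where v0: "v0 \<in> \<Delta>" by blast
      interpret v0: valued_qspace F V q v0 using vq v0 \<Delta> by blast
      obtain x0 y0 where "v0.gpair x0 y0" using loc v0 \<Delta> by blast
      hence xy: "x0 \<in> carrier V" "y0 \<in> carrier V" "bq x0 y0 = \<one>" "q x0 \<otimes> q y0 \<noteq> \<zero>" "disc (q x0 \<otimes> q y0) \<noteq> \<zero>"
        by (auto simp: v0.gpair_def unit_at_def)
      define Z where "Z = {q x0, q y0, disc (q x0 \<otimes> q y0)} \<union> (\<lambda>i. q (ee i)) ` {..<nn}"
      \<comment> \<open>All zeros and poles of the finitely many elements that describe the base
        pair and the norms of the basis. Adding v0 makes B nonempty.\<close>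
      define B where "B = insert v0 S \<union> (\<Union>z\<in>Z - {\<zero>}. {v \<in> valuations F K. v z \<noteq> 0})"
      have Z: "finite Z" "Z \<subseteq> carrier F" using xy ee_closed by (auto simp: Z_def)
      have B: "finite B" "B \<subseteq> valuations F K" "B \<noteq> {}" "S \<subseteq> B"
        using Z S v0 \<Delta> finite_support by (auto simp: B_def)
      have zB: "z = \<zero> \<or> v z = 0" if "z \<in> Z" "v \<in> \<Delta> - B" for z v using that \<Delta> by (auto simp: B_def)
      have nz: "q x0 \<noteq> \<zero>" "q y0 \<noteq> \<zero>" using xy by auto
      interpret G: good_reduction F K V q \<Delta> B x0 y0
      proof unfold_locales
        show "\<And>x. x \<in> carrier V \<Longrightarrow> q x = \<zero> \<Longrightarrow> x = \<zero>\<^bsub>V\<^esub>" using Delta_anisotropic v0 unfolding \<Delta>_def by blast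
        show "\<And>v x y. v \<in> \<Delta> \<Longrightarrow> x \<in> carrier V \<Longrightarrow> y \<in> carrier V \<Longrightarrow> bq x y \<noteq> \<zero> \<Longrightarrow> q x \<noteq> \<zero> \<Longrightarrow> q y \<noteq> \<zero> \<Longrightarrow>
          v (q x) + v (q y) \<le> 2 * v (bq x y)" using Delta_bound unfolding \<Delta>_def by blast
        fix v assume v: "v \<in> \<Delta> - B"
        have "q (ee i) \<in> vge F v 0" if "i < nn" for i
          using zB[of "q (ee i)" v] v that ee_closed by (auto simp: Z_def vge_def)
        moreover have "unit_at F v z" if "z \<in> {q x0, q y0, disc (q x0 \<otimes> q y0)}" for z
          using zB[of z v] v that xy nz by (auto simp: Z_def unit_at_def)
        ultimately show "unit_at F v (q x0) \<and> unit_at F v (q y0) \<and> unit_at F v (disc (q x0 \<otimes> q y0)) \<and>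
          (\<forall>i<nn. q (ee i) \<in> vge F v 0)" by blast
      qed (use B xy \<Delta> in auto)
      have "\<exists>x y. \<forall>v\<in>\<Delta> \<union> B. valued_qspace.gpair F V q v x y"
      proof (rule G.global_pair[OF n3])
        fix v assume v: "v \<in> B"
        show "\<exists>x y. valued_qspace.gpair F V q v x y" using loc v B(2) by blast
      qed
      thus ?thesis using B(4) by blast
    qed
    then obtain x y where xy: "\<And>v. v \<in> \<Delta> \<union> S \<Longrightarrow> valued_qspace.gpair F V q v x y" by blast
    have P: "x \<in> carrier V \<and> y \<in> carrier V \<and> bq x y = \<one> \<and> unit_at F v (q x \<otimes> q y) \<and> unit_at F v (disc (q x \<otimes> q y))"
      if v: "v \<in> \<Delta> \<union> S" for v
    proof -
      interpret v: valued_qspace F V q v using vq v \<Delta> S by blast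
      show ?thesis using xy[OF v] by (simp add: v.gpair_def)
    qed
    show ?thesis
      by (intro exI[of _ x] exI[of _ y]) (use P ne in \<open>auto simp: unit_at_def \<Delta>_def[symmetric]\<close>)
  qed
qed

end

theorem theorem6p11:
  fixes F :: "('a, 'm) ring_scheme"
    and K :: "'a set"
    and V :: "('a, 'v, 'n) module_scheme"
    and q :: "'v \<Rightarrow> 'a"
    and S :: "('a \<Rightarrow> int) set"
    and R :: "'a set"
  assumes "function_field_one_var F K"
    and "quadratic_form F V q"
    and "nondegenerate F V q"
    and "vectorspace.dim F V \<ge> 3"
    and "finite S"
    and "S \<subseteq> valuations F K"
    and "R = carrier F \<inter> (\<Inter>v\<in>Delta F K V q \<union> S. val_ring F v)"
    and "\<forall>v\<in>Delta F K V q. S_set_over F (val_ring F v) V q \<noteq> {}"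
  shows "S_set_over F R V q \<noteq> {}"
proof -
  interpret F: function_field F K
    by (intro function_field.intro function_field_axioms.intro assms(1)) (use assms(1) in \<open>simp add: function_field_one_var_def\<close>)
  interpret Q: qspace F V q by (rule quadratic_form_qspace[OF assms(2)])
  interpret X: function_field_form F K V q
    by (intro function_field_form.intro qform.intro qform_axioms.intro F.function_field_axioms Q.qspace_axioms assms(2))
  define T where "T = Delta F K V q \<union> S"
  have T: "T \<subseteq> valuations F K" using assms(6) by (auto simp: T_def Delta_def)
  obtain x y where xy: "x \<in> carrier V" "y \<in> carrier V" "polar F V q x y = \<one>\<^bsub>F\<^esub>" "q x \<otimes>\<^bsub>F\<^esub> q y \<noteq> \<zero>\<^bsub>F\<^esub>"
    "F.disc (q x \<otimes>\<^bsub>F\<^esub> q y) \<noteq> \<zero>\<^bsub>F\<^esub>" "\<And>v. v \<in> T \<Longrightarrow> v (q x \<otimes>\<^bsub>F\<^esub> q y) = 0" "\<And>v. v \<in> T \<Longrightarrow> v (F.disc (q x \<otimes>\<^bsub>F\<^esub> q y)) = 0"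
    using X.common_pair[OF assms(3) _ assms(5,6)] assms(4,8) X.nn_dim unfolding T_def by auto
  have c: "q x \<otimes>\<^bsub>F\<^esub> q y \<in> carrier F" using xy by simp
  have R: "R = carrier F \<inter> (\<Inter>v\<in>T. val_ring F v)" using assms(7) by (simp add: T_def)
  have "\<ominus>\<^bsub>F\<^esub> (q x \<otimes>\<^bsub>F\<^esub> q y) \<in> S_set_over F R V q"
    unfolding R by (intro X.S_set_overI F.val_rings_subring[OF T] F.val_rings_units[OF T] xy c F.disc_closed)
  thus ?thesis by blast
qed

end
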